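(* Let $G$ be a connected locally finite graph, and let $f$ be the map on $H_1(G)$ (the modified homology group $Z_1(G)/B_1(G)$ defined in the context) given by $f([\phi])(\vec{e}) = f'([\phi'])(\vec{e})$, where $\phi=\sum_{i\in I}\lambda_i\sigma_i\in Z_1(G)$ is in any standard representation as a cycle and $\phi'=\sum_{i\in I'}\lambda_i\sigma_i$ for any finite $I'\subseteq I$ containing all $i$ for which the image of $\sigma_i$ meets $e$ and such that $\phi'$ is a singular 1-cycle in $|G|$. Then $f$ is a group isomorphism between $H_1(G)$ and $\vec{\mathcal{C}}(G)$, and its restriction to $H'_1(G)$ is a group isomorphism between $H'_1(G)$ and $\vec{\mathcal{C}}(G)$. In particular, $H'_1(G)=H_1(G)$.
   Context: Graphs may have multiple edges but no loops (edges joining a vertex to itself). A connected locally finite graph $G$ is viewed as a 1-complex; every edge $e$ comes with a fixed homeomorphism $\theta_e\colon[0,1]\to e$ mapping $0,1$ to the two endvertices of $e$. Write $\mathring{e}$ for the edge without its endvertices. A ray is a 1-way infinite path in $G$; two rays are equivalent if no finite set of vertices separates them in $G$; the ends of $G$ are the equivalence classes of rays, and $\Omega(G)$ is the set of ends. $|G|$ is the Freudenthal compactification of $G$: its point set is $G\cup\Omega(G)$, and its topology is generated by the open sets of $G$ and the sets $\hat C(S,\omega)$ for all finite vertex sets $S$ and ends $\omega$, where $\hat C(S,\omega)$ is the union of the component $C$ of $G-S$ that contains a tail of every ray in $\omega$, all ends whose rays have tails in $C$, and all open edges between $S$ and $C$. Oriented cycle space: the two orientations of an edge $e=uv$ are the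 triples $(e,u,v)$ and $(e,v,u)$, denoted by $\vec{e},\overleftarrow{e}$ (in some order); the natural orientation is $(e,\theta_e(0),\theta_e(1))$. $\vec{E}$ is the set of all orientations of edges of $G$. $\vec{\mathcal{E}}(G)$ is the abelian group of all functions $\phi\colon\vec{E}\to\mathbb{Z}$ with $\phi(\overleftarrow{e})=-\phi(\vec{e})$. A family $(\phi_i)_{i\in I}$ in $\vec{\mathcal{E}}(G)$ is thin if for every $\vec{e}$ only finitely many $i$ satisfy $\phi_i(\vec{e})\neq0$; its thin sum is defined pointwise. A path $\sigma\colon[0,1]\to|G|$ traverses $\vec{e}=(e,\sigma(s),\sigma(t))$ if there is a subinterval $[s,t]$ such that $\sigma(s)\ne\sigma(t)$ are the endvertices of $e$ and $\sigma((s,t))=\mathring{e}$. A circle in $|G|$ is a continuous $\alpha\colon[0,1]\to|G|$ with $\alpha(0)=\alpha(1)$ that is injective on $[0,1)$; for circles, traversing is read cyclically (on $[0,1]/(0\sim1)$). The oriented circuit $\phi_\alpha$ maps $\vec{e}$ to $1$ if $\alpha$ traverses $\vec{e}$, to $-1$ if $\alpha$ traverses $\overleftarrow{e}$, and to $0$ otherwise. $\vec{\mathcal{C}}(G)$ is the subgroup of $\vec{\mathcal{E}}(G)$ formed by all thin sums of oriented circuits. Modified homology: a family $(\sigma_i\mid i\in I)$ of singular $n$-simplices in $|G|$ is good if (i) every $x\in G$ has a neighbourhood in $G$ that meets the image of $\sigma_i$ for only finitely many $i$, and (ii) every $\sigma_i$ maps the vertices (0-faces) of the standard simplex $\Delta^n$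 to $G$ (not to ends). An $n$-chain in $G$ is a formal (possibly infinite) linear combination $\sum_{i\in I}\lambda_i\sigma_i$ with $\lambda_i\in\mathbb{Z}$ and $(\sigma_i\mid i\in I)$ good; the $\sigma_i$ need not be distinct, and formal sums that agree after adding up the coefficients of equal simplices are the same chain. $C_n(G)$ is the group of $n$-chains, $C'_n(G)$ its subgroup of finite ones; $\partial_n\colon C_n(G)\to C_{n-1}(G)$ is the usual boundary operator extended linearly. $Z'_n(G)=\ker(\partial_n\restriction C'_n(G))$. $Z_n(G)$ consists of those $\phi\in C_n(G)$ that can be written as $\phi=\sum_{i\in I}\lambda_i\sigma_i$ (with $(\sigma_i\mid i\in I)$ good) so that $I$ has a partition into finite sets $I_j$ ($j\in J$) with $\sum_{i\in I_j}\lambda_i\sigma_i\in Z'_n(G)$ for all $j$; such a representation is called a standard representation of $\phi$ as a cycle. $B_n(G)=\operatorname{Im}\partial_{n+1}\subseteq Z_n(G)$, $H_n(G)=Z_n(G)/B_n(G)$, and $H'_n(G)=\{[z]: z\in Z'_n(G)\}\subseteq H_n(G)$. The map $f'$: let $H_1(|G|)$ be the usual first singular homology group with integer coefficients. Let $S^1\subseteq\mathbb{C}$ be the unit circle, $\eta_k\colon[0,1]\to S^1$, $s\mapsto e^{2\pi iks}$, and $\pi\colon H_1(S^1)\to\mathbb{Z}$ the isomorphism $[\eta_k]\mapsto k$. For an edge $e$ let $f_e\colon|G|\to S^1$ equal $\eta_1\circ\theta_e^{-1}$ on $\mathring{e}$ and $1$ elsewhere. Then $f'\colon H_1(|G|)\to\vec{\mathcal{E}}(G)$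 is defined by $f'(h)(\vec{e})=\pi((f_e)_*(h))$ for natural orientations $\vec{e}$ (and $f'(h)(\overleftarrow{e})=-f'(h)(\vec{e})$). The definition of $f$ in the claim does not depend on the choice of the representative $\phi$, its standard representation, or $I'$; in $f'([\phi'])$ the class $[\phi']$ is taken in $H_1(|G|)$. *)

theory Defs
  imports "HOL-Homology.Homology" "Graph_Theory.Graph_Theory"
begin

section \<open>Graphs, rays and ends\<close>

text \<open>
  An undirected loopless multigraph with a fixed natural orientation of every edge is represented
  by a \<^typ>\<open>('v,'e) pre_digraph\<close> satisfying \<^const>\<open>loopfree_digraph\<close>: the edges are
  the arcs, and the natural orientation of \<open>e\<close> goes from \<open>tail G e\<close> to \<open>head G e\<close>. All notions
  below ignore the direction of the arcs unless they explicitly speak of orientations.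
  \<^const>\<open>Digraph_Component.connected\<close> is connectedness of the underlying undirected graph
  (and includes that the graph is nonempty).
\<close>

definition locally_finite :: "('v,'e) pre_digraph \<Rightarrow> bool" where
  "locally_finite G \<longleftrightarrow> (\<forall>v\<in>verts G. finite {e \<in> arcs G. tail G e = v \<or> head G e = v})"

definition components_avoiding :: "('v,'e) pre_digraph \<Rightarrow> 'v set \<Rightarrow> 'v set set" where
  "components_avoiding G S =
     pre_digraph.sccs_verts (with_proj (mk_symmetric (induce_subgraph G (verts G - S))))"

type_synonym ('v,'e) ray = "(nat \<Rightarrow> 'v) \<times> (nat \<Rightarrow> 'e)"

definition is_ray :: "('v,'e) pre_digraph \<Rightarrow> ('v,'e) ray \<Rightarrow> bool" where
  "is_ray G = (\<lambda>(x, a). inj x \<and> range x \<subseteq> verts G \<and> range a \<subseteq> arcs G \<and>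
     (\<forall>n. {tail G (a n), head G (a n)} = {x n, x (Suc n)}))"

definition separates :: "('v,'e) pre_digraph \<Rightarrow> 'v set \<Rightarrow> 'v set \<Rightarrow> 'v set \<Rightarrow> bool" where
  "separates G S A B \<longleftrightarrow>
     \<not> (\<exists>C\<in>components_avoiding G S. A \<inter> C \<noteq> {} \<and> B \<inter> C \<noteq> {})"

definition ray_rel :: "('v,'e) pre_digraph \<Rightarrow> (('v,'e) ray \<times> ('v,'e) ray) set" where
  "ray_rel G = {(r, r'). is_ray G r \<and> is_ray G r' \<and>
     (\<forall>S. finite S \<and> S \<subseteq> verts G \<longrightarrow> \<not> separates G S (range (fst r)) (range (fst r')))}"

definition ends :: "('v,'e) pre_digraph \<Rightarrow> ('v,'e) ray set set" where
  "ends G = {r. is_ray G r} // ray_rel G"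

definition has_tail_in :: "('v,'e) ray \<Rightarrow> 'v set \<Rightarrow> bool" where
  "has_tail_in r C \<longleftrightarrow> (\<exists>n. \<forall>m\<ge>n. fst r m \<in> C)"


section \<open>The Freudenthal compactification\<close>

text \<open>
  The 1-complex of \<open>G\<close> is realised concretely: an inner point of an edge \<open>e\<close> is \<open>Inner e t\<close>
  with \<open>0 < t < 1\<close>, and \<open>\<theta>\<^sub>e t\<close> is this point.
\<close>

datatype ('v,'e) point = Vertex 'v | Inner 'e real | End "('v,'e) ray set"

definition theta :: "('v,'e) pre_digraph \<Rightarrow> 'e \<Rightarrow> real \<Rightarrow> ('v,'e) point" where
  "theta G e t = (if t = 0 then Vertex (tail G e) else if t = 1 then Vertex (head G e) else Inner e t)"

definition closed_edge :: "('v,'e) pre_digraph \<Rightarrow> 'e \<Rightarrow> ('v,'e) point set" where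
  "closed_edge G e = theta G e ` {0..1}"

definition open_edge :: "('v,'e) pre_digraph \<Rightarrow> 'e \<Rightarrow> ('v,'e) point set" where
  "open_edge G e = theta G e ` {0<..<1}"

definition graph_points :: "('v,'e) pre_digraph \<Rightarrow> ('v,'e) point set" where
  "graph_points G = Vertex ` verts G \<union> (\<Union>e\<in>arcs G. open_edge G e)"

definition graph_topology :: "('v,'e) pre_digraph \<Rightarrow> ('v,'e) point topology" where
  "graph_topology G = topology (\<lambda>U. U \<subseteq> graph_points G \<and>
     (\<forall>e\<in>arcs G. openin (top_of_set {0..1}) {t \<in> {0..1}. theta G e t \<in> U}))"

lemma openin_graph_topology:
  "openin (graph_topology G) U \<longleftrightarrow> U \<subseteq> graph_points G \<and>
     (\<forall>e\<in>arcs G. openin (top_of_set {0..1}) {t \<in> {0..1}. theta G e t \<in> U})"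
proof -
  let ?P = "\<lambda>U. U \<subseteq> graph_points G \<and>
     (\<forall>e\<in>arcs G. openin (top_of_set {0..1}) {t \<in> {0..1}. theta G e t \<in> U})"
  have "istopology ?P"
    unfolding istopology_def
  proof (intro conjI allI impI)
    fix S T assume "?P S" "?P T"
    moreover have "{t \<in> {0..1}. theta G e t \<in> S \<inter> T} =
      {t \<in> {0..1}. theta G e t \<in> S} \<inter> {t \<in> {0..1}. theta G e t \<in> T}" for e by auto
    ultimately show "S \<inter> T \<subseteq> graph_points G"
      and "\<forall>e\<in>arcs G. openin (top_of_set {0..1}) {t \<in> {0..1}. theta G e t \<in> S \<inter> T}"
      by auto
  next
    fix K assume K: "\<forall>S\<in>K. ?P S"
    then show "\<Union>K \<subseteq> graph_points G" by auto
    have "{t \<in> {0..1}. theta G e t \<in> \<Union>K} = (\<Union>S\<in>K. {t \<in> {0..1}. theta G e t \<in> S})" for e by auto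
    with K show "\<forall>e\<in>arcs G. openin (top_of_set {0..1}) {t \<in> {0..1}. theta G e t \<in> \<Union>K}"
      by auto
  qed
  then show ?thesis
    by (simp add: graph_topology_def topology_inverse')
qed

text \<open>
  For an end \<open>\<omega>\<close> and a finite vertex set \<open>S\<close>, the basic neighbourhood of \<open>\<omega>\<close> is \<open>end_nbhd G S C\<close> for the
  component \<open>C\<close> of \<open>G - S\<close> that contains a tail of every ray in \<open>\<omega>\<close>. Components are represented
  by their vertex sets, so the inner points of the edges of \<open>C\<close> have to be added explicitly.
\<close>

definition end_nbhd :: "('v,'e) pre_digraph \<Rightarrow> 'v set \<Rightarrow> 'v set \<Rightarrow> ('v,'e) point set" where
  "end_nbhd G S C =
     Vertex ` C \<union>
     (\<Union>e \<in> {e \<in> arcs G. tail G e \<in> C \<and> head G e \<in> C}. open_edge G e) \<union>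
     End ` {\<omega> \<in> ends G. \<forall>r\<in>\<omega>. has_tail_in r C} \<union>
     (\<Union>e \<in> {e \<in> arcs G. tail G e \<in> S \<and> head G e \<in> C \<or> tail G e \<in> C \<and> head G e \<in> S}. open_edge G e)"

definition freudenthal :: "('v,'e) pre_digraph \<Rightarrow> ('v,'e) point topology" where
  "freudenthal G = topology_generated_by
     ({U. openin (graph_topology G) U} \<union>
      {end_nbhd G S C | S C \<omega>. finite S \<and> S \<subseteq> verts G \<and> \<omega> \<in> ends G \<and>
         C \<in> components_avoiding G S \<and> (\<forall>r\<in>\<omega>. has_tail_in r C)})"


section \<open>The oriented cycle space\<close>

type_synonym ('v,'e) oriented_edge = "'e \<times> 'v \<times> 'v"

definition natural_orientation :: "('v,'e) pre_digraph \<Rightarrow> 'e \<Rightarrow> ('v,'e) oriented_edge" where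
  "natural_orientation G e = (e, tail G e, head G e)"

definition reverse :: "('v,'e) oriented_edge \<Rightarrow> ('v,'e) oriented_edge" where
  "reverse = (\<lambda>(e, u, v). (e, v, u))"

definition oriented_edges :: "('v,'e) pre_digraph \<Rightarrow> ('v,'e) oriented_edge set" where
  "oriented_edges G = natural_orientation G ` arcs G \<union> (reverse \<circ> natural_orientation G) ` arcs G"

text \<open>Functions on \<open>oriented_edges G\<close> are extended by \<open>0\<close> to all triples.\<close>

definition edge_functions :: "('v,'e) pre_digraph \<Rightarrow> (('v,'e) oriented_edge \<Rightarrow> int) set" where
  "edge_functions G = {\<phi>. (\<forall>x\<in>oriented_edges G. \<phi> (reverse x) = - \<phi> x) \<and>
     (\<forall>x. x \<notin> oriented_edges G \<longrightarrow> \<phi> x = 0)}"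

definition edge_function_group :: "('v,'e) pre_digraph \<Rightarrow> (('v,'e) oriented_edge \<Rightarrow> int) monoid" where
  "edge_function_group G =
     \<lparr>carrier = edge_functions G, monoid.mult = (\<lambda>\<phi> \<psi> x. \<phi> x + \<psi> x), one = (\<lambda>_. 0)\<rparr>"

definition is_circle :: "('v,'e) pre_digraph \<Rightarrow> (real \<Rightarrow> ('v,'e) point) \<Rightarrow> bool" where
  "is_circle G \<alpha> \<longleftrightarrow> pathin (freudenthal G) \<alpha> \<and> \<alpha> 0 = \<alpha> 1 \<and> inj_on \<alpha> {0..<1}"

text \<open>
  The cyclic reading on \<open>[0,1]/(0 \<sim> 1)\<close> is obtained by extending \<open>\<alpha>\<close> periodically, i.e. by
  composing it with \<^const>\<open>frac\<close>.
\<close>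

definition traverses ::
    "('v,'e) pre_digraph \<Rightarrow> (real \<Rightarrow> ('v,'e) point) \<Rightarrow> ('v,'e) oriented_edge \<Rightarrow> bool" where
  "traverses G \<alpha> = (\<lambda>(e, u, v). (e, u, v) \<in> oriented_edges G \<and>
     (\<exists>s t. s < t \<and> t \<le> s + 1 \<and> \<alpha> (frac s) = Vertex u \<and> \<alpha> (frac t) = Vertex v \<and>
        (\<lambda>r. \<alpha> (frac r)) ` {s<..<t} = open_edge G e))"

definition oriented_circuit ::
    "('v,'e) pre_digraph \<Rightarrow> (real \<Rightarrow> ('v,'e) point) \<Rightarrow> ('v,'e) oriented_edge \<Rightarrow> int" where
  "oriented_circuit G \<alpha> x =
     (if traverses G \<alpha> x then 1 else if traverses G \<alpha> (reverse x) then - 1 else 0)"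

definition thin :: "('v,'e) pre_digraph \<Rightarrow> 'i set \<Rightarrow> ('i \<Rightarrow> ('v,'e) oriented_edge \<Rightarrow> int) \<Rightarrow> bool" where
  "thin G I \<Phi> \<longleftrightarrow> (\<forall>x\<in>oriented_edges G. finite {i \<in> I. \<Phi> i x \<noteq> 0})"

definition thin_sum ::
    "'i set \<Rightarrow> ('i \<Rightarrow> ('v,'e) oriented_edge \<Rightarrow> int) \<Rightarrow> ('v,'e) oriented_edge \<Rightarrow> int" where
  "thin_sum I \<Phi> x = (\<Sum>i | i \<in> I \<and> \<Phi> i x \<noteq> 0. \<Phi> i x)"

text \<open>
  Index sets of type \<^typ>\<open>nat set\<close> suffice here and in the definition of \<open>inf_cycles\<close> below:
  a connected locally finite graph is countable, so all but countably many members of a thin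
  family vanish; see \<open>thin_sum_in_oriented_cycle_space\<close> and \<open>standard_rep_imp_inf_cycles\<close>.
\<close>

definition oriented_cycle_space :: "('v,'e) pre_digraph \<Rightarrow> (('v,'e) oriented_edge \<Rightarrow> int) set" where
  "oriented_cycle_space G = {thin_sum I (\<lambda>i. oriented_circuit G (\<alpha> i)) | (I :: nat set) \<alpha>.
     (\<forall>i\<in>I. is_circle G (\<alpha> i)) \<and> thin G I (\<lambda>i. oriented_circuit G (\<alpha> i))}"

definition oriented_cycle_group :: "('v,'e) pre_digraph \<Rightarrow> (('v,'e) oriented_edge \<Rightarrow> int) monoid" where
  "oriented_cycle_group G = (edge_function_group G)\<lparr>carrier := oriented_cycle_space G\<rparr>"


section \<open>The modified homology groups\<close>

type_synonym ('v,'e) simplex = "(nat \<Rightarrow> real) \<Rightarrow> ('v,'e) point"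

definition good_family :: "('v,'e) pre_digraph \<Rightarrow> nat \<Rightarrow> 'i set \<Rightarrow> ('i \<Rightarrow> ('v,'e) simplex) \<Rightarrow> bool" where
  "good_family G n I \<sigma> \<longleftrightarrow>
     (\<forall>i\<in>I. singular_simplex n (freudenthal G) (\<sigma> i)) \<and>
     (\<forall>x\<in>graph_points G. \<exists>U. openin (graph_topology G) U \<and> x \<in> U \<and>
        finite {i \<in> I. \<sigma> i ` standard_simplex n \<inter> U \<noteq> {}}) \<and>
     (\<forall>i\<in>I. \<forall>k\<le>n. simplicial_vertex k (\<sigma> i) \<in> graph_points G)"

text \<open>
  A (possibly infinite) formal sum is identified with its function of coefficients, obtained by
  adding up the coefficients of equal simplices.
\<close>

definition formal_sum :: "'i set \<Rightarrow> ('i \<Rightarrow> int) \<Rightarrow> ('i \<Rightarrow> ('v,'e) simplex) \<Rightarrow> ('v,'e) simplex \<Rightarrow> int" where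
  "formal_sum I l \<sigma> \<tau> = (\<Sum>i | i \<in> I \<and> \<sigma> i = \<tau>. l i)"

definition inf_chains :: "('v,'e) pre_digraph \<Rightarrow> nat \<Rightarrow> (('v,'e) simplex \<Rightarrow> int) set" where
  "inf_chains G n = {c. good_family G n {\<tau>. c \<tau> \<noteq> 0} (\<lambda>\<tau>. \<tau>)}"

definition fin_chains :: "('v,'e) pre_digraph \<Rightarrow> nat \<Rightarrow> (('v,'e) simplex \<Rightarrow> int) set" where
  "fin_chains G n = {c \<in> inf_chains G n. finite {\<tau>. c \<tau> \<noteq> 0}}"

definition inf_boundary :: "nat \<Rightarrow> (('v,'e) simplex \<Rightarrow> int) \<Rightarrow> ('v,'e) simplex \<Rightarrow> int" where
  "inf_boundary n c \<rho> =
     (\<Sum>\<tau> | c \<tau> \<noteq> 0 \<and> Poly_Mapping.lookup (chain_boundary n (frag_of \<tau>)) \<rho> \<noteq> 0.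
        c \<tau> * Poly_Mapping.lookup (chain_boundary n (frag_of \<tau>)) \<rho>)"

definition fin_cycles :: "('v,'e) pre_digraph \<Rightarrow> nat \<Rightarrow> (('v,'e) simplex \<Rightarrow> int) set" where
  "fin_cycles G n = {c \<in> fin_chains G n. inf_boundary n c = (\<lambda>_. 0)}"

definition standard_rep ::
    "('v,'e) pre_digraph \<Rightarrow> nat \<Rightarrow> 'i set \<Rightarrow> ('i \<Rightarrow> int) \<Rightarrow> ('i \<Rightarrow> ('v,'e) simplex) \<Rightarrow>
     (('v,'e) simplex \<Rightarrow> int) \<Rightarrow> bool" where
  "standard_rep G n I l \<sigma> \<phi> \<longleftrightarrow>
     good_family G n I \<sigma> \<and> \<phi> = formal_sum I l \<sigma> \<and>
     (\<exists>P. partition_on I P \<and> (\<forall>J\<in>P. finite J \<and> formal_sum J l \<sigma> \<in> fin_cycles G n))"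

definition inf_cycles :: "('v,'e) pre_digraph \<Rightarrow> nat \<Rightarrow> (('v,'e) simplex \<Rightarrow> int) set" where
  "inf_cycles G n = {\<phi> \<in> inf_chains G n. \<exists>(I :: nat set) l \<sigma>. standard_rep G n I l \<sigma> \<phi>}"

definition inf_boundaries :: "('v,'e) pre_digraph \<Rightarrow> nat \<Rightarrow> (('v,'e) simplex \<Rightarrow> int) set" where
  "inf_boundaries G n = inf_boundary (Suc n) ` inf_chains G (Suc n)"

definition inf_cycle_group :: "('v,'e) pre_digraph \<Rightarrow> nat \<Rightarrow> (('v,'e) simplex \<Rightarrow> int) monoid" where
  "inf_cycle_group G n =
     \<lparr>carrier = inf_cycles G n, monoid.mult = (\<lambda>c d \<tau>. c \<tau> + d \<tau>), one = (\<lambda>_. 0)\<rparr>"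

definition inf_homology_group ::
    "('v,'e) pre_digraph \<Rightarrow> nat \<Rightarrow> (('v,'e) simplex \<Rightarrow> int) set monoid" where
  "inf_homology_group G n = inf_cycle_group G n Mod inf_boundaries G n"

definition inf_homology_class ::
    "('v,'e) pre_digraph \<Rightarrow> nat \<Rightarrow> (('v,'e) simplex \<Rightarrow> int) \<Rightarrow> (('v,'e) simplex \<Rightarrow> int) set" where
  "inf_homology_class G n z = inf_boundaries G n #>\<^bsub>inf_cycle_group G n\<^esub> z"

definition fin_homology_group ::
    "('v,'e) pre_digraph \<Rightarrow> nat \<Rightarrow> (('v,'e) simplex \<Rightarrow> int) set monoid" where
  "fin_homology_group G n =
     (inf_homology_group G n)\<lparr>carrier := inf_homology_class G n ` fin_cycles G n\<rparr>"


section \<open>The maps \<open>f'\<close> and \<open>f\<close>\<close>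

definition eta :: "int \<Rightarrow> real \<Rightarrow> complex" where
  "eta k s = exp (2 * of_real pi * \<i> * of_int k * of_real s)"

abbreviation circle_top :: "complex topology" where
  "circle_top \<equiv> top_of_set (sphere 0 1)"

text \<open>
  The standard 1-simplex is identified with \<open>[0,1]\<close> via its second barycentric coordinate, so that
  the 0-th vertex corresponds to \<open>0\<close> and the first one to \<open>1\<close>.
\<close>

definition eta_class :: "int \<Rightarrow> complex chain set" where
  "eta_class k = homologous_rel_set 1 circle_top {}
     (frag_of (restrict (\<lambda>x. eta k (x 1)) (standard_simplex 1)))"

definition circle_degree :: "complex chain set \<Rightarrow> int" where
  "circle_degree h = (THE k. h = eta_class k)"

definition edge_map :: "('v,'e) pre_digraph \<Rightarrow> 'e \<Rightarrow> ('v,'e) point \<Rightarrow> complex" where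
  "edge_map G e p =
     (if p \<in> open_edge G e then eta 1 (inv_into {0<..<1} (theta G e) p) else 1)"

definition f_prime ::
    "('v,'e) pre_digraph \<Rightarrow> ('v,'e) point chain set \<Rightarrow> ('v,'e) oriented_edge \<Rightarrow> int" where
  "f_prime G h x =
     (let d = circle_degree (hom_induced 1 (freudenthal G) {} circle_top {} (edge_map G (fst x)) h)
      in if fst x \<notin> arcs G then 0
         else if x = natural_orientation G (fst x) then d
         else if x = reverse (natural_orientation G (fst x)) then - d
         else 0)"

definition fin_part :: "'i set \<Rightarrow> ('i \<Rightarrow> int) \<Rightarrow> ('i \<Rightarrow> ('v,'e) simplex) \<Rightarrow> ('v,'e) point chain" where
  "fin_part I' l \<sigma> = (\<Sum>i\<in>I'. frag_cmul (l i) (frag_of (\<sigma> i)))"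

definition admissible_part ::
    "('v,'e) pre_digraph \<Rightarrow> 'i set \<Rightarrow> ('i \<Rightarrow> int) \<Rightarrow> ('i \<Rightarrow> ('v,'e) simplex) \<Rightarrow> 'e \<Rightarrow> 'i set \<Rightarrow> bool" where
  "admissible_part G I l \<sigma> e I' \<longleftrightarrow>
     finite I' \<and> I' \<subseteq> I \<and>
     {i \<in> I. \<sigma> i ` standard_simplex 1 \<inter> closed_edge G e \<noteq> {}} \<subseteq> I' \<and>
     singular_relcycle 1 (freudenthal G) {} (fin_part I' l \<sigma>)"

text \<open>
  The value \<open>z\<close> below is the same for all representatives \<open>\<phi>\<close> of the class \<open>h\<close>, all their standard
  representations and all admissible finite parts \<open>I'\<close>.
\<close>

definition f_map ::
    "('v,'e) pre_digraph \<Rightarrow> (('v,'e) simplex \<Rightarrow> int) set \<Rightarrow> ('v,'e) oriented_edge \<Rightarrow> int" where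
  "f_map G h x =
     (if x \<in> oriented_edges G
      then THE z. \<exists>\<phi> \<in> inf_cycles G 1. \<exists>(I :: nat set) l \<sigma> I'.
             h = inf_homology_class G 1 \<phi> \<and> standard_rep G 1 I l \<sigma> \<phi> \<and>
             admissible_part G I l \<sigma> (fst x) I' \<and>
             z = f_prime G (homologous_rel_set 1 (freudenthal G) {} (fin_part I' l \<sigma>)) x
      else 0)"


section \<open>Adequacy of countable index sets\<close>

lemma countable_graph:
  assumes "loopfree_digraph G" "Digraph_Component.connected G" "locally_finite G"
  shows "countable (verts G)" "countable (arcs G)"
proof -
  interpret loopfree_digraph G by fact
  let ?R = "parcs (mk_symmetric G)"
  have fin: "finite {e \<in> arcs G. tail G e = v \<or> head G e = v}" for v
  proof (cases "v \<in> verts G")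
    case False
    then have "{e \<in> arcs G. tail G e = v \<or> head G e = v} = {}" by auto
    then show ?thesis by (metis finite.emptyI)
  qed (use assms(3) in \<open>auto simp: locally_finite_def\<close>)
  have "countable (?R `` {v})" for v
  proof -
    have "?R `` {v} \<subseteq> tail G ` {e \<in> arcs G. tail G e = v \<or> head G e = v} \<union>
        head G ` {e \<in> arcs G. tail G e = v \<or> head G e = v}"
      by (auto simp: mk_symmetric_def)
    then have "finite (?R `` {v})"
      using fin[of v] by (meson finite_UnI finite_imageI finite_subset)
    then show ?thesis by (rule countable_finite)
  qed
  then have "countable (?R `` Y)" if "countable Y" for Y
    using that countable_UN[of Y "\<lambda>v. ?R `` {v}"] by (simp add: Image_eq_UN[of ?R Y])
  then have star: "countable (?R\<^sup>* `` {v})" for v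
    by (rule countable_rtrancl) auto
  obtain v0 where v0: "v0 \<in> verts G"
    and reach: "\<And>v. v \<in> verts G \<Longrightarrow> (v0, v) \<in> rtrancl_on (verts G) ?R"
    using assms(2)
    by (auto simp: Digraph_Component.connected_def strongly_connected_def reachable_def
        mk_symmetric_def)
  have "(a, b) \<in> ?R\<^sup>*" if "(a, b) \<in> rtrancl_on (verts G) ?R" for a b
    using that by induct auto
  with reach have "verts G \<subseteq> ?R\<^sup>* `` {v0}" by auto
  then show cv: "countable (verts G)" using star countable_subset by blast
  have "arcs G \<subseteq> (\<Union>v\<in>verts G. {e \<in> arcs G. tail G e = v \<or> head G e = v})"
    using tail_in_verts by blast
  moreover have "countable (\<Union>v\<in>verts G. {e \<in> arcs G. tail G e = v \<or> head G e = v})"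
    using cv fin countable_finite by (intro countable_UN) auto
  ultimately show "countable (arcs G)" using countable_subset by blast
qed

lemma thin_sum_in_oriented_cycle_space:
  fixes I :: "'i set" and G :: "('v,'e) pre_digraph"
  assumes G: "loopfree_digraph G" "Digraph_Component.connected G" "locally_finite G"
    and circ: "\<And>i. i \<in> I \<Longrightarrow> is_circle G (\<alpha> i)"
    and thin: "thin G I (\<lambda>i. oriented_circuit G (\<alpha> i))"
  shows "thin_sum I (\<lambda>i. oriented_circuit G (\<alpha> i)) \<in> oriented_cycle_space G"
proof -
  let ?S = "\<lambda>x. {i \<in> I. oriented_circuit G (\<alpha> i) x \<noteq> 0}"
  let ?I = "\<Union>x\<in>oriented_edges G. ?S x"
  have rev: "reverse x \<in> oriented_edges G \<longleftrightarrow> x \<in> oriented_edges G" for x :: "('v,'e) oriented_edge"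
    by (cases x) (auto simp: oriented_edges_def reverse_def natural_orientation_def)
  have out: "oriented_circuit G \<beta> x = 0" if "x \<notin> oriented_edges G" for \<beta> x
    using that rev[of x]
    by (cases x) (auto simp: oriented_circuit_def traverses_def reverse_def)
  have "countable (oriented_edges G)"
    using countable_graph[OF G] by (auto simp: oriented_edges_def)
  then have cI: "countable ?I"
    using thin countable_finite by (intro countable_UN) (auto simp: thin_def)
  define h where "h = to_nat_on ?I"
  have inj: "inj_on h ?I" unfolding h_def by (rule inj_on_to_nat_on[OF cI])
  define g where "g = inv_into ?I h"
  have gh: "g (h i) = i" if "i \<in> ?I" for i
    unfolding g_def by (rule inv_into_f_f[OF inj that])
  have img: "{j \<in> h ` ?I. oriented_circuit G (\<alpha> (g j)) x \<noteq> 0} = h ` ?S x" (is "?L = ?R")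
    if "x \<in> oriented_edges G" for x
  proof
    show "?L \<subseteq> ?R" using gh by fastforce
    show "?R \<subseteq> ?L" using gh that by fastforce
  qed
  have "thin_sum I (\<lambda>i. oriented_circuit G (\<alpha> i)) x =
      thin_sum (h ` ?I) (\<lambda>j. oriented_circuit G (\<alpha> (g j))) x" for x
  proof (cases "x \<in> oriented_edges G")
    case True
    then have sub: "?S x \<subseteq> ?I" by auto
    have "thin_sum (h ` ?I) (\<lambda>j. oriented_circuit G (\<alpha> (g j))) x =
        (\<Sum>j\<in>h ` ?S x. oriented_circuit G (\<alpha> (g j)) x)"
      unfolding thin_sum_def using img[OF True] by simp
    also have "\<dots> = (\<Sum>i\<in>?S x. oriented_circuit G (\<alpha> (g (h i))) x)"
      using sum.reindex[OF inj_on_subset[OF inj sub]] by (simp add: comp_def)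
    also have "\<dots> = thin_sum I (\<lambda>i. oriented_circuit G (\<alpha> i)) x"
      unfolding thin_sum_def
    proof (rule sum.cong)
      fix i assume "i \<in> ?S x"
      then have "i \<in> ?I" using sub by (rule subsetD[rotated])
      then show "oriented_circuit G (\<alpha> (g (h i))) x = oriented_circuit G (\<alpha> i) x"
        by (simp only: gh)
    qed simp
    finally show ?thesis by simp
  qed (simp add: thin_sum_def out)
  then have "thin_sum I (\<lambda>i. oriented_circuit G (\<alpha> i)) =
      thin_sum (h ` ?I) (\<lambda>j. oriented_circuit G (\<alpha> (g j)))" by (rule ext)
  moreover have "\<forall>j\<in>h ` ?I. is_circle G (\<alpha> (g j))"
    using gh circ by (metis (no_types, lifting) UN_E imageE mem_Collect_eq)
  moreover have "thin G (h ` ?I) (\<lambda>j. oriented_circuit G (\<alpha> (g j)))"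
    using img thin by (auto simp: thin_def)
  ultimately show ?thesis unfolding oriented_cycle_space_def mem_Collect_eq
    by (intro exI[of _ "h ` ?I"] exI[of _ "\<lambda>j. \<alpha> (g j)"] conjI)
qed

lemma simplicial_vertex_in_image:
  assumes "k \<le> n" shows "simplicial_vertex k \<tau> \<in> \<tau> ` standard_simplex n"
  using assms by (auto simp: simplicial_vertex_def standard_simplex_def sum.delta' intro!: imageI)

lemma good_familyE:
  assumes "good_family G n I \<sigma>" "x \<in> graph_points G"
  obtains U where "openin (graph_topology G) U" "x \<in> U"
    "finite {i \<in> I. \<sigma> i ` standard_simplex n \<inter> U \<noteq> {}}"
proof -
  from assms(1) have "\<forall>x\<in>graph_points G. \<exists>U. openin (graph_topology G) U \<and> x \<in> U \<and>
      finite {i \<in> I. \<sigma> i ` standard_simplex n \<inter> U \<noteq> {}}"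
    unfolding good_family_def by (elim conjE)
  from bspec[OF this assms(2)] show thesis
    by (elim exE conjE) (rule that)
qed

lemma good_familyD:
  assumes "good_family G n I \<sigma>" "i \<in> I"
  shows "singular_simplex n (freudenthal G) (\<sigma> i)"
    "\<forall>k\<le>n. simplicial_vertex k (\<sigma> i) \<in> graph_points G"
  using assms by (simp_all add: good_family_def)

lemma good_family_closed_edge:
  assumes "good_family G n I \<sigma>" "e \<in> arcs G" "wf_digraph G"
  shows "finite {i \<in> I. \<sigma> i ` standard_simplex n \<inter> closed_edge G e \<noteq> {}}"
proof -
  interpret wf_digraph G by fact
  have "theta G e t \<in> graph_points G" if "t \<in> {0..1}" for t
    using assms(2) that by (force simp: theta_def graph_points_def open_edge_def)
  then have "\<forall>t\<in>{0..1}. \<exists>U. openin (graph_topology G) U \<and> theta G e t \<in> U \<and>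
      finite {i \<in> I. \<sigma> i ` standard_simplex n \<inter> U \<noteq> {}}"
    using assms(1) unfolding good_family_def by blast
  from bchoice[OF this] obtain U where
      "\<forall>t\<in>{0..1}. openin (graph_topology G) (U t) \<and> theta G e t \<in> U t \<and>
        finite {i \<in> I. \<sigma> i ` standard_simplex n \<inter> U t \<noteq> {}}"
    by (elim exE)
  then have U: "\<And>t. t \<in> {0..1} \<Longrightarrow> openin (graph_topology G) (U t)"
      "\<And>t. t \<in> {0..1} \<Longrightarrow> theta G e t \<in> U t"
      "\<And>t. t \<in> {0..1} \<Longrightarrow> finite {i \<in> I. \<sigma> i ` standard_simplex n \<inter> U t \<noteq> {}}"
    by blast+
  define D where "D t = {s \<in> {0..1}. theta G e s \<in> U t}" for t
  have "compact {0..1::real}" by simp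
  moreover have "\<forall>c\<in>D ` {0..1}. openin (top_of_set {0..1}) c"
    using U(1) assms(2) by (auto simp: D_def openin_graph_topology)
  moreover have "{0..1} \<subseteq> \<Union>(D ` {0..1})" using U(2) by (auto simp: D_def)
  ultimately obtain K where K: "K \<subseteq> D ` {0..1}" "finite K" "{0..1} \<subseteq> \<Union>K"
    unfolding compact_eq_openin_cover by meson
  then obtain T where T: "T \<subseteq> {0..1}" "finite T" "K = D ` T"
    by (meson finite_subset_image)
  have "{i \<in> I. \<sigma> i ` standard_simplex n \<inter> closed_edge G e \<noteq> {}} \<subseteq>
      (\<Union>t\<in>T. {i \<in> I. \<sigma> i ` standard_simplex n \<inter> U t \<noteq> {}})"
  proof
    fix i assume i: "i \<in> {i \<in> I. \<sigma> i ` standard_simplex n \<inter> closed_edge G e \<noteq> {}}"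
    then obtain p where p: "p \<in> closed_edge G e" "p \<in> \<sigma> i ` standard_simplex n" by blast
    from p(1) obtain s where "s \<in> {0..1}" "p = theta G e s"
      unfolding closed_edge_def by (rule imageE)
    with p(2) have s: "s \<in> {0..1}" "theta G e s \<in> \<sigma> i ` standard_simplex n" by simp_all
    then obtain t where "t \<in> T" "theta G e s \<in> U t"
      using K(3) T(3) by (auto simp: D_def)
    with s i show "i \<in> (\<Union>t\<in>T. {i \<in> I. \<sigma> i ` standard_simplex n \<inter> U t \<noteq> {}})" by blast
  qed
  moreover have "finite (\<Union>t\<in>T. {i \<in> I. \<sigma> i ` standard_simplex n \<inter> U t \<noteq> {}})"
    using T U(3) by auto
  ultimately show ?thesis by (rule finite_subset)
qed

lemma good_family_countable:
  assumes G: "loopfree_digraph G" "Digraph_Component.connected G" "locally_finite G"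
    and good: "good_family G n I \<sigma>"
  shows "countable I"
proof -
  interpret loopfree_digraph G by fact
  let ?V = "\<lambda>v. {i \<in> I. Vertex v \<in> \<sigma> i ` standard_simplex n}"
  let ?E = "\<lambda>e. {i \<in> I. \<sigma> i ` standard_simplex n \<inter> closed_edge G e \<noteq> {}}"
  have "finite (?V v)" if "v \<in> verts G" for v
  proof -
    have "Vertex v \<in> graph_points G" using that by (simp add: graph_points_def)
    then obtain U where U: "Vertex v \<in> U" "finite {i \<in> I. \<sigma> i ` standard_simplex n \<inter> U \<noteq> {}}"
      using good unfolding good_family_def by blast
    have "?V v \<subseteq> {i \<in> I. \<sigma> i ` standard_simplex n \<inter> U \<noteq> {}}" using U(1) by blast
    with U(2) show ?thesis by (rule rev_finite_subset)
  qed
  then have "countable (\<Union>v\<in>verts G. ?V v)"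
    using countable_graph(1)[OF G] countable_finite by (intro countable_UN) auto
  moreover have "countable (\<Union>e\<in>arcs G. ?E e)"
    using countable_graph(2)[OF G] good_family_closed_edge[OF good _ wf_digraph] countable_finite
    by (intro countable_UN) auto
  moreover have "I \<subseteq> (\<Union>v\<in>verts G. ?V v) \<union> (\<Union>e\<in>arcs G. ?E e)"
  proof
    fix i assume i: "i \<in> I"
    let ?p = "simplicial_vertex 0 (\<sigma> i)"
    have p: "?p \<in> graph_points G" "?p \<in> \<sigma> i ` standard_simplex n"
      using good i simplicial_vertex_in_image[of 0 n "\<sigma> i"] by (auto simp: good_family_def)
    from p(1) consider v where "v \<in> verts G" "?p = Vertex v"
      | e where "e \<in> arcs G" "?p \<in> open_edge G e"
      by (auto simp: graph_points_def)
    then show "i \<in> (\<Union>v\<in>verts G. ?V v) \<union> (\<Union>e\<in>arcs G. ?E e)"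
    proof cases
      case 1
      then have "i \<in> ?V v" using p(2) i by simp
      with 1 show ?thesis by (intro UnI1 UN_I)
    next
      case 2
      have "open_edge G e \<subseteq> closed_edge G e"
        by (auto simp: open_edge_def closed_edge_def)
      with 2 have "i \<in> ?E e" using p(2) i by (simp only: mem_Collect_eq) blast
      with 2 show ?thesis by (intro UnI2 UN_I)
    qed
  qed
  ultimately show ?thesis by (meson countable_Un countable_subset)
qed

lemma formal_sum_in_inf_chains:
  assumes "good_family G n I \<sigma>"
  shows "formal_sum I l \<sigma> \<in> inf_chains G n"
proof -
  have supp: "{\<tau>. formal_sum I l \<sigma> \<tau> \<noteq> 0} \<subseteq> \<sigma> ` I"
  proof
    fix \<tau> assume "\<tau> \<in> {\<tau>. formal_sum I l \<sigma> \<tau> \<noteq> 0}"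
    then have "{i. i \<in> I \<and> \<sigma> i = \<tau>} \<noteq> {}"
      unfolding formal_sum_def by (intro notI) (simp only: mem_Collect_eq sum.empty)
    then show "\<tau> \<in> \<sigma> ` I" by blast
  qed
  have "\<exists>U. openin (graph_topology G) U \<and> x \<in> U \<and>
      finite {\<tau> \<in> {\<tau>. formal_sum I l \<sigma> \<tau> \<noteq> 0}. \<tau> ` standard_simplex n \<inter> U \<noteq> {}}"
    if x: "x \<in> graph_points G" for x
  proof -
    obtain U where U: "openin (graph_topology G) U" "x \<in> U"
      and fin: "finite {i \<in> I. \<sigma> i ` standard_simplex n \<inter> U \<noteq> {}}"
      by (rule good_familyE[OF assms x])
    have "{\<tau> \<in> {\<tau>. formal_sum I l \<sigma> \<tau> \<noteq> 0}. \<tau> ` standard_simplex n \<inter> U \<noteq> {}} \<subseteq>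
        \<sigma> ` {i \<in> I. \<sigma> i ` standard_simplex n \<inter> U \<noteq> {}}"
      using supp by blast
    then have "finite {\<tau> \<in> {\<tau>. formal_sum I l \<sigma> \<tau> \<noteq> 0}. \<tau> ` standard_simplex n \<inter> U \<noteq> {}}"
      using fin by (rule finite_subset[OF _ finite_imageI])
    with U show ?thesis by (intro exI[of _ U] conjI)
  qed
  moreover have "singular_simplex n (freudenthal G) \<tau>"
      "\<forall>k\<le>n. simplicial_vertex k \<tau> \<in> graph_points G" if "formal_sum I l \<sigma> \<tau> \<noteq> 0" for \<tau>
    using that supp good_familyD[OF assms] by auto
  ultimately show ?thesis
    unfolding inf_chains_def mem_Collect_eq by (subst good_family_def) auto
qed

lemma standard_rep_imp_inf_cycles:
  fixes I :: "'i set"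
  assumes G: "loopfree_digraph G" "Digraph_Component.connected G" "locally_finite G"
    and rep: "standard_rep G n I l \<sigma> \<phi>"
  shows "\<phi> \<in> inf_cycles G n"
proof -
  have good: "good_family G n I \<sigma>" and \<phi>: "\<phi> = formal_sum I l \<sigma>"
    using rep by (auto simp: standard_rep_def)
  obtain P where P: "partition_on I P"
    "\<And>J. J \<in> P \<Longrightarrow> finite J" "\<And>J. J \<in> P \<Longrightarrow> formal_sum J l \<sigma> \<in> fin_cycles G n"
    using rep by (auto simp: standard_rep_def)
  have cI: "countable I" by (rule good_family_countable[OF G good])
  define h where "h = to_nat_on I"
  have inj: "inj_on h I" unfolding h_def by (rule inj_on_to_nat_on[OF cI])
  define g where "g = inv_into I h"
  have gh: "g (h i) = i" if "i \<in> I" for i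
    unfolding g_def by (rule inv_into_f_f[OF inj that])
  have fs: "formal_sum (h ` J) (l \<circ> g) (\<sigma> \<circ> g) = formal_sum J l \<sigma>" if "J \<subseteq> I" for J
  proof
    fix \<tau>
    have eq: "{j. j \<in> h ` J \<and> (\<sigma> \<circ> g) j = \<tau>} = h ` {i. i \<in> J \<and> \<sigma> i = \<tau>}"
      using gh that by force
    have "inj_on h {i. i \<in> J \<and> \<sigma> i = \<tau>}" using that by (auto intro: inj_on_subset[OF inj])
    then have "formal_sum (h ` J) (l \<circ> g) (\<sigma> \<circ> g) \<tau> =
        (\<Sum>i | i \<in> J \<and> \<sigma> i = \<tau>. (l \<circ> g) (h i))"
      unfolding formal_sum_def eq by (simp add: sum.reindex comp_def)
    also have "\<dots> = formal_sum J l \<sigma> \<tau>"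
      unfolding formal_sum_def using gh that by (intro sum.cong) auto
    finally show "formal_sum (h ` J) (l \<circ> g) (\<sigma> \<circ> g) \<tau> = formal_sum J l \<sigma> \<tau>" .
  qed
  have "\<exists>U. openin (graph_topology G) U \<and> x \<in> U \<and>
      finite {j \<in> h ` I. (\<sigma> \<circ> g) j ` standard_simplex n \<inter> U \<noteq> {}}"
    if x: "x \<in> graph_points G" for x
  proof -
    obtain U where U: "openin (graph_topology G) U" "x \<in> U"
      and fin: "finite {i \<in> I. \<sigma> i ` standard_simplex n \<inter> U \<noteq> {}}"
      by (rule good_familyE[OF good x])
    have "{j \<in> h ` I. (\<sigma> \<circ> g) j ` standard_simplex n \<inter> U \<noteq> {}} \<subseteq>
        h ` {i \<in> I. \<sigma> i ` standard_simplex n \<inter> U \<noteq> {}}"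
    proof
      fix j assume j: "j \<in> {j \<in> h ` I. (\<sigma> \<circ> g) j ` standard_simplex n \<inter> U \<noteq> {}}"
      then obtain i where "i \<in> I" "j = h i" by blast
      with j gh show "j \<in> h ` {i \<in> I. \<sigma> i ` standard_simplex n \<inter> U \<noteq> {}}"
        by simp
    qed
    then have "finite {j \<in> h ` I. (\<sigma> \<circ> g) j ` standard_simplex n \<inter> U \<noteq> {}}"
      using fin by (rule finite_subset[OF _ finite_imageI])
    with U show ?thesis by (intro exI[of _ U] conjI)
  qed
  moreover have "singular_simplex n (freudenthal G) ((\<sigma> \<circ> g) j) \<and>
      (\<forall>k\<le>n. simplicial_vertex k ((\<sigma> \<circ> g) j) \<in> graph_points G)" if "j \<in> h ` I" for j
    using that gh good_familyD[OF good] by auto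
  ultimately have "good_family G n (h ` I) (\<sigma> \<circ> g)"
    by (subst good_family_def) auto
  moreover have "partition_on (h ` I) ((`) h ` P - {{}})"
    by (rule partition_on_inj_image[OF P(1) inj])
  moreover have "finite K \<and> formal_sum K (l \<circ> g) (\<sigma> \<circ> g) \<in> fin_cycles G n"
    if K: "K \<in> (`) h ` P - {{}}" for K
  proof -
    obtain J where J: "J \<in> P" "K = h ` J" using K by blast
    then have "J \<subseteq> I" using P(1) by (auto simp: partition_on_def)
    then show ?thesis using J P(2,3) fs by simp
  qed
  ultimately have "standard_rep G n (h ` I) (l \<circ> g) (\<sigma> \<circ> g) \<phi>"
    unfolding standard_rep_def using fs[OF order_refl] \<phi> by auto
  then show ?thesis
    unfolding inf_cycles_def using formal_sum_in_inf_chains[OF good, of l] \<phi> by blast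
qed

end

theory Submission
  imports Defs "HOL-Analysis.Further_Topology"
begin

text \<open>
  Every class is determined by its winding numbers round the edges, which are the values of \<open>f\<close>.
  Given an edge, a standard representation has a finite subfamily that is a cycle and contains all
  simplices meeting the edge; hence the winding numbers are integers, and over every finite cut they
  sum to \<open>0\<close>, because the product of the edge maps of a finite cut extends to a null-homotopic map on the
  compactification. The functions satisfying this cut condition are exactly the elements of the
  oriented cycle space: relative to a normal spanning tree, such a function is the thin sum of
  fundamental cycles weighted by its values on the chords.

  For surjectivity, even from finite cycles, one single loop has the prescribed winding numbers. It
  walks round the whole normal spanning tree, spending ever shorter time intervals on the branches,
  and inserts the required number of fundamental cycles at their lowest vertices; it is continuous at the ends
  because the subtrees above a branch form neighbourhood bases of its end.

  For injectivity, let all winding numbers of a cycle vanish. Going through the vertices one by one,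
  add boundaries of finite chains so that the cycle avoids the star of one further vertex in every
  step. A simplex used in a step avoids the stars already cleared or lies in the star of the current vertex,
  so every star is met in finitely many steps; the chains used add up to a good infinite chain, and the
  original cycle is its boundary.
\<close>

section \<open>Singular chains in low dimensions\<close>

text \<open>Windings are measured in real numbers, simplex by simplex, so that a chain can be
  evaluated before it is known to be a cycle; integrality appears only for cycles. A 1-chain with
  boundary 0 need not be an infinite cycle: the edges of a double ray joining two different ends add
  up to one that is not. The finite cut condition makes the difference. It leads to a description of
  the infinite cycles by conditions on their coefficients (\<open>has_flow\<close>), free of
  standard representations; sums, the kernel of \<open>f\<close> and the independence of choices are
  read off from it. The way back from it needs both hard parts: a cycle minus a loop with the same
  windings bounds, and an infinite boundary is represented in blocks, one for each 2-simplex. The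
  constants 2/3 and 3/4 belong together. Open stars of radius 2/3 > 1/2 cover the graph, so a chain
  driven off all of them is empty. The overlap of distance < 3/4 and distance > 2/3 allows paths to
  be cut into near and far pieces, and 3/4 < 1 keeps near pieces away from the neighbours, where
  arms of a star may meet again.\<close>

definition frag_eval :: "('a \<Rightarrow> real) \<Rightarrow> ('a \<Rightarrow>\<^sub>0 int) \<Rightarrow> real" where
  "frag_eval g c = (\<Sum>x\<in>Poly_Mapping.keys c. of_int (Poly_Mapping.lookup c x) * g x)"

lemma frag_eval_superset:
  assumes "finite A" "Poly_Mapping.keys c \<subseteq> A"
  shows "frag_eval g c = (\<Sum>x\<in>A. of_int (Poly_Mapping.lookup c x) * g x)"
  unfolding frag_eval_def using assms
  by (intro sum.mono_neutral_left) (auto simp: in_keys_iff)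

lemma frag_eval_0 [simp]: "frag_eval g 0 = 0"
  by (simp add: frag_eval_def)

lemma frag_eval_of [simp]: "frag_eval g (frag_of x) = g x"
  by (simp add: frag_eval_def)

lemma frag_eval_add: "frag_eval g (a + b) = frag_eval g a + frag_eval g b"
proof -
  let ?A = "Poly_Mapping.keys a \<union> Poly_Mapping.keys b"
  have "Poly_Mapping.keys (a + b) \<subseteq> ?A" by (rule Poly_Mapping.keys_add)
  then show ?thesis
    by (simp add: frag_eval_superset[of ?A] lookup_add ring_distribs sum.distrib)
qed

lemma frag_eval_cmul: "frag_eval g (frag_cmul k a) = of_int k * frag_eval g a"
proof -
  have "Poly_Mapping.keys (frag_cmul k a) \<subseteq> Poly_Mapping.keys a" by (rule keys_cmul)
  then show ?thesis
    by (simp add: frag_eval_superset[of "Poly_Mapping.keys a"] sum_distrib_left mult.assoc)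
qed

lemma frag_eval_minus: "frag_eval g (- a) = - frag_eval g a"
  using frag_eval_add[of g a "- a"] by simp

lemma frag_eval_diff: "frag_eval g (a - b) = frag_eval g a - frag_eval g b"
  using frag_eval_add[of g a "- b"] by (simp add: frag_eval_minus)

lemma frag_eval_sum: "frag_eval g (sum f A) = (\<Sum>i\<in>A. frag_eval g (f i))"
  by (induction A rule: infinite_finite_induct) (simp_all add: frag_eval_add)

lemma frag_eval_extend: "frag_eval g (frag_extend b c) = frag_eval (\<lambda>x. frag_eval g (b x)) c"
  by (simp add: frag_extend_def frag_eval_sum frag_eval_cmul) (simp add: frag_eval_def)

lemma frag_eval_cong:
  "(\<And>x. x \<in> Poly_Mapping.keys c \<Longrightarrow> g x = h x) \<Longrightarrow> frag_eval g c = frag_eval h c"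
  by (simp add: frag_eval_def)

lemma frag_eval_diff_fun: "frag_eval (\<lambda>x. g x - h x) c = frag_eval g c - frag_eval h c"
  by (simp add: frag_eval_def sum_subtractf ring_distribs)

lemma frag_eval_eq_0: "(\<And>x. x \<in> Poly_Mapping.keys c \<Longrightarrow> g x = 0) \<Longrightarrow> frag_eval g c = 0"
  by (simp add: frag_eval_def)

lemma frag_eval_boundary:
  "frag_eval g (chain_boundary p c) = frag_eval (\<lambda>\<tau>. frag_eval g (chain_boundary p (frag_of \<tau>))) c"
  by (simp add: chain_boundary_def frag_eval_extend frag_eval_eq_0)

section \<open>Paths as singular 1-simplices\<close>

definition bary :: "real \<Rightarrow> nat \<Rightarrow> real" where
  "bary t = (\<lambda>i. if i = 0 then 1 - t else if i = 1 then t else 0)"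

text \<open>Singular simplices are extensional, so the path has to be cut off outside the standard
  simplex; in return \<open>simplex_path\<close> recovers it on \<open>{0..1}\<close> only.\<close>

definition path_simplex :: "(real \<Rightarrow> 'a) \<Rightarrow> (nat \<Rightarrow> real) \<Rightarrow> 'a" where
  "path_simplex p = restrict (\<lambda>x. p (x 1)) (standard_simplex 1)"

definition simplex_path :: "((nat \<Rightarrow> real) \<Rightarrow> 'a) \<Rightarrow> real \<Rightarrow> 'a" where
  "simplex_path \<tau> t = \<tau> (bary t)"

definition point_simplex :: "'a \<Rightarrow> (nat \<Rightarrow> real) \<Rightarrow> 'a" where
  "point_simplex a = restrict (\<lambda>_. a) (standard_simplex 0)"

definition path_segment :: "(real \<Rightarrow> 'a) \<Rightarrow> real \<Rightarrow> real \<Rightarrow> (nat \<Rightarrow> real) \<Rightarrow> 'a" where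
  "path_segment p a b = path_simplex (\<lambda>t. p ((1 - t) * a + t * b))"

text \<open>The affine triangle with corners \<open>a\<close>, \<open>b\<close>, \<open>c\<close> in
  the parameter interval, followed by \<open>p\<close>. Its image is a piece of the path, while its
  boundary compares the path from \<open>a\<close> to \<open>c\<close> with its two parts; so
  subdividing a path costs only a boundary supported on the path itself.\<close>

definition triangle :: "(real \<Rightarrow> 'a) \<Rightarrow> real \<Rightarrow> real \<Rightarrow> real \<Rightarrow> (nat \<Rightarrow> real) \<Rightarrow> 'a" where
  "triangle p a b c = restrict (\<lambda>x. p (x 0 * a + x 1 * b + x 2 * c)) (standard_simplex 2)"

lemma bary_in_simplex: "t \<in> {0..1} \<Longrightarrow> bary t \<in> standard_simplex 1"
  by (auto simp: bary_def standard_simplex_def)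

lemma simplex_1_eq_bary: "x \<in> standard_simplex 1 \<Longrightarrow> x = bary (x 1) \<and> x 1 \<in> {0..1}"
proof -
  assume x: "x \<in> standard_simplex 1"
  then have "x 0 + x 1 = 1" "\<forall>i>1. x i = 0" "0 \<le> x 1" "x 1 \<le> 1"
    by (auto simp: standard_simplex_def)
  then show ?thesis by (auto simp: bary_def fun_eq_iff)
qed

lemma standard_simplex_1: "standard_simplex 1 = bary ` {0..1}"
  using bary_in_simplex simplex_1_eq_bary by blast

lemma bary_1 [simp]: "bary t 1 = t" "bary t (Suc 0) = t"
  by (simp_all add: bary_def)

lemma simplex_path_path_simplex: "t \<in> {0..1} \<Longrightarrow> simplex_path (path_simplex p) t = p t"
  using bary_in_simplex[of t] by (simp add: simplex_path_def path_simplex_def)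

lemma path_simplex_image: "path_simplex p ` standard_simplex 1 = p ` {0..1}"
  unfolding standard_simplex_1 path_simplex_def image_image by auto

lemma simplex_image: "\<tau> ` standard_simplex 1 = simplex_path \<tau> ` {0..1}"
  unfolding standard_simplex_1 by (auto simp: simplex_path_def)

lemma simplicial_vertex_path:
  "simplicial_vertex 0 \<tau> = simplex_path \<tau> 0" "simplicial_vertex (Suc 0) \<tau> = simplex_path \<tau> 1"
proof -
  have "(\<lambda>j. if j = 0 then 1 else 0) = bary 0" "(\<lambda>j. if j = Suc 0 then 1 else 0) = bary 1"
    by (auto simp: bary_def fun_eq_iff)
  then show "simplicial_vertex 0 \<tau> = simplex_path \<tau> 0"
    "simplicial_vertex (Suc 0) \<tau> = simplex_path \<tau> 1"
    by (simp_all add: simplicial_vertex_def simplex_path_def)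
qed

lemma continuous_map_coord:
  "continuous_map (subtopology (powertop_real UNIV) S) euclideanreal (\<lambda>x. x i)"
  by (rule continuous_map_from_subtopology) (rule continuous_map_product_projection, simp)

lemma singular_simplex_path_simplex:
  assumes "pathin X p" shows "singular_simplex 1 X (path_simplex p)"
proof -
  have "continuous_map (subtopology (powertop_real UNIV) (standard_simplex 1)) (top_of_set {0..1}) (\<lambda>x. x (1::nat))"
    by (auto simp: continuous_map_in_subtopology continuous_map_coord standard_simplex_def)
  from continuous_map_compose[OF this assms[unfolded pathin_def]]
  have "continuous_map (subtopology (powertop_real UNIV) (standard_simplex 1)) X (path_simplex p)"
    by (rule continuous_map_eq) (auto simp: path_simplex_def)
  then show ?thesis by (auto simp: singular_simplex_def path_simplex_def)
qed

lemma pathin_simplex_path: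
  assumes "singular_simplex 1 X \<tau>" shows "pathin X (simplex_path \<tau>)"
proof -
  have "continuous_map (top_of_set {0..1}) (subtopology (powertop_real UNIV) (standard_simplex 1)) bary"
    unfolding continuous_map_in_subtopology
  proof
    show "continuous_map (top_of_set {0..1}) (powertop_real UNIV) bary"
      unfolding continuous_map_componentwise_UNIV
    proof
      fix k
      have "continuous_on {0..1} (\<lambda>x. bary x k)"
        by (cases "k = 0"; cases "k = 1") (auto simp: bary_def intro!: continuous_intros)
      then show "continuous_map (top_of_set {0..1}) euclideanreal (\<lambda>x. bary x k)" by simp
    qed
  qed (use bary_in_simplex in auto)
  then show ?thesis
    using assms continuous_map_compose unfolding singular_simplex_def pathin_def simplex_path_def comp_def
    by fastforce
qed

lemma path_simplex_simplex_path:
  assumes "singular_simplex 1 X \<tau>" shows "path_simplex (simplex_path \<tau>) = \<tau>"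
proof
  fix x show "path_simplex (simplex_path \<tau>) x = \<tau> x"
  proof (cases "x \<in> standard_simplex 1")
    case True
    then have "bary (x 1) = x" using simplex_1_eq_bary by metis
    then show ?thesis using True by (simp add: path_simplex_def simplex_path_def)
  qed (use assms in \<open>auto simp: path_simplex_def singular_simplex_def extensional_def\<close>)
qed

lemma point_simplex_eq_iff [simp]: "point_simplex a = point_simplex b \<longleftrightarrow> a = b"
proof
  assume "point_simplex a = point_simplex b"
  then have "point_simplex a (\<lambda>j. if j = 0 then 1 else 0) = point_simplex b (\<lambda>j. if j = 0 then 1 else 0)"
    by simp
  then show "a = b" by (simp add: point_simplex_def)
qed simp

lemma boundary_1:
  "chain_boundary 1 (frag_of \<tau>) =
    frag_of (point_simplex (simplex_path \<tau> 1)) - frag_of (point_simplex (simplex_path \<tau> 0))"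
proof -
  have "simplical_face 0 (\<lambda>j. if j = 0 then 1 else 0) = bary 1"
    "simplical_face 1 (\<lambda>j. if j = 0 then 1 else 0) = bary 0"
    by (auto simp: simplical_face_def bary_def)
  then have "singular_face 1 0 \<tau> = point_simplex (simplex_path \<tau> 1)"
    "singular_face 1 1 \<tau> = point_simplex (simplex_path \<tau> 0)"
    unfolding singular_face_def point_simplex_def simplex_path_def diff_self_eq_0 One_nat_def[symmetric] standard_simplex_0
    by (auto intro!: restrict_ext)
  then show ?thesis by (simp add: chain_boundary_of)
qed

lemma boundary_2:
  "chain_boundary 2 (frag_of \<kappa>) =
    frag_of (singular_face 2 0 \<kappa>) - frag_of (singular_face 2 1 \<kappa>) + frag_of (singular_face 2 2 \<kappa>)"
  by (simp add: chain_boundary_of numeral_2_eq_2 frag_of_eq)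

lemma frag_eval_boundary_1:
  "frag_eval g (chain_boundary 1 c) =
     frag_eval (\<lambda>\<tau>. g (point_simplex (simplex_path \<tau> 1)) - g (point_simplex (simplex_path \<tau> 0))) c"
  by (subst frag_eval_boundary) (simp only: boundary_1 frag_eval_diff frag_eval_of)

lemma simplical_face_bary:
  "simplical_face 0 (bary t) = (\<lambda>i. if i = 1 then 1 - t else if i = 2 then t else 0)"
  "simplical_face (Suc 0) (bary t) = (\<lambda>i. if i = 0 then 1 - t else if i = 2 then t else 0)"
  "simplical_face 2 (bary t) = (\<lambda>i. if i = 0 then 1 - t else if i = 1 then t else 0)"
  by (auto simp: simplical_face_def bary_def fun_eq_iff)

lemma simplical_face_bary_in:
  assumes "t \<in> {0..1}" "k \<le> 2" shows "simplical_face k (bary t) \<in> standard_simplex 2"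
  using simplical_face_in_standard_simplex[of 2 k "bary t"] bary_in_simplex[OF assms(1)] assms(2) by simp

lemma singular_face_path_simplex:
  "singular_face 2 k \<kappa> = path_simplex (\<lambda>t. \<kappa> (simplical_face k (bary t)))"
proof
  fix x
  show "singular_face 2 k \<kappa> x = path_simplex (\<lambda>t. \<kappa> (simplical_face k (bary t))) x"
  proof (cases "x \<in> standard_simplex 1")
    case True
    then obtain t where "x = bary t" "t \<in> {0..1}" unfolding standard_simplex_1 by blast
    then show ?thesis using True by (simp add: singular_face_def path_simplex_def)
  qed (auto simp: singular_face_def path_simplex_def)
qed

lemma path_simplex_cong: "(\<And>t. t \<in> {0..1} \<Longrightarrow> p t = q t) \<Longrightarrow> path_simplex p = path_simplex q"
  unfolding path_simplex_def standard_simplex_1 by (rule restrict_ext) auto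

lemma boundary_triangle:
  "chain_boundary 2 (frag_of (triangle p a b c)) =
    frag_of (path_segment p b c) - frag_of (path_segment p a c) + frag_of (path_segment p a b)"
proof -
  have *: "triangle p a b c (simplical_face k (bary t)) = p (simplical_face k (bary t) 0 * a +
     simplical_face k (bary t) 1 * b + simplical_face k (bary t) 2 * c)" if "t \<in> {0..1}" "k \<le> 2" for t k
    using simplical_face_bary_in[OF that] by (simp add: triangle_def)
  have "singular_face 2 0 (triangle p a b c) = path_segment p b c"
    "singular_face 2 1 (triangle p a b c) = path_segment p a c"
    "singular_face 2 2 (triangle p a b c) = path_segment p a b"
    unfolding singular_face_path_simplex path_segment_def
    by (rule path_simplex_cong, simp only: *, simp add: simplical_face_bary)+
  then show ?thesis by (simp add: boundary_2)
qed

section \<open>Triangles cut out of a path\<close>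

lemma convex_comb_3:
  fixes a :: real
  assumes "convex S" "a \<in> S" "b \<in> S" "c \<in> S" "x \<in> standard_simplex 2"
  shows "x 0 * a + x 1 * b + x 2 * c \<in> S"
proof -
  have "x 0 + x 1 + x 2 = 1" "0 \<le> x 0" "0 \<le> x 1" "0 \<le> x 2"
    using assms(5) by (auto simp: standard_simplex_def numeral_2_eq_2)
  moreover from this have "\<exists>u\<ge>0. \<exists>v\<ge>0. \<exists>w\<ge>0. x 0 * a + x 1 * b + x 2 * c = u *\<^sub>R a + v *\<^sub>R b + w *\<^sub>R c \<and> u + v + w = 1"
    by (intro exI[of _ "x 0"] conjI exI[of _ "x 1"] exI[of _ "x 2"]) auto
  ultimately have "x 0 * a + x 1 * b + x 2 * c \<in> convex hull {a, b, c}"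
    unfolding convex_hull_3 by blast
  then show ?thesis using hull_minimal[of "{a, b, c}" S convex] assms(1-4) by blast
qed

lemma continuous_map_triangle:
  "continuous_map (subtopology (powertop_real UNIV) S) euclideanreal (\<lambda>x. x 0 * a + x 1 * b + x (2::nat) * c)"
  by (intro continuous_map_add continuous_map_real_mult continuous_map_coord) simp_all

lemma triangle_image:
  assumes "convex S" "a \<in> S" "b \<in> S" "c \<in> S"
  shows "triangle p a b c ` standard_simplex 2 \<subseteq> p ` S"
  using convex_comb_3[OF assms] by (auto simp: triangle_def)

lemma singular_simplex_triangle:
  assumes "continuous_map (top_of_set S) X p" "convex S" "a \<in> S" "b \<in> S" "c \<in> S"
  shows "singular_simplex 2 X (triangle p a b c)"
proof -
  have "continuous_map (subtopology (powertop_real UNIV) (standard_simplex 2)) (top_of_set S)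
      (\<lambda>x. x 0 * a + x 1 * b + x 2 * c)"
    using convex_comb_3[OF assms(2-5)] continuous_map_triangle
    by (auto simp: continuous_map_in_subtopology)
  from continuous_map_compose[OF this assms(1)]
  have "continuous_map (subtopology (powertop_real UNIV) (standard_simplex 2)) X (triangle p a b c)"
    by (rule continuous_map_eq) (auto simp: triangle_def)
  then show ?thesis by (auto simp: singular_simplex_def triangle_def)
qed

lemma pathin_path_segment:
  assumes "continuous_map (top_of_set S) X p" "convex S" "a \<in> S" "b \<in> S"
  shows "pathin X (\<lambda>t. p ((1 - t) * a + t * b))"
proof -
  have "continuous_map (top_of_set {0..1}) (top_of_set S) (\<lambda>t. (1 - t) * a + t * b)"
    using convexD_alt[OF assms(2-4)] by (auto intro!: continuous_intros)
  from continuous_map_compose[OF this assms(1)] show ?thesis by (simp add: pathin_def comp_def)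
qed

lemma singular_simplex_path_segment:
  assumes "continuous_map (top_of_set S) X p" "convex S" "a \<in> S" "b \<in> S"
  shows "singular_simplex 1 X (path_segment p a b)"
  unfolding path_segment_def by (rule singular_simplex_path_simplex[OF pathin_path_segment[OF assms]])

lemma path_segment_image:
  assumes "a \<le> b" shows "path_segment p a b ` standard_simplex 1 = p ` {a..b}"
proof -
  have "(\<lambda>t. (1 - t) * a + t * b) ` {0..1} = closed_segment a b"
    by (simp add: closed_segment_image_interval)
  then have "p ` closed_segment a b = (\<lambda>t. p ((1 - t) * a + t * b)) ` {0..1}"
    by (metis image_image)
  then show ?thesis
    using assms by (simp add: path_segment_def path_simplex_image[unfolded One_nat_def] closed_segment_eq_real_ivl)
qed

lemma path_segment_ends [simp]: "simplex_path (path_segment p a b) 0 = p a" "simplex_path (path_segment p a b) 1 = p b"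
  by (simp_all add: path_segment_def simplex_path_path_simplex)

lemma path_segment_0_1: "path_segment p 0 1 = path_simplex p"
  by (simp add: path_segment_def)

section \<open>Winding numbers and the homology of the circle\<close>

lemma cis_eq_1_imp_Ints: "cis (2 * pi * x) = 1 \<Longrightarrow> x \<in> \<int>"
proof -
  assume "cis (2 * pi * x) = 1"
  then have "cos (2 * pi * x) = 1" by (metis cis.simps(1) one_complex.simps(1))
  then obtain n :: int where "2 * pi * x = of_int n * 2 * pi"
    unfolding cos_one_2pi_int by blast
  then have "x = of_int n" by (simp add: field_simps)
  then show ?thesis by simp
qed

lemma cis_eq_iff_Ints: "cis (2 * pi * x) = cis (2 * pi * y) \<longleftrightarrow> x - y \<in> \<int>"
proof
  assume "cis (2 * pi * x) = cis (2 * pi * y)"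
  then have "cis (2 * pi * (x - y)) = 1"
    by (simp add: ring_distribs flip: cis_divide)
  then show "x - y \<in> \<int>" by (rule cis_eq_1_imp_Ints)
next
  assume "x - y \<in> \<int>"
  then have "cis (2 * pi * (x - y)) = 1" by (rule cis_multiple_2pi)
  then show "cis (2 * pi * x) = cis (2 * pi * y)"
    by (simp add: ring_distribs flip: cis_divide)
qed

text \<open>The difference of two lifts is continuous with integer values, and distinct integers are
  at least 1 apart; so it is constant on a connected set.\<close>

lemma cis_lift_unique:
  fixes g h :: "real \<Rightarrow> real"
  assumes "Topological_Spaces.connected S" "continuous_on S g" "continuous_on S h"
    "\<And>t. t \<in> S \<Longrightarrow> cis (2 * pi * g t) = cis (2 * pi * h t)" "a \<in> S" "b \<in> S"
  shows "g b - g a = h b - h a"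
proof -
  have int: "g t - h t \<in> \<int>" if "t \<in> S" for t
    using assms(4)[OF that] by (simp add: cis_eq_iff_Ints)
  have "(\<lambda>t. g t - h t) constant_on S"
  proof (rule continuous_discrete_range_constant[OF assms(1)])
    show "continuous_on S (\<lambda>t. g t - h t)" by (intro continuous_intros assms)
    fix x assume x: "x \<in> S"
    show "\<exists>e>0. \<forall>y. y \<in> S \<and> g y - h y \<noteq> g x - h x \<longrightarrow> e \<le> norm (g y - h y - (g x - h x))"
    proof (intro exI[of _ 1] conjI allI impI)
      fix y assume y: "y \<in> S \<and> g y - h y \<noteq> g x - h x"
      have "g y - h y - (g x - h x) \<in> \<int>" using Ints_diff[OF int[of y] int[of x]] x y by simp
      then show "1 \<le> norm (g y - h y - (g x - h x))"
        using y Ints_nonzero_abs_ge1[of "g y - h y - (g x - h x)"] by simp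
    qed simp
  qed
  then have "g b - h b = g a - h a" using assms(5,6) unfolding constant_on_def by metis
  then show ?thesis by simp
qed

text \<open>The total change of angle, in full turns, along any lift. Open paths are included, hence
  the real value; \<open>cis_lift_unique\<close> shows that the lift does not matter.\<close>

definition winding :: "(real \<Rightarrow> complex) \<Rightarrow> real" where
  "winding p = (THE d. \<exists>g. continuous_on {0..1} g \<and> (\<forall>t\<in>{0..1}. p t = cis (2 * pi * g t)) \<and> d = g 1 - g 0)"

lemma windingI:
  assumes "continuous_on {0..1} g" "\<And>t. t \<in> {0..1} \<Longrightarrow> p t = cis (2 * pi * g t)"
  shows "winding p = g 1 - g 0"
  unfolding winding_def
proof (rule the_equality)
  show "\<exists>h. continuous_on {0..1} h \<and> (\<forall>t\<in>{0..1}. p t = cis (2 * pi * h t)) \<and> g 1 - g 0 = h 1 - h 0"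
    using assms by blast
  fix d assume "\<exists>h. continuous_on {0..1} h \<and> (\<forall>t\<in>{0..1}. p t = cis (2 * pi * h t)) \<and> d = h 1 - h 0"
  then obtain h where h: "continuous_on {0..1} h" "\<And>t. t \<in> {0..1} \<Longrightarrow> p t = cis (2 * pi * h t)" "d = h 1 - h 0"
    by blast
  have "h 1 - h 0 = g 1 - g 0"
    by (rule cis_lift_unique[OF _ h(1) assms(1)]) (use h(2) assms(2) in auto)
  then show "d = g 1 - g 0" using h(3) by simp
qed

lemma winding_cong: "(\<And>t. t \<in> {0..1} \<Longrightarrow> p t = q t) \<Longrightarrow> winding p = winding q"
  by (simp add: winding_def)

text \<open>A convex set is contractible and so admits a continuous logarithm; on the unit circle
  its real part is 0 and its imaginary part is the angle.\<close>

lemma circle_lift: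
  fixes f :: "'a::real_normed_vector \<Rightarrow> complex"
  assumes "continuous_on S f" "convex S" "f ` S \<subseteq> sphere 0 1"
  obtains g where "continuous_on S g" "\<And>x. x \<in> S \<Longrightarrow> f x = cis (2 * pi * g x)"
proof -
  have nz: "f x \<noteq> 0" if "x \<in> S" for x using assms(3) that by fastforce
  obtain g where g: "continuous_on S g" "\<And>x. x \<in> S \<Longrightarrow> f x = exp (g x)"
    using continuous_logarithm_on_contractible[OF assms(1) convex_imp_contractible[OF assms(2)] nz] by blast
  show thesis
  proof
    show "continuous_on S (\<lambda>x. Im (g x) / (2 * pi))" by (intro continuous_intros g) simp
    fix x assume x: "x \<in> S"
    then have "norm (exp (g x)) = 1" using g(2)[OF x] assms(3) by fastforce
    then have "Re (g x) = 0" by (simp add: norm_exp_eq_Re)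
    then show "f x = cis (2 * pi * (Im (g x) / (2 * pi)))"
      using g(2)[OF x] by (simp add: exp_eq_polar)
  qed
qed

lemma winding_affine:
  assumes "continuous_on {0..1} g" "\<And>t. t \<in> {0..1} \<Longrightarrow> p t = cis (2 * pi * g t)"
    and "a \<in> {0..1}" "b \<in> {0..1}"
  shows "winding (\<lambda>t. p ((1 - t) * a + t * b)) = g b - g a"
proof -
  have in01: "(1 - t) * a + t * b \<in> {0..1}" if "t \<in> {0..1}" for t
    using convexD_alt[of "{0..1::real}" a b t] that assms(3,4) by simp
  have "winding (\<lambda>t. p ((1 - t) * a + t * b)) = g ((1 - 1) * a + 1 * b) - g ((1 - 0) * a + 0 * b)"
  proof (rule windingI)
    show "continuous_on {0..1} (\<lambda>t. g ((1 - t) * a + t * b))"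
      by (rule continuous_on_compose2[OF assms(1)]) (use in01 in \<open>auto intro!: continuous_intros\<close>)
  qed (use in01 assms(2) in auto)
  then show ?thesis by simp
qed

lemma winding_const: "norm c = 1 \<Longrightarrow> (\<And>t. t \<in> {0..1} \<Longrightarrow> p t = c) \<Longrightarrow> winding p = 0"
proof -
  assume c: "norm c = 1" "\<And>t. t \<in> {0..1} \<Longrightarrow> p t = c"
  have "cis (Arg c) = c" using c(1) by (metis cis_Arg norm_zero sgn_eq div_by_1 of_real_1 zero_neq_one)
  then have "winding p = (\<lambda>t::real. Arg c / (2 * pi)) 1 - (\<lambda>t. Arg c / (2 * pi)) 0"
    by (intro windingI) (auto simp: c(2))
  then show ?thesis by simp
qed

lemma pathin_circle_iff: "pathin circle_top p \<longleftrightarrow> continuous_on {0..1} p \<and> p ` {0..1} \<subseteq> sphere 0 1"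
  by (auto simp: pathin_def)

lemma pathin_circle_lift:
  assumes "pathin circle_top p"
  obtains g where "continuous_on {0..1} g" "\<And>t. t \<in> {0..1} \<Longrightarrow> p t = cis (2 * pi * g t)"
  using assms circle_lift[of "{0..1}" p] unfolding pathin_circle_iff by (metis convex_real_interval(5))

section \<open>Windings of singular chains in the circle\<close>

abbreviation simplex_winding :: "((nat \<Rightarrow> real) \<Rightarrow> complex) \<Rightarrow> real" where
  "simplex_winding \<tau> \<equiv> winding (simplex_path \<tau>)"

text \<open>A single lift \<open>g\<close> on the whole triangle serves all three faces, so the
  windings of the faces are differences of \<open>g\<close> at the corners and cancel. The triangle
  is first parametrised by a convex set in the plane, because \<open>circle_lift\<close> asks for a
  normed space.\<close>

lemma winding_boundary_2:
  assumes "singular_simplex 2 circle_top \<kappa>"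
  shows "frag_eval simplex_winding (chain_boundary 2 (frag_of \<kappa>)) = 0"
proof -
  define x :: "real \<times> real \<Rightarrow> nat \<Rightarrow> real" where
    "x z = (\<lambda>i. if i = 0 then 1 - fst z - snd z else if i = 1 then fst z else if i = 2 then snd z else 0)" for z
  define S where "S = {z::real\<times>real. fst z \<ge> 0 \<and> snd z \<ge> 0 \<and> fst z + snd z \<le> 1}"
  have S: "convex S"
  proof -
    have "S = {z. fst z \<ge> 0} \<inter> {z. snd z \<ge> 0} \<inter> {z. fst z + snd z \<le> 1}" by (auto simp: S_def)
    moreover have "convex {z::real\<times>real. fst z \<ge> 0}" "convex {z::real\<times>real. snd z \<ge> 0}"
      by (auto simp: convex_def)
    moreover have "convex {z::real\<times>real. fst z + snd z \<le> 1}"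
    proof -
      have "{z::real\<times>real. fst z + snd z \<le> 1} = {z. inner (1,1) z \<le> 1}"
        by (auto simp: inner_prod_def)
      then show ?thesis by (simp add: convex_halfspace_le)
    qed
    ultimately show ?thesis by (simp add: convex_Int)
  qed
  have "continuous_map (top_of_set S) (subtopology (powertop_real UNIV) (standard_simplex 2)) x"
    unfolding continuous_map_in_subtopology
  proof
    show "continuous_map (top_of_set S) (powertop_real UNIV) x"
      unfolding continuous_map_componentwise_UNIV
    proof
      fix k
      have "continuous_on S (\<lambda>z. x z k)"
        unfolding x_def by (cases "k = 0"; cases "k = 1"; cases "k = 2") (auto intro!: continuous_intros)
      then show "continuous_map (top_of_set S) euclideanreal (\<lambda>z. x z k)" by simp
    qed
    show "x \<in> topspace (top_of_set S) \<rightarrow> standard_simplex 2"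
      by (auto simp: S_def x_def standard_simplex_def numeral_2_eq_2)
  qed
  then have "continuous_map (top_of_set S) circle_top (\<kappa> \<circ> x)"
    using assms continuous_map_compose unfolding singular_simplex_def by blast
  then have "continuous_on S (\<kappa> \<circ> x)" "(\<kappa> \<circ> x) ` S \<subseteq> sphere 0 1" by auto
  from circle_lift[OF this(1) S this(2)] obtain g where
    g: "continuous_on S g" "\<And>z. z \<in> S \<Longrightarrow> \<kappa> (x z) = cis (2 * pi * g z)" by auto
  have face: "simplex_winding (singular_face 2 k \<kappa>) = g (q 1) - g (q 0)"
    if q: "continuous_on {0..1} q" "\<And>t. t \<in> {0..1} \<Longrightarrow> q t \<in> S"
      "\<And>t. t \<in> {0..1} \<Longrightarrow> simplical_face k (bary t) = x (q t)" for k and q :: "real \<Rightarrow> real \<times> real"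
  proof (rule windingI)
    show "continuous_on {0..1} (\<lambda>t. g (q t))"
      by (rule continuous_on_compose2[OF g(1) q(1)]) (use q(2) in auto)
    fix t :: real assume "t \<in> {0..1}"
    then show "simplex_path (singular_face 2 k \<kappa>) t = cis (2 * pi * g (q t))"
      using q g(2) by (simp add: singular_face_path_simplex simplex_path_path_simplex)
  qed
  have "simplex_winding (singular_face 2 0 \<kappa>) = g (0, 1) - g (1, 0)"
    by (subst face[where q = "\<lambda>t. (1 - t, t)"]) (auto intro!: continuous_intros simp: S_def x_def simplical_face_bary fun_eq_iff)
  moreover have "simplex_winding (singular_face 2 1 \<kappa>) = g (0, 1) - g (0, 0)"
    by (subst face[where q = "\<lambda>t. (0, t)"]) (auto intro!: continuous_intros simp: S_def x_def simplical_face_bary fun_eq_iff)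
  moreover have "simplex_winding (singular_face 2 2 \<kappa>) = g (1, 0) - g (0, 0)"
    by (subst face[where q = "\<lambda>t. (t, 0)"]) (auto intro!: continuous_intros simp: S_def x_def simplical_face_bary fun_eq_iff)
  ultimately show ?thesis by (simp add: boundary_2 frag_eval_add frag_eval_diff)
qed

lemma winding_boundary:
  assumes "singular_chain 2 circle_top c"
  shows "frag_eval simplex_winding (chain_boundary 2 c) = 0"
  unfolding frag_eval_boundary[of _ 2 c]
  by (rule frag_eval_eq_0) (use assms winding_boundary_2 in \<open>auto simp: singular_chain_def\<close>)

text \<open>Summation by parts: differences of a potential \<open>k\<close> see only the boundary.
  The point \<open>bary 0\<close> is the one element of the standard 0-simplex, so
  \<open>\<rho> (bary 0)\<close> reads off the point that \<rho> represents.\<close>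

lemma frag_eval_coboundary:
  "frag_eval (\<lambda>\<tau>. k (simplex_path \<tau> 1) - k (simplex_path \<tau> 0)) c = frag_eval (\<lambda>\<rho>. k (\<rho> (bary 0))) (chain_boundary 1 c)"
proof -
  have "point_simplex a (bary 0) = a" for a :: 'a
    unfolding point_simplex_def standard_simplex_0 by (auto simp: bary_def)
  then show ?thesis unfolding frag_eval_boundary_1 by simp
qed

text \<open>Choose an angle \<open>a\<close> for every point of the circle, without any continuity.
  The winding of a simplex differs from the difference of \<open>a\<close> at its ends by an
  integer, and these differences form a coboundary, which is 0 on cycles.\<close>

lemma winding_cycle_Ints:
  assumes "singular_relcycle 1 circle_top {} z"
  shows "frag_eval simplex_winding z \<in> \<int>"
proof -
  define a where "a c = Arg c / (2 * pi)" for c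
  have a: "cis (2 * pi * a c) = c" if "norm c = 1" for c
    using that unfolding a_def by (metis cis_Arg norm_zero sgn_eq div_by_1 of_real_1 zero_neq_one
        times_divide_eq_right nonzero_mult_div_cancel_left mult_eq_0_iff pi_neq_zero zero_neq_numeral)
  have sz: "singular_simplex 1 circle_top \<tau>" if "\<tau> \<in> Poly_Mapping.keys z" for \<tau>
    using assms that by (auto simp: singular_cycle singular_chain_def)
  have int: "simplex_winding \<tau> - (a (simplex_path \<tau> 1) - a (simplex_path \<tau> 0)) \<in> \<int>"
    if \<tau>: "\<tau> \<in> Poly_Mapping.keys z" for \<tau>
  proof -
    have p: "pathin circle_top (simplex_path \<tau>)" using pathin_simplex_path[OF sz[OF \<tau>]] .
    obtain g where g: "continuous_on {0..1} g" "\<And>t. t \<in> {0..1} \<Longrightarrow> simplex_path \<tau> t = cis (2 * pi * g t)"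
      using pathin_circle_lift[OF p] by blast
    have n: "norm (simplex_path \<tau> t) = 1" if "t \<in> {0..1}" for t using p that unfolding pathin_circle_iff by fastforce
    have "g t - a (simplex_path \<tau> t) \<in> \<int>" if "t \<in> {0..1}" for t
      using g(2)[OF that] a[OF n[OF that]] by (simp add: flip: cis_eq_iff_Ints)
    moreover have "simplex_winding \<tau> = g 1 - g 0" by (rule windingI) (use g in auto)
    then have "simplex_winding \<tau> - (a (simplex_path \<tau> 1) - a (simplex_path \<tau> 0)) =
        (g 1 - a (simplex_path \<tau> 1)) - (g 0 - a (simplex_path \<tau> 0))" by simp
    ultimately show ?thesis using Ints_diff[of "g 1 - a (simplex_path \<tau> 1)" "g 0 - a (simplex_path \<tau> 0)"]
      by (metis atLeastAtMost_iff order_refl zero_le_one)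
  qed
  have "chain_boundary 1 z = 0" using assms by (simp add: singular_cycle)
  then have "frag_eval (\<lambda>\<tau>. a (simplex_path \<tau> 1) - a (simplex_path \<tau> 0)) z = 0"
    by (simp only: frag_eval_coboundary frag_eval_0)
  then have "frag_eval simplex_winding z =
      frag_eval (\<lambda>\<tau>. simplex_winding \<tau> - (a (simplex_path \<tau> 1) - a (simplex_path \<tau> 0))) z"
    by (simp only: frag_eval_diff_fun[of simplex_winding] diff_zero)
  also have "\<dots> \<in> \<int>" unfolding frag_eval_def using int by (intro Ints_sum Ints_mult) auto
  finally show ?thesis .
qed

section \<open>First homology of the circle and the degree\<close>

lemma eta_cis: "eta k t = cis (2 * pi * (of_int k * t))"
  by (simp add: eta_def cis_conv_exp mult_ac)

lemma pathin_eta: "pathin circle_top (eta k)"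
  unfolding pathin_circle_iff eta_cis by (auto intro!: continuous_intros)

lemma eta_simplex: "restrict (\<lambda>x. eta k (x 1)) (standard_simplex 1) = path_simplex (eta k)"
  by (simp add: path_simplex_def)

lemma winding_eta: "simplex_winding (path_simplex (eta k)) = of_int k"
proof -
  have "simplex_winding (path_simplex (eta k)) = of_int k * 1 - of_int k * 0"
    by (rule windingI) (auto simp: simplex_path_path_simplex eta_cis intro!: continuous_intros)
  then show ?thesis by simp
qed

lemma eta_cycle: "singular_relcycle 1 circle_top {} (frag_of (path_simplex (eta k)))"
proof -
  have "eta k 0 = 1" "eta k 1 = 1" by (simp_all add: eta_cis cis_multiple_2pi)
  then show ?thesis
    unfolding singular_cycle
    using singular_simplex_path_simplex[OF pathin_eta, of k]
    by (simp add: singular_chain_of boundary_1[unfolded One_nat_def] simplex_path_path_simplex)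
qed

text \<open>Makes the known homology of spheres available; \<open>nsphere 1\<close> consists of
  sequences supported on the first two coordinates.\<close>

lemma circle_homeomorphic_nsphere: "circle_top homeomorphic_space nsphere 1"
proof -
  let ?f = "\<lambda>z i. if i = 0 then Re z else if i = (1::nat) then Im z else 0"
  let ?g = "\<lambda>x::nat\<Rightarrow>real. Complex (x 0) (x 1)"
  have norm: "norm z = 1 \<longleftrightarrow> (Re z)\<^sup>2 + (Im z)\<^sup>2 = 1" for z
    by (simp add: cmod_def)
  have "continuous_map circle_top (powertop_real UNIV) ?f"
    unfolding continuous_map_componentwise_UNIV
  proof
    fix k :: nat
    have "continuous_on (sphere 0 1) (\<lambda>z. ?f z k)"
      by (cases "k = 0"; cases "k = 1") (auto intro!: continuous_intros)
    then show "continuous_map circle_top euclideanreal (\<lambda>z. ?f z k)"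
      unfolding continuous_map_iff_continuous .
  qed
  then have f: "continuous_map circle_top (nsphere 1) ?f"
    unfolding nsphere continuous_map_in_subtopology by (auto simp: norm)
  have "continuous_on UNIV (\<lambda>x::nat \<Rightarrow> real. complex_of_real (x 0) + \<i> * of_real (x 1))"
    by (intro continuous_intros) (auto intro: continuous_on_product_coordinates)
  then have "continuous_map (nsphere 1) euclidean (\<lambda>x. of_real (x 0) + \<i> * of_real (x 1))"
    unfolding nsphere
    by (intro continuous_map_from_subtopology) (simp add: euclidean_product_topology)
  then have g: "continuous_map (nsphere 1) circle_top ?g"
    unfolding nsphere continuous_map_in_subtopology
    by (auto simp: norm Complex_eq)
  have "homeomorphic_maps circle_top (nsphere 1) ?f ?g"
    unfolding homeomorphic_maps_def
    using f g by (auto simp: nsphere fun_eq_iff)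
  then show ?thesis unfolding homeomorphic_space_def by blast
qed

lemma homologous_rel_set_add:
  "homologous_rel_set p X S (a + b) = homologous_rel_set p X S a \<otimes>\<^bsub>relative_homology_group (int p) X S\<^esub> homologous_rel_set p X S b"
proof -
  have "\<exists>r. homologous_rel p X S a r \<and> (\<exists>s. homologous_rel p X S b s \<and> x = r + s)"
    if "homologous_rel p X S (a + b) x" for x
    using that by (intro exI[of _ a] conjI homologous_rel_refl exI[of _ "x - a"]) (auto simp: homologous_rel_def algebra_simps)
  then show ?thesis
    unfolding mult_relative_homology_group by (auto simp: homologous_rel_add)
qed

text \<open>What is known is an abstract injective homomorphism \<theta> to the integers, not its
  value on the standard loop \<open>e\<close>. But \<open>\<theta>(e) z - \<theta>(z) e\<close> has
  \<theta>-value 0 and therefore bounds, so its winding \<open>- \<theta>(z)\<close> is 0. Hence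
  \<open>z\<close> has \<theta>-value 0 and bounds as well.\<close>

lemma circle_cycle_boundary:
  assumes z: "singular_relcycle 1 circle_top {} z" and 0: "frag_eval simplex_winding z = 0"
  shows "singular_relboundary 1 circle_top {} z"
proof -
  let ?H = "homology_group 1 circle_top"
  have "?H \<cong> homology_group 1 (nsphere 1)"
    by (rule homeomorphic_space_imp_isomorphic_homology_groups[OF circle_homeomorphic_nsphere])
  also have "homology_group 1 (nsphere 1) \<cong> integer_group"
    using reduced_homology_group_nsphere(1)[of 1] by (simp add: un_reduced_homology_group)
  finally have "?H \<cong> integer_group" using group_relative_homology_group iso_trans by blast
  then obtain \<psi> where \<psi>: "\<psi> \<in> hom ?H integer_group" "inj_on \<psi> (carrier ?H)"
    unfolding is_iso_def iso_def bij_betw_def by blast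
  define \<theta> where "\<theta> c = \<psi> (homologous_rel_set 1 circle_top {} c)" for c
  have car: "homologous_rel_set 1 circle_top {} c \<in> carrier ?H" if "singular_relcycle 1 circle_top {} c" for c
    using that carrier_relative_homology_group[of 1 circle_top "{}"] by auto
  have add: "\<theta> (a + b) = \<theta> a + \<theta> b"
    if "singular_relcycle 1 circle_top {} a" "singular_relcycle 1 circle_top {} b" for a b
    using hom_mult[OF \<psi>(1) car[OF that(1)] car[OF that(2)]] homologous_rel_set_add[of 1 circle_top "{}" a b]
    by (simp add: \<theta>_def)
  have nat: "\<theta> (frag_cmul (int k) c) = int k * \<theta> c" if "singular_relcycle 1 circle_top {} c" for k c
  proof (induction k)
    case 0
    have "\<theta> 0 = 0" using add[of 0 0] by simp
    then show ?case by simp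
  next
    case (Suc k)
    have "\<theta> (frag_cmul (int (Suc k)) c) = \<theta> (c + frag_cmul (int k) c)" by (simp add: frag_cmul_distrib)
    also have "\<dots> = \<theta> c + \<theta> (frag_cmul (int k) c)"
      by (rule add) (simp_all only: that singular_relcycle_cmul)
    finally show ?case using Suc by (simp add: algebra_simps)
  qed
  have cmul: "\<theta> (frag_cmul k c) = k * \<theta> c" if "singular_relcycle 1 circle_top {} c" for k c
  proof (cases "k \<ge> 0")
    case True then show ?thesis using nat[OF that, of "nat k"] by simp
  next
    case False
    have "\<theta> (frag_cmul k c) + \<theta> (frag_cmul (int (nat (-k))) c) = \<theta> (frag_cmul k c + frag_cmul (int (nat (-k))) c)"
      by (rule add[symmetric]) (simp_all only: that singular_relcycle_cmul)
    also have "\<dots> = \<theta> (frag_cmul (int 0) c)" using False by (simp flip: frag_cmul_distrib)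
    also have "\<dots> = 0" by (subst nat[OF that]) simp
    finally show ?thesis using nat[OF that, of "nat (-k)"] False by simp
  qed
  define n where "n = \<theta> z"
  define e where "e = frag_of (path_simplex (eta 1))"
  have e: "singular_relcycle 1 circle_top {} e" unfolding e_def by (rule eta_cycle)
  have eq: "a - b \<in> {c. singular_relboundary 1 circle_top {} c}" if "\<theta> a = \<theta> b"
    "singular_relcycle 1 circle_top {} a" "singular_relcycle 1 circle_top {} b" for a b
    using inj_onD[OF \<psi>(2) _ car[OF that(2)] car[OF that(3)]] that(1)
    by (auto simp: \<theta>_def homologous_rel_set_eq homologous_rel_eq) (simp add: homologous_rel_def)
  have "singular_relboundary 1 circle_top {} (frag_cmul (\<theta> e) z - frag_cmul n e)"
    using eq[of "frag_cmul (\<theta> e) z" "frag_cmul n e"] cmul[OF z] cmul[OF e]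
      singular_relcycle_cmul[OF z] singular_relcycle_cmul[OF e] by (simp add: n_def)
  then obtain d where "singular_chain 2 circle_top d" "chain_boundary 2 d = frag_cmul (\<theta> e) z - frag_cmul n e"
    unfolding singular_boundary by (auto simp: numeral_2_eq_2)
  then have "frag_eval simplex_winding (frag_cmul (\<theta> e) z - frag_cmul n e) = 0"
    using winding_boundary by metis
  then have "n = 0" by (simp add: frag_eval_diff frag_eval_cmul 0 e_def winding_eta)
  then have "\<theta> z = \<theta> 0" using add[of 0 0] by (simp add: n_def)
  from eq[OF this z] show ?thesis by simp
qed

text \<open>Identifies the \<open>THE\<close> in \<open>circle_degree\<close>: cycles in the circle
  are homologous exactly if their total windings agree, and the total winding of
  \<open>eta_class j\<close> is \<open>j\<close>.\<close>

lemma circle_degree_eq: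
  assumes z: "singular_relcycle 1 circle_top {} z"
  shows "of_int (circle_degree (homologous_rel_set 1 circle_top {} z)) = frag_eval simplex_winding z"
proof -
  obtain k where k: "frag_eval simplex_winding z = of_int k"
    using winding_cycle_Ints[OF z] by (auto elim: Ints_cases)
  have "homologous_rel_set 1 circle_top {} z = eta_class j \<longleftrightarrow> j = k" for j
  proof -
    let ?e = "frag_of (path_simplex (eta j))"
    have "homologous_rel_set 1 circle_top {} z = eta_class j \<longleftrightarrow> singular_relboundary 1 circle_top {} (z - ?e)"
      unfolding eta_class_def eta_simplex homologous_rel_set_eq homologous_rel_eq by (simp add: homologous_rel_def)
    also have "\<dots> \<longleftrightarrow> frag_eval simplex_winding (z - ?e) = 0"
    proof
      assume "singular_relboundary 1 circle_top {} (z - ?e)"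
      then obtain d where "singular_chain 2 circle_top d" "chain_boundary 2 d = z - ?e"
        unfolding singular_boundary by (auto simp: numeral_2_eq_2)
      then show "frag_eval simplex_winding (z - ?e) = 0" using winding_boundary by metis
    qed (rule circle_cycle_boundary[OF singular_relcycle_diff[OF z eta_cycle]])
    also have "\<dots> \<longleftrightarrow> j = k" by (auto simp: frag_eval_diff winding_eta k)
    finally show ?thesis .
  qed
  then show ?thesis by (simp add: circle_degree_def k)
qed

section \<open>Components, ends and the topology of the compactification\<close>

locale lf_graph = loopfree_digraph G for G :: "('v,'e) pre_digraph" +
  assumes conn: "Digraph_Component.connected G" and lf: "locally_finite G"
begin

section \<open>Components of induced subgraphs\<close>

definition joins :: "'e \<Rightarrow> 'v \<Rightarrow> 'v \<Rightarrow> bool" where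
  "joins e u v \<longleftrightarrow> e \<in> arcs G \<and> (tail G e = u \<and> head G e = v \<or> tail G e = v \<and> head G e = u)"

definition links :: "'v set \<Rightarrow> ('v \<times> 'v) set" where
  "links D = {(u, v). u \<in> D \<and> v \<in> D \<and> (\<exists>e. joins e u v)}"

text \<open>For \<open>v\<close> in \<open>D\<close> this is the component of \<open>v\<close> in
  the subgraph induced by \<open>D\<close>; for other \<open>v\<close> it is just
  \<open>{v}\<close>.\<close>

definition linked :: "'v set \<Rightarrow> 'v \<Rightarrow> 'v set" where
  "linked D v = (links D)\<^sup>* `` {v}"

lemma joins_sym: "joins e u v \<Longrightarrow> joins e v u"
  by (auto simp: joins_def)

lemma joins_verts: "joins e u v \<Longrightarrow> u \<in> verts G \<and> v \<in> verts G"
  by (auto simp: joins_def)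

lemma joins_neq: "joins e u v \<Longrightarrow> u \<noteq> v"
  unfolding joins_def using no_loops by metis

lemma sym_links: "sym (links D)"
  by (auto simp: links_def sym_def intro: joins_sym)

lemma linked_self [simp]: "v \<in> linked D v"
  by (simp add: linked_def)

lemma linked_subset: "v \<in> D \<Longrightarrow> linked D v \<subseteq> D"
proof
  fix u assume "v \<in> D" "u \<in> linked D v"
  then have "(v, u) \<in> (links D)\<^sup>*" by (simp add: linked_def)
  then show "u \<in> D" using \<open>v \<in> D\<close> by (induction rule: rtrancl_induct) (auto simp: links_def)
qed

lemma linked_sym: "u \<in> linked D v \<longleftrightarrow> v \<in> linked D u"
  using sym_rtrancl[OF sym_links[of D]] by (auto simp: linked_def sym_def)

lemma linked_eq: "u \<in> linked D v \<Longrightarrow> linked D u = linked D v"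
proof -
  assume u: "u \<in> linked D v"
  have "(u, v) \<in> (links D)\<^sup>*" "(v, u) \<in> (links D)\<^sup>*"
    using u linked_sym[of u D v] by (auto simp: linked_def)
  then show ?thesis unfolding linked_def by (auto intro: rtrancl_trans)
qed

lemma linked_mono: "D \<subseteq> D' \<Longrightarrow> linked D v \<subseteq> linked D' v"
proof -
  assume "D \<subseteq> D'"
  then have "links D \<subseteq> links D'" by (auto simp: links_def)
  then show ?thesis using rtrancl_mono unfolding linked_def by blast
qed

lemma linked_step: "u \<in> linked D v \<Longrightarrow> joins e u w \<Longrightarrow> u \<in> D \<Longrightarrow> w \<in> D \<Longrightarrow> w \<in> linked D v"
  by (auto simp: linked_def links_def intro: rtrancl_into_rtrancl)

lemma rtrancl_on_links:
  "(u, v) \<in> rtrancl_on D {(x, y). \<exists>e. joins e x y \<and> x \<in> D \<and> y \<in> D} \<longleftrightarrow> u \<in> D \<and> v \<in> linked D u"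
proof
  assume "(u, v) \<in> rtrancl_on D {(x, y). \<exists>e. joins e x y \<and> x \<in> D \<and> y \<in> D}"
  then show "u \<in> D \<and> v \<in> linked D u"
  proof (induction rule: rtrancl_on.induct)
    case (rtrancl_on_into_rtrancl_on x y z)
    then show ?case by (auto intro: linked_step)
  qed simp
next
  assume a: "u \<in> D \<and> v \<in> linked D u"
  then have "(u, v) \<in> (links D)\<^sup>*" "u \<in> D" by (simp_all add: linked_def)
  then show "(u, v) \<in> rtrancl_on D {(x, y). \<exists>e. joins e x y \<and> x \<in> D \<and> y \<in> D}"
    by (induction rule: rtrancl_induct) (auto simp: links_def intro: rtrancl_on_into_rtrancl_on)
qed

lemma reachable_links:
  assumes "verts H = D" "arcs_ends H = {(x, y). \<exists>e. joins e x y \<and> x \<in> D \<and> y \<in> D}"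
  shows "u \<rightarrow>\<^sup>*\<^bsub>H\<^esub> v \<longleftrightarrow> u \<in> D \<and> v \<in> linked D u"
  unfolding reachable_def assms rtrancl_on_links ..

lemma reachable_induced:
  "u \<rightarrow>\<^sup>*\<^bsub>with_proj (mk_symmetric (induce_subgraph G D))\<^esub> v \<longleftrightarrow> u \<in> D \<and> v \<in> linked D u"
  by (rule reachable_links) (auto simp: mk_symmetric_def joins_def)

lemma linked_verts: "v \<in> verts G \<Longrightarrow> linked (verts G) v = verts G"
proof -
  assume v: "v \<in> verts G"
  have *: "x \<rightarrow>\<^sup>*\<^bsub>with_proj (mk_symmetric G)\<^esub> y \<longleftrightarrow> x \<in> verts G \<and> y \<in> linked (verts G) x" for x y
    by (rule reachable_links) (auto simp: mk_symmetric_def joins_def)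
  then have "u \<in> linked (verts G) v" if "u \<in> verts G" for u
    using conn that v unfolding Digraph_Component.connected_def strongly_connected_def
    by (auto simp: mk_symmetric_def)
  then show ?thesis using linked_subset[OF v] by blast
qed

lemma verts_nonempty: "verts G \<noteq> {}"
  using conn by (auto simp: Digraph_Component.connected_def strongly_connected_def mk_symmetric_def)

text \<open>In a symmetrised digraph reachability is an equivalence, so the strongly connected
  components are its classes. All later arguments work with \<open>linked\<close> only.\<close>

lemma components_avoiding_iff:
  "C \<in> components_avoiding G S \<longleftrightarrow> (\<exists>v\<in>verts G - S. C = linked (verts G - S) v)"
proof -
  let ?D = "verts G - S"
  have "C \<in> components_avoiding G S \<longleftrightarrow> C \<noteq> {} \<and> (\<forall>u\<in>C. \<forall>v\<in>C. u \<in> ?D \<and> v \<in> linked ?D u) \<and>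
      (\<forall>u\<in>C. \<forall>v. v \<notin> C \<longrightarrow> \<not> (u \<in> ?D \<and> v \<in> linked ?D u) \<or> \<not> (v \<in> ?D \<and> u \<in> linked ?D v))"
    unfolding components_avoiding_def pre_digraph.sccs_verts_def reachable_induced by simp
  also have "\<dots> \<longleftrightarrow> (\<exists>v\<in>?D. C = linked ?D v)" (is "?L \<longleftrightarrow> ?R")
  proof
    assume L: ?L
    then obtain v where v: "v \<in> C" by blast
    have vD: "v \<in> ?D" using L v by blast
    have "u \<in> C" if "u \<in> linked ?D v" for u
      using L v that vD linked_subset[OF vD] linked_sym[of u ?D v] by blast
    moreover have "C \<subseteq> linked ?D v" using L v by blast
    ultimately show ?R using vD by blast
  next
    assume ?R
    then obtain v where v: "v \<in> ?D" "C = linked ?D v" by blast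
    have "u \<in> ?D" if "u \<in> C" for u using linked_subset[OF v(1)] v(2) that by blast
    moreover have "linked ?D u = C" if "u \<in> C" for u using linked_eq that v(2) by blast
    moreover have "v \<in> C" using v(2) by simp
    ultimately show ?L by blast
  qed
  finally show ?thesis .
qed

lemma component_subset: "C \<in> components_avoiding G S \<Longrightarrow> C \<subseteq> verts G - S"
  using linked_subset unfolding components_avoiding_iff by metis

lemma component_disjoint:
  "C \<in> components_avoiding G S \<Longrightarrow> C' \<in> components_avoiding G S \<Longrightarrow> x \<in> C \<Longrightarrow> x \<in> C' \<Longrightarrow> C = C'"
  unfolding components_avoiding_iff using linked_eq by metis

lemma component_closed:
  "C \<in> components_avoiding G S \<Longrightarrow> u \<in> C \<Longrightarrow> joins e u w \<Longrightarrow> w \<notin> S \<Longrightarrow> w \<in> C"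
  using joins_verts[of e u w] component_subset[of C S]
  unfolding components_avoiding_iff by (auto intro: linked_step)

lemma component_linked:
  "C \<in> components_avoiding G S \<Longrightarrow> u \<in> C \<Longrightarrow> linked (verts G - S) u = C"
  unfolding components_avoiding_iff using linked_eq by blast

section \<open>Rays and ends\<close>

lemma ray_joins: "is_ray G r \<Longrightarrow> joins (snd r n) (fst r n) (fst r (Suc n))"
  by (cases r) (auto simp: is_ray_def joins_def doubleton_eq_iff)

lemma ray_inj: "is_ray G r \<Longrightarrow> inj (fst r)"
  by (cases r) (auto simp: is_ray_def)

lemma ray_verts: "is_ray G r \<Longrightarrow> fst r n \<in> verts G"
  by (cases r) (auto simp: is_ray_def)

lemma ray_avoids: "is_ray G r \<Longrightarrow> finite S \<Longrightarrow> \<exists>n. \<forall>m\<ge>n. fst r m \<notin> S"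
proof -
  assume r: "is_ray G r" "finite S"
  have "finite (fst r -` S)" using finite_vimageI[OF r(2) ray_inj[OF r(1)]] .
  then obtain n where n: "fst r -` S \<subseteq> {..<n}"
    using finite_nat_bounded by blast
  then show ?thesis by (intro exI[of _ n]) (auto simp: subset_iff not_less[symmetric])
qed

lemma ray_tail:
  assumes "is_ray G r" "finite S"
  shows "\<exists>C\<in>components_avoiding G S. has_tail_in r C"
proof -
  obtain n where n: "\<And>m. m \<ge> n \<Longrightarrow> fst r m \<notin> S" using ray_avoids[OF assms] by blast
  let ?C = "linked (verts G - S) (fst r n)"
  have "fst r m \<in> ?C" if "m \<ge> n" for m
    using that
  proof (induction rule: dec_induct)
    case (step k)
    then show ?case
      using linked_step[OF step.IH ray_joins[OF assms(1)]] ray_verts[OF assms(1)] n by simp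
  qed simp
  then have "has_tail_in r ?C" by (auto simp: has_tail_in_def)
  moreover have "?C \<in> components_avoiding G S"
    unfolding components_avoiding_iff using n ray_verts[OF assms(1)] by blast
  ultimately show ?thesis by blast
qed

text \<open>Equivalence speaks of whole rays, not of tails. So the initial segments of both rays are
  added to \<open>S\<close>: a component that still meets both rays does so in their tails, and it
  lies in one component of the graph without \<open>S\<close>.\<close>

lemma ray_rel_same_tail:
  assumes rel: "(r, r') \<in> ray_rel G" and S: "finite S" "S \<subseteq> verts G"
    and C: "C \<in> components_avoiding G S" "has_tail_in r C"
  shows "has_tail_in r' C"
proof -
  have r: "is_ray G r" "is_ray G r'" using rel by (auto simp: ray_rel_def)
  obtain C' where C': "C' \<in> components_avoiding G S" "has_tail_in r' C'" using ray_tail[OF r(2) S(1)] by blast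
  obtain n n' where n: "\<And>m. m \<ge> n \<Longrightarrow> fst r m \<in> C" and n': "\<And>m. m \<ge> n' \<Longrightarrow> fst r' m \<in> C'"
    using C(2) C'(2) unfolding has_tail_in_def by blast
  let ?S = "S \<union> fst r ` {..<n} \<union> fst r' ` {..<n'}"
  have fin: "finite ?S" "?S \<subseteq> verts G" using S ray_verts[OF r(1)] ray_verts[OF r(2)] by blast+
  then have "\<not> separates G ?S (range (fst r)) (range (fst r'))" using rel by (auto simp: ray_rel_def)
  then obtain K where K: "K \<in> components_avoiding G ?S" "range (fst r) \<inter> K \<noteq> {}" "range (fst r') \<inter> K \<noteq> {}"
    unfolding separates_def by blast
  then obtain i j where ij: "fst r i \<in> K" "fst r' j \<in> K" by blast
  have "i \<ge> n" "j \<ge> n'" using ij component_subset[OF K(1)] by (auto simp: not_less[symmetric])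
  then have "fst r i \<in> C" "fst r' j \<in> C'" using n n' by auto
  moreover have "K \<subseteq> linked (verts G - S) (fst r i)"
    using component_linked[OF K(1) ij(1)] linked_mono[of "verts G - ?S" "verts G - S"] by blast
  ultimately have "fst r' j \<in> C" using component_linked[OF C(1)] ij(2) by blast
  then have "C = C'" using component_disjoint C(1) C'(1) \<open>fst r' j \<in> C'\<close> by blast
  then show ?thesis using C'(2) by simp
qed

lemma ray_rel_refl: "is_ray G r \<Longrightarrow> (r, r) \<in> ray_rel G"
  using ray_tail unfolding ray_rel_def separates_def has_tail_in_def
  by simp (metis disjoint_iff order_refl rangeI)

lemma end_ray:
  assumes "\<omega> \<in> ends G" obtains r where "is_ray G r" "r \<in> \<omega>" "\<omega> = ray_rel G `` {r}"
  using assms ray_rel_refl by (auto simp: ends_def quotient_def)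

lemma end_component:
  assumes "\<omega> \<in> ends G" "finite S" "S \<subseteq> verts G"
  shows "\<exists>C\<in>components_avoiding G S. \<forall>r\<in>\<omega>. has_tail_in r C"
proof -
  obtain r where r: "is_ray G r" "\<omega> = ray_rel G `` {r}" using end_ray[OF assms(1)] by blast
  obtain C where "C \<in> components_avoiding G S" "has_tail_in r C" using ray_tail[OF r(1) assms(2)] by blast
  then show ?thesis using ray_rel_same_tail[OF _ assms(2,3)] r(2) by blast
qed

lemma end_nonempty: "\<omega> \<in> ends G \<Longrightarrow> \<omega> \<noteq> {}"
  using end_ray by blast

lemma ray_class_end: "is_ray G r \<Longrightarrow> ray_rel G `` {r} \<in> ends G"
  unfolding ends_def quotient_def by blast

section \<open>Points of the 1-complex and continuity on the compactification\<close>

lemma open_edge_eq: "open_edge G e = Inner e ` {0<..<1}"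
  unfolding open_edge_def theta_def by (rule image_cong) auto

lemma in_open_edge [simp]:
  "Inner e' t \<in> open_edge G e \<longleftrightarrow> e' = e \<and> 0 < t \<and> t < 1"
  "Vertex v \<notin> open_edge G e" "End \<omega> \<notin> open_edge G e"
  by (auto simp: open_edge_eq)

lemma theta_simps [simp]: "theta G e 0 = Vertex (tail G e)" "theta G e 1 = Vertex (head G e)"
  "0 < t \<Longrightarrow> t < 1 \<Longrightarrow> theta G e t = Inner e t"
  by (auto simp: theta_def)

lemma theta_cases:
  fixes t :: real
  assumes "t \<in> {0..1}"
  obtains "t = 0" | "t = 1" | "0 < t" "t < 1"
proof (cases "t = 0 \<or> t = 1")
  case True then show thesis using that(1,2) by blast
next
  case False
  then have "0 < t" "t < 1" using assms by auto
  then show thesis by (rule that(3))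
qed

lemma graph_points_simps [simp]:
  "Vertex v \<in> graph_points G \<longleftrightarrow> v \<in> verts G"
  "Inner e t \<in> graph_points G \<longleftrightarrow> e \<in> arcs G \<and> 0 < t \<and> t < 1"
  "End \<omega> \<notin> graph_points G"
  by (auto simp: graph_points_def)

lemma theta_in_graph: "e \<in> arcs G \<Longrightarrow> t \<in> {0..1} \<Longrightarrow> theta G e t \<in> graph_points G"
  by (erule theta_cases) auto

lemma graph_points_cases:
  assumes "p \<in> graph_points G"
  obtains v where "v \<in> verts G" "p = Vertex v" | e t where "e \<in> arcs G" "0 < t" "t < 1" "p = Inner e t"
  using assms by (cases p) auto

lemma openin_freudenthal_graph: "openin (graph_topology G) U \<Longrightarrow> openin (freudenthal G) U"
  unfolding freudenthal_def by (rule topology_generated_by_Basis) simp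

lemma openin_end_nbhd:
  assumes "finite S" "S \<subseteq> verts G" "\<omega> \<in> ends G" "C \<in> components_avoiding G S" "\<forall>r\<in>\<omega>. has_tail_in r C"
  shows "openin (freudenthal G) (end_nbhd G S C)"
  unfolding freudenthal_def using assms by (intro topology_generated_by_Basis) blast

lemma end_in_end_nbhd: "\<omega> \<in> ends G \<Longrightarrow> \<forall>r\<in>\<omega>. has_tail_in r C \<Longrightarrow> End \<omega> \<in> end_nbhd G S C"
  by (simp add: end_nbhd_def)

lemma openin_graph_points: "openin (graph_topology G) (graph_points G)"
proof -
  have "{t \<in> {0..1}. theta G e t \<in> graph_points G} = {0..1}" if "e \<in> arcs G" for e
    using theta_in_graph[OF that] by auto
  then show ?thesis by (simp add: openin_graph_topology)
qed

lemma topspace_freudenthal: "topspace (freudenthal G) = graph_points G \<union> End ` ends G"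
proof
  have "U \<subseteq> graph_points G" if "openin (graph_topology G) U" for U
    using that by (simp add: openin_graph_topology)
  moreover have "end_nbhd G S C \<subseteq> graph_points G \<union> End ` ends G" if "C \<in> components_avoiding G S" for S C
    using component_subset[OF that] by (auto simp: end_nbhd_def graph_points_def)
  ultimately show "topspace (freudenthal G) \<subseteq> graph_points G \<union> End ` ends G"
    unfolding freudenthal_def topology_generated_by_topspace by blast
  have "End \<omega> \<in> topspace (freudenthal G)" if \<omega>: "\<omega> \<in> ends G" for \<omega>
  proof -
    obtain C where C: "C \<in> components_avoiding G {}" "\<forall>r\<in>\<omega>. has_tail_in r C"
      using end_component[OF \<omega>, of "{}"] by auto
    show ?thesis
      using openin_subset[OF openin_end_nbhd[OF _ _ \<omega> C]] end_in_end_nbhd[OF \<omega> C(2)] by blast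
  qed
  then show "graph_points G \<union> End ` ends G \<subseteq> topspace (freudenthal G)"
    using openin_subset[OF openin_freudenthal_graph[OF openin_graph_points]] by blast
qed

text \<open>An edge with one end in \<open>C\<close> has its other end in \<open>C\<close> or in
  \<open>S\<close>, so its interior belongs to the neighbourhood in either case and only the two
  ends have to be distinguished.\<close>

lemma theta_in_end_nbhd:
  assumes e: "e \<in> arcs G" and t: "t \<in> {0..1}" and C: "C \<in> components_avoiding G S"
  shows "theta G e t \<in> end_nbhd G S C \<longleftrightarrow>
    (t < 1 \<and> tail G e \<in> C) \<or> (t > 0 \<and> head G e \<in> C)"
proof -
  have out: "head G e \<in> S \<or> head G e \<in> C" if "tail G e \<in> C"
    using component_closed[OF C that, of e "head G e"] e by (auto simp: joins_def)
  have inn: "tail G e \<in> S \<or> tail G e \<in> C" if "head G e \<in> C"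
    using component_closed[OF C that, of e "tail G e"] e by (auto simp: joins_def)
  from t show ?thesis
    by (rule theta_cases) (use out inn e in \<open>auto simp: end_nbhd_def\<close>)
qed

lemma continuous_theta:
  assumes e: "e \<in> arcs G"
  shows "continuous_map (top_of_set {0..1}) (freudenthal G) (theta G e)"
  unfolding freudenthal_def
proof (rule continuous_on_generated_topo)
  let ?B = "{U. openin (graph_topology G) U} \<union>
      {end_nbhd G S C | S C \<omega>. finite S \<and> S \<subseteq> verts G \<and> \<omega> \<in> ends G \<and>
         C \<in> components_avoiding G S \<and> (\<forall>r\<in>\<omega>. has_tail_in r C)}"
  show "theta G e ` topspace (top_of_set {0..1}) \<subseteq> \<Union> ?B"
    using openin_graph_points theta_in_graph[OF e] by auto
  fix U assume "U \<in> ?B"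
  then consider "openin (graph_topology G) U" |
    S C where "U = end_nbhd G S C" "C \<in> components_avoiding G S" by blast
  then show "openin (top_of_set {0..1}) (theta G e -` U \<inter> topspace (top_of_set {0..1}))"
  proof cases
    case 1
    then have "openin (top_of_set {0..1}) {t \<in> {0..1}. theta G e t \<in> U}"
      using e by (simp add: openin_graph_topology)
    also have "{t \<in> {0..1}. theta G e t \<in> U} = theta G e -` U \<inter> topspace (top_of_set {0..1})" by auto
    finally show ?thesis .
  next
    case 2
    have "theta G e -` U \<inter> topspace (top_of_set {0..1}) =
      {0..1} \<inter> ((if tail G e \<in> C then {..<1} else {}) \<union> (if head G e \<in> C then {0<..} else {}))"
      using theta_in_end_nbhd[OF e _ 2(2)] 2(1) by auto
    also have "openin (top_of_set {0..1}) \<dots>"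
      by (rule openin_open_Int) auto
    finally show ?thesis .
  qed
qed

text \<open>The neighbourhoods of ends add no open sets to the 1-complex, because every
  \<open>theta G e\<close> is continuous into the compactification.\<close>

lemma openin_graph_part:
  assumes "openin (freudenthal G) U" shows "openin (graph_topology G) (U \<inter> graph_points G)"
  unfolding openin_graph_topology
proof (intro conjI ballI)
  fix e assume e: "e \<in> arcs G"
  have "openin (top_of_set {0..1}) {t \<in> topspace (top_of_set {0..1}). theta G e t \<in> U}"
    by (rule openin_continuous_map_preimage[OF continuous_theta[OF e] assms])
  also have "{t \<in> topspace (top_of_set {0..1}). theta G e t \<in> U} = {t \<in> {0..1}. theta G e t \<in> U \<inter> graph_points G}"
    using theta_in_graph[OF e] by auto
  finally show "openin (top_of_set {0..1}) {t \<in> {0..1}. theta G e t \<in> U \<inter> graph_points G}" .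
qed simp

text \<open>Inside the graph, continuity is tested on single edges. At an end the strong form of
  being constant on a basic neighbourhood is demanded; the real and circle-valued functions used
  below all satisfy it.\<close>

lemma continuous_map_freudenthal:
  assumes "\<And>p. p \<in> topspace (freudenthal G) \<Longrightarrow> g p \<in> topspace Y"
    and edge: "\<And>e. e \<in> arcs G \<Longrightarrow> continuous_map (top_of_set {0..1}) Y (\<lambda>t. g (theta G e t))"
    and ends: "\<And>\<omega>. \<omega> \<in> ends G \<Longrightarrow> \<exists>S. finite S \<and> S \<subseteq> verts G \<and> (\<forall>C\<in>components_avoiding G S.
        (\<forall>r\<in>\<omega>. has_tail_in r C) \<longrightarrow> (\<forall>p\<in>end_nbhd G S C. g p = g (End \<omega>)))"
  shows "continuous_map (freudenthal G) Y g"
  unfolding continuous_map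
proof (intro conjI allI impI)
  show "g ` topspace (freudenthal G) \<subseteq> topspace Y" using assms(1) by blast
  fix U assume U: "openin Y U"
  let ?W = "{p \<in> topspace (freudenthal G). g p \<in> U}"
  show "openin (freudenthal G) ?W"
  proof (subst openin_subopen, intro ballI)
    fix p assume p: "p \<in> ?W"
    show "\<exists>T. openin (freudenthal G) T \<and> p \<in> T \<and> T \<subseteq> ?W"
    proof (cases "p \<in> graph_points G")
      case True
      have "openin (graph_topology G) {q \<in> graph_points G. g q \<in> U}"
        unfolding openin_graph_topology
      proof (intro conjI ballI)
        fix e assume e: "e \<in> arcs G"
        have "openin (top_of_set {0..1}) {t \<in> topspace (top_of_set {0..1}). g (theta G e t) \<in> U}"
          by (rule openin_continuous_map_preimage[OF edge[OF e] U])
        also have "{t \<in> topspace (top_of_set {0..1}). g (theta G e t) \<in> U} =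
            {t \<in> {0..1}. theta G e t \<in> {q \<in> graph_points G. g q \<in> U}}"
          using theta_in_graph[OF e] by auto
        finally show "openin (top_of_set {0..1}) {t \<in> {0..1}. theta G e t \<in> {q \<in> graph_points G. g q \<in> U}}" .
      qed blast
      from openin_freudenthal_graph[OF this] show ?thesis
        using True p by (intro exI[of _ "{q \<in> graph_points G. g q \<in> U}"]) (auto simp: topspace_freudenthal)
    next
      case False
      then obtain \<omega> where \<omega>: "\<omega> \<in> ends G" "p = End \<omega>" using p by (auto simp: topspace_freudenthal)
      obtain S where S: "finite S" "S \<subseteq> verts G" and const: "\<And>C p. C \<in> components_avoiding G S \<Longrightarrow>
        (\<forall>r\<in>\<omega>. has_tail_in r C) \<Longrightarrow> p\<in>end_nbhd G S C \<Longrightarrow> g p = g (End \<omega>)"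
        using ends[OF \<omega>(1)] by metis
      obtain C where C: "C \<in> components_avoiding G S" "\<forall>r\<in>\<omega>. has_tail_in r C"
        using end_component[OF \<omega>(1) S] by blast
      have o: "openin (freudenthal G) (end_nbhd G S C)" by (rule openin_end_nbhd[OF S \<omega>(1) C])
      have "end_nbhd G S C \<subseteq> ?W"
      proof
        fix q assume q: "q \<in> end_nbhd G S C"
        have "g q = g (End \<omega>)" by (rule const[OF C q])
        then show "q \<in> ?W" using p \<omega>(2) q openin_subset[OF o] by auto
      qed
      with o show ?thesis using \<omega>(2) end_in_end_nbhd[OF \<omega>(1) C(2)] by blast
    qed
  qed
qed

lemma end_nbhd_avoids:
  assumes "C \<in> components_avoiding G S" "p \<in> end_nbhd G S C"
  shows "p \<notin> Vertex ` S" "e \<in> arcs G \<Longrightarrow> tail G e \<in> S \<Longrightarrow> head G e \<in> S \<Longrightarrow> p \<notin> open_edge G e"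
  using component_subset[OF assms(1)] assms(2) by (auto simp: end_nbhd_def open_edge_eq)

text \<open>A basic neighbourhood with separator \<open>S\<close> contains no vertex of
  \<open>S\<close> and no inner point of an edge spanned by \<open>S\<close>; so a function that is
  the constant \<open>c\<close> off this finite subgraph is constant near every end.\<close>

lemma continuous_map_freudenthal_compact:
  assumes "\<And>p. p \<in> topspace (freudenthal G) \<Longrightarrow> g p \<in> topspace Y"
    and edge: "\<And>e. e \<in> arcs G \<Longrightarrow> continuous_map (top_of_set {0..1}) Y (\<lambda>t. g (theta G e t))"
    and S: "finite S" "S \<subseteq> verts G"
    and out: "\<And>p. p \<notin> Vertex ` S \<Longrightarrow> (\<And>e. e \<in> arcs G \<Longrightarrow> tail G e \<in> S \<Longrightarrow> head G e \<in> S \<Longrightarrow> p \<notin> open_edge G e) \<Longrightarrow> g p = c"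
  shows "continuous_map (freudenthal G) Y g"
proof (rule continuous_map_freudenthal[OF assms(1) edge])
  fix \<omega> assume "\<omega> \<in> ends G"
  have "g (End \<omega>) = c" by (rule out) (auto simp: open_edge_eq)
  then show "\<exists>S. finite S \<and> S \<subseteq> verts G \<and> (\<forall>C\<in>components_avoiding G S.
        (\<forall>r\<in>\<omega>. has_tail_in r C) \<longrightarrow> (\<forall>p\<in>end_nbhd G S C. g p = g (End \<omega>)))"
    using end_nbhd_avoids out S by (intro exI[of _ S] conjI ballI impI) metis+
qed

text \<open>The common form of the edge maps into the circle and of their real lifts around a star;
  it is applied to \<gamma> that start and end at \<open>c\<close>.\<close>

definition edge_fun :: "'e \<Rightarrow> (real \<Rightarrow> 'a) \<Rightarrow> 'a \<Rightarrow> ('v,'e) point \<Rightarrow> 'a" where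
  "edge_fun e \<gamma> c p = (case p of Inner e' t \<Rightarrow> if e' = e \<and> 0 < t \<and> t < 1 then \<gamma> t else c | _ \<Rightarrow> c)"

lemma edge_fun_theta:
  assumes "\<gamma> 0 = c" "\<gamma> 1 = c" "t \<in> {0..1}"
  shows "edge_fun e \<gamma> c (theta G e' t) = (if e' = e then \<gamma> t else c)"
  using assms(3) by (rule theta_cases) (auto simp: edge_fun_def assms(1,2))

lemma edge_fun_outside: "p \<notin> open_edge G e \<Longrightarrow> edge_fun e \<gamma> c p = c"
  by (cases p) (auto simp: edge_fun_def open_edge_eq)

lemma continuous_edge_fun:
  assumes e: "e \<in> arcs G" and \<gamma>: "\<gamma> 0 = c" "\<gamma> 1 = c" "continuous_map (top_of_set {0..1}) Y \<gamma>"
  shows "continuous_map (freudenthal G) Y (edge_fun e \<gamma> c)"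
proof (rule continuous_map_freudenthal_compact[where S = "{tail G e, head G e}"])
  have in_top: "\<gamma> t \<in> topspace Y" if "t \<in> {0..1}" for t
    using continuous_map_image_subset_topspace[OF \<gamma>(3)] that by auto
  then show "edge_fun e \<gamma> c p \<in> topspace Y" for p
    using in_top[of 0] \<gamma>(1) by (cases p) (auto simp: edge_fun_def)
  fix e' assume "e' \<in> arcs G"
  have "continuous_map (top_of_set {0..1}) Y (if e' = e then \<gamma> else (\<lambda>_. c))"
    using \<gamma>(3) in_top[of 0] \<gamma>(1) by auto
  then show "continuous_map (top_of_set {0..1}) Y (\<lambda>t. edge_fun e \<gamma> c (theta G e' t))"
    by (rule continuous_map_eq) (auto simp: edge_fun_theta[OF \<gamma>(1,2)])
qed (use e in \<open>auto intro: edge_fun_outside\<close>)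

lemma edge_map_eq: "edge_map G e = edge_fun e (eta 1) 1"
proof
  fix p
  have inj: "inj_on (theta G e) {0<..<1}" by (auto simp: inj_on_def)
  show "edge_map G e p = edge_fun e (eta 1) 1 p"
  proof (cases "p \<in> open_edge G e")
    case True
    then obtain t where t: "0 < t" "t < 1" "p = theta G e t" by (auto simp: open_edge_def)
    have "inv_into {0<..<1} (theta G e) p = t" using inv_into_f_f[OF inj, of t] t by simp
    then show ?thesis using True t by (simp add: edge_map_def edge_fun_def)
  qed (simp add: edge_map_def edge_fun_outside)
qed

lemma eta_0_1 [simp]: "eta k 0 = 1" "eta k 1 = 1"
  by (simp_all add: eta_cis cis_multiple_2pi)

lemma continuous_edge_map: "e \<in> arcs G \<Longrightarrow> continuous_map (freudenthal G) circle_top (edge_map G e)"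
  unfolding edge_map_eq using pathin_eta by (intro continuous_edge_fun) (auto simp: pathin_def)

lemma edge_map_theta: "t \<in> {0..1} \<Longrightarrow> edge_map G e (theta G e' t) = (if e' = e then eta 1 t else 1)"
  unfolding edge_map_eq by (subst edge_fun_theta) auto

lemma edge_map_outside: "p \<notin> open_edge G e \<Longrightarrow> edge_map G e p = 1"
  by (simp add: edge_map_def)

end

section \<open>Normal spanning trees\<close>

context lf_graph
begin

section \<open>Deleting a vertex from a component\<close>

lemma linked_linked: "v \<in> D \<Longrightarrow> u \<in> linked D v \<Longrightarrow> linked (linked D v) u = linked D v"
proof -
  assume v: "v \<in> D" and u: "u \<in> linked D v"
  have "x \<in> linked (linked D v) v" if "(v, x) \<in> (links D)\<^sup>*" for x
    using that
  proof (induction rule: rtrancl_induct)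
    case (step y z)
    have y: "y \<in> linked D v" using step.hyps(1) by (simp add: linked_def)
    obtain e where e: "joins e y z" "y \<in> D" "z \<in> D" using step.hyps(2) by (auto simp: links_def)
    show ?case using linked_step[OF step.IH e(1) y] linked_step[OF y e] .
  qed simp
  then have "linked D v \<subseteq> linked (linked D v) v" unfolding linked_def by blast
  moreover have "linked (linked D v) v \<subseteq> linked D v" by (rule linked_mono[OF linked_subset[OF v]])
  ultimately have eq: "linked (linked D v) v = linked D v" by blast
  then have "u \<in> linked (linked D v) v" using u by simp
  from linked_eq[OF this] eq show ?thesis by simp
qed

text \<open>A walk from \<open>w\<close> to \<open>r\<close> stays in the component of
  \<open>w\<close> in \<open>D - {r}\<close> up to its first visit to \<open>r\<close>, so the
  vertex just before that visit is the required neighbour.\<close>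

lemma linked_neighbour:
  assumes "w \<in> D" "w \<noteq> r" "r \<in> linked D w"
  shows "\<exists>u\<in>linked (D - {r}) w. \<exists>e. joins e r u"
proof -
  have "y \<in> linked (D - {r}) w \<or> (\<exists>u\<in>linked (D - {r}) w. \<exists>e. joins e r u)" if "(w, y) \<in> (links D)\<^sup>*" for y
    using that
  proof (induction rule: rtrancl_induct)
    case (step y z)
    obtain e where e: "joins e y z" "y \<in> D" "z \<in> D" using step.hyps(2) by (auto simp: links_def)
    show ?case
    proof (cases "y \<in> linked (D - {r}) w")
      case True
      then have "y \<noteq> r" using linked_subset[of w "D - {r}"] assms by blast
      then show ?thesis using linked_step[OF True e(1)] e True joins_sym[OF e(1)] by (cases "z = r") auto
    qed (use step.IH in blast)
  qed simp
  moreover have "r \<notin> linked (D - {r}) w" using linked_subset[of w "D - {r}"] assms by blast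
  ultimately show ?thesis using assms(3) unfolding linked_def by blast
qed

text \<open>This enumeration serves twice: in the choice of the tree, and as the order in which the
  stars of the vertices are cleared.\<close>

definition idx :: "'v \<Rightarrow> nat" where "idx = to_nat_on (verts G)"

lemma idx_inj: "inj_on idx (verts G)"
  unfolding idx_def
  by (rule inj_on_to_nat_on[OF countable_graph(1)]) (unfold_locales, rule conn, rule lf)

definition first_vertex :: "'v set \<Rightarrow> 'v" where
  "first_vertex D = (SOME v. v \<in> D \<and> (\<forall>u. u \<in> D \<longrightarrow> idx v \<le> idx u))"

lemma first_vertex: "D \<noteq> {} \<Longrightarrow> first_vertex D \<in> D \<and> (\<forall>u. u \<in> D \<longrightarrow> idx (first_vertex D) \<le> idx u)"
  unfolding first_vertex_def
  by (rule someI_ex) (use ex_has_least_nat[of "\<lambda>v. v \<in> D" _ idx] in blast)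

definition link_dist :: "'v set \<Rightarrow> 'v \<Rightarrow> 'v \<Rightarrow> nat" where
  "link_dist D a b = (LEAST k. (a, b) \<in> links D ^^ k)"

text \<open>
  The tree is grown by depth-first descent: inside a component \<open>D\<close> below \<open>r\<close>, the next vertex is
  the neighbour of \<open>r\<close> in \<open>D\<close> closest to the first vertex of \<open>D\<close> in a fixed enumeration. This
  choice guarantees that every vertex is eventually reached.
\<close>

definition next_vertex :: "'v \<Rightarrow> 'v set \<Rightarrow> 'v" where
  "next_vertex r D = (SOME v. (v \<in> D \<and> (\<exists>e. joins e r v)) \<and>
     (\<forall>u. u \<in> D \<and> (\<exists>e. joins e r u) \<longrightarrow> link_dist D v (first_vertex D) \<le> link_dist D u (first_vertex D)))"

definition root :: 'v where "root = (SOME v. v \<in> verts G)"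

text \<open>The tree is never built as an object. For every target \<open>w\<close> there is a
  sequence of pairs: the component containing \<open>w\<close> that is left after the first
  \<open>n\<close> vertices of the branch towards \<open>w\<close> are deleted, and the vertex
  chosen in it. Once the branch has passed \<open>w\<close> the values mean nothing;
  \<open>active w n\<close> says that this has not happened before stage \<open>n\<close>.\<close>

primrec node :: "'v \<Rightarrow> nat \<Rightarrow> 'v set \<times> 'v" where
  "node w 0 = (verts G, root)"
| "node w (Suc n) = (let D = linked (fst (node w n) - {snd (node w n)}) w in (D, next_vertex (snd (node w n)) D))"

abbreviation "branch_set w n \<equiv> fst (node w n)"
abbreviation "branch w n \<equiv> snd (node w n)"

definition active :: "'v \<Rightarrow> nat \<Rightarrow> bool" where
  "active w n \<longleftrightarrow> w \<in> verts G \<and> (\<forall>k<n. branch w k \<noteq> w)"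

lemma root_in: "root \<in> verts G"
  unfolding root_def by (rule someI_ex) (use verts_nonempty in blast)

lemma active_mono: "active w n \<Longrightarrow> k \<le> n \<Longrightarrow> active w k"
  by (auto simp: active_def)

lemma next_vertex:
  assumes "u \<in> D" "joins e r u"
  shows "next_vertex r D \<in> D" "\<exists>e. joins e r (next_vertex r D)"
    "\<And>v e. v \<in> D \<Longrightarrow> joins e r v \<Longrightarrow> link_dist D (next_vertex r D) (first_vertex D) \<le> link_dist D v (first_vertex D)"
proof -
  have "\<exists>v. (v \<in> D \<and> (\<exists>e. joins e r v)) \<and>
     (\<forall>u. u \<in> D \<and> (\<exists>e. joins e r u) \<longrightarrow> link_dist D v (first_vertex D) \<le> link_dist D u (first_vertex D))"
    by (rule ex_has_least_nat[of "\<lambda>v. v \<in> D \<and> (\<exists>e. joins e r v)" u]) (use assms in blast)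
  from someI_ex[OF this, folded next_vertex_def]
  show "next_vertex r D \<in> D" "\<exists>e. joins e r (next_vertex r D)"
    "\<And>v e. v \<in> D \<Longrightarrow> joins e r v \<Longrightarrow> link_dist D (next_vertex r D) (first_vertex D) \<le> link_dist D v (first_vertex D)"
    by blast+
qed

definition node_inv :: "'v \<Rightarrow> nat \<Rightarrow> bool" where
  "node_inv w n \<longleftrightarrow> w \<in> branch_set w n \<and> branch w n \<in> branch_set w n \<and> branch_set w n \<subseteq> verts G \<and>
     (\<forall>u\<in>branch_set w n. linked (branch_set w n) u = branch_set w n)"

lemma node_step:
  assumes inv: "node_inv w n" and w: "branch w n \<noteq> w"
  shows "node_inv w (Suc n)" "branch_set w (Suc n) \<subseteq> branch_set w n - {branch w n}"
    "\<exists>e. joins e (branch w n) (branch w (Suc n))"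
    "\<And>v e. v \<in> branch_set w (Suc n) \<Longrightarrow> joins e (branch w n) v \<Longrightarrow>
       link_dist (branch_set w (Suc n)) (branch w (Suc n)) (first_vertex (branch_set w (Suc n)))
       \<le> link_dist (branch_set w (Suc n)) v (first_vertex (branch_set w (Suc n)))"
proof -
  define D where "D = branch_set w n"
  define r where "r = branch w n"
  define D' where "D' = linked (D - {r}) w"
  have suc: "branch_set w (Suc n) = D'" "branch w (Suc n) = next_vertex r D'"
    by (simp_all add: D'_def D_def r_def Let_def)
  have D: "w \<in> D" "r \<in> D" "D \<subseteq> verts G" "linked D w = D" "w \<noteq> r"
    using inv w unfolding node_inv_def D_def r_def by auto
  have wD: "w \<in> D - {r}" using D by blast
  have sub: "D' \<subseteq> D - {r}" unfolding D'_def by (rule linked_subset[OF wD])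
  obtain u e where u: "u \<in> D'" "joins e r u"
    using linked_neighbour[of w D r] D unfolding D'_def by auto
  note nv = next_vertex[OF u]
  have "linked D' x = D'" if "x \<in> D'" for x
    using linked_linked[OF wD] that unfolding D'_def .
  moreover have "w \<in> D'" by (simp add: D'_def)
  ultimately show "node_inv w (Suc n)"
    unfolding node_inv_def suc using nv(1) sub D(3) by blast
  show "branch_set w (Suc n) \<subseteq> branch_set w n - {branch w n}" using sub suc by (simp add: D_def r_def)
  show "\<exists>e. joins e (branch w n) (branch w (Suc n))" using nv(2) suc by (simp add: r_def)
  show "\<And>v e. v \<in> branch_set w (Suc n) \<Longrightarrow> joins e (branch w n) v \<Longrightarrow>
       link_dist (branch_set w (Suc n)) (branch w (Suc n)) (first_vertex (branch_set w (Suc n)))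
       \<le> link_dist (branch_set w (Suc n)) v (first_vertex (branch_set w (Suc n)))"
    unfolding suc using nv(3) by (simp add: r_def)
qed

lemma active_inv: "active w n \<Longrightarrow> node_inv w n"
proof (induction n)
  case 0
  then have "w \<in> verts G" by (simp add: active_def)
  then show ?case unfolding node_inv_def using root_in linked_verts by simp
next
  case (Suc n)
  have "node_inv w n" by (rule Suc.IH[OF active_mono[OF Suc.prems]]) simp
  moreover have "branch w n \<noteq> w" using Suc.prems by (simp add: active_def)
  ultimately show ?case by (rule node_step(1))
qed

lemma active_step:
  assumes "active w (Suc n)" shows "node_inv w n" "branch w n \<noteq> w"
  using active_inv[OF active_mono[OF assms, of n]] assms by (auto simp: active_def)

lemma branch_set_mono: "active w n \<Longrightarrow> k \<le> n \<Longrightarrow> branch_set w n \<subseteq> branch_set w k"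
proof (induction n)
  case (Suc n)
  show ?case
  proof (cases "k = Suc n")
    case False
    then show ?thesis
      using node_step(2)[OF active_step[OF Suc.prems(1)]] Suc.IH[OF active_mono[OF Suc.prems(1)]] Suc.prems(2) by auto
  qed simp
qed simp

lemma branch_removed: "active w n \<Longrightarrow> k < n \<Longrightarrow> branch w k \<notin> branch_set w n"
  using node_step(2)[OF active_step[OF active_mono[of w n "Suc k"]]] branch_set_mono[of w n "Suc k"] by auto

text \<open>The component at each stage depends on \<open>w\<close> only through the component it
  lies in. Hence vertices that are together at stage \<open>n\<close> have a common past, which is
  why the branches fit together to a tree.\<close>

lemma node_consistent: "active w n \<Longrightarrow> u \<in> branch_set w n \<Longrightarrow> k \<le> n \<Longrightarrow> node u k = node w k"
proof (induction n arbitrary: k)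
  case (Suc n)
  have sub: "branch_set w (Suc n) \<subseteq> branch_set w n" by (rule branch_set_mono[OF Suc.prems(1)]) simp
  have IH: "node u k = node w k" if "k \<le> n" for k
    using Suc.IH[OF active_mono[OF Suc.prems(1)]] sub Suc.prems(2) that by auto
  have "u \<in> linked (branch_set w n - {branch w n}) w" using Suc.prems(2) by (simp add: Let_def)
  from linked_eq[OF this] have "node u (Suc n) = node w (Suc n)" using IH[of n] by (simp add: Let_def)
  then show ?case using IH Suc.prems(3) by (cases "k = Suc n") auto
qed simp

text \<open>A walk through \<open>a\<close> contains a walk from \<open>a\<close> to its end that is
  no longer.\<close>

lemma relpow_avoid:
  "(z, b) \<in> links D ^^ j \<Longrightarrow> (z, b) \<in> links (D - {a}) ^^ j \<or> (\<exists>i\<le>j. (a, b) \<in> links D ^^ i)"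
proof (induction j arbitrary: z)
  case (Suc j)
  obtain y where y: "(z, y) \<in> links D" "(y, b) \<in> links D ^^ j" using relpow_Suc_D2[OF Suc.prems] by blast
  show ?case
  proof (cases "z = a \<or> y = a")
    case True
    then show ?thesis using Suc.prems y(2) by (meson le_SucI order_refl)
  next
    case False
    then have "(z, y) \<in> links (D - {a})" using y(1) by (auto simp: links_def)
    then show ?thesis using Suc.IH[OF y(2)] relpow_Suc_I2[of z y] by (meson le_SucI)
  qed
qed simp

lemma relpow_linked:
  "(z, b) \<in> links D ^^ j \<Longrightarrow> z \<in> linked D w \<Longrightarrow> (z, b) \<in> links (linked D w) ^^ j"
proof (induction j arbitrary: z)
  case (Suc j)
  obtain y where y: "(z, y) \<in> links D" "(y, b) \<in> links D ^^ j" using relpow_Suc_D2[OF Suc.prems(1)] by blast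
  then have yl: "y \<in> linked D w" using Suc.prems(2) unfolding linked_def by (auto intro: rtrancl_into_rtrancl)
  then have "(z, y) \<in> links (linked D w)" using y(1) Suc.prems(2) by (auto simp: links_def)
  then show ?case using Suc.IH[OF y(2) yl] relpow_Suc_I2[of z y] by blast
qed simp

text \<open>A shortest walk from \<open>r\<close> to \<open>v\<close> never returns to
  \<open>r\<close>, so its second vertex \<open>z\<close> is a neighbour of \<open>r\<close> in the
  next component, at distance one less. The chosen vertex is at least as close to \<open>v\<close>
  as \<open>z\<close>, and distances inside the component of \<open>D - {r}\<close> lose nothing,
  since the walk stays in it.\<close>

lemma branch_dist_decreases:
  assumes act: "active w (Suc n)" and v: "v \<in> branch_set w (Suc n)" "v = first_vertex (branch_set w (Suc n))"
  shows "link_dist (branch_set w (Suc n)) (branch w (Suc n)) v < link_dist (branch_set w n) (branch w n) v"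
proof -
  define D where "D = branch_set w n"
  define r where "r = branch w n"
  define D' where "D' = branch_set w (Suc n)"
  have D'l: "D' = linked (D - {r}) w" by (simp add: D'_def D_def r_def Let_def)
  note st = node_step[OF active_step[OF act]]
  have inv: "node_inv w n" by (rule active_step(1)[OF act])
  have vD: "v \<in> D - {r}" using v(1) st(2) by (auto simp: D_def r_def)
  have "v \<in> linked D r" using inv vD unfolding node_inv_def D_def r_def by blast
  then have "\<exists>k. (r, v) \<in> links D ^^ k" unfolding linked_def using rtrancl_imp_relpow by fastforce
  then have k: "(r, v) \<in> links D ^^ link_dist D r v" unfolding link_dist_def by (rule LeastI_ex)
  then have "link_dist D r v \<noteq> 0" using vD by (metis DiffD2 insertI1 relpow_0_E)
  then obtain k' where k': "link_dist D r v = Suc k'" using not0_implies_Suc by blast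
  obtain z where z: "(r, z) \<in> links D" "(z, v) \<in> links D ^^ k'" using relpow_Suc_D2 k k' by metis
  have no: "\<not> (\<exists>i\<le>k'. (r, v) \<in> links D ^^ i)"
    using k' Least_le[of "\<lambda>k. (r, v) \<in> links D ^^ k"] unfolding link_dist_def[symmetric]
    by (metis not_less_eq_eq)
  then have zv: "(z, v) \<in> links (D - {r}) ^^ k'" using relpow_avoid[OF z(2), of r] by blast
  then have "v \<in> linked (D - {r}) z" unfolding linked_def using relpow_imp_rtrancl by blast
  then have "z \<in> linked (D - {r}) v" using linked_sym by blast
  moreover have "linked (D - {r}) v = D'" using linked_eq v(1) D'l D'_def by metis
  ultimately have zD: "z \<in> D'" by simp
  then have "(z, v) \<in> links D' ^^ k'" using relpow_linked[OF zv] D'l by simp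
  then have "link_dist D' z v \<le> k'" unfolding link_dist_def by (rule Least_le)
  moreover have "link_dist D' (branch w (Suc n)) v \<le> link_dist D' z v"
  proof -
    obtain e where "joins e r z" using z(1) by (auto simp: links_def)
    then show ?thesis using st(4)[of z e] zD v(2) by (simp add: D'_def r_def del: node.simps)
  qed
  ultimately show ?thesis using k' by (simp add: D_def r_def D'_def del: node.simps)
qed

text \<open>If \<open>w\<close> were never reached, the components would shrink for ever while
  containing \<open>w\<close>. The least index occurring in them is nondecreasing and bounded by
  \<open>idx w\<close>, hence finally constant; from then on the distance from the branch to this
  fixed vertex would decrease without end.\<close>

lemma branch_reaches:
  assumes w: "w \<in> verts G" shows "\<exists>n. branch w n = w"
proof (rule ccontr)
  assume "\<not> (\<exists>n. branch w n = w)"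
  then have act: "active w n" for n using w by (simp add: active_def)
  define D where "D n = branch_set w n" for n
  define v where "v n = first_vertex (D n)" for n
  have wD: "w \<in> D n" "D n \<subseteq> verts G" for n using active_inv[OF act] unfolding node_inv_def D_def by auto
  have v: "v n \<in> D n" "\<And>u. u \<in> D n \<Longrightarrow> idx (v n) \<le> idx u" for n
    using first_vertex[of "D n"] wD(1) unfolding v_def by blast+
  have mono: "k \<le> n \<Longrightarrow> D n \<subseteq> D k" for k n unfolding D_def by (rule branch_set_mono[OF act])
  have bound: "idx (v n) \<le> idx w" for n using v(2) wD(1) by blast
  have fin: "finite (range (\<lambda>n. idx (v n)))" using bound finite_nat_set_iff_bounded_le by auto
  obtain N where N: "idx (v N) = Max (range (\<lambda>n. idx (v n)))"
    using Max_in[OF fin] by (metis (no_types, lifting) empty_not_UNIV image_iff image_is_empty)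
  have "idx (v n) = idx (v N)" if "n \<ge> N" for n
  proof (rule antisym)
    show "idx (v n) \<le> idx (v N)" unfolding N using fin by (intro Max_ge) auto
    show "idx (v N) \<le> idx (v n)" using v(2)[of "v n" N] v(1) mono[OF that] by blast
  qed
  then have vN: "v n = v N" if "n \<ge> N" for n
    using idx_inj that v(1) wD(2) by (meson inj_onD subsetD)
  have dec: "link_dist (D (Suc n)) (branch w (Suc n)) (v N) < link_dist (D n) (branch w n) (v N)" if "n \<ge> N" for n
    unfolding D_def
  proof (rule branch_dist_decreases[OF act])
    show "v N \<in> branch_set w (Suc n)" using v(1)[of "Suc n"] vN[of "Suc n"] that by (simp add: D_def del: node.simps)
    show "v N = first_vertex (branch_set w (Suc n))" using vN[of "Suc n"] that by (simp add: v_def D_def del: node.simps)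
  qed
  have "link_dist (D (N + k)) (branch w (N + k)) (v N) + k \<le> link_dist (D N) (branch w N) (v N)" for k
  proof (induction k)
    case (Suc k)
    then show ?case using dec[of "N + k"] by (simp del: node.simps)
  qed simp
  from this[of "Suc (link_dist (D N) (branch w N) (v N))"] show False by simp
qed

section \<open>The tree order\<close>

definition height :: "'v \<Rightarrow> nat" where "height w = (LEAST n. branch w n = w)"

lemma branch_height: "w \<in> verts G \<Longrightarrow> branch w (height w) = w"
  unfolding height_def by (rule LeastI_ex[OF branch_reaches])

lemma branch_below_height: "k < height w \<Longrightarrow> branch w k \<noteq> w"
  unfolding height_def using not_less_Least by blast

lemma active_height: "w \<in> verts G \<Longrightarrow> k \<le> height w \<Longrightarrow> active w k"
  unfolding active_def using branch_below_height by simp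

lemma branch_in:
  assumes "w \<in> verts G" "k \<le> height w"
  shows "branch w k \<in> verts G" "branch w k \<in> branch_set w k"
  using active_inv[OF active_height[OF assms]] by (auto simp: node_inv_def)

lemma node_branch:
  assumes "w \<in> verts G" "k \<le> height w" "j \<le> k"
  shows "node (branch w k) j = node w j"
  by (rule node_consistent[OF active_height[OF assms(1,2)] branch_in(2)[OF assms(1,2)] assms(3)])

lemma height_branch:
  assumes w: "w \<in> verts G" and k: "k \<le> height w" shows "height (branch w k) = k"
  unfolding height_def
proof (rule Least_equality)
  show "branch (branch w k) k = branch w k" using node_branch[OF w k] by simp
  fix j assume j: "branch (branch w k) j = branch w k"
  show "k \<le> j"
  proof (rule ccontr)
    assume "\<not> k \<le> j"
    then have "branch w j = branch w k" "j < k" using j node_branch[OF w k, of j] by auto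
    then show False using branch_removed[OF active_height[OF w k]] branch_in(2)[OF w k] by metis
  qed
qed

definition below :: "'v \<Rightarrow> 'v \<Rightarrow> bool" where
  "below x y \<longleftrightarrow> x \<in> verts G \<and> y \<in> verts G \<and> height x \<le> height y \<and> branch y (height x) = x"

lemma below_verts: "below x y \<Longrightarrow> x \<in> verts G \<and> y \<in> verts G"
  by (simp add: below_def)

lemma below_height: "below x y \<Longrightarrow> height x \<le> height y"
  by (simp add: below_def)

lemma below_refl: "x \<in> verts G \<Longrightarrow> below x x"
  by (simp add: below_def branch_height)

lemma below_same_height: "below x y \<Longrightarrow> height x = height y \<Longrightarrow> x = y"
  using branch_height by (metis below_def)

lemma below_trans: "below x y \<Longrightarrow> below y z \<Longrightarrow> below x z"
  using node_branch[of z "height y" "height x"] by (auto simp: below_def)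

lemma below_chain: "below x z \<Longrightarrow> below y z \<Longrightarrow> height x \<le> height y \<Longrightarrow> below x y"
  using node_branch[of z "height y" "height x"] by (auto simp: below_def)

lemma branch_below: "w \<in> verts G \<Longrightarrow> k \<le> height w \<Longrightarrow> below (branch w k) w"
  unfolding below_def by (simp add: height_branch branch_in)

lemma finite_below: "finite {x. below x y}"
proof -
  have "{x. below x y} \<subseteq> branch y ` {..height y}" by (force simp: below_def)
  then show ?thesis by (rule finite_subset) simp
qed

text \<open>This is normality of the tree. As long as the branch towards \<open>u\<close> has
  reached neither end, the edge survives the deletions and keeps \<open>u\<close> and
  \<open>v\<close> in one component; so the branch of \<open>v\<close> agrees with that of
  \<open>u\<close> up to \<open>u\<close>.\<close>

lemma joins_below:
  assumes e: "joins e u v" and h: "height u \<le> height v" shows "below u v"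
proof -
  have uv: "u \<in> verts G" "v \<in> verts G" using joins_verts[OF e] by auto
  have "v \<in> branch_set u k" if "k \<le> height u" for k
    using that
  proof (induction k)
    case 0 show ?case using uv by simp
  next
    case (Suc k)
    have k: "k < height u" "k < height v" using Suc.prems h by auto
    have act: "active u k" using active_height[OF uv(1)] k by simp
    have v: "v \<in> branch_set u k" using Suc k by simp
    have u: "u \<in> branch_set u k" using active_inv[OF act] by (simp add: node_inv_def)
    have "branch v k = branch u k" using node_consistent[OF act v, of k] by simp
    then have "v \<noteq> branch u k" "u \<noteq> branch u k" using branch_below_height k by metis+
    then have "v \<in> linked (branch_set u k - {branch u k}) u"
      using u v by (intro linked_step[OF linked_self e]) auto
    then show ?case by (simp add: Let_def)
  qed
  then have "node v (height u) = node u (height u)"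
    using node_consistent[OF active_height[OF uv(1)]] by blast
  then show ?thesis using uv h branch_height by (simp add: below_def)
qed

lemma joins_comparable: "joins e u v \<Longrightarrow> below u v \<or> below v u"
  using joins_below joins_sym by (meson nat_le_linear)

definition parent :: "'v \<Rightarrow> 'v" where "parent w = branch w (height w - 1)"

lemma height_root: "height root = 0"
  unfolding height_def by (rule Least_equality) auto

lemma height_0_iff: "w \<in> verts G \<Longrightarrow> height w = 0 \<longleftrightarrow> w = root"
  using branch_height[of w] height_root by auto

lemma parent:
  assumes "w \<in> verts G" "w \<noteq> root"
  shows "below (parent w) w" "height w = Suc (height (parent w))" "\<exists>e. joins e (parent w) w"
proof -
  have h: "height w > 0" using height_0_iff assms by blast
  then show "below (parent w) w" unfolding parent_def by (intro branch_below) (use assms in auto)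
  show "height w = Suc (height (parent w))" unfolding parent_def using h height_branch assms(1) by simp
  obtain n where n: "height w = Suc n" using h gr0_conv_Suc by blast
  have "active w (Suc n)" using active_height[OF assms(1)] n by simp
  from node_step(3)[OF active_step[OF this]]
  have "\<exists>e. joins e (branch w n) (branch w (Suc n))" .
  moreover have "branch w (Suc n) = w" using branch_height[OF assms(1)] by (simp only: n)
  ultimately show "\<exists>e. joins e (parent w) w" unfolding parent_def n by (simp del: node.simps)
qed

lemma below_parent:
  assumes "below x w" "x \<noteq> w" shows "w \<noteq> root" "below x (parent w)"
proof -
  have h: "height x < height w" using assms below_same_height below_height le_neq_implies_less by blast
  then show wr: "w \<noteq> root" using height_root by auto
  note p = parent[OF conjunct2[OF below_verts[OF assms(1)]] wr]
  show "below x (parent w)" by (rule below_chain[OF assms(1) p(1)]) (use h p(2) in simp)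
qed

lemma parent_not_below: "w \<in> verts G \<Longrightarrow> w \<noteq> root \<Longrightarrow> \<not> below w (parent w)"
  using parent(2) below_height by fastforce

lemma root_below: "w \<in> verts G \<Longrightarrow> below root w"
  using branch_below[of w 0] by simp

section \<open>Subtrees and tree edges\<close>

definition up :: "'v \<Rightarrow> 'v set" where "up x = {y. below x y}"

lemma up_verts: "up x \<subseteq> verts G"
  using below_verts by (auto simp: up_def)

lemma up_subset: "below x y \<Longrightarrow> up y \<subseteq> up x"
  using below_trans by (auto simp: up_def)

lemma up_linked:
  assumes "y \<in> up x" shows "y \<in> linked (up x) x"
  using assms
proof (induction "height y" arbitrary: y)
  case 0
  then have "y = x" using below_same_height[of x y] below_height[of x y] by (simp add: up_def)
  then show ?case by simp
next
  case (Suc n)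
  show ?case
  proof (cases "x = y")
    case False
    have xy: "below x y" using Suc.prems by (simp add: up_def)
    note bp = below_parent[OF xy False]
    have yv: "y \<in> verts G" using below_verts[OF xy] by simp
    obtain e where e: "joins e (parent y) y" using parent(3)[OF yv bp(1)] by blast
    have pu: "parent y \<in> up x" using bp(2) by (simp add: up_def)
    have "parent y \<in> linked (up x) x"
      by (rule Suc.hyps(1)[OF _ pu]) (use parent(2)[OF yv bp(1)] Suc.hyps(2) in simp)
    then show ?thesis using linked_step[OF _ e pu Suc.prems] by blast
  qed simp
qed

definition tree_edge :: "'v \<Rightarrow> 'e" where "tree_edge w = (SOME e. joins e (parent w) w)"

definition tree_edges :: "'e set" where "tree_edges = tree_edge ` (verts G - {root})"

lemma tree_edge: "w \<in> verts G \<Longrightarrow> w \<noteq> root \<Longrightarrow> joins (tree_edge w) (parent w) w"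
  unfolding tree_edge_def by (rule someI_ex[OF parent(3)])

definition incident :: "'v \<Rightarrow> 'e set" where
  "incident v = {e \<in> arcs G. tail G e = v \<or> head G e = v}"

lemma finite_incident: "finite (incident v)"
proof (cases "v \<in> verts G")
  case True then show ?thesis using lf by (simp add: locally_finite_def incident_def)
next
  case False
  then have "incident v = {}" unfolding incident_def by auto
  then show ?thesis by simp
qed

lemma finite_joined: "finite {w. \<exists>e. joins e v w}"
proof -
  have "{w. \<exists>e. joins e v w} \<subseteq> tail G ` incident v \<union> head G ` incident v"
    by (auto simp: joins_def incident_def)
  then show ?thesis using finite_incident by (meson finite_UnI finite_imageI finite_subset)
qed

section \<open>Cuts\<close>

definition cut :: "'v set \<Rightarrow> 'e set" where
  "cut A = {e \<in> arcs G. (tail G e \<in> A) \<noteq> (head G e \<in> A)}"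

text \<open>The net value entering \<open>A\<close>.\<close>

definition cut_sum :: "('e \<Rightarrow> 'b::ab_group_add) \<Rightarrow> 'v set \<Rightarrow> 'b" where
  "cut_sum \<psi> A = (\<Sum>e\<in>cut A. if head G e \<in> A then \<psi> e else - \<psi> e)"

text \<open>Singletons \<open>A\<close> give conservation at the vertices. Infinite \<open>A\<close>
  with a finite cut say more: nothing may flow from one end to another across the cut.\<close>

definition balanced :: "('e \<Rightarrow> 'b::ab_group_add) \<Rightarrow> bool" where
  "balanced \<psi> \<longleftrightarrow> (\<forall>A. A \<subseteq> verts G \<longrightarrow> finite (cut A) \<longrightarrow> cut_sum \<psi> A = 0)"

lemma cut_joins: "e \<in> cut A \<Longrightarrow> \<exists>y z. joins e y z \<and> y \<in> A \<and> z \<notin> A"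
  unfolding cut_def joins_def by auto

lemma joins_cut: "joins e y z \<Longrightarrow> e \<in> cut A \<longleftrightarrow> (y \<in> A) \<noteq> (z \<in> A)"
  unfolding cut_def joins_def by auto

text \<open>By normality an edge leaving \<open>up x\<close> goes to a vertex below
  \<open>x\<close>, of which there are finitely many, each with finitely many edges.\<close>

lemma finite_cut_up: "finite (cut (up x))"
proof -
  have "cut (up x) \<subseteq> (\<Union>z\<in>{z. below z x}. incident z)"
  proof
    fix e assume e: "e \<in> cut (up x)"
    then obtain y z where yz: "joins e y z" "y \<in> up x" "z \<notin> up x" using cut_joins by blast
    have xy: "below x y" "\<not> below x z" using yz by (auto simp: up_def)
    then have zy: "below z y" using joins_comparable[OF yz(1)] below_trans by blast
    have "below z x" using below_chain[OF zy xy(1)] below_chain[OF xy(1) zy] xy(2) by linarith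
    moreover have "e \<in> incident z" using yz(1) by (auto simp: incident_def joins_def)
    ultimately show "e \<in> (\<Union>z\<in>{z. below z x}. incident z)" by blast
  qed
  then show ?thesis using finite_below finite_incident by (meson finite_UN_I finite_subset)
qed

lemma tree_edge_cut:
  assumes w: "w \<in> verts G" "w \<noteq> root" shows "tree_edges \<inter> cut (up w) = {tree_edge w}"
proof -
  have *: "tree_edge u \<in> cut (up w) \<longleftrightarrow> u = w" if u: "u \<in> verts G" "u \<noteq> root" for u
  proof -
    have "tree_edge u \<in> cut (up w) \<longleftrightarrow> (below w (parent u)) \<noteq> (below w u)"
      using joins_cut[OF tree_edge[OF u]] by (simp add: up_def)
    also have "\<dots> \<longleftrightarrow> u = w"
      using below_parent(2)[of w u] below_trans[of w "parent u" u] parent(1)[OF u] parent_not_below[OF u]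
        below_refl[OF u(1)] by blast
    finally show ?thesis .
  qed
  then show ?thesis using w by (auto simp: tree_edges_def)
qed

text \<open>The cut of \<open>up w\<close> contains only one tree edge, \<open>tree_edge w\<close>;
  if the chords contribute 0, so must this edge.\<close>

lemma balanced_unique:
  assumes "balanced \<psi>" "\<And>e. e \<in> arcs G \<Longrightarrow> e \<notin> tree_edges \<Longrightarrow> \<psi> e = 0" "e \<in> arcs G"
  shows "\<psi> e = 0"
proof (cases "e \<in> tree_edges")
  case True
  then obtain w where w: "w \<in> verts G" "w \<noteq> root" "e = tree_edge w" by (auto simp: tree_edges_def)
  let ?g = "\<lambda>e. if head G e \<in> up w then \<psi> e else - \<psi> e"
  have "0 = cut_sum \<psi> (up w)" using assms(1) finite_cut_up up_verts by (simp add: balanced_def)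
  also have "\<dots> = sum ?g {e}"
    unfolding cut_sum_def
  proof (rule sum.mono_neutral_right[OF finite_cut_up])
    show "{e} \<subseteq> cut (up w)" using tree_edge_cut[OF w(1,2)] w(3) by blast
    show "\<forall>i\<in>cut (up w) - {e}. ?g i = 0"
    proof
      fix i assume i: "i \<in> cut (up w) - {e}"
      then have "i \<notin> tree_edges" using tree_edge_cut[OF w(1,2)] w(3) by blast
      then show "?g i = 0" using assms(2) i by (simp add: cut_def)
    qed
  qed
  finally show ?thesis by (simp split: if_splits)
qed (use assms in blast)

lemma balanced_eqI:
  assumes "balanced \<psi>" "balanced \<phi>" "\<And>e. e \<in> arcs G \<Longrightarrow> e \<notin> tree_edges \<Longrightarrow> \<psi> e = \<phi> e" "e \<in> arcs G"
  shows "\<psi> e = \<phi> e"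
proof -
  have cs: "cut_sum (\<lambda>e. \<psi> e - \<phi> e) A = cut_sum \<psi> A - cut_sum \<phi> A" for A
    unfolding cut_sum_def sum_subtractf[symmetric] by (rule sum.cong) auto
  have "balanced (\<lambda>e. \<psi> e - \<phi> e)"
    using assms(1,2) unfolding balanced_def cs by simp
  from balanced_unique[OF this _ assms(4)] assms(3) show ?thesis by simp
qed

end

section \<open>Winding numbers along edges\<close>

lemma periodic_continuous:
  fixes f :: "real \<Rightarrow> 'a::topological_space"
  assumes f: "continuous_on {0..1} f" "f 0 = f 1"
  shows "continuous_on UNIV (\<lambda>r. f (frac r))"
proof -
  have piece: "continuous_on {of_int n..of_int n + 1} (\<lambda>r. f (frac r))" for n
  proof -
    have c1: "continuous_on {of_int n..of_int n + 1} (\<lambda>r. f (r - of_int n))"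
      by (rule continuous_on_compose2[OF f(1)]) (auto intro!: continuous_intros)
    have c2: "f (frac r) = f (r - of_int n)" if r: "r \<in> {of_int n..of_int n + 1}" for r
    proof (cases "r = of_int n + 1")
      case True
      then have "frac r = 0" by simp
      then show ?thesis using True f(2) by simp
    next
      case False
      then have "\<lfloor>r\<rfloor> = n" using r by (intro floor_unique) auto
      then show ?thesis by (simp add: frac_def)
    qed
    show ?thesis by (rule continuous_on_eq[OF c1]) (rule c2[symmetric])
  qed
  have "isCont (\<lambda>r. f (frac r)) r" for r
  proof -
    let ?n = "\<lfloor>r\<rfloor>"
    have eq: "{of_int (?n - 1)..of_int (?n - 1) + 1} \<union> {of_int ?n..of_int ?n + 1} = {of_int ?n - 1..of_int ?n + (1::real)}"
      by auto
    have "continuous_on ({of_int (?n - 1)..of_int (?n - 1) + 1} \<union> {of_int ?n..of_int ?n + 1}) (\<lambda>r. f (frac r))"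
      by (rule continuous_on_closed_Un[OF _ _ piece piece]) auto
    then have "continuous_on {of_int ?n - 1..of_int ?n + (1::real)} (\<lambda>r. f (frac r))"
      unfolding eq .
    then have "continuous_on {of_int ?n - 1<..<of_int ?n + (1::real)} (\<lambda>r. f (frac r))"
      by (rule continuous_on_subset) auto
    moreover have "r \<in> {of_int ?n - 1<..<of_int ?n + (1::real)}" by simp linarith
    ultimately show ?thesis using continuous_on_eq_continuous_at[OF open_greaterThanLessThan] by blast
  qed
  then show ?thesis by (simp add: continuous_at_imp_continuous_on)
qed

text \<open>Start from a time \<open>r1\<close> with an integer value \<open>M\<close>; within one
  period \<open>g\<close> rises to \<open>M + 1\<close>. Let \<open>t\<close> be the first such time
  after \<open>r1\<close>, and \<open>s\<close> the last time before \<open>t\<close> with value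
  \<open>M\<close>. By the intermediate value theorem \<open>g\<close> stays strictly between the
  two integers from \<open>s\<close> to \<open>t\<close>. The period gives
  \<open>t \<le> r1 + 1 \<le> s + 1\<close>.\<close>

lemma integer_crossing:
  fixes g :: "real \<Rightarrow> real"
  assumes g: "continuous_on UNIV g" and per: "\<And>r. g (r + 1) = g r + w" and w: "w \<ge> 1"
  obtains s t and M :: int where "s < t" "t \<le> s + 1" "g s = of_int M" "g t = of_int M + 1"
    "\<And>r. s < r \<Longrightarrow> r < t \<Longrightarrow> of_int M < g r \<and> g r < of_int M + 1"
proof -
  have cont: "continuous_on {a..b} g" for a b using g continuous_on_subset by blast
  let ?M = "\<lceil>g 0\<rceil>"
  have "g 0 \<le> of_int ?M" by simp
  moreover have "of_int ?M \<le> g 1" using per[of 0] w ceiling_correct[of "g 0"] by simp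
  ultimately obtain r1 where r1: "g r1 = of_int ?M" using IVT'[of g 0 "of_int ?M" 1] cont by auto
  have "g r1 \<le> of_int ?M + 1" "of_int ?M + 1 \<le> g (r1 + 1)" using r1 per[of r1] w by simp_all
  then obtain r2 where r2: "g r2 = of_int ?M + 1" "r1 \<le> r2" "r2 \<le> r1 + 1"
    using IVT'[of g r1 "of_int ?M + 1" "r1 + 1"] cont by auto
  have comp: "compact {r \<in> {a..b}. g r = c}" for a b c :: real
    unfolding compact_eq_bounded_closed
    by (intro conjI bounded_subset[OF bounded_closed_interval[of a b]] continuous_closed_preimage_constant cont) auto
  obtain t where t: "t \<in> {r1..r2}" "g t = of_int ?M + 1"
    "\<And>r. r \<in> {r1..r2} \<Longrightarrow> g r = of_int ?M + 1 \<Longrightarrow> t \<le> r"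
    using compact_attains_inf[OF comp[of r1 r2 "of_int ?M + 1"]] r2 by auto
  have "r1 \<in> {r \<in> {r1..t}. g r = of_int ?M}" using r1 t(1) by simp
  then obtain s where s: "s \<in> {r1..t}" "g s = of_int ?M"
    "\<And>r. r \<in> {r1..t} \<Longrightarrow> g r = of_int ?M \<Longrightarrow> r \<le> s"
    using compact_attains_sup[OF comp[of r1 t "of_int ?M"]] by blast
  show thesis
  proof
    show st: "s < t" using s(1,2) t(2) by (cases "s = t") auto
    show "t \<le> s + 1" using t(1) s(1) r2 by simp
    show "g s = of_int ?M" "g t = of_int ?M + 1" by (fact s(2) t(2))+
    fix r assume r: "s < r" "r < t"
    have ne: "g x \<noteq> of_int ?M" "g x \<noteq> of_int ?M + 1" if "s < x" "x < t" for x
      using s(3)[of x] t(3)[of x] that s(1) t(1) by auto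
    show "of_int ?M < g r \<and> g r < of_int ?M + 1"
    proof (rule ccontr)
      assume "\<not> (of_int ?M < g r \<and> g r < of_int ?M + 1)"
      then consider "g r < of_int ?M" | "g r > of_int ?M + 1" using ne[OF r] by linarith
      then show False
      proof cases
        case 1
        then obtain x where "r \<le> x" "x \<le> t" "g x = of_int ?M"
          using IVT'[of g r "of_int ?M" t] cont t(2) r by auto
        then show False using ne(1)[of x] r t(2) by (cases "x = t") auto
      next
        case 2
        then obtain x where "s \<le> x" "x \<le> r" "g x = of_int ?M + 1"
          using IVT'[of g s "of_int ?M + 1" r] cont s(2) r by auto
        then show False using ne(2)[of x] r s(2) by (cases "x = s") auto
      qed
    qed
  qed
qed

context lf_graph
begin

definition edge_winding :: "'e \<Rightarrow> (real \<Rightarrow> ('v,'e) point) \<Rightarrow> real" where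
  "edge_winding e p = winding (\<lambda>t. edge_map G e (p t))"

definition simplex_edge_winding :: "'e \<Rightarrow> ((nat \<Rightarrow> real) \<Rightarrow> ('v,'e) point) \<Rightarrow> real" where
  "simplex_edge_winding e \<tau> = edge_winding e (simplex_path \<tau>)"

lemma edge_winding_cong: "(\<And>t. t \<in> {0..1} \<Longrightarrow> p t = q t) \<Longrightarrow> edge_winding e p = edge_winding e q"
  unfolding edge_winding_def by (rule winding_cong) simp

lemma simplex_edge_winding_path: "simplex_edge_winding e (path_simplex p) = edge_winding e p"
  unfolding simplex_edge_winding_def by (rule edge_winding_cong) (rule simplex_path_path_simplex)

lemma edge_winding_outside:
  assumes "\<And>t. t \<in> {0..1} \<Longrightarrow> p t \<notin> open_edge G e" shows "edge_winding e p = 0"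
  unfolding edge_winding_def by (rule winding_const[of 1]) (use assms in \<open>auto simp: edge_map_outside\<close>)

lemma simplex_edge_winding_outside:
  assumes "\<tau> ` standard_simplex 1 \<inter> open_edge G e = {}" shows "simplex_edge_winding e \<tau> = 0"
  unfolding simplex_edge_winding_def
proof (rule edge_winding_outside)
  fix t :: real assume "t \<in> {0..1}"
  then have "simplex_path \<tau> t \<in> \<tau> ` standard_simplex 1" unfolding simplex_image by (rule imageI)
  then show "simplex_path \<tau> t \<notin> open_edge G e" using assms by blast
qed

lemma pathin_edge_map:
  assumes "pathin (freudenthal G) p" "e \<in> arcs G"
  shows "pathin circle_top (\<lambda>t. edge_map G e (p t))"
  using continuous_map_compose[OF assms(1)[unfolded pathin_def] continuous_edge_map[OF assms(2)]]
  by (simp add: pathin_def comp_def)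

lemma edge_lift:
  assumes "pathin (freudenthal G) p" "e \<in> arcs G"
  obtains g where "continuous_on {0..1} g" "\<And>t. t \<in> {0..1} \<Longrightarrow> edge_map G e (p t) = cis (2 * pi * g t)"
    "edge_winding e p = g 1 - g 0"
proof -
  obtain g where g: "continuous_on {0..1} g" "\<And>t. t \<in> {0..1} \<Longrightarrow> edge_map G e (p t) = cis (2 * pi * g t)"
    using pathin_circle_lift[OF pathin_edge_map[OF assms]] by blast
  show thesis by (rule that[OF g]) (auto simp: edge_winding_def intro!: windingI g)
qed

lemma edge_winding_affine:
  assumes "continuous_on {0..1} g" "\<And>t. t \<in> {0..1} \<Longrightarrow> edge_map G e (p t) = cis (2 * pi * g t)"
    and "a \<in> {0..1}" "b \<in> {0..1}"
  shows "edge_winding e (\<lambda>t. p ((1 - t) * a + t * b)) = g b - g a"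
  unfolding edge_winding_def using winding_affine[OF assms(1) _ assms(3,4), of "\<lambda>t. edge_map G e (p t)"] assms(2) by simp

lemma edge_winding_reverse:
  assumes "pathin (freudenthal G) p" "e \<in> arcs G"
  shows "edge_winding e (\<lambda>t. p (1 - t)) = - edge_winding e p"
proof -
  obtain g where g: "continuous_on {0..1} g" "\<And>t. t \<in> {0..1} \<Longrightarrow> edge_map G e (p t) = cis (2 * pi * g t)"
    "edge_winding e p = g 1 - g 0" using edge_lift[OF assms] by blast
  show ?thesis using edge_winding_affine[OF g(1,2), of 1 0] g(3) by simp
qed

lemma frag_eval_simplex_edge_winding:
  "frag_eval (simplex_edge_winding e) c = frag_eval simplex_winding (chain_map 1 (edge_map G e) c)"
proof -
  have "simplex_winding (simplex_map 1 (edge_map G e) \<tau>) = simplex_edge_winding e \<tau>" for \<tau>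
    unfolding simplex_edge_winding_def edge_winding_def
  proof (rule winding_cong)
    fix t :: real assume "t \<in> {0..1}"
    then show "simplex_path (simplex_map 1 (edge_map G e) \<tau>) t = edge_map G e (simplex_path \<tau> t)"
      using bary_in_simplex[of t] by (simp add: simplex_path_def simplex_map_def)
  qed
  then show ?thesis by (simp add: chain_map_def frag_eval_extend)
qed

lemma edge_winding_boundary:
  assumes "singular_chain 2 (freudenthal G) c" "e \<in> arcs G"
  shows "frag_eval (simplex_edge_winding e) (chain_boundary 2 c) = 0"
proof -
  have "chain_map 1 (edge_map G e) (chain_boundary 2 c) = chain_boundary 2 (chain_map 2 (edge_map G e) c)"
    using chain_boundary_chain_map[OF assms(1), of "edge_map G e"] by simp
  then show ?thesis
    unfolding frag_eval_simplex_edge_winding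
    using winding_boundary[OF singular_chain_chain_map[OF assms(1) continuous_edge_map[OF assms(2)]]] by simp
qed

lemma reverse_natural: "reverse (natural_orientation G e) = (e, head G e, tail G e)"
  by (simp add: reverse_def natural_orientation_def)

text \<open>The link between \<open>f_prime\<close> and windings: the degree of the image cycle in
  the circle is the sum of the windings of its simplices, by
  \<open>circle_degree_eq\<close>.\<close>

lemma f_prime_eq:
  assumes z: "singular_relcycle 1 (freudenthal G) {} z" and e: "e \<in> arcs G"
  shows "of_int (f_prime G (homologous_rel_set 1 (freudenthal G) {} z) (natural_orientation G e)) = frag_eval (simplex_edge_winding e) z"
    "f_prime G (homologous_rel_set 1 (freudenthal G) {} z) (reverse (natural_orientation G e)) =
      - f_prime G (homologous_rel_set 1 (freudenthal G) {} z) (natural_orientation G e)"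
proof -
  have "hom_induced 1 (freudenthal G) {} circle_top {} (edge_map G e) (homologous_rel_set 1 (freudenthal G) {} z)
    = homologous_rel_set 1 circle_top {} (chain_map 1 (edge_map G e) z)"
    using hom_induced_chain_map[OF continuous_edge_map[OF e] _ z, of "{}"] by simp
  moreover have "singular_relcycle 1 circle_top {} (chain_map 1 (edge_map G e) z)"
    by (rule singular_relcycle_chain_map[OF z continuous_edge_map[OF e]]) simp
  ultimately have d: "of_int (circle_degree (hom_induced 1 (freudenthal G) {} circle_top {} (edge_map G e)
     (homologous_rel_set 1 (freudenthal G) {} z))) = frag_eval (simplex_edge_winding e) z"
    by (simp add: circle_degree_eq[unfolded One_nat_def] frag_eval_simplex_edge_winding)
  show "of_int (f_prime G (homologous_rel_set 1 (freudenthal G) {} z) (natural_orientation G e)) = frag_eval (simplex_edge_winding e) z"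
    using d e by (simp add: f_prime_def natural_orientation_def Let_def)
  show "f_prime G (homologous_rel_set 1 (freudenthal G) {} z) (reverse (natural_orientation G e)) =
      - f_prime G (homologous_rel_set 1 (freudenthal G) {} z) (natural_orientation G e)"
    using no_loops[OF e] e by (simp add: f_prime_def natural_orientation_def reverse_def Let_def)
qed

section \<open>Cycles and finite cuts\<close>

definition cut_fun :: "'v set \<Rightarrow> ('v,'e) point \<Rightarrow> real" where
  "cut_fun A p = (case p of Vertex v \<Rightarrow> if v \<in> A then 1 else 0
     | Inner e t \<Rightarrow> (if tail G e \<in> A then 1 - t else 0) + (if head G e \<in> A then t else 0)
     | End \<omega> \<Rightarrow> if \<forall>r\<in>\<omega>. has_tail_in r A then 1 else 0)"

lemma cut_fun_theta:
  assumes "t \<in> {0..1}"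
  shows "cut_fun A (theta G e t) = (if tail G e \<in> A then 1 - t else 0) + (if head G e \<in> A then t else 0)"
  using assms by (rule theta_cases) (auto simp: cut_fun_def)

lemma component_one_side:
  assumes C: "C \<in> components_avoiding G S" and S: "\<And>e. e \<in> cut A \<Longrightarrow> tail G e \<in> S \<and> head G e \<in> S"
  shows "C \<subseteq> A \<or> C \<inter> A = {}"
proof -
  obtain v where v: "v \<in> verts G - S" "C = linked (verts G - S) v" using C components_avoiding_iff by blast
  have "u \<in> A \<longleftrightarrow> v \<in> A" if "(v, u) \<in> (links (verts G - S))\<^sup>*" for u
    using that
  proof (induction rule: rtrancl_induct)
    case (step y z)
    then obtain e where e: "joins e y z" "y \<notin> S" "z \<notin> S" by (auto simp: links_def)
    then have "e \<notin> cut A" using S by (auto simp: joins_def)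
    then show ?case using joins_cut[OF e(1)] step.IH by blast
  qed simp
  then show ?thesis unfolding v(2) linked_def by blast
qed

text \<open>Take all ends of cut edges as separator. Then every component lies on one side of the
  cut, and no edge meeting it is a cut edge; so the function is constant on the corresponding
  neighbourhoods of ends.\<close>

lemma continuous_cut_fun:
  assumes "finite (cut A)"
  shows "continuous_map (freudenthal G) euclideanreal (cut_fun A)"
proof (rule continuous_map_freudenthal)
  fix e
  have "continuous_on {0..1} (\<lambda>t. (if tail G e \<in> A then 1 - t else 0) + (if head G e \<in> A then t else (0::real)))"
    by (cases "tail G e \<in> A"; cases "head G e \<in> A") (auto intro!: continuous_intros)
  then show "continuous_map (top_of_set {0..1}) euclideanreal (\<lambda>t. cut_fun A (theta G e t))"
    unfolding continuous_map_iff_continuous by (rule continuous_on_eq) (simp add: cut_fun_theta)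
next
  fix \<omega> assume \<omega>: "\<omega> \<in> ends G"
  let ?S = "tail G ` cut A \<union> head G ` cut A"
  have ca: "e \<in> cut A \<Longrightarrow> tail G e \<in> ?S \<and> head G e \<in> ?S" for e by blast
  have "cut_fun A p = cut_fun A (End \<omega>)" if C: "C \<in> components_avoiding G ?S" "\<forall>r\<in>\<omega>. has_tail_in r C"
    and p: "p \<in> end_nbhd G ?S C" for C p
  proof -
    define b :: real where "b = (if C \<subseteq> A then 1 else 0)"
    have inA: "x \<in> A \<longleftrightarrow> C \<subseteq> A" if "x \<in> C" for x using component_one_side[OF C(1) ca] that by blast
    have endb: "cut_fun A (End \<omega>') = b" if \<omega>': "\<omega>' \<in> ends G" "\<forall>r\<in>\<omega>'. has_tail_in r C" for \<omega>'
    proof (cases "C \<subseteq> A")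
      case True
      then have "\<forall>r\<in>\<omega>'. has_tail_in r A" using \<omega>'(2) unfolding has_tail_in_def by blast
      then show ?thesis using True by (simp add: cut_fun_def b_def)
    next
      case False
      obtain r where r: "r \<in> \<omega>'" using end_nonempty[OF \<omega>'(1)] by blast
      have "\<not> has_tail_in r A"
      proof
        assume "has_tail_in r A"
        then obtain n m where "\<And>k. k \<ge> n \<Longrightarrow> fst r k \<in> A" "\<And>k. k \<ge> m \<Longrightarrow> fst r k \<in> C"
          using \<omega>'(2) r unfolding has_tail_in_def by blast
        then have "fst r (max n m) \<in> A" "fst r (max n m) \<in> C" by auto
        then show False using inA False by blast
      qed
      then have "\<not> (\<forall>r\<in>\<omega>'. has_tail_in r A)" using r by blast
      then show ?thesis using False by (simp add: cut_fun_def b_def)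
    qed
    have edgeb: "cut_fun A (Inner e t) = b"
      if e: "e \<in> arcs G" "tail G e \<in> C \<or> head G e \<in> C" "e \<notin> cut A" for e t
    proof -
      have "tail G e \<in> A \<longleftrightarrow> head G e \<in> A" using e by (auto simp: cut_def)
      moreover have "tail G e \<in> A \<longleftrightarrow> C \<subseteq> A" using inA e(2) calculation by blast
      ultimately show ?thesis by (simp add: cut_fun_def b_def)
    qed
    have notcut: "e \<notin> cut A" if "tail G e \<in> C \<or> head G e \<in> C" for e
      using component_subset[OF C(1)] ca[of e] that by blast
    show ?thesis
    proof (cases p)
      case (Vertex v)
      then have "v \<in> C" using p by (auto simp: end_nbhd_def)
      then show ?thesis using endb[OF \<omega> C(2)] inA[of v] Vertex by (simp add: cut_fun_def b_def)
    next
      case (Inner e t)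
      then have "e \<in> arcs G" "tail G e \<in> C \<or> head G e \<in> C" using p by (auto simp: end_nbhd_def)
      then show ?thesis using edgeb notcut endb[OF \<omega> C(2)] Inner by simp
    next
      case (End \<omega>')
      then have "\<omega>' \<in> ends G" "\<forall>r\<in>\<omega>'. has_tail_in r C" using p by (auto simp: end_nbhd_def)
      then show ?thesis using endb endb[OF \<omega> C(2)] End by simp
    qed
  qed
  moreover have "finite ?S" "?S \<subseteq> verts G" using assms by (auto simp: cut_def)
  ultimately show "\<exists>S. finite S \<and> S \<subseteq> verts G \<and> (\<forall>C\<in>components_avoiding G S.
      (\<forall>r\<in>\<omega>. has_tail_in r C) \<longrightarrow> (\<forall>p\<in>end_nbhd G S C. cut_fun A p = cut_fun A (End \<omega>)))"
    by (intro exI[of _ ?S]) blast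
qed simp

lemma edge_map_cases:
  "edge_map G e p = (case p of Inner e' t \<Rightarrow> if e' = e \<and> 0 < t \<and> t < 1 then cis (2 * pi * t) else 1 | _ \<Rightarrow> 1)"
  by (cases p) (simp_all add: edge_map_eq edge_fun_def eta_cis)

text \<open>At most one factor differs from 1. On a cut edge whose head is outside \<open>A\<close>
  the angle is \<open>- t\<close>, whereas \<open>cut_fun\<close> has the value
  \<open>1 - t\<close>; these agree modulo 1.\<close>

lemma cut_fun_circle:
  assumes A: "finite (cut A)" and p: "p \<in> topspace (freudenthal G)"
  shows "(\<Prod>e\<in>cut A. if head G e \<in> A then edge_map G e p else inverse (edge_map G e p)) = cis (2 * pi * cut_fun A p)"
    (is "prod ?f _ = _")
proof (cases p)
  case (Inner e t)
  then have et: "e \<in> arcs G" "0 < t" "t < 1" using p by (auto simp: topspace_freudenthal)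
  have one: "?f e' = 1" if "e' \<noteq> e" for e' using that Inner by (simp add: edge_map_cases)
  have fe: "?f e = (if head G e \<in> A then cis (2 * pi * t) else cis (- (2 * pi * t)))"
    using Inner et by (simp add: edge_map_cases cis_inverse)
  show ?thesis
  proof (cases "e \<in> cut A")
    case True
    have "prod ?f (cut A) = prod ?f {e}"
      by (rule prod.mono_neutral_right[OF A]) (use True one in auto)
    also have "\<dots> = cis (2 * pi * cut_fun A p)"
    proof (cases "head G e \<in> A")
      case True
      then have "cut_fun A p = t" using \<open>e \<in> cut A\<close> Inner by (simp add: cut_fun_def cut_def)
      then show ?thesis using fe True by simp
    next
      case False
      then have "cut_fun A p = 1 - t" using \<open>e \<in> cut A\<close> Inner by (simp add: cut_fun_def cut_def)
      moreover have "cis (2 * pi * (1 - t)) = cis (2 * pi * (- t))"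
        unfolding cis_eq_iff_Ints by simp
      ultimately show ?thesis using fe False by simp
    qed
    finally show ?thesis .
  next
    case False
    have "prod ?f (cut A) = 1" by (rule prod.neutral) (use one False in metis)
    moreover have "cut_fun A p \<in> \<int>" using False et Inner by (auto simp: cut_fun_def cut_def)
    then have "cis (2 * pi * cut_fun A p) = 1" by (rule cis_multiple_2pi)
    ultimately show ?thesis by simp
  qed
next
  case (Vertex v)
  have "cut_fun A p \<in> \<int>" using Vertex by (simp add: cut_fun_def)
  then have "cis (2 * pi * cut_fun A p) = 1" by (rule cis_multiple_2pi)
  moreover have "prod ?f (cut A) = 1" using Vertex by (intro prod.neutral) (simp add: edge_map_cases)
  ultimately show ?thesis by simp
next
  case (End \<omega>)
  have "cut_fun A p \<in> \<int>" using End by (simp add: cut_fun_def)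
  then have "cis (2 * pi * cut_fun A p) = 1" by (rule cis_multiple_2pi)
  moreover have "prod ?f (cut A) = 1" using End by (intro prod.neutral) (simp add: edge_map_cases)
  ultimately show ?thesis by simp
qed

text \<open>
  The product of the maps of the edges of a finite cut, suitably oriented, has the lift
  \<^term>\<open>cut_fun A\<close>; so the winding numbers along the cut add up to a coboundary.
\<close>

lemma cut_sum_edge_winding:
  assumes p: "pathin (freudenthal G) p" and A: "finite (cut A)"
  shows "cut_sum (\<lambda>e. edge_winding e p) A = cut_fun A (p 1) - cut_fun A (p 0)"
proof -
  have "\<forall>e\<in>cut A. \<exists>g. continuous_on {0..1} g \<and> (\<forall>t\<in>{0..1}. edge_map G e (p t) = cis (2 * pi * g t)) \<and>
    edge_winding e p = g 1 - g 0"
    using edge_lift[OF p] unfolding cut_def by (metis (no_types, lifting) mem_Collect_eq)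
  from bchoice[OF this] obtain g where g: "\<And>e. e \<in> cut A \<Longrightarrow> continuous_on {0..1} (g e)"
    "\<And>e t. e \<in> cut A \<Longrightarrow> t \<in> {0..1} \<Longrightarrow> edge_map G e (p t) = cis (2 * pi * g e t)"
    "\<And>e. e \<in> cut A \<Longrightarrow> edge_winding e p = g e 1 - g e 0" by blast
  define K where "K t = (\<Sum>e\<in>cut A. if head G e \<in> A then g e t else - g e t)" for t
  have "K 1 - K 0 = cut_fun A (p 1) - cut_fun A (p 0)"
  proof (rule cis_lift_unique[of "{0..1}"])
    have "continuous_on {0..1} (\<lambda>t. if head G e \<in> A then g e t else - g e t)" if "e \<in> cut A" for e
      using g(1)[OF that] by (cases "head G e \<in> A") (auto intro: continuous_on_minus)
    then show "continuous_on {0..1} K" unfolding K_def by (intro continuous_on_sum)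
    show "continuous_on {0..1} (\<lambda>t. cut_fun A (p t))"
      using continuous_map_compose[OF p[unfolded pathin_def] continuous_cut_fun[OF A]]
      by (simp add: comp_def)
    fix t :: real assume t: "t \<in> {0..1}"
    have pt: "p t \<in> topspace (freudenthal G)"
      using continuous_map_image_subset_topspace[OF p[unfolded pathin_def]] t by auto
    have prod_cis: "(\<Prod>e\<in>B. cis (x e)) = cis (\<Sum>e\<in>B. x e)" for B :: "'e set" and x
      by (induction B rule: infinite_finite_induct) (simp_all add: cis_mult)
    have "cis (2 * pi * K t) = (\<Prod>e\<in>cut A. cis (if head G e \<in> A then 2 * pi * g e t else - (2 * pi * g e t)))"
      unfolding prod_cis K_def sum_distrib_left by (intro arg_cong[of _ _ cis] sum.cong) auto
    also have "\<dots> = (\<Prod>e\<in>cut A. if head G e \<in> A then edge_map G e (p t) else inverse (edge_map G e (p t)))"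
      by (intro prod.cong) (auto simp: g(2)[OF _ t] cis_inverse)
    finally show "cis (2 * pi * K t) = cis (2 * pi * cut_fun A (p t))"
      using cut_fun_circle[OF A pt] by simp
  qed auto
  moreover have "cut_sum (\<lambda>e. edge_winding e p) A = K 1 - K 0"
    unfolding cut_sum_def K_def sum_subtractf[symmetric] using g(3) by (intro sum.cong) auto
  ultimately show ?thesis by simp
qed

lemma balanced_loop:
  assumes "pathin (freudenthal G) p" "p 0 = p 1" shows "balanced (\<lambda>e. edge_winding e p)"
  unfolding balanced_def using cut_sum_edge_winding[OF assms(1)] assms(2) by simp

text \<open>Interchanging the sums over the cut and over the simplices leaves the coboundary of
  \<open>cut_fun A\<close>, which vanishes on cycles.\<close>

lemma balanced_cycle:
  assumes z: "singular_relcycle 1 (freudenthal G) {} z"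
  shows "balanced (\<lambda>e. frag_eval (simplex_edge_winding e) z)"
  unfolding balanced_def
proof (intro allI impI)
  fix A assume A: "A \<subseteq> verts G" "finite (cut A)"
  let ?K = "Poly_Mapping.keys z" and ?l = "\<lambda>\<tau>. real_of_int (Poly_Mapping.lookup z \<tau>)"
  have "cut_sum (\<lambda>e. frag_eval (simplex_edge_winding e) z) A =
      (\<Sum>e\<in>cut A. \<Sum>\<tau>\<in>?K. ?l \<tau> * (if head G e \<in> A then simplex_edge_winding e \<tau> else - simplex_edge_winding e \<tau>))"
    unfolding cut_sum_def frag_eval_def sum_negf[symmetric] by (intro sum.cong) (auto simp: sum_negf)
  also have "\<dots> = (\<Sum>\<tau>\<in>?K. \<Sum>e\<in>cut A. ?l \<tau> * (if head G e \<in> A then simplex_edge_winding e \<tau> else - simplex_edge_winding e \<tau>))"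
    by (rule sum.swap)
  also have "\<dots> = frag_eval (\<lambda>\<tau>. cut_sum (\<lambda>e. simplex_edge_winding e \<tau>) A) z"
    unfolding frag_eval_def cut_sum_def sum_distrib_left ..
  also have "\<dots> = frag_eval (\<lambda>\<tau>. cut_fun A (simplex_path \<tau> 1) - cut_fun A (simplex_path \<tau> 0)) z"
  proof (rule frag_eval_cong)
    fix \<tau> assume "\<tau> \<in> ?K"
    then have "singular_simplex 1 (freudenthal G) \<tau>" using z by (auto simp: singular_cycle singular_chain_def)
    from cut_sum_edge_winding[OF pathin_simplex_path[OF this] A(2)]
    show "cut_sum (\<lambda>e. simplex_edge_winding e \<tau>) A = cut_fun A (simplex_path \<tau> 1) - cut_fun A (simplex_path \<tau> 0)"
      by (simp add: simplex_edge_winding_def)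
  qed
  also have "\<dots> = 0"
    unfolding frag_eval_coboundary using z by (simp add: singular_cycle)
  finally show "cut_sum (\<lambda>e. frag_eval (simplex_edge_winding e) z) A = 0" .
qed

section \<open>Oriented circuits\<close>

text \<open>The distance from \<open>v\<close> along its edges, cut off at 1. Being 1 outside the
  open star makes it constant near every end; the tests for \<open>graph_points\<close> give the
  value 1 to \<open>Inner\<close> points that are not in the graph.\<close>

definition star_dist :: "'v \<Rightarrow> ('v,'e) point \<Rightarrow> real" where
  "star_dist v p = (case p of Vertex u \<Rightarrow> if u = v then 0 else 1
     | Inner e t \<Rightarrow> if p \<in> graph_points G \<and> tail G e = v then t
         else if p \<in> graph_points G \<and> head G e = v then 1 - t else 1
     | End \<omega> \<Rightarrow> 1)"

lemma star_dist_theta: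
  assumes "e \<in> arcs G" "t \<in> {0..1}"
  shows "star_dist v (theta G e t) = (if tail G e = v then t else if head G e = v then 1 - t else 1)"
  using assms(2) by (rule theta_cases) (use no_loops[OF assms(1)] assms(1) in \<open>auto simp: star_dist_def\<close>)

lemma continuous_star_dist:
  assumes v: "v \<in> verts G"
  shows "continuous_map (freudenthal G) euclideanreal (star_dist v)"
proof (rule continuous_map_freudenthal_compact[where c = 1])
  let ?S = "insert v {w. \<exists>e. joins e v w}"
  show "finite ?S" using finite_joined by simp
  show "?S \<subseteq> verts G" using v joins_verts by auto
  fix p assume p: "p \<notin> Vertex ` ?S" "\<And>e. e \<in> arcs G \<Longrightarrow> tail G e \<in> ?S \<Longrightarrow> head G e \<in> ?S \<Longrightarrow> p \<notin> open_edge G e"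
  have joined: "tail G e = v \<Longrightarrow> head G e \<in> ?S" "head G e = v \<Longrightarrow> tail G e \<in> ?S" if "e \<in> arcs G" for e
    using that by (auto simp: joins_def)
  show "star_dist v p = 1"
  proof (cases p)
    case (Inner e t)
    then show ?thesis using p(2)[of e] joined[of e] by (auto simp: star_dist_def)
  qed (use p(1) in \<open>auto simp: star_dist_def\<close>)
next
  fix e assume e: "e \<in> arcs G"
  have "continuous_on {0..1} (\<lambda>t. if tail G e = v then t else if head G e = v then 1 - t else (1::real))"
    by (cases "tail G e = v"; cases "head G e = v") (auto intro!: continuous_intros)
  then show "continuous_map (top_of_set {0..1}) euclideanreal (\<lambda>t. star_dist v (theta G e t))"
    unfolding continuous_map_iff_continuous by (rule continuous_on_eq) (simp add: star_dist_theta[OF e])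
qed simp

lemma star_dist_0: "p \<in> topspace (freudenthal G) \<Longrightarrow> star_dist v p = 0 \<longleftrightarrow> p = Vertex v"
  by (cases p) (auto simp: star_dist_def topspace_freudenthal split: if_splits)

lemma circle_periodic:
  assumes \<alpha>: "pathin (freudenthal G) \<alpha>" "\<alpha> 0 = \<alpha> 1" and k: "continuous_map (freudenthal G) euclidean k"
  shows "continuous_on UNIV (\<lambda>r. k (\<alpha> (frac r)))"
proof -
  have "continuous_on {0..1} (\<lambda>t. k (\<alpha> t))"
    using continuous_map_compose[OF \<alpha>(1)[unfolded pathin_def] k] by (simp add: comp_def)
  from periodic_continuous[OF this] show ?thesis using \<alpha>(2) by simp
qed

lemma frac_01: "frac r \<in> {0..1::real}"
  using frac_ge_0[of r] frac_lt_1[of r] by simp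

text \<open>Traversal is read cyclically, so the closed path is unrolled to the whole line. Its lift
  is not periodic, but grows by the winding number in every period.\<close>

lemma circle_lift_line:
  assumes \<alpha>: "pathin (freudenthal G) \<alpha>" "\<alpha> 0 = \<alpha> 1" and e: "e \<in> arcs G"
  obtains g where "continuous_on UNIV g" "\<And>r. edge_map G e (\<alpha> (frac r)) = cis (2 * pi * g r)"
    "\<And>r. g (r + 1) = g r + edge_winding e \<alpha>"
proof -
  have c: "continuous_map (freudenthal G) euclidean (edge_map G e)"
    using continuous_edge_map[OF e] by (simp add: continuous_map_in_subtopology)
  have cont: "continuous_on UNIV (\<lambda>r. edge_map G e (\<alpha> (frac r)))" by (rule circle_periodic[OF \<alpha> c])
  have "\<alpha> (frac r) \<in> topspace (freudenthal G)" for r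
    using continuous_map_image_subset_topspace[OF \<alpha>(1)[unfolded pathin_def]] frac_01[of r] by auto
  moreover have "edge_map G e ` topspace (freudenthal G) \<subseteq> sphere 0 1"
    using continuous_map_image_subset_topspace[OF continuous_edge_map[OF e]] by simp
  ultimately have "edge_map G e (\<alpha> (frac r)) \<in> sphere 0 1" for r by blast
  then have "(\<lambda>r. edge_map G e (\<alpha> (frac r))) ` UNIV \<subseteq> sphere 0 1" by blast
  from circle_lift[OF cont convex_UNIV this] obtain g where g: "continuous_on UNIV g" "\<And>r. edge_map G e (\<alpha> (frac r)) = cis (2 * pi * g r)"
    by (auto intro: that)
  have w: "edge_winding e \<alpha> = g 1 - g 0"
    unfolding edge_winding_def
  proof (rule windingI)
    show "continuous_on {0..1} g" using g(1) continuous_on_subset by blast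
    fix t :: real assume t: "t \<in> {0..1}"
    have "\<alpha> t = \<alpha> (frac t)"
    proof (cases "t = 1")
      case False
      then have "frac t = t" using t by (simp add: frac_eq)
      then show ?thesis by simp
    qed (use \<alpha>(2) in simp)
    then show "edge_map G e (\<alpha> t) = cis (2 * pi * g t)" using g(2)[of t] by simp
  qed
  have "g (r + 1) - g (0 + 1) = g r - g 0" for r
  proof (rule cis_lift_unique[of UNIV "\<lambda>r. g (r + 1)" g])
    show "continuous_on UNIV (\<lambda>r. g (r + 1))"
      by (rule continuous_on_compose2[OF g(1)]) (auto intro!: continuous_intros)
    fix t show "cis (2 * pi * g (t + 1)) = cis (2 * pi * g t)"
      using g(2)[of t] g(2)[of "t + 1"] by (simp add: frac_1_eq)
  qed (use g(1) in auto)
  then have "g (r + 1) - g 1 = g r - g 0" for r by simp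
  then have "g (r + 1) = g r + edge_winding e \<alpha>" for r
    unfolding w by (metis add.commute add_diff_eq diff_add_cancel)
  with g show thesis by (rule that)
qed

lemma edge_map_eq_1_iff: "edge_map G e p = 1 \<longleftrightarrow> p \<notin> open_edge G e"
proof
  assume 1: "edge_map G e p = 1"
  show "p \<notin> open_edge G e"
  proof
    assume "p \<in> open_edge G e"
    then obtain t where t: "p = Inner e t" "0 < t" "t < 1" by (auto simp: open_edge_eq)
    then have "cis (2 * pi * t) = 1" using 1 by (simp add: edge_map_cases)
    then have "t \<in> \<int>" by (rule cis_eq_1_imp_Ints)
    then show False using t by (auto elim!: Ints_cases)
  qed
qed (rule edge_map_outside)

lemma open_edge_star_dist:
  assumes "p \<in> open_edge G e" "e \<in> arcs G"
  shows "p = Inner e (star_dist (tail G e) p)" "0 < star_dist (tail G e) p" "star_dist (tail G e) p < 1"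
    "star_dist (head G e) p = 1 - star_dist (tail G e) p"
    "edge_map G e p = cis (2 * pi * star_dist (tail G e) p)"
  using assms no_loops[OF assms(2)] by (auto simp: open_edge_eq star_dist_def edge_map_cases)

text \<open>During the traversal the distance from the tail is itself a lift. In the rest of the
  period the circle is injective and so cannot return to the open edge; there the lift is
  constant.\<close>

lemma traverses_winding:
  assumes \<alpha>: "is_circle G \<alpha>" and e: "e \<in> arcs G" and tr: "traverses G \<alpha> (e, u, v)"
  shows "edge_winding e \<alpha> = star_dist (tail G e) (Vertex v) - star_dist (tail G e) (Vertex u)"
proof -
  have circ: "pathin (freudenthal G) \<alpha>" "\<alpha> 0 = \<alpha> 1" "inj_on \<alpha> {0..<1}" using \<alpha> by (auto simp: is_circle_def)
  obtain s t where st: "s < t" "t \<le> s + 1" "\<alpha> (frac s) = Vertex u" "\<alpha> (frac t) = Vertex v"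
    and img: "(\<lambda>r. \<alpha> (frac r)) ` {s<..<t} = open_edge G e"
    using tr unfolding traverses_def by auto
  obtain g where g: "continuous_on UNIV g" "\<And>r. edge_map G e (\<alpha> (frac r)) = cis (2 * pi * g r)"
    "\<And>r. g (r + 1) = g r + edge_winding e \<alpha>" using circle_lift_line[OF circ(1,2) e] by blast
  have outside: "\<alpha> (frac r) \<notin> open_edge G e" if r: "t \<le> r" "r \<le> s + 1" for r
  proof
    assume "\<alpha> (frac r) \<in> open_edge G e"
    then obtain r' where r': "s < r'" "r' < t" "\<alpha> (frac r) = \<alpha> (frac r')" unfolding img[symmetric] by auto
    have "frac r = frac r'"
      by (rule inj_onD[OF circ(3) r'(3)]) (auto simp: frac_lt_1)
    then have "r - r' \<in> \<int>" by (simp add: frac_def algebra_simps) (metis Ints_of_int Ints_diff add_diff_cancel_left' diff_add_eq add.commute)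
    moreover have "0 < r - r'" "r - r' < 1" using r r' by auto
    ultimately show False by (auto elim!: Ints_cases)
  qed
  let ?h = "\<lambda>r. star_dist (tail G e) (\<alpha> (frac r))"
  have tv: "tail G e \<in> verts G" using e by simp
  have 1: "g t - g s = ?h t - ?h s"
  proof (rule cis_lift_unique[of "{s..t}"])
    show "continuous_on {s..t} g" using g(1) continuous_on_subset by blast
    show "continuous_on {s..t} ?h"
      using circle_periodic[OF circ(1,2) continuous_star_dist[OF tv]] continuous_on_subset by blast
    fix r assume r: "r \<in> {s..t}"
    have int: "star_dist (tail G e) (Vertex x) \<in> \<int>" for x by (simp add: star_dist_def)
    consider "r = s" | "r = t" | "\<alpha> (frac r) \<in> open_edge G e" using r unfolding img[symmetric] by force
    then show "cis (2 * pi * g r) = cis (2 * pi * ?h r)"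
    proof cases
      case 1
      then show ?thesis using g(2)[of s] st(3) cis_multiple_2pi[OF int[of u]] by (simp add: edge_map_cases)
    next
      case 2
      then show ?thesis using g(2)[of t] st(4) cis_multiple_2pi[OF int[of v]] by (simp add: edge_map_cases)
    next
      case 3
      then show ?thesis using open_edge_star_dist(5)[OF 3 e] g(2)[of r] by simp
    qed
  qed (use st in auto)
  have 2: "g (s + 1) - g t = 0 - 0"
  proof (rule cis_lift_unique[of "{t..s + 1}" g "\<lambda>_. 0"])
    show "continuous_on {t..s + 1} g" using g(1) continuous_on_subset by blast
    fix r assume "r \<in> {t..s + 1}"
    then have "edge_map G e (\<alpha> (frac r)) = 1" using outside[of r] by (simp add: edge_map_outside)
    then show "cis (2 * pi * g r) = cis (2 * pi * 0)" using g(2)[of r] by simp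
  qed (use st in auto)
  show ?thesis using 1 2 g(3)[of s] st(3,4) by simp
qed

text \<open>A nonzero integral winding forces the lift \<open>g\<close> through an interval between
  consecutive integers. While \<open>g\<close> is strictly inside it, the point lies on the open
  edge, at distance \<open>g\<close> minus an integer from the tail; by continuity the interval
  begins and ends at the vertices.\<close>

lemma winding_traverses:
  assumes \<alpha>: "is_circle G \<alpha>" and e: "e \<in> arcs G" and w: "edge_winding e \<alpha> \<noteq> 0"
  shows "traverses G \<alpha> (natural_orientation G e) \<or> traverses G \<alpha> (reverse (natural_orientation G e))"
proof -
  have circ: "pathin (freudenthal G) \<alpha>" "\<alpha> 0 = \<alpha> 1" "inj_on \<alpha> {0..<1}" using \<alpha> by (auto simp: is_circle_def)
  obtain g where g: "continuous_on UNIV g" "\<And>r. edge_map G e (\<alpha> (frac r)) = cis (2 * pi * g r)"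
    "\<And>r. g (r + 1) = g r + edge_winding e \<alpha>" using circle_lift_line[OF circ(1,2) e] by blast
  have "cis (2 * pi * g (0 + 1)) = cis (2 * pi * g 0)"
    using g(2)[of 0] g(2)[of 1] by simp
  then have "edge_winding e \<alpha> \<in> \<int>" unfolding cis_eq_iff_Ints g(3) by simp
  then have w1: "\<bar>edge_winding e \<alpha>\<bar> \<ge> 1" using w Ints_nonzero_abs_ge1 by blast
  let ?h = "\<lambda>r. star_dist (tail G e) (\<alpha> (frac r))"
  let ?h' = "\<lambda>r. star_dist (head G e) (\<alpha> (frac r))"
  have hc: "continuous_on UNIV ?h" "continuous_on UNIV ?h'"
    by (rule circle_periodic[OF circ(1,2) continuous_star_dist], use e in simp)+
  have top: "\<alpha> (frac r) \<in> topspace (freudenthal G)" for r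
    using continuous_map_image_subset_topspace[OF circ(1)[unfolded pathin_def]] frac_01[of r] by auto
  have main: "traverses G \<alpha> (e, u, v)"
    if st: "s < t" "t \<le> s + 1" and M: "\<And>r. s < r \<Longrightarrow> r < t \<Longrightarrow> of_int M < g r \<and> g r < of_int M + 1"
      and ends: "g s = of_int M \<and> g t = of_int M + 1 \<and> u = tail G e \<and> v = head G e \<or>
        g s = of_int M + 1 \<and> g t = of_int M \<and> u = head G e \<and> v = tail G e" for s t M u v
  proof -
    have inside: "\<alpha> (frac r) \<in> open_edge G e" if r: "s < r" "r < t" for r
    proof -
      have "g r \<notin> \<int>" using M[OF r] by (auto elim!: Ints_cases)
      then have "edge_map G e (\<alpha> (frac r)) \<noteq> 1" using g(2)[of r] cis_eq_1_imp_Ints by metis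
      then show ?thesis by (simp add: edge_map_eq_1_iff)
    qed
    have hg: "?h r = g r - of_int M" if r: "s < r" "r < t" for r
    proof -
      note o = open_edge_star_dist[OF inside[OF r] e]
      have "g r - ?h r \<in> \<int>" using o(5) g(2)[of r] by (simp flip: cis_eq_iff_Ints)
      then have "g r - ?h r - of_int M \<in> \<int>" by simp
      moreover have "\<bar>g r - ?h r - of_int M\<bar> < 1" using M[OF r] o(2,3) by linarith
      ultimately show ?thesis using Ints_nonzero_abs_less1 by fastforce
    qed
    have cl: "closure {s<..<t} = {s..t}" using st(1) by simp
    have hcl: "?h r = g r - of_int M" if r: "r \<in> {s..t}" for r
    proof -
      have "?h r - g r = - of_int M"
      proof (rule continuous_constant_on_closure[of "{s<..<t}" "\<lambda>r. ?h r - g r"])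
        show "continuous_on (closure {s<..<t}) (\<lambda>r. ?h r - g r)"
          using hc(1) g(1) by (intro continuous_on_diff) (auto intro: continuous_on_subset)
      qed (use hg r cl in auto)
      then show ?thesis by simp
    qed
    \<comment> \<open>Distance 1 from the tail does not determine a point, but distance 0 from the
      head does; so the head needs its own distance function.\<close>
    have h'cl: "?h' r = 1 - (g r - of_int M)" if r: "r \<in> {s..t}" for r
    proof -
      have "?h' r + g r = 1 + of_int M"
      proof (rule continuous_constant_on_closure[of "{s<..<t}" "\<lambda>r. ?h' r + g r"])
        show "continuous_on (closure {s<..<t}) (\<lambda>r. ?h' r + g r)"
          using hc(2) g(1) by (intro continuous_on_add) (auto intro: continuous_on_subset)
        show "?h' r + g r = 1 + of_int M" if "r \<in> {s<..<t}" for r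
          using open_edge_star_dist(4)[OF inside e, of r] hg[of r] that by simp
      qed (use r cl in auto)
      then show ?thesis by simp
    qed
    have "\<alpha> (frac s) = Vertex u \<and> \<alpha> (frac t) = Vertex v"
      using ends hcl[of s] hcl[of t] h'cl[of s] h'cl[of t] st(1) star_dist_0[OF top] by auto
    moreover have "(\<lambda>r. \<alpha> (frac r)) ` {s<..<t} = open_edge G e"
    proof
      show "(\<lambda>r. \<alpha> (frac r)) ` {s<..<t} \<subseteq> open_edge G e" using inside by auto
      show "open_edge G e \<subseteq> (\<lambda>r. \<alpha> (frac r)) ` {s<..<t}"
      proof
        fix p assume "p \<in> open_edge G e"
        then obtain x where x: "p = Inner e x" "0 < x" "x < 1" by (auto simp: open_edge_eq)
        have cont: "continuous_on {s..t} ?h" using hc(1) continuous_on_subset by blast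
        have "\<exists>r. s \<le> r \<and> r \<le> t \<and> ?h r = x"
          using ends hcl[of s] hcl[of t] st(1) x IVT'[of ?h s x t] IVT2'[of ?h t x s] cont by force
        then obtain r where r: "s \<le> r" "r \<le> t" "?h r = x" by blast
        have "r \<noteq> s" "r \<noteq> t" using r ends hcl[of s] hcl[of t] x st(1) by auto
        then have r': "s < r" "r < t" using r by auto
        have "\<alpha> (frac r) = p" using open_edge_star_dist(1)[OF inside[OF r'] e] r(3) x(1) by simp
        then show "p \<in> (\<lambda>r. \<alpha> (frac r)) ` {s<..<t}" using r' by force
      qed
    qed
    moreover have "(e, u, v) \<in> oriented_edges G"
      using ends e by (auto simp: oriented_edges_def natural_orientation_def reverse_def image_iff)
    ultimately show ?thesis unfolding traverses_def using st by auto
  qed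
  show ?thesis
  proof (cases "edge_winding e \<alpha> \<ge> 1")
    case True
    from integer_crossing[OF g(1,3) True] obtain s t and M :: int where
      "s < t" "t \<le> s + 1" "g s = of_int M" "g t = of_int M + 1"
      "\<And>r. s < r \<Longrightarrow> r < t \<Longrightarrow> of_int M < g r \<and> g r < of_int M + 1" by metis
    from main[OF this(1,2,5), of "tail G e" "head G e"] this(3,4)
    show ?thesis by (simp add: natural_orientation_def)
  next
    case False
    have "\<exists>s t M. s < t \<and> t \<le> s + 1 \<and> - g s = of_int M \<and> - g t = of_int M + 1 \<and>
      (\<forall>r. s < r \<longrightarrow> r < t \<longrightarrow> of_int M < - g r \<and> - g r < of_int M + 1)"
      by (rule integer_crossing[of "\<lambda>r. - g r" "- edge_winding e \<alpha>"])
        (use g(1,3) w1 False in \<open>auto intro: continuous_on_minus\<close>)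
    then obtain s t and M :: int where *: "s < t" "t \<le> s + 1" "- g s = of_int M" "- g t = of_int M + 1"
      "\<And>r. s < r \<Longrightarrow> r < t \<Longrightarrow> of_int M < - g r \<and> - g r < of_int M + 1" by blast
    \<comment> \<open>The crossing was found for the negated lift, so \<open>g\<close> itself falls
      from \<open>- M\<close> to \<open>- M - 1\<close>.\<close>
    have "of_int (- M - 1) < g r \<and> g r < of_int (- M - 1) + 1" if "s < r" "r < t" for r
      using *(5)[OF that] by simp
    from main[OF *(1,2) this, of "head G e" "tail G e"] *(3,4)
    show ?thesis unfolding reverse_natural by simp
  qed
qed

text \<open>Traversal in the two directions would force the windings 1 and -1. So no circle does
  both, and the case distinction in \<open>oriented_circuit\<close> is antisymmetric.\<close>

lemma oriented_circuit_winding: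
  assumes \<alpha>: "is_circle G \<alpha>" and e: "e \<in> arcs G"
  shows "of_int (oriented_circuit G \<alpha> (natural_orientation G e)) = edge_winding e \<alpha>"
    "oriented_circuit G \<alpha> (reverse (natural_orientation G e)) = - oriented_circuit G \<alpha> (natural_orientation G e)"
proof -
  let ?n = "natural_orientation G e"
  have n: "traverses G \<alpha> ?n \<Longrightarrow> edge_winding e \<alpha> = 1"
    using traverses_winding[OF \<alpha> e, of "tail G e" "head G e"] no_loops[OF e]
    by (simp add: natural_orientation_def star_dist_def)
  have r: "traverses G \<alpha> (reverse ?n) \<Longrightarrow> edge_winding e \<alpha> = - 1"
    using traverses_winding[OF \<alpha> e, of "head G e" "tail G e"] no_loops[OF e]
    by (simp add: reverse_natural star_dist_def)
  have rr: "reverse (reverse ?n) = ?n" by (simp add: reverse_def natural_orientation_def)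
  show "of_int (oriented_circuit G \<alpha> ?n) = edge_winding e \<alpha>"
    unfolding oriented_circuit_def using n r winding_traverses[OF \<alpha> e] by auto
  show "oriented_circuit G \<alpha> (reverse ?n) = - oriented_circuit G \<alpha> ?n"
    unfolding oriented_circuit_def rr using n r by auto
qed

end

section \<open>Concatenation of paths\<close>

definition pjoin :: "(real \<Rightarrow> 'a) \<Rightarrow> (real \<Rightarrow> 'a) \<Rightarrow> real \<Rightarrow> 'a" where
  "pjoin p q t = (if t \<le> 1/2 then p (2 * t) else q (2 * t - 1))"

text \<open>Without an entry there is no base point, so the empty list has no sensible
  value.\<close>

fun cat :: "(real \<Rightarrow> 'a) list \<Rightarrow> real \<Rightarrow> 'a" where
  "cat [] = undefined"
| "cat [p] = p"
| "cat (p # q # ps) = pjoin p (cat (q # ps))"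

lemma pjoin_ends [simp]: "pjoin p q 0 = p 0" "pjoin p q 1 = q 1"
  by (simp_all add: pjoin_def)

lemma pathin_pjoin:
  assumes p: "pathin X p" and q: "pathin X q" and pq: "p 1 = q 0"
  shows "pathin X (pjoin p q)"
  unfolding pathin_def pjoin_def
proof (rule continuous_map_cases_le)
  show "continuous_map (subtopology (top_of_set {0..1}) {x \<in> topspace (top_of_set {0..1}). x \<le> 1/2}) X (\<lambda>x. p (2 * x))"
  proof -
    have "continuous_map (subtopology (top_of_set {0..1}) {x \<in> topspace (top_of_set {0..1}). x \<le> 1/2}) (top_of_set {0..1}) (\<lambda>x. 2 * x :: real)"
      by (auto simp: continuous_map_in_subtopology intro!: continuous_map_from_subtopology continuous_intros)
    from continuous_map_compose[OF this p[unfolded pathin_def]] show ?thesis by (simp add: comp_def)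
  qed
  show "continuous_map (subtopology (top_of_set {0..1}) {x \<in> topspace (top_of_set {0..1}). 1/2 \<le> x}) X (\<lambda>x. q (2 * x - 1))"
  proof -
    have "continuous_map (subtopology (top_of_set {0..1}) {x \<in> topspace (top_of_set {0..1}). 1/2 \<le> x}) (top_of_set {0..1}) (\<lambda>x. 2 * x - 1 :: real)"
      by (auto simp: continuous_map_in_subtopology intro!: continuous_map_from_subtopology continuous_intros)
    from continuous_map_compose[OF this q[unfolded pathin_def]] show ?thesis by (simp add: comp_def)
  qed
  show "p (2 * x) = q (2 * x - 1)" if "x = 1/2" for x unfolding that using pq by simp
qed auto

text \<open>Which part is active at a time, and the local time there, do not depend on the paths.
  Together with its extension \<open>cat_cases\<close> this allows one time to be followed through
  all approximations of a loop at once.\<close>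

lemma pjoin_cases_uniform:
  assumes "t \<in> {0..1}"
  shows "(\<exists>s\<in>{0..1}. \<forall>p q :: real \<Rightarrow> 'a. pjoin p q t = p s) \<or> (\<exists>s\<in>{0..1}. \<forall>p q :: real \<Rightarrow> 'a. pjoin p q t = q s)"
proof (cases "t \<le> 1/2")
  case True
  then show ?thesis using assms by (intro disjI1 bexI[of _ "2 * t"]) (auto simp: pjoin_def)
next
  case False
  then show ?thesis using assms by (intro disjI2 bexI[of _ "2 * t - 1"]) (auto simp: pjoin_def)
qed

lemma pjoin_cases:
  assumes "t \<in> {0..1}"
  obtains s where "s \<in> {0..1}" "pjoin p q t = p s" | s where "s \<in> {0..1}" "pjoin p q t = q s"
proof (cases "t \<le> 1/2")
  case True
  show thesis by (rule that(1)[of "2 * t"]) (use True assms in \<open>auto simp: pjoin_def\<close>)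
next
  case False
  show thesis by (rule that(2)[of "2 * t - 1"]) (use False assms in \<open>auto simp: pjoin_def\<close>)
qed

lemma cat_cases:
  assumes "t \<in> {0..1}" "m > 0"
  shows "\<exists>i s. i < m \<and> s \<in> {0..1} \<and> (\<forall>ps :: (real \<Rightarrow> 'a) list. length ps = m \<longrightarrow> cat ps t = (ps ! i) s)"
  using assms
proof (induction m arbitrary: t)
  case (Suc m)
  show ?case
  proof (cases "m = 0")
    case True
    have "cat ps t = (ps ! 0) t" if "length ps = Suc m" for ps :: "(real \<Rightarrow> 'a) list"
      using that True by (cases ps) auto
    then show ?thesis using Suc.prems(1) by blast
  next
    case False
    have rec: "cat ps = pjoin (ps ! 0) (cat (tl ps))" if "length ps = Suc m" for ps :: "(real \<Rightarrow> 'a) list"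
      using that False by (cases ps; cases "tl ps") auto
    have "(\<exists>s\<in>{0..1}. \<forall>p q :: real \<Rightarrow> 'a. pjoin p q t = p s) \<or> (\<exists>s\<in>{0..1}. \<forall>p q :: real \<Rightarrow> 'a. pjoin p q t = q s)"
      by (rule pjoin_cases_uniform[OF Suc.prems(1)])
    then show ?thesis
    proof
      assume "\<exists>s\<in>{0..1}. \<forall>p q :: real \<Rightarrow> 'a. pjoin p q t = p s"
      then obtain s where s: "s \<in> {0..1}" "\<forall>p q :: real \<Rightarrow> 'a. pjoin p q t = p s" by blast
      have "cat ps t = (ps ! 0) s" if "length ps = Suc m" for ps :: "(real \<Rightarrow> 'a) list"
        using rec[OF that] s(2) by simp
      then show ?thesis using s(1) by blast
    next
      assume "\<exists>s\<in>{0..1}. \<forall>p q :: real \<Rightarrow> 'a. pjoin p q t = q s"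
      then obtain s where s: "s \<in> {0..1}" "\<forall>p q :: real \<Rightarrow> 'a. pjoin p q t = q s" by blast
      obtain i s' where i: "i < m" "s' \<in> {0..1}" "\<forall>ps :: (real \<Rightarrow> 'a) list. length ps = m \<longrightarrow> cat ps s = (ps ! i) s'"
        using Suc.IH[OF s(1)] False by blast
      have "cat ps t = (ps ! Suc i) s'" if "length ps = Suc m" for ps :: "(real \<Rightarrow> 'a) list"
        using rec[OF that] s(2) i(3)[rule_format, of "tl ps"] that i(1) by (simp add: nth_tl)
      then show ?thesis using i(1,2) Suc_mono by blast
    qed
  qed
qed simp

lemma cat_closed:
  assumes "ps \<noteq> []" "\<And>p. p \<in> set ps \<Longrightarrow> pathin X p \<and> p 0 = a \<and> p 1 = a"
  shows "pathin X (cat ps) \<and> cat ps 0 = a \<and> cat ps 1 = a"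
  using assms by (induction ps rule: cat.induct) (auto intro!: pathin_pjoin)

lemma cat_ends:
  assumes "ps \<noteq> []" "\<And>p. p \<in> set ps \<Longrightarrow> p 0 = a \<and> p 1 = a"
  shows "cat ps 0 = a \<and> cat ps 1 = a"
  using assms by (induction ps rule: cat.induct) auto

lemma pathin_reverse:
  assumes "pathin X p" shows "pathin X (\<lambda>t. p (1 - t))"
proof -
  have "continuous_map (top_of_set {0..1}) (top_of_set {0..1}) (\<lambda>t. 1 - t :: real)"
    by (auto simp: continuous_map_in_subtopology intro!: continuous_intros)
  from continuous_map_compose[OF this assms[unfolded pathin_def]] show ?thesis by (simp add: pathin_def comp_def)
qed

text \<open>\<open>J\<close> is the closed or the half-open unit interval; in the latter case the
  end of \<open>q\<close> may return to the start of \<open>p\<close>, as in a circle. The parameter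
  0 of \<open>q\<close> is exempt in the last assumption because it is the junction.\<close>

lemma inj_on_pjoin:
  assumes p: "inj_on p {0..1}" and q: "inj_on q J" "J \<subseteq> {0..1}" and S: "S \<subseteq> {0..1}" "\<And>t. t \<in> S \<Longrightarrow> t > 1/2 \<Longrightarrow> 2 * t - 1 \<in> J"
    and dis: "\<And>s t. s \<in> {0..1} \<Longrightarrow> t \<in> J \<Longrightarrow> t > 0 \<Longrightarrow> p s \<noteq> q t"
  shows "inj_on (pjoin p q) S"
proof (rule inj_onI)
  have aux: False if "s \<in> S" "t \<in> S" "pjoin p q s = pjoin p q t" "s \<le> 1/2" "\<not> t \<le> 1/2" for s t
    using dis[of "2 * s" "2 * t - 1"] S that by (auto simp: pjoin_def)
  fix s t assume st: "s \<in> S" "t \<in> S" "pjoin p q s = pjoin p q t"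
  consider "s \<le> 1/2" "t \<le> 1/2" | "\<not> s \<le> 1/2" "\<not> t \<le> 1/2" using aux st by metis
  then show "s = t"
  proof cases
    case 1
    moreover have "s \<in> {0..1}" "t \<in> {0..1}" using st S(1) by blast+
    ultimately have "2 * s = 2 * t" using inj_onD[OF p, of "2 * s" "2 * t"] st S(1) by (auto simp: pjoin_def)
    then show ?thesis by simp
  next
    case 2
    then have "2 * s - 1 = 2 * t - 1" using inj_onD[OF q(1), of "2 * s - 1" "2 * t - 1"] st S(2) by (auto simp: pjoin_def)
    then show ?thesis by simp
  qed
qed

context lf_graph
begin

lemma edge_winding_pjoin:
  assumes "pathin (freudenthal G) p" "pathin (freudenthal G) q" "p 1 = q 0" "e \<in> arcs G"
  shows "edge_winding e (pjoin p q) = edge_winding e p + edge_winding e q"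
proof -
  obtain g where g: "continuous_on {0..1} g" "\<And>t. t \<in> {0..1} \<Longrightarrow> edge_map G e (pjoin p q t) = cis (2 * pi * g t)"
    "edge_winding e (pjoin p q) = g 1 - g 0"
    using edge_lift[OF pathin_pjoin[OF assms(1-3)] assms(4)] by blast
  have "edge_winding e p = edge_winding e (\<lambda>t. pjoin p q ((1 - t) * 0 + t * (1/2)))"
    by (rule edge_winding_cong) (auto simp: pjoin_def)
  also have "\<dots> = g (1/2) - g 0" by (rule edge_winding_affine[OF g(1,2)]) auto
  finally have 1: "edge_winding e p = g (1/2) - g 0" .
  have "edge_winding e q = edge_winding e (\<lambda>t. pjoin p q ((1 - t) * (1/2) + t * 1))"
  proof (rule edge_winding_cong)
    fix t :: real assume t: "t \<in> {0..1}"
    have eq: "(1 - t) * (1/2) + t * 1 = 1/2 + t/2" by (simp add: field_simps)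
    show "q t = pjoin p q ((1 - t) * (1/2) + t * 1)"
      unfolding eq using t assms(3) by (cases "t = 0") (auto simp: pjoin_def)
  qed
  also have "\<dots> = g 1 - g (1/2)" by (rule edge_winding_affine[OF g(1,2)]) auto
  finally show ?thesis using 1 g(3) by simp
qed

lemma edge_winding_cat:
  assumes "ps \<noteq> []" "\<And>p. p \<in> set ps \<Longrightarrow> pathin (freudenthal G) p \<and> p 0 = a \<and> p 1 = a" "e \<in> arcs G"
  shows "edge_winding e (cat ps) = sum_list (map (edge_winding e) ps)"
  using assms(1,2)
proof (induction ps rule: cat.induct)
  case (3 p q ps)
  have "edge_winding e (cat (p # q # ps)) = edge_winding e p + edge_winding e (cat (q # ps))"
    unfolding cat.simps
    by (rule edge_winding_pjoin[OF _ _ _ assms(3)])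
      (use 3(3)[of p] cat_closed[of "q # ps" "freudenthal G" a] 3(3) in auto)
  then show ?case using 3 by simp
qed auto

section \<open>Fundamental cycles\<close>

definition edge_path :: "'e \<Rightarrow> 'v \<Rightarrow> real \<Rightarrow> ('v,'e) point" where
  "edge_path e u t = (if tail G e = u then theta G e t else theta G e (1 - t))"

lemma pathin_edge_path: "e \<in> arcs G \<Longrightarrow> pathin (freudenthal G) (edge_path e u)"
  using continuous_theta[of e] pathin_reverse[of "freudenthal G" "theta G e"]
  unfolding edge_path_def pathin_def by (cases "tail G e = u") auto

lemma edge_path_ends:
  assumes "joins e u v" shows "edge_path e u 0 = Vertex u" "edge_path e u 1 = Vertex v"
  using assms joins_neq[OF assms] by (auto simp: edge_path_def joins_def)

lemma edge_path_inner:
  "0 < t \<Longrightarrow> t < 1 \<Longrightarrow> edge_path e u t = Inner e (if tail G e = u then t else 1 - t)"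
  by (simp add: edge_path_def)

lemma edge_path_cases:
  assumes "joins e u v" "t \<in> {0..1}"
  obtains "t = 0" "edge_path e u t = Vertex u" | "t = 1" "edge_path e u t = Vertex v"
  | "0 < t" "t < 1" "edge_path e u t \<in> open_edge G e"
  using assms(2)
proof (rule theta_cases)
  assume t: "0 < t" "t < 1"
  then have "edge_path e u t \<in> open_edge G e" by (simp add: edge_path_inner)
  with t show thesis by (rule that(3))
qed (use that edge_path_ends[OF assms(1)] in auto)

lemma inj_edge_path:
  assumes "joins e u v" shows "inj_on (edge_path e u) {0..1}"
proof (rule inj_onI)
  fix s t :: real assume st: "s \<in> {0..1}" "t \<in> {0..1}" "edge_path e u s = edge_path e u t"
  show "s = t"
    by (rule edge_path_cases[OF assms st(1)]; rule edge_path_cases[OF assms st(2)])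
      (use st(3) joins_neq[OF assms] in \<open>auto simp: edge_path_inner split: if_splits\<close>)
qed

lemma edge_winding_edge_path:
  assumes "joins e u v" shows "edge_winding e (edge_path e u) = (if tail G e = u then 1 else - 1)"
proof -
  have e: "e \<in> arcs G" using assms by (simp add: joins_def)
  have th: "edge_winding e (theta G e) = 1"
  proof -
    have "edge_winding e (theta G e) = (\<lambda>t. t) 1 - (\<lambda>t. t) 0"
      unfolding edge_winding_def
      by (rule windingI) (auto simp: edge_map_theta eta_cis)
    then show ?thesis by simp
  qed
  have "pathin (freudenthal G) (theta G e)" using continuous_theta[OF e] by (simp add: pathin_def)
  from edge_winding_reverse[OF this e] th show ?thesis
    by (cases "tail G e = u") (auto simp: edge_path_def[abs_def])
qed

lemma edge_winding_edge_path_other: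
  assumes "joins e' u v" "e \<noteq> e'" shows "edge_winding e (edge_path e' u) = 0"
proof (rule edge_winding_outside)
  fix t :: real assume "t \<in> {0..1}"
  then show "edge_path e' u t \<notin> open_edge G e"
    by (rule edge_path_cases[OF assms(1)]) (use assms(2) in \<open>auto simp: open_edge_eq\<close>)
qed

text \<open>Otherwise each of the two vertices would be the parent of the other, against their
  heights.\<close>

lemma tree_edge_inj:
  assumes "w \<in> verts G" "w \<noteq> root" "w' \<in> verts G" "w' \<noteq> root" "tree_edge w = tree_edge w'"
  shows "w = w'"
proof -
  have j: "joins (tree_edge w) (parent w) w" "joins (tree_edge w) (parent w') w'"
    using tree_edge assms by metis+
  have h: "height (parent w) < height w" "height (parent w') < height w'"
    using parent(2) assms by fastforce+
  from j consider "w = w'" | "parent w = w'" "w = parent w'" unfolding joins_def by metis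
  then show ?thesis
  proof cases
    case 2
    then have "height w < height w" using h less_trans[of "height w" "height w'" "height w"] by metis
    then show ?thesis by simp
  qed
qed

text \<open>\<open>descent n\<close> runs through \<open>n + 1\<close> tree edges; there is no
  descent of length 0.\<close>

primrec descent :: "nat \<Rightarrow> 'v \<Rightarrow> real \<Rightarrow> ('v,'e) point" where
  "descent 0 y = edge_path (tree_edge y) y"
| "descent (Suc n) y = pjoin (edge_path (tree_edge y) y) (descent n (parent y))"

text \<open>The tree path between \<open>x\<close> and \<open>y\<close>. Each vertex brings along
  the edge to its parent, except the lowest one, whose parent is outside.\<close>

definition tree_segment :: "'v \<Rightarrow> 'v \<Rightarrow> ('v,'e) point set" where
  "tree_segment x y = {p. \<exists>z. below x z \<and> below z y \<and> (p = Vertex z \<or> z \<noteq> x \<and> p \<in> open_edge G (tree_edge z))}"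

lemma descent:
  assumes "below x y" "height y = height x + Suc n"
  shows "pathin (freudenthal G) (descent n y)" "descent n y 0 = Vertex y" "descent n y 1 = Vertex x"
    "descent n y ` {0..1} \<subseteq> tree_segment x y" "inj_on (descent n y) {0..1}"
proof -
  have "pathin (freudenthal G) (descent n y) \<and> descent n y 0 = Vertex y \<and> descent n y 1 = Vertex x \<and>
    descent n y ` {0..1} \<subseteq> tree_segment x y \<and> inj_on (descent n y) {0..1}"
    using assms
  proof (induction n arbitrary: y)
    case (0 y)
    have yv: "y \<in> verts G" "y \<noteq> root" "x \<noteq> y" using 0 below_verts height_root by auto
    note p = parent[OF yv(1,2)] tree_edge[OF yv(1,2)]
    have "below x (parent y)" using below_parent(2)[OF 0(1) yv(3)] .
    then have px: "parent y = x" using below_same_height[of x "parent y"] 0(2) p(2) by simp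
    have j: "joins (tree_edge y) y x" using joins_sym[OF p(4)] px by simp
    have "edge_path (tree_edge y) y t \<in> tree_segment x y" if "t \<in> {0..1}" for t
      by (rule edge_path_cases[OF j that])
        (use 0(1) below_refl[OF yv(1)] below_refl[of x] below_verts[OF 0(1)] yv(3) in \<open>auto simp: tree_segment_def\<close>)
    then show ?case
      using pathin_edge_path[of "tree_edge y" y] j edge_path_ends[OF j] inj_edge_path[OF j] by (auto simp: joins_def)
  next
    case (Suc n y)
    have yv: "y \<in> verts G" "y \<noteq> root" "x \<noteq> y" using Suc.prems below_verts height_root by auto
    note p = parent[OF yv(1,2)] tree_edge[OF yv(1,2)]
    let ?p = "parent y"
    have xp: "below x ?p" using below_parent(2)[OF Suc.prems(1) yv(3)] .
    have hp: "height ?p = height x + Suc n" using Suc.prems(2) p(2) by simp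
    note IH = Suc.IH[OF xp hp]
    have j: "joins (tree_edge y) y ?p" using joins_sym[OF p(4)] .
    have path: "pathin (freudenthal G) (descent (Suc n) y)"
      unfolding descent.simps
      by (rule pathin_pjoin) (use IH edge_path_ends[OF j] pathin_edge_path[of "tree_edge y" y] j in \<open>auto simp: joins_def\<close>)
    have sub: "tree_segment x ?p \<subseteq> tree_segment x y"
      using below_trans[OF _ p(1)] by (auto simp: tree_segment_def)
    have e_in: "edge_path (tree_edge y) y t \<in> tree_segment x y" if "t \<in> {0..1}" for t
      by (rule edge_path_cases[OF j that])
        (use Suc.prems(1) below_refl[OF yv(1)] xp p(1) yv(3) in \<open>auto simp: tree_segment_def\<close>)
    have img: "descent (Suc n) y ` {0..1} \<subseteq> tree_segment x y"
    proof
      fix q assume "q \<in> descent (Suc n) y ` {0..1}"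
      then obtain t where t: "t \<in> {0..1}" "q = pjoin (edge_path (tree_edge y) y) (descent n ?p) t" by auto
      from t(1) show "q \<in> tree_segment x y"
      proof (rule pjoin_cases[of t "edge_path (tree_edge y) y" "descent n ?p"])
        fix s assume "s \<in> {0..1}" "pjoin (edge_path (tree_edge y) y) (descent n ?p) t = descent n ?p s"
        then show ?thesis using t(2) IH sub by blast
      qed (use t(2) e_in in auto)
    qed
    have notin: "edge_path (tree_edge y) y s \<notin> tree_segment x ?p" if s: "s \<in> {0..1}" "s < 1" for s
    proof
      assume "edge_path (tree_edge y) y s \<in> tree_segment x ?p"
      then obtain z where z: "below x z" "below z ?p" "edge_path (tree_edge y) y s = Vertex z \<or> z \<noteq> x \<and> edge_path (tree_edge y) y s \<in> open_edge G (tree_edge z)"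
        by (auto simp: tree_segment_def)
      have zy: "height z < height y" using below_height[OF z(2)] p(2) by simp
      show False
      proof (rule edge_path_cases[OF j s(1)])
        assume "edge_path (tree_edge y) y s = Vertex y"
        then show False using z(3) zy by auto
      next
        assume "edge_path (tree_edge y) y s \<in> open_edge G (tree_edge y)"
        then have "z \<noteq> x" "tree_edge z = tree_edge y" using z(3) by (auto simp: open_edge_eq)
        moreover have "z \<in> verts G" "z \<noteq> root" using below_verts[OF z(1)] below_parent(1)[OF z(1)] \<open>z \<noteq> x\<close> by auto
        ultimately show False using tree_edge_inj[of z y] yv zy by auto
      qed (use s in auto)
    qed
    have inj: "inj_on (descent (Suc n) y) {0..1}"
      unfolding descent.simps
    proof (rule inj_on_pjoin[of _ _ "{0..1}"])
      show "inj_on (edge_path (tree_edge y) y) {0..1}" by (rule inj_edge_path[OF j])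
      show injd: "inj_on (descent n ?p) {0..1}" using IH by simp
      fix s t :: real assume s: "s \<in> {0..1}" and t: "t \<in> {0..1}" "t > 0"
      show "edge_path (tree_edge y) y s \<noteq> descent n ?p t"
      proof (cases "s = 1")
        case True
        have "edge_path (tree_edge y) y s = descent n ?p 0" using edge_path_ends(2)[OF j] IH True by simp
        then show ?thesis using inj_onD[OF injd, of 0 t] t by auto
      next
        case False
        have "descent n ?p t \<in> tree_segment x ?p" using IH t(1) by blast
        then show ?thesis using notin[of s] s False by auto
      qed
    qed auto
    have "descent (Suc n) y 0 = Vertex y" using edge_path_ends(1)[OF j] by simp
    moreover have "descent (Suc n) y 1 = Vertex x" using IH by simp
    ultimately show ?case using path img inj by blast
  qed
  then show "pathin (freudenthal G) (descent n y)" "descent n y 0 = Vertex y" "descent n y 1 = Vertex x"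
    "descent n y ` {0..1} \<subseteq> tree_segment x y" "inj_on (descent n y) {0..1}" by blast+
qed

definition low :: "'e \<Rightarrow> 'v" where
  "low c = (if height (tail G c) < height (head G c) then tail G c else head G c)"

definition high :: "'e \<Rightarrow> 'v" where
  "high c = (if height (tail G c) < height (head G c) then head G c else tail G c)"

lemma low_high:
  assumes "c \<in> arcs G" shows "joins c (low c) (high c)" "below (low c) (high c)" "height (low c) < height (high c)"
proof -
  show j: "joins c (low c) (high c)" using assms by (auto simp: joins_def low_def high_def)
  have le: "height (low c) \<le> height (high c)" by (auto simp: low_def high_def)
  show b: "below (low c) (high c)" by (rule joins_below[OF j le])
  show "height (low c) < height (high c)" using le below_same_height[OF b] joins_neq[OF j] by force
qed

text \<open>Since \<open>descent n\<close> has \<open>n + 1\<close> edges, its index is one less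
  than the difference of the heights. The base point is the lower end, where the cycle will be
  inserted into the big loop.\<close>

definition base_cycle :: "'e \<Rightarrow> real \<Rightarrow> ('v,'e) point" where
  "base_cycle c = pjoin (edge_path c (low c)) (descent (height (high c) - Suc (height (low c))) (high c))"

lemma base_cycle:
  assumes c: "c \<in> arcs G" "c \<notin> tree_edges"
  shows "pathin (freudenthal G) (base_cycle c)" "base_cycle c 0 = Vertex (low c)" "base_cycle c 1 = Vertex (low c)"
    "base_cycle c ` {0..1} \<subseteq> open_edge G c \<union> tree_segment (low c) (high c)" "is_circle G (base_cycle c)"
    "edge_winding c (base_cycle c) = (if tail G c = low c then 1 else - 1)"
proof -
  let ?x = "low c" and ?y = "high c"
  define n where "n = height ?y - Suc (height ?x)"
  note lh = low_high[OF c(1)]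
  have h: "height ?y = height ?x + Suc n" using lh(3) by (simp add: n_def)
  note d = descent[OF lh(2) h]
  note ends = edge_path_ends[OF lh(1)]
  have ep: "pathin (freudenthal G) (edge_path c ?x)" by (rule pathin_edge_path[OF c(1)])
  have eq: "base_cycle c = pjoin (edge_path c ?x) (descent n ?y)" by (simp add: base_cycle_def n_def)
  show path: "pathin (freudenthal G) (base_cycle c)" unfolding eq by (rule pathin_pjoin[OF ep d(1)]) (simp add: ends d)
  show e01: "base_cycle c 0 = Vertex ?x" "base_cycle c 1 = Vertex ?x" unfolding eq using ends d by auto
  have seg: "Vertex ?x \<in> tree_segment ?x ?y" "Vertex ?y \<in> tree_segment ?x ?y"
    using lh(2) below_verts[OF lh(2)] below_refl by (auto simp: tree_segment_def)
  have chord: "open_edge G c \<inter> tree_segment ?x ?y = {}"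
  proof -
    have "tree_edge z \<noteq> c" if "below ?x z" "z \<noteq> ?x" for z
      using c(2) below_parent(1)[OF that(1)] that(2) below_verts[OF that(1)] by (auto simp: tree_edges_def)
    then show ?thesis by (auto simp: tree_segment_def open_edge_eq)
  qed
  show "base_cycle c ` {0..1} \<subseteq> open_edge G c \<union> tree_segment ?x ?y"
  proof
    fix q assume "q \<in> base_cycle c ` {0..1}"
    then obtain t where t: "t \<in> {0..1}" "q = pjoin (edge_path c ?x) (descent n ?y) t" unfolding eq by auto
    from t(1) show "q \<in> open_edge G c \<union> tree_segment ?x ?y"
    proof (rule pjoin_cases[of t "edge_path c ?x" "descent n ?y"])
      fix s assume s: "s \<in> {0..1}" "pjoin (edge_path c ?x) (descent n ?y) t = edge_path c ?x s"
      show ?thesis by (rule edge_path_cases[OF lh(1) s(1)]) (use t(2) s(2) seg in auto)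
    next
      fix s assume "s \<in> {0..1}" "pjoin (edge_path c ?x) (descent n ?y) t = descent n ?y s"
      then show ?thesis using t(2) d(4) by blast
    qed
  qed
  have "inj_on (base_cycle c) {0..<1}"
    unfolding eq
  proof (rule inj_on_pjoin[of _ _ "{0..<1}"])
    show "inj_on (edge_path c ?x) {0..1}" by (rule inj_edge_path[OF lh(1)])
    show "inj_on (descent n ?y) {0..<1}" using d(5) by (rule inj_on_subset) auto
    fix s t :: real assume s: "s \<in> {0..1}" and t: "t \<in> {0..<1}" "t > 0"
    have t1: "t \<in> {0..1}" using t by simp
    show "edge_path c ?x s \<noteq> descent n ?y t"
    proof (rule edge_path_cases[OF lh(1) s])
      assume "edge_path c ?x s = Vertex ?x"
      then show ?thesis using inj_onD[OF d(5) _ t1, of 1] d(3) t by auto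
    next
      assume "edge_path c ?x s = Vertex ?y"
      then show ?thesis using inj_onD[OF d(5) _ t1, of 0] d(2) t by auto
    next
      assume "edge_path c ?x s \<in> open_edge G c"
      then show ?thesis using chord d(4) t1 by blast
    qed
  qed auto
  then show "is_circle G (base_cycle c)" using path e01 by (simp add: is_circle_def)
  have "edge_winding c (descent n ?y) = 0"
    by (rule edge_winding_outside) (use d(4) chord in blast)
  then show "edge_winding c (base_cycle c) = (if tail G c = ?x then 1 else - 1)"
    unfolding eq using edge_winding_pjoin[OF ep d(1) _ c(1)] ends d(2) edge_winding_edge_path[OF lh(1)] by simp
qed

lemma is_circle_reverse:
  assumes "is_circle G \<alpha>" shows "is_circle G (\<lambda>t. \<alpha> (1 - t))"
proof -
  have c: "pathin (freudenthal G) \<alpha>" "\<alpha> 0 = \<alpha> 1" "inj_on \<alpha> {0..<1}" using assms by (auto simp: is_circle_def)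
  have "inj_on (\<lambda>t. \<alpha> (1 - t)) {0..<1}"
  proof (rule inj_onI)
    fix s t :: real assume st: "s \<in> {0..<1}" "t \<in> {0..<1}" "\<alpha> (1 - s) = \<alpha> (1 - t)"
    define f where "f x = (if x = (1::real) then 0 else x)" for x
    have "\<alpha> (f (1 - s)) = \<alpha> (f (1 - t))" using st(3) c(2) by (auto simp: f_def)
    moreover have "f (1 - s) \<in> {0..<1}" "f (1 - t) \<in> {0..<1}" using st by (auto simp: f_def)
    ultimately have "f (1 - s) = f (1 - t)" using inj_onD[OF c(3)] by blast
    then show "s = t" using st by (auto simp: f_def split: if_splits)
  qed
  then show ?thesis using pathin_reverse[OF c(1)] c(2) by (simp add: is_circle_def)
qed

text \<open>\<open>b\<close> tells whether the chord is run through in its natural orientation; the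
  base cycle always starts at the lower end, which may be the tail or the head.\<close>

definition fund_cycle :: "bool \<Rightarrow> 'e \<Rightarrow> real \<Rightarrow> ('v,'e) point" where
  "fund_cycle b c = (if (tail G c = low c) = b then base_cycle c else (\<lambda>t. base_cycle c (1 - t)))"

lemma fund_cycle:
  assumes c: "c \<in> arcs G" "c \<notin> tree_edges"
  shows "pathin (freudenthal G) (fund_cycle b c)" "fund_cycle b c 0 = Vertex (low c)" "fund_cycle b c 1 = Vertex (low c)"
    "fund_cycle b c ` {0..1} \<subseteq> open_edge G c \<union> tree_segment (low c) (high c)" "is_circle G (fund_cycle b c)"
    "edge_winding c (fund_cycle b c) = (if b then 1 else - 1)"
    "e \<in> arcs G \<Longrightarrow> e \<notin> tree_edges \<Longrightarrow> e \<noteq> c \<Longrightarrow> edge_winding e (fund_cycle b c) = 0"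
proof -
  note b = base_cycle[OF c]
  show "pathin (freudenthal G) (fund_cycle b c)" "fund_cycle b c 0 = Vertex (low c)" "fund_cycle b c 1 = Vertex (low c)"
     "is_circle G (fund_cycle b c)"
    using b pathin_reverse[OF b(1)] is_circle_reverse[OF b(5)] by (auto simp: fund_cycle_def)
  show "edge_winding c (fund_cycle b c) = (if b then 1 else - 1)"
    using b(6) edge_winding_reverse[OF b(1) c(1)] by (auto simp: fund_cycle_def)
  have "fund_cycle b c t \<in> base_cycle c ` {0..1}" if "t \<in> {0..1}" for t
    using that by (auto simp: fund_cycle_def)
  then show img: "fund_cycle b c ` {0..1} \<subseteq> open_edge G c \<union> tree_segment (low c) (high c)" using b(4) by blast
  assume e: "e \<in> arcs G" "e \<notin> tree_edges" "e \<noteq> c"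
  have "open_edge G e \<inter> tree_segment (low c) (high c) = {}"
  proof -
    have "tree_edge z \<noteq> e" if "below (low c) z" "z \<noteq> low c" for z
      using e(2) below_parent(1)[OF that(1)] that(2) below_verts[OF that(1)] by (auto simp: tree_edges_def)
    then show ?thesis by (auto simp: tree_segment_def open_edge_eq)
  qed
  moreover have "open_edge G e \<inter> open_edge G c = {}" using e(3) by (auto simp: open_edge_eq)
  ultimately show "edge_winding e (fund_cycle b c) = 0" using img by (intro edge_winding_outside) blast
qed

text \<open>Balance across the cut of \<open>up w\<close>: apart from the tree edge only
  \<open>c\<close> could carry a winding there, and \<open>c\<close> is not in the cut. So the
  fundamental cycles through a given tree edge belong to the chords of one finite cut, which makes
  their family thin.\<close>

lemma fund_cycle_tree_edge:
  assumes c: "c \<in> arcs G" "c \<notin> tree_edges" and w: "w \<in> verts G" "w \<noteq> root" and out: "c \<notin> cut (up w)"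
  shows "edge_winding (tree_edge w) (fund_cycle b c) = 0"
proof -
  let ?e = "tree_edge w" and ?\<psi> = "\<lambda>e. edge_winding e (fund_cycle b c)"
  let ?g = "\<lambda>e. if head G e \<in> up w then ?\<psi> e else - ?\<psi> e"
  have "balanced ?\<psi>" using fund_cycle[OF c] by (intro balanced_loop) auto
  then have "0 = cut_sum ?\<psi> (up w)" using finite_cut_up up_verts by (simp add: balanced_def)
  also have "\<dots> = sum ?g {?e}"
    unfolding cut_sum_def
  proof (rule sum.mono_neutral_right[OF finite_cut_up])
    show "{?e} \<subseteq> cut (up w)" using tree_edge_cut[OF w] by blast
    show "\<forall>i\<in>cut (up w) - {?e}. ?g i = 0"
    proof
      fix i assume i: "i \<in> cut (up w) - {?e}"
      then have "i \<notin> tree_edges" using tree_edge_cut[OF w] by blast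
      then show "?g i = 0" using fund_cycle(7)[OF c, of i] i out by (auto simp: cut_def)
    qed
  qed
  finally show ?thesis by (simp split: if_splits)
qed

section \<open>The cycle space consists of the functions satisfying the finite cut condition\<close>

lemma natural_in_oriented: "e \<in> arcs G \<Longrightarrow> natural_orientation G e \<in> oriented_edges G"
  by (simp add: oriented_edges_def)

lemma oriented_edges_cases:
  assumes "x \<in> oriented_edges G"
  obtains e where "e \<in> arcs G" "x = natural_orientation G e" | e where "e \<in> arcs G" "x = reverse (natural_orientation G e)"
  using assms by (auto simp: oriented_edges_def)

lemma reverse_reverse [simp]: "reverse (reverse x) = x"
  by (cases x) (simp add: reverse_def)

lemma reverse_oriented: "x \<in> oriented_edges G \<Longrightarrow> reverse x \<in> oriented_edges G"
  by (erule oriented_edges_cases) (auto simp: oriented_edges_def)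

lemma edge_functionsI:
  assumes "\<And>e. e \<in> arcs G \<Longrightarrow> \<phi> (reverse (natural_orientation G e)) = - \<phi> (natural_orientation G e)"
    "\<And>x. x \<notin> oriented_edges G \<Longrightarrow> \<phi> x = 0"
  shows "\<phi> \<in> edge_functions G"
  unfolding edge_functions_def using assms by (auto elim!: oriented_edges_cases)

lemma edge_functions_eqI:
  assumes "\<phi> \<in> edge_functions G" "\<psi> \<in> edge_functions G"
    "\<And>e. e \<in> arcs G \<Longrightarrow> \<phi> (natural_orientation G e) = \<psi> (natural_orientation G e)"
  shows "\<phi> = \<psi>"
proof
  fix x
  show "\<phi> x = \<psi> x"
  proof (cases "x \<in> oriented_edges G")
    case True
    then show ?thesis
    proof (rule oriented_edges_cases)
      fix e assume e: "e \<in> arcs G" "x = reverse (natural_orientation G e)"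
      then show ?thesis using assms natural_in_oriented[OF e(1)] unfolding edge_functions_def by auto
    qed (use assms(3) in auto)
  next
    case False
    then have "\<phi> x = 0" "\<psi> x = 0" using assms(1,2) unfolding edge_functions_def by blast+
    then show ?thesis by simp
  qed
qed

lemma oriented_circuit_edge_function:
  assumes "is_circle G \<alpha>" shows "oriented_circuit G \<alpha> \<in> edge_functions G"
proof (rule edge_functionsI)
  fix x assume "x \<notin> oriented_edges G"
  then show "oriented_circuit G \<alpha> x = 0"
    using reverse_oriented[of "reverse x"] by (cases x) (auto simp: oriented_circuit_def traverses_def reverse_def)
qed (rule oriented_circuit_winding(2)[OF assms])

definition balanced_functions :: "(('v,'e) oriented_edge \<Rightarrow> int) set" where
  "balanced_functions = {\<phi> \<in> edge_functions G. balanced (\<lambda>e. real_of_int (\<phi> (natural_orientation G e)))}"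

text \<open>Over a finite cut only the finite set \<open>J\<close> of members is nonzero, so the sum
  over the cut may be interchanged with the thin sum.\<close>

lemma thin_sum_balanced:
  assumes circ: "\<And>i. i \<in> I \<Longrightarrow> is_circle G (\<alpha> i)" and thin: "thin G I (\<lambda>i. oriented_circuit G (\<alpha> i))"
  shows "thin_sum I (\<lambda>i. oriented_circuit G (\<alpha> i)) \<in> balanced_functions"
proof -
  let ?O = "\<lambda>i. oriented_circuit G (\<alpha> i)"
  have fin: "finite {i \<in> I. ?O i x \<noteq> 0}" if "x \<in> oriented_edges G" for x
    using thin that by (simp add: thin_def)
  have ef: "thin_sum I ?O \<in> edge_functions G"
  proof (rule edge_functionsI)
    fix e assume e: "e \<in> arcs G"
    have rev: "?O i (reverse (natural_orientation G e)) = - ?O i (natural_orientation G e)" if "i \<in> I" for i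
      by (rule oriented_circuit_winding(2)[OF circ[OF that] e])
    then have "{i. i \<in> I \<and> ?O i (reverse (natural_orientation G e)) \<noteq> 0} = {i. i \<in> I \<and> ?O i (natural_orientation G e) \<noteq> 0}"
      by auto
    then show "thin_sum I ?O (reverse (natural_orientation G e)) = - thin_sum I ?O (natural_orientation G e)"
      unfolding thin_sum_def sum_negf[symmetric] using rev by (intro sum.cong) auto
  next
    fix x assume "x \<notin> oriented_edges G"
    then have "?O i x = 0" if "i \<in> I" for i
      using oriented_circuit_edge_function[OF circ[OF that]] unfolding edge_functions_def by blast
    then show "thin_sum I ?O x = 0" unfolding thin_sum_def by (intro sum.neutral) blast
  qed
  have "balanced (\<lambda>e. real_of_int (thin_sum I ?O (natural_orientation G e)))"
    unfolding balanced_def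
  proof (intro allI impI)
    fix A assume A: "A \<subseteq> verts G" "finite (cut A)"
    define J where "J = (\<Union>e\<in>cut A. {i \<in> I. ?O i (natural_orientation G e) \<noteq> 0})"
    have J: "finite J" unfolding J_def using A(2) fin natural_in_oriented by (intro finite_UN_I) (auto simp: cut_def)
    have eq: "real_of_int (thin_sum I ?O (natural_orientation G e)) = (\<Sum>i\<in>J. edge_winding e (\<alpha> i))" if e: "e \<in> cut A" for e
    proof -
      have ea: "e \<in> arcs G" using e by (simp add: cut_def)
      have "thin_sum I ?O (natural_orientation G e) = (\<Sum>i\<in>J. ?O i (natural_orientation G e))"
        unfolding thin_sum_def by (rule sum.mono_neutral_left[OF J]) (use e in \<open>auto simp: J_def\<close>)
      then have "real_of_int (thin_sum I ?O (natural_orientation G e)) = (\<Sum>i\<in>J. of_int (?O i (natural_orientation G e)))"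
        by simp
      also have "\<dots> = (\<Sum>i\<in>J. edge_winding e (\<alpha> i))"
        by (rule sum.cong[OF refl], rule oriented_circuit_winding(1)[OF circ ea]) (auto simp: J_def)
      finally show ?thesis .
    qed
    have "cut_sum (\<lambda>e. real_of_int (thin_sum I ?O (natural_orientation G e))) A =
        (\<Sum>e\<in>cut A. \<Sum>i\<in>J. if head G e \<in> A then edge_winding e (\<alpha> i) else - edge_winding e (\<alpha> i))"
      unfolding cut_sum_def by (intro sum.cong) (auto simp: eq sum_negf)
    also have "\<dots> = (\<Sum>i\<in>J. cut_sum (\<lambda>e. edge_winding e (\<alpha> i)) A)"
      unfolding cut_sum_def by (rule sum.swap)
    also have "\<dots> = 0"
    proof (rule sum.neutral, rule ballI)
      fix i assume "i \<in> J"
      then have "is_circle G (\<alpha> i)" using circ by (auto simp: J_def)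
      then have "balanced (\<lambda>e. edge_winding e (\<alpha> i))" by (intro balanced_loop) (auto simp: is_circle_def)
      then show "cut_sum (\<lambda>e. edge_winding e (\<alpha> i)) A = 0" using A by (simp add: balanced_def)
    qed
    finally show "cut_sum (\<lambda>e. real_of_int (thin_sum I ?O (natural_orientation G e))) A = 0" .
  qed
  with ef show ?thesis by (simp add: balanced_functions_def)
qed

lemma lf_graph_assms: "loopfree_digraph G" "Digraph_Component.connected G" "locally_finite G"
  by (unfold_locales, rule conn, rule lf)

text \<open>The values on tree edges are never computed: both sides are balanced, and balanced
  functions that agree on the chords are equal.\<close>

lemma oriented_cycle_space_eq: "oriented_cycle_space G = balanced_functions"
proof
  show "oriented_cycle_space G \<subseteq> balanced_functions"
  proof
    fix \<phi> assume "\<phi> \<in> oriented_cycle_space G"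
    then obtain I :: "nat set" and \<alpha> where "\<phi> = thin_sum I (\<lambda>i. oriented_circuit G (\<alpha> i))"
      "\<forall>i\<in>I. is_circle G (\<alpha> i)" "thin G I (\<lambda>i. oriented_circuit G (\<alpha> i))"
      unfolding oriented_cycle_space_def by (auto simp only: mem_Collect_eq)
    then show "\<phi> \<in> balanced_functions" using thin_sum_balanced[of I \<alpha>] by simp
  qed
  show "balanced_functions \<subseteq> oriented_cycle_space G"
  proof
    fix \<phi> assume \<phi>: "\<phi> \<in> balanced_functions"
    define \<psi> where "\<psi> e = \<phi> (natural_orientation G e)" for e
    \<comment> \<open>Thin sums of circuits carry no coefficients, so a chord with value
      \<open>n\<close> occurs in \<bar>n\<bar> copies, counted by \<open>k\<close>; the sign is
      taken care of by the direction of the cycle.\<close>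
    define I where "I = {(c, k). c \<in> arcs G \<and> c \<notin> tree_edges \<and> k < nat \<bar>\<psi> c\<bar>}"
    define \<alpha> where "\<alpha> = (\<lambda>(c, k :: nat). fund_cycle (\<psi> c > 0) c)"
    let ?O = "\<lambda>i. oriented_circuit G (\<alpha> i)"
    have circ: "is_circle G (\<alpha> i)" if "i \<in> I" for i
      using that fund_cycle(5) by (auto simp: I_def \<alpha>_def)
    have val: "real_of_int (?O i (natural_orientation G e)) = edge_winding e (\<alpha> i)" if "i \<in> I" "e \<in> arcs G" for i e
      by (rule oriented_circuit_winding(1)[OF circ[OF that(1)] that(2)])
    have fin_nat: "finite {i \<in> I. ?O i (natural_orientation G e) \<noteq> 0}" if e: "e \<in> arcs G" for e
    proof -
      \<comment> \<open>The chords whose fundamental cycle may use \<open>e\<close>: those across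
        the cut of \<open>e\<close> if it is a tree edge, otherwise only \<open>e\<close>
        itself.\<close>
      define F where "F = (if e \<in> tree_edges then cut (up (SOME w. w \<in> verts G \<and> w \<noteq> root \<and> e = tree_edge w)) else {e})"
      have F: "finite F" by (simp add: F_def finite_cut_up)
      have "c \<in> F" if ck: "(c, k) \<in> I" "?O (c, k) (natural_orientation G e) \<noteq> 0" for c k
      proof -
        have c: "c \<in> arcs G" "c \<notin> tree_edges" using ck(1) by (auto simp: I_def)
        have nz: "edge_winding e (fund_cycle (\<psi> c > 0) c) \<noteq> 0" using val[OF ck(1) e] ck(2) by (simp add: \<alpha>_def)
        show ?thesis
        proof (cases "e \<in> tree_edges")
          case True
          then have "\<exists>w. w \<in> verts G \<and> w \<noteq> root \<and> e = tree_edge w" by (auto simp: tree_edges_def)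
          from someI_ex[OF this] show ?thesis using fund_cycle_tree_edge[OF c] nz True unfolding F_def by metis
        next
          case False
          then show ?thesis using fund_cycle(7)[OF c e] nz by (auto simp: F_def)
        qed
      qed
      then have "{i \<in> I. ?O i (natural_orientation G e) \<noteq> 0} \<subseteq> Sigma F (\<lambda>c. {..<nat \<bar>\<psi> c\<bar>})"
        by (auto simp: I_def)
      then show ?thesis by (rule finite_subset) (simp add: F)
    qed
    have thin: "thin G I ?O"
      unfolding thin_def
    proof
      fix x assume "x \<in> oriented_edges G"
      then show "finite {i \<in> I. ?O i x \<noteq> 0}"
      proof (rule oriented_edges_cases)
        fix e assume e: "e \<in> arcs G" "x = reverse (natural_orientation G e)"
        have "{i \<in> I. ?O i x \<noteq> 0} = {i \<in> I. ?O i (natural_orientation G e) \<noteq> 0}"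
          using oriented_circuit_winding(2)[OF circ e(1)] e(2) by auto
        then show ?thesis using fin_nat[OF e(1)] by simp
      qed (use fin_nat in simp)
    qed
    have b: "thin_sum I ?O \<in> balanced_functions" by (rule thin_sum_balanced[OF circ thin])
    have chord: "thin_sum I ?O (natural_orientation G e) = \<psi> e" if e: "e \<in> arcs G" "e \<notin> tree_edges" for e
    proof -
      have *: "?O (c, k) (natural_orientation G e) = (if c = e then sgn (\<psi> e) else 0)" if "(c, k) \<in> I" for c k
      proof -
        have c: "c \<in> arcs G" "c \<notin> tree_edges" "\<psi> c \<noteq> 0" using that by (auto simp: I_def)
        have "real_of_int (?O (c, k) (natural_orientation G e)) = (if c = e then real_of_int (sgn (\<psi> e)) else 0)"
          unfolding val[OF that e(1)] using fund_cycle(6)[OF c(1,2)] fund_cycle(7)[OF c(1,2) e] c(3)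
          by (auto simp: \<alpha>_def sgn_if)
        then show ?thesis by (metis of_int_0 of_int_eq_iff)
      qed
      have "{i. i \<in> I \<and> ?O i (natural_orientation G e) \<noteq> 0} = {e} \<times> {..<nat \<bar>\<psi> e\<bar>}"
        using * e by (auto simp: I_def sgn_if split: if_splits)
      then have "thin_sum I ?O (natural_orientation G e) = (\<Sum>i\<in>{e} \<times> {..<nat \<bar>\<psi> e\<bar>}. ?O i (natural_orientation G e))"
        by (simp add: thin_sum_def)
      also have "\<dots> = (\<Sum>i\<in>{e} \<times> {..<nat \<bar>\<psi> e\<bar>}. sgn (\<psi> e))"
        by (rule sum.cong) (use * e in \<open>auto simp: I_def\<close>)
      also have "\<dots> = \<psi> e" by (auto simp: card_cartesian_product sgn_if)
      finally show ?thesis .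
    qed
    have "thin_sum I ?O = \<phi>"
    proof (rule edge_functions_eqI)
      fix e assume e: "e \<in> arcs G"
      have "real_of_int (thin_sum I ?O (natural_orientation G e)) = real_of_int (\<phi> (natural_orientation G e))"
        by (rule balanced_eqI[where \<psi> = "\<lambda>e. real_of_int (thin_sum I ?O (natural_orientation G e))"
              and \<phi> = "\<lambda>e. real_of_int (\<phi> (natural_orientation G e))", OF _ _ _ e])
          (use b \<phi> chord in \<open>auto simp: balanced_functions_def \<psi>_def\<close>)
      then show "thin_sum I ?O (natural_orientation G e) = \<phi> (natural_orientation G e)" by simp
    qed (use b \<phi> in \<open>auto simp: balanced_functions_def\<close>)
    then show "\<phi> \<in> oriented_cycle_space G"
      using thin_sum_in_oriented_cycle_space[OF lf_graph_assms circ thin] by simp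
  qed
qed

end

section \<open>A loop with prescribed winding numbers\<close>

context lf_graph
begin

text \<open>By normality a neighbour of \<open>up x\<close> outside it lies strictly below
  \<open>x\<close>. So deleting the finitely many such vertices separates \<open>up x\<close>, and
  within itself it is connected through the tree.\<close>

lemma up_component:
  assumes x: "x \<in> verts G"
  shows "up x \<in> components_avoiding G {z. below z x \<and> z \<noteq> x}" (is "_ \<in> components_avoiding G ?S")
proof -
  have xS: "x \<in> verts G - ?S" using x by simp
  have up_sub: "up x \<subseteq> verts G - ?S"
  proof
    fix z assume "z \<in> up x"
    then have "below x z" by (simp add: up_def)
    then show "z \<in> verts G - ?S"
      using below_verts below_same_height[of z x] below_height[of x z] below_height[of z x] by auto
  qed
  have "linked (verts G - ?S) x = up x"
  proof
    show "up x \<subseteq> linked (verts G - ?S) x" using up_linked linked_mono[OF up_sub] by blast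
    have "y \<in> up x" if "(x, y) \<in> (links (verts G - ?S))\<^sup>*" for y
      using that
    proof (induction rule: rtrancl_induct)
      case base then show ?case using below_refl[OF x] by (simp add: up_def)
    next
      case (step y z)
      obtain e where e: "joins e y z" "z \<notin> ?S" using step.hyps(2) by (auto simp: links_def)
      have xy: "below x y" using step.IH by (simp add: up_def)
      show ?case
      proof (cases "below y z")
        case True then show ?thesis using below_trans[OF xy] by (simp add: up_def)
      next
        case False
        then have zy: "below z y" using joins_comparable[OF e(1)] by blast
        have "below x z \<or> below z x" using below_chain[OF xy zy] below_chain[OF zy xy] by linarith
        then show ?thesis using e(2) below_refl[OF x] by (auto simp: up_def)
      qed
    qed
    then show "linked (verts G - ?S) x \<subseteq> up x" unfolding linked_def by blast
  qed
  then show ?thesis unfolding components_avoiding_iff using xS by blast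
qed

text \<open>The part of the compactification above \<open>x\<close>, without the edges leading down
  from \<open>up x\<close>; so it contains an edge only together with both ends.\<close>

definition region :: "'v \<Rightarrow> ('v,'e) point set" where
  "region x = Vertex ` up x \<union> (\<Union>e\<in>{e \<in> arcs G. tail G e \<in> up x \<and> head G e \<in> up x}. open_edge G e) \<union>
     End ` {\<omega> \<in> ends G. \<forall>r\<in>\<omega>. has_tail_in r (up x)}"

lemma in_region [simp]:
  "Vertex v \<in> region x \<longleftrightarrow> below x v"
  "Inner e t \<in> region x \<longleftrightarrow> e \<in> arcs G \<and> 0 < t \<and> t < 1 \<and> below x (tail G e) \<and> below x (head G e)"
  "End \<omega> \<in> region x \<longleftrightarrow> \<omega> \<in> ends G \<and> (\<forall>r\<in>\<omega>. has_tail_in r (up x))"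
  by (auto simp: region_def up_def)

lemma has_tail_in_mono: "has_tail_in r A \<Longrightarrow> A \<subseteq> B \<Longrightarrow> has_tail_in r B"
  unfolding has_tail_in_def by blast

lemma region_mono: "below x y \<Longrightarrow> region y \<subseteq> region x"
proof
  fix p assume xy: "below x y" and p: "p \<in> region y"
  show "p \<in> region x"
    using p below_trans[OF xy] has_tail_in_mono[OF _ up_subset[OF xy]] by (cases p) auto
qed

lemma edge_path_region:
  assumes "joins e u v" "below x u" "below x v" "t \<in> {0..1}"
  shows "edge_path e w t \<in> region x"
proof -
  have e: "e \<in> arcs G" "below x (tail G e)" "below x (head G e)" using assms(1-3) by (auto simp: joins_def)
  have "theta G e s \<in> region x" if "s \<in> {0..1}" for s
    using that by (rule theta_cases) (use e in auto)
  from this[of t] this[of "1 - t"] show ?thesis using assms(4) by (auto simp: edge_path_def)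
qed

lemma fund_cycle_region:
  assumes c: "c \<in> arcs G" "c \<notin> tree_edges" and t: "t \<in> {0..1}"
  shows "fund_cycle b c t \<in> region (low c)"
proof -
  note lh = low_high[OF c(1)]
  have v: "below (low c) (low c)" using below_refl below_verts[OF lh(2)] by blast
  have "tree_segment (low c) (high c) \<subseteq> region (low c)"
  proof
    fix p assume "p \<in> tree_segment (low c) (high c)"
    then obtain z where z: "below (low c) z" "p = Vertex z \<or> z \<noteq> low c \<and> p \<in> open_edge G (tree_edge z)"
      by (auto simp: tree_segment_def)
    show "p \<in> region (low c)"
    proof (cases "p = Vertex z")
      case False
      then have p: "z \<noteq> low c" "p \<in> open_edge G (tree_edge z)" using z(2) by auto
      have zr: "z \<in> verts G" "z \<noteq> root" "below (low c) (parent z)"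
        using below_verts[OF z(1)] below_parent[OF z(1)] p(1) by auto
      from tree_edge[OF zr(1,2)] have "tree_edge z \<in> arcs G" "below (low c) (tail G (tree_edge z))" "below (low c) (head G (tree_edge z))"
        using zr(3) z(1) by (auto simp: joins_def)
      then show ?thesis using p(2) by (auto simp: open_edge_eq)
    qed (use z in simp)
  qed
  moreover have "open_edge G c \<subseteq> region (low c)"
    using lh(1,2) v c(1) by (auto simp: open_edge_eq joins_def)
  ultimately show ?thesis using fund_cycle(4)[OF c, of b] t by blast
qed

section \<open>One level of the loop\<close>

definition children :: "'v \<Rightarrow> 'v set" where
  "children x = {y \<in> verts G. y \<noteq> root \<and> parent y = x}"

lemma children_joins: "y \<in> children x \<Longrightarrow> joins (tree_edge y) x y"
  using tree_edge by (auto simp: children_def)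

lemma children_below: "y \<in> children x \<Longrightarrow> below x y \<and> height y = Suc (height x) \<and> y \<in> verts G"
  using parent by (auto simp: children_def)

lemma finite_children: "finite (children x)"
proof -
  have "children x \<subseteq> {w. \<exists>e. joins e x w}" using children_joins by blast
  then show ?thesis using finite_joined finite_subset by blast
qed

definition chords :: "'v \<Rightarrow> 'e set" where
  "chords x = {c \<in> arcs G. c \<notin> tree_edges \<and> low c = x}"

lemma finite_chords: "finite (chords x)"
proof -
  have "chords x \<subseteq> incident x" by (auto simp: chords_def incident_def low_def)
  then show ?thesis using finite_incident finite_subset by blast
qed

definition some_list :: "'a set \<Rightarrow> 'a list" where
  "some_list A = (SOME xs. set xs = A \<and> distinct xs)"

lemma some_list: "finite A \<Longrightarrow> set (some_list A) = A \<and> distinct (some_list A)"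
  unfolding some_list_def by (rule someI_ex[OF finite_distinct_list])

text \<open>
  The loop at \<open>x\<close> first visits, for every child \<open>y\<close> of \<open>x\<close>, the edge to \<open>y\<close>, the loop at \<open>y\<close> and
  the edge back, and then runs \<open>\<psi> c\<close> times round the fundamental cycle of every chord \<open>c\<close> with
  lower end \<open>x\<close>. Its items are \<open>Inr y\<close> and \<open>Inl\<close> of the fundamental cycle, respectively.
\<close>

definition items :: "('e \<Rightarrow> int) \<Rightarrow> 'v \<Rightarrow> ((real \<Rightarrow> ('v,'e) point) + 'v) list" where
  "items \<psi> x = Inl (\<lambda>_. Vertex x) # map Inr (some_list (children x)) @
     concat (map (\<lambda>c. replicate (nat \<bar>\<psi> c\<bar>) (Inl (fund_cycle (\<psi> c > 0) c))) (some_list (chords x)))"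

definition item_path :: "('v \<Rightarrow> real \<Rightarrow> ('v,'e) point) \<Rightarrow> 'v \<Rightarrow> (real \<Rightarrow> ('v,'e) point) + 'v \<Rightarrow> real \<Rightarrow> ('v,'e) point" where
  "item_path f x i = (case i of Inl p \<Rightarrow> p
     | Inr y \<Rightarrow> pjoin (edge_path (tree_edge y) x) (pjoin (f y) (edge_path (tree_edge y) y)))"

text \<open>One level of the recursion, with the loops at the children as a parameter
  \<open>f\<close>: the approximations iterate it, and their limit is a fixed point of it.\<close>

definition assemble :: "('e \<Rightarrow> int) \<Rightarrow> ('v \<Rightarrow> real \<Rightarrow> ('v,'e) point) \<Rightarrow> 'v \<Rightarrow> real \<Rightarrow> ('v,'e) point" where
  "assemble \<psi> f x = cat (map (item_path f x) (items \<psi> x))"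

lemma items_cases:
  assumes "i \<in> set (items \<psi> x)"
  obtains "i = Inl (\<lambda>_. Vertex x)" | y where "y \<in> children x" "i = Inr y"
  | c b where "c \<in> chords x" "i = Inl (fund_cycle b c)"
proof -
  from assms consider "i = Inl (\<lambda>_. Vertex x)" | "i \<in> Inr ` children x" |
      "\<exists>c\<in>chords x. i = Inl (fund_cycle (\<psi> c > 0) c)"
    using some_list[OF finite_children[of x]] some_list[OF finite_chords[of x]]
    unfolding items_def by auto
  then show thesis using that by cases blast+
qed

lemma item_path_ends:
  assumes "i \<in> set (items \<psi> x)" shows "item_path f x i 0 = Vertex x" "item_path f x i 1 = Vertex x"
proof -
  have "item_path f x i 0 = Vertex x \<and> item_path f x i 1 = Vertex x"
    using assms
  proof (rule items_cases)
    fix y assume y: "y \<in> children x" "i = Inr y"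
    then show ?thesis
      using edge_path_ends(1)[OF children_joins[OF y(1)]] edge_path_ends(2)[OF joins_sym[OF children_joins[OF y(1)]]]
      by (simp add: item_path_def)
  next
    fix c b assume c: "c \<in> chords x" "i = Inl (fund_cycle b c)"
    then show ?thesis using fund_cycle(2,3)[of c b] by (auto simp: item_path_def chords_def)
  qed (simp add: item_path_def)
  then show "item_path f x i 0 = Vertex x" "item_path f x i 1 = Vertex x" by auto
qed

lemma item_path_path:
  assumes x: "x \<in> verts G" and i: "i \<in> set (items \<psi> x)"
    and f: "\<And>y. y \<in> children x \<Longrightarrow> pathin (freudenthal G) (f y) \<and> f y 0 = Vertex y \<and> f y 1 = Vertex y"
  shows "pathin (freudenthal G) (item_path f x i)"
  using i
proof (rule items_cases)
  assume "i = Inl (\<lambda>_. Vertex x)"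
  then show ?thesis using x by (simp add: item_path_def pathin_def topspace_freudenthal)
next
  fix y assume y: "y \<in> children x" "i = Inr y"
  note j = children_joins[OF y(1)]
  have e: "tree_edge y \<in> arcs G" using j by (simp add: joins_def)
  show ?thesis
    using y(2) f[OF y(1)] pathin_edge_path[OF e] edge_path_ends(2)[OF j] edge_path_ends(1)[OF joins_sym[OF j]]
    by (auto simp: item_path_def intro!: pathin_pjoin)
next
  fix c b assume c: "c \<in> chords x" "i = Inl (fund_cycle b c)"
  then show ?thesis using fund_cycle(1)[of c b] by (auto simp: item_path_def chords_def)
qed

text \<open>The constant path at the head of the list ensures this also at a leaf without chords;
  \<open>cat\<close> of the empty list would be undefined.\<close>

lemma items_nonempty [simp]: "items \<psi> x \<noteq> []"
  by (simp add: items_def)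

lemma assemble_ends: "assemble \<psi> f x 0 = Vertex x" "assemble \<psi> f x 1 = Vertex x"
  using cat_ends[of "map (item_path f x) (items \<psi> x)" "Vertex x"] item_path_ends[of _ \<psi> x f]
  by (auto simp: assemble_def)

lemma assemble_path:
  assumes x: "x \<in> verts G"
    and f: "\<And>y. y \<in> children x \<Longrightarrow> pathin (freudenthal G) (f y) \<and> f y 0 = Vertex y \<and> f y 1 = Vertex y"
  shows "pathin (freudenthal G) (assemble \<psi> f x)"
  unfolding assemble_def
  using cat_closed[of "map (item_path f x) (items \<psi> x)" "freudenthal G" "Vertex x"]
    item_path_ends[of _ \<psi> x f] item_path_path[OF x _ f] by auto

text \<open>The alternative is uniform in \<open>f\<close>: a time is either decided on this level,
  by a point of the graph, or handed on to a child together with a local time.\<close>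

lemma assemble_cases:
  assumes x: "x \<in> verts G" and t: "t \<in> {0..1}"
  obtains q where "q \<in> region x" "q \<in> graph_points G" "\<And>f. assemble \<psi> f x t = q"
  | y s where "y \<in> children x" "s \<in> {0..1}" "\<And>f. assemble \<psi> f x t = f y s"
proof -
  obtain i s where i: "i < length (items \<psi> x)" "s \<in> {0..1}"
    "\<forall>ps :: (real \<Rightarrow> ('v,'e) point) list. length ps = length (items \<psi> x) \<longrightarrow> cat ps t = (ps ! i) s"
    using cat_cases[OF t, of "length (items \<psi> x)"] by auto
  define it where "it = items \<psi> x ! i"
  have it: "it \<in> set (items \<psi> x)" using i(1) by (simp add: it_def)
  have as: "assemble \<psi> f x t = item_path f x it s" for f
    using i by (simp add: assemble_def it_def)
  have xx: "below x x" by (rule below_refl[OF x])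
  have noend: "q \<in> graph_points G" if "q \<in> region x" "\<And>\<omega>. q \<noteq> End \<omega>" for q
    using that below_verts by (cases q) auto
  show thesis
    using it
  proof (rule items_cases)
    assume "it = Inl (\<lambda>_. Vertex x)"
    then show thesis using x xx as by (intro that(1)[of "Vertex x"]) (auto simp: item_path_def)
  next
    fix c b assume c: "c \<in> chords x" "it = Inl (fund_cycle b c)"
    then have c': "c \<in> arcs G" "c \<notin> tree_edges" "low c = x" by (auto simp: chords_def)
    let ?q = "fund_cycle b c s"
    have "?q \<in> open_edge G c \<union> tree_segment (low c) (high c)" using fund_cycle(4)[OF c'(1,2), of b] i(2) by blast
    then have "?q \<noteq> End \<omega>" for \<omega> by (auto simp: tree_segment_def)
    then show thesis
      using as c(2) noend fund_cycle_region[OF c'(1,2) i(2), of b] c'(3) by (intro that(1)[of ?q]) (auto simp: item_path_def)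
  next
    fix y assume y: "y \<in> children x" "it = Inr y"
    note j = children_joins[OF y(1)]
    have e: "tree_edge y \<in> arcs G" using j by (simp add: joins_def)
    have ep: "edge_path (tree_edge y) w r \<in> region x \<and> edge_path (tree_edge y) w r \<in> graph_points G" if "r \<in> {0..1}" for w r
      using edge_path_region[OF j xx _ that, of w] children_below[OF y(1)] theta_in_graph[OF e, of r] theta_in_graph[OF e, of "1 - r"] that
      by (auto simp: edge_path_def)
    have as': "assemble \<psi> f x t = pjoin (edge_path (tree_edge y) x) (pjoin (f y) (edge_path (tree_edge y) y)) s" for f
      using as y(2) by (simp add: item_path_def)
    from pjoin_cases_uniform[OF i(2), where 'a = "('v,'e) point"]
    show thesis
    proof
      assume "\<exists>r\<in>{0..1}. \<forall>p q :: real \<Rightarrow> ('v,'e) point. pjoin p q s = p r"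
      then obtain r where r: "r \<in> {0..1}" "\<forall>p q :: real \<Rightarrow> ('v,'e) point. pjoin p q s = p r" by blast
      then show thesis using as' ep[OF r(1), of x] by (intro that(1)[of "edge_path (tree_edge y) x r"]) auto
    next
      assume "\<exists>r\<in>{0..1}. \<forall>p q :: real \<Rightarrow> ('v,'e) point. pjoin p q s = q r"
      then obtain r where r: "r \<in> {0..1}" "\<forall>p q :: real \<Rightarrow> ('v,'e) point. pjoin p q s = q r" by blast
      from pjoin_cases_uniform[OF r(1), where 'a = "('v,'e) point"]
      show thesis
      proof
        assume "\<exists>u\<in>{0..1}. \<forall>p q :: real \<Rightarrow> ('v,'e) point. pjoin p q r = p u"
        then obtain u where u: "u \<in> {0..1}" "\<forall>p q :: real \<Rightarrow> ('v,'e) point. pjoin p q r = p u" by blast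
        then show thesis using as' r by (intro that(2)[OF y(1), of u]) auto
      next
        assume "\<exists>u\<in>{0..1}. \<forall>p q :: real \<Rightarrow> ('v,'e) point. pjoin p q r = q u"
        then obtain u where u: "u \<in> {0..1}" "\<forall>p q :: real \<Rightarrow> ('v,'e) point. pjoin p q r = q u" by blast
        then show thesis using as' r ep[OF u(1), of y] by (intro that(1)[of "edge_path (tree_edge y) y u"]) auto
      qed
    qed
  qed
qed

text \<open>The approximation descends \<open>n\<close> levels into the recursion and waits at the
  vertices reached there, for the time reserved for the loops above them.\<close>

primrec approx :: "('e \<Rightarrow> int) \<Rightarrow> nat \<Rightarrow> 'v \<Rightarrow> real \<Rightarrow> ('v,'e) point" where
  "approx \<psi> 0 = (\<lambda>x _. Vertex x)"
| "approx \<psi> (Suc n) = assemble \<psi> (approx \<psi> n)"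

text \<open>Meant for times that are handed on for ever: the vertices at which the approximations
  then wait form a branch of the tree, and \<omega> is an end to which this branch leads.\<close>

definition limit_end :: "('e \<Rightarrow> int) \<Rightarrow> 'v \<Rightarrow> real \<Rightarrow> ('v,'e) ray set \<Rightarrow> bool" where
  "limit_end \<psi> x t \<omega> \<longleftrightarrow> \<omega> \<in> ends G \<and> (\<forall>n y. approx \<psi> n x t = Vertex y \<longrightarrow> (\<forall>r\<in>\<omega>. has_tail_in r (up y)))"

definition settles :: "('e \<Rightarrow> int) \<Rightarrow> 'v \<Rightarrow> real \<Rightarrow> ('v,'e) point \<Rightarrow> bool" where
  "settles \<psi> x t p \<longleftrightarrow> (\<exists>N. \<forall>n\<ge>N. approx \<psi> n x t = p)"

text \<open>The pointwise limit of the approximations; a time that never settles is sent to an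
  end.\<close>

definition grand_loop :: "('e \<Rightarrow> int) \<Rightarrow> 'v \<Rightarrow> real \<Rightarrow> ('v,'e) point" where
  "grand_loop \<psi> x t = (if \<exists>p. settles \<psi> x t p then THE p. settles \<psi> x t p else End (SOME \<omega>. limit_end \<psi> x t \<omega>))"

lemma settles_unique: "settles \<psi> x t p \<Longrightarrow> settles \<psi> x t q \<Longrightarrow> p = q"
  unfolding settles_def by (metis max.cobounded1 max.cobounded2)

lemma grand_loop_settles: "settles \<psi> x t p \<Longrightarrow> grand_loop \<psi> x t = p"
  unfolding grand_loop_def using settles_unique by (auto intro!: the_equality)

lemma settles_Suc: "settles \<psi> x t p \<longleftrightarrow> (\<exists>N. \<forall>n\<ge>N. approx \<psi> (Suc n) x t = p)"
proof
  assume "settles \<psi> x t p"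
  then show "\<exists>N. \<forall>n\<ge>N. approx \<psi> (Suc n) x t = p" unfolding settles_def by (meson le_SucI)
next
  assume "\<exists>N. \<forall>n\<ge>N. approx \<psi> (Suc n) x t = p"
  then obtain N where "\<forall>n\<ge>N. approx \<psi> (Suc n) x t = p" by blast
  then have "\<forall>n\<ge>Suc N. approx \<psi> n x t = p" by (metis Suc_le_D Suc_le_mono)
  then show "settles \<psi> x t p" unfolding settles_def by blast
qed

text \<open>Handing a time on to a child shifts the sequence of approximations by one index, which
  changes neither its settling nor its end.\<close>

lemma descend:
  assumes x: "x \<in> verts G" and y: "y \<in> children x" and eq: "\<And>f. assemble \<psi> f x t = f y s"
  shows "settles \<psi> x t p \<longleftrightarrow> settles \<psi> y s p" "grand_loop \<psi> x t = grand_loop \<psi> y s"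
proof -
  have ap: "approx \<psi> (Suc n) x t = approx \<psi> n y s" for n using eq by simp
  show st: "settles \<psi> x t p \<longleftrightarrow> settles \<psi> y s p" for p
    unfolding settles_Suc[of \<psi> x] ap by (simp add: settles_def)
  have lim: "limit_end \<psi> x t \<omega> \<longleftrightarrow> limit_end \<psi> y s \<omega>" for \<omega>
  proof
    assume l: "limit_end \<psi> x t \<omega>"
    show "limit_end \<psi> y s \<omega>"
      using l ap unfolding limit_end_def by metis
  next
    assume l: "limit_end \<psi> y s \<omega>"
    have "has_tail_in r (up z)" if "approx \<psi> n x t = Vertex z" "r \<in> \<omega>" for n z r
    proof (cases n)
      \<comment> \<open>The approximation of index 0 at \<open>x\<close> has no counterpart at
        \<open>y\<close>; it waits at \<open>x\<close>, and \<open>up x\<close> contains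
        \<open>up y\<close>.\<close>
      case 0
      have "approx \<psi> 0 y s = Vertex y" by simp
      then have "has_tail_in r (up y)" using l that(2) unfolding limit_end_def by blast
      moreover have "up y \<subseteq> up x" using children_below[OF y] up_subset by blast
      ultimately show ?thesis using 0 that(1) has_tail_in_mono by simp
    next
      case (Suc m)
      then show ?thesis using l that ap unfolding limit_end_def by metis
    qed
    then show "limit_end \<psi> x t \<omega>" using l unfolding limit_end_def by blast
  qed
  have "settles \<psi> x t = settles \<psi> y s" "limit_end \<psi> x t = limit_end \<psi> y s"
    using st lim by (auto intro!: ext)
  then show "grand_loop \<psi> x t = grand_loop \<psi> y s" unfolding grand_loop_def by (simp only:)
qed

lemma settled:
  assumes eq: "\<And>f. assemble \<psi> f x t = q" shows "settles \<psi> x t q" "grand_loop \<psi> x t = q"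
proof -
  show "settles \<psi> x t q" unfolding settles_Suc using eq by simp
  then show "grand_loop \<psi> x t = q" by (rule grand_loop_settles)
qed

lemma approx_region: "x \<in> verts G \<Longrightarrow> t \<in> {0..1} \<Longrightarrow> approx \<psi> n x t \<in> region x \<and> approx \<psi> n x t \<in> graph_points G"
proof (induction n arbitrary: x t)
  case 0 then show ?case using below_refl by simp
next
  case (Suc n)
  show ?case
    using Suc.prems
  proof (rule assemble_cases[of x t \<psi>])
    fix y s assume y: "y \<in> children x" "s \<in> {0..1}" "\<And>f. assemble \<psi> f x t = f y s"
    have "region y \<subseteq> region x" using children_below[OF y(1)] region_mono by blast
    then show ?thesis using Suc.IH[of y s] y children_below[OF y(1)] by auto
  qed simp
qed

text \<open>If the approximations do not settle, they run along a branch of the tree to an end.\<close>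

lemma limit_end_exists:
  assumes x: "x \<in> verts G" and t: "t \<in> {0..1}" and ns: "\<And>p. \<not> settles \<psi> x t p"
  shows "\<exists>\<omega>. limit_end \<psi> x t \<omega>"
proof -
  \<comment> \<open>A state consists of the vertex in charge and the local time there; since nothing
    settles, dependent choice follows the given time upwards for ever.\<close>
  define P where "P n a \<longleftrightarrow> fst a \<in> verts G \<and> snd a \<in> {0..1} \<and> (\<forall>p. \<not> settles \<psi> (fst a) (snd a) p) \<and>
      (n = (0::nat) \<longrightarrow> a = (x, t))" for n a
  define Q where "Q a b \<longleftrightarrow> fst b \<in> children (fst a) \<and> (\<forall>f. assemble \<psi> f (fst a) (snd a) = f (fst b) (snd b))" for a b
  have "\<exists>F. \<forall>n. P n (F n) \<and> Q (F n) (F (Suc n))"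
  proof (rule dependent_nat_choice)
    show "\<exists>a. P 0 a" using x t ns by (auto simp: P_def)
    fix a n assume "P n a"
    then obtain y s where ys: "a = (y, s)" "y \<in> verts G" "s \<in> {0..1}" "\<And>p. \<not> settles \<psi> y s p"
      by (cases a) (auto simp: P_def)
    show "\<exists>b. P (Suc n) b \<and> Q a b"
    proof (rule assemble_cases[OF ys(2,3), of \<psi>])
      fix q assume "\<And>f. assemble \<psi> f y s = q"
      then show ?thesis using settled(1) ys(4) by blast
    next
      fix z u assume z: "z \<in> children y" "u \<in> {0..1}" "\<And>f. assemble \<psi> f y s = f z u"
      then show ?thesis
        using ys descend(1)[OF ys(2) z(1) z(3)] children_below[OF z(1)]
        by (intro exI[of _ "(z, u)"]) (auto simp: P_def Q_def)
    qed
  qed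
  then obtain F where FP: "\<And>n. P n (F n)" and FQ: "\<And>n. Q (F n) (F (Suc n))" by blast
  have F0: "F 0 = (x, t)" using FP[of 0] by (simp add: P_def)
  define Y where "Y n = fst (F n)" for n
  define S where "S n = snd (F n)" for n
  have Y: "Y n \<in> verts G" "Y (Suc n) \<in> children (Y n)" "\<And>f. assemble \<psi> f (Y n) (S n) = f (Y (Suc n)) (S (Suc n))" for n
    using FP[of n] FQ[of n] by (auto simp: Y_def S_def P_def Q_def)
  have ap: "approx \<psi> (n + k) (Y m) (S m) = approx \<psi> k (Y (m + n)) (S (m + n))" for n k m
  proof (induction n arbitrary: m)
    case (Suc n)
    have "approx \<psi> (Suc n + k) (Y m) (S m) = approx \<psi> (n + k) (Y (Suc m)) (S (Suc m))" using Y(3) by simp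
    then show ?case using Suc[of "Suc m"] by simp
  qed simp
  have apY: "approx \<psi> n x t = Vertex (Y n)" for n
    using ap[of n 0 0] by (simp add: Y_def S_def F0)
  have hY: "height (Y n) = height x + n" for n
  proof (induction n)
    case (Suc n) then show ?case using children_below[OF Y(2)[of n]] by simp
  qed (simp add: Y_def F0)
  have bY: "n \<le> m \<Longrightarrow> below (Y n) (Y m)" for n m
  proof (induction m)
    case (Suc m)
    show ?case
    proof (cases "n = Suc m")
      case True then show ?thesis using below_refl[OF Y(1)] by simp
    next
      case False
      then show ?thesis using Suc below_trans[OF _ conjunct1[OF children_below[OF Y(2)[of m]]]] by simp
    qed
  qed (use below_refl[OF Y(1)] in simp)
  define r where "r = (Y, \<lambda>n. tree_edge (Y (Suc n)))"
  have "inj Y" by (rule injI) (metis hY add_left_cancel)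
  moreover have "joins (tree_edge (Y (Suc n))) (Y n) (Y (Suc n))" for n by (rule children_joins[OF Y(2)])
  ultimately have r: "is_ray G r" using Y(1) unfolding is_ray_def r_def joins_def by (auto simp: doubleton_eq_iff)
  have tail: "has_tail_in r (up (Y n))" for n
    unfolding has_tail_in_def r_def using bY[of n] by (auto simp: up_def)
  let ?\<omega> = "ray_rel G `` {r}"
  have "has_tail_in r' (up (Y n))" if "r' \<in> ?\<omega>" for r' n
  proof (rule ray_rel_same_tail[OF _ _ _ up_component[OF Y(1)[of n]] tail])
    show "(r, r') \<in> ray_rel G" using that by simp
    show "finite {z. below z (Y n) \<and> z \<noteq> Y n}" using finite_below[of "Y n"] by simp
    show "{z. below z (Y n) \<and> z \<noteq> Y n} \<subseteq> verts G" using below_verts by auto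
  qed
  then have "limit_end \<psi> x t ?\<omega>" unfolding limit_end_def using ray_class_end[OF r] apY by auto
  then show ?thesis by blast
qed

lemma grand_loop_limit:
  assumes "x \<in> verts G" "t \<in> {0..1}" "\<And>p. \<not> settles \<psi> x t p"
  obtains \<omega> where "grand_loop \<psi> x t = End \<omega>" "limit_end \<psi> x t \<omega>"
  using someI_ex[OF limit_end_exists[OF assms]] assms(3) by (auto simp: grand_loop_def)

lemma grand_loop_region:
  assumes x: "x \<in> verts G" and t: "t \<in> {0..1}" shows "grand_loop \<psi> x t \<in> region x"
proof (cases "\<exists>p. settles \<psi> x t p")
  case True
  then obtain p N where "settles \<psi> x t p" "approx \<psi> N x t = p" unfolding settles_def by blast
  then show ?thesis using grand_loop_settles approx_region[OF assms, of \<psi> N] by metis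
next
  case False
  then obtain \<omega> where \<omega>: "grand_loop \<psi> x t = End \<omega>" "limit_end \<psi> x t \<omega>" using grand_loop_limit[OF assms] by blast
  have "approx \<psi> 0 x t = Vertex x" by simp
  then have "\<omega> \<in> ends G \<and> (\<forall>r\<in>\<omega>. has_tail_in r (up x))" using \<omega>(2) unfolding limit_end_def by blast
  then show ?thesis using \<omega>(1) by simp
qed

text \<open>The fixed point equation. It gives access to the windings of a loop that is only defined
  pointwise.\<close>

lemma grand_loop_unfold:
  assumes x: "x \<in> verts G" and t: "t \<in> {0..1}"
  shows "grand_loop \<psi> x t = assemble \<psi> (grand_loop \<psi>) x t"
proof (rule assemble_cases[OF assms, of \<psi>])
  fix q assume "\<And>f. assemble \<psi> f x t = q"
  then show ?thesis using settled(2)[of \<psi> x t q] by simp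
next
  fix y s assume y: "y \<in> children x" "s \<in> {0..1}" "\<And>f. assemble \<psi> f x t = f y s"
  show ?thesis using descend(2)[OF x y(1) y(3)] y(3) by simp
qed

lemma grand_loop_ends: "x \<in> verts G \<Longrightarrow> grand_loop \<psi> x 0 = Vertex x \<and> grand_loop \<psi> x 1 = Vertex x"
  by (simp add: grand_loop_unfold assemble_ends)

text \<open>The approximation can be wrong only while it waits, and then the true loop remains in
  the region above the waiting place. This control is uniform in \<open>t\<close> and yields
  continuity.\<close>

lemma grand_loop_approx:
  assumes "x \<in> verts G" "t \<in> {0..1}"
  shows "grand_loop \<psi> x t = approx \<psi> n x t \<or>
    (\<exists>y. y \<in> verts G \<and> height y = height x + n \<and> approx \<psi> n x t = Vertex y \<and> grand_loop \<psi> x t \<in> region y)"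
  using assms
proof (induction n arbitrary: x t)
  case 0 then show ?case using grand_loop_region by simp
next
  case (Suc n)
  show ?case
    using Suc.prems
  proof (rule assemble_cases[of x t \<psi>])
    fix q assume "\<And>f. assemble \<psi> f x t = q"
    then show ?thesis using settled(2)[of \<psi> x t q] by simp
  next
    fix y s assume y: "y \<in> children x" "s \<in> {0..1}" "\<And>f. assemble \<psi> f x t = f y s"
    have "grand_loop \<psi> x t = grand_loop \<psi> y s" "approx \<psi> (Suc n) x t = approx \<psi> n y s"
      using descend(2)[OF Suc.prems(1) y(1) y(3)] y(3) by simp_all
    then show ?thesis using Suc.IH[of y s] children_below[OF y(1)] y(2) by simp
  qed
qed

section \<open>Continuity of the limit loop\<close>

lemma approx_path: "x \<in> verts G \<Longrightarrow> pathin (freudenthal G) (approx \<psi> n x) \<and> approx \<psi> n x 0 = Vertex x \<and> approx \<psi> n x 1 = Vertex x"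
proof (induction n arbitrary: x)
  case 0 then show ?case by (simp add: pathin_def topspace_freudenthal)
next
  case (Suc n)
  have "pathin (freudenthal G) (assemble \<psi> (approx \<psi> n) x)"
    by (rule assemble_path[OF Suc.prems]) (use Suc.IH children_below in blast)
  then show ?case by (simp add: assemble_ends)
qed

text \<open>Any set of vertices is closed in the 1-complex, since it meets each closed edge in at
  most the two ends.\<close>

lemma openin_minus_vertices:
  assumes "openin (graph_topology G) U" shows "openin (graph_topology G) (U - Vertex ` A)"
  unfolding openin_graph_topology
proof (intro conjI ballI)
  show "U - Vertex ` A \<subseteq> graph_points G" using assms by (auto simp: openin_graph_topology)
  fix e assume e: "e \<in> arcs G"
  have "{t \<in> {0..1}. theta G e t \<in> U - Vertex ` A} = {t \<in> {0..1}. theta G e t \<in> U} \<inter>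
      ({0..1} \<inter> - ((if tail G e \<in> A then {0} else {}) \<union> (if head G e \<in> A then {1} else {})))"
    by (auto simp: theta_def)
  moreover have "openin (top_of_set {0..1}) {t \<in> {0..1}. theta G e t \<in> U}"
    using assms e by (simp add: openin_graph_topology)
  moreover have "openin (top_of_set {0..1}) ({0..1::real} \<inter> - ((if tail G e \<in> A then {0} else {}) \<union> (if head G e \<in> A then {1} else {})))"
    by (rule openin_open_Int) (auto intro!: open_Compl)
  ultimately show "openin (top_of_set {0..1}) {t \<in> {0..1}. theta G e t \<in> U - Vertex ` A}"
    by (simp add: openin_Int)
qed

lemma openin_edge_nbhd:
  assumes "A \<subseteq> verts G"
  shows "openin (graph_topology G) (Vertex ` A \<union> (\<Union>e\<in>{e \<in> arcs G. tail G e \<in> A \<or> head G e \<in> A}. open_edge G e))"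
    (is "openin _ ?O")
  unfolding openin_graph_topology
proof (intro conjI ballI)
  show "?O \<subseteq> graph_points G" using assms by (auto simp: graph_points_def)
  fix e assume e: "e \<in> arcs G"
  define W where "W = ?O"
  have iff: "theta G e t \<in> W \<longleftrightarrow> t < 1 \<and> tail G e \<in> A \<or> t > 0 \<and> head G e \<in> A" if "t \<in> {0..1}" for t
    using that by (rule theta_cases) (use e in \<open>auto simp: W_def\<close>)
  have "{t \<in> {0..1}. theta G e t \<in> W} =
    {0..1} \<inter> ((if tail G e \<in> A then {..<1} else {}) \<union> (if head G e \<in> A then {0<..} else {}))"
    using iff by auto
  also have "openin (top_of_set {0..1}) \<dots>" by (rule openin_open_Int) auto
  finally show "openin (top_of_set {0..1}) {t \<in> {0..1}. theta G e t \<in> ?O}" unfolding W_def .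
qed

text \<open>\<open>up y\<close> is connected, avoids \<open>S\<close> and shares a vertex with
  \<open>C\<close>, namely on a ray of \<omega> with tails in both; hence it is contained in
  \<open>C\<close>, and so is everything attached to it.\<close>

lemma end_nbhd_contains_up:
  assumes C: "C \<in> components_avoiding G S" "\<omega> \<in> ends G" "\<forall>r\<in>\<omega>. has_tail_in r C"
    and y: "\<forall>r\<in>\<omega>. has_tail_in r (up y)" "up y \<inter> S = {}"
  shows "Vertex ` up y \<union> (\<Union>e\<in>{e \<in> arcs G. tail G e \<in> up y \<or> head G e \<in> up y}. open_edge G e) \<union> region y \<subseteq> end_nbhd G S C"
proof -
  obtain r where r: "r \<in> \<omega>" using end_nonempty[OF C(2)] by blast
  then obtain n m where "\<forall>k\<ge>n. fst r k \<in> C" "\<forall>k\<ge>m. fst r k \<in> up y"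
    using C(3) y(1) unfolding has_tail_in_def by blast
  then have v: "fst r (max n m) \<in> C" "fst r (max n m) \<in> up y" by auto
  have sub: "up y \<subseteq> verts G - S" using y(2) up_verts by blast
  have "linked (up y) y \<subseteq> linked (verts G - S) y" by (rule linked_mono[OF sub])
  then have upl: "up y \<subseteq> linked (verts G - S) y" using up_linked by blast
  then have "linked (verts G - S) (fst r (max n m)) = linked (verts G - S) y" using linked_eq v(2) by blast
  then have upC: "up y \<subseteq> C" using upl component_linked[OF C(1) v(1)] by simp
  have edge: "open_edge G e \<subseteq> end_nbhd G S C" if e: "e \<in> arcs G" "tail G e \<in> up y \<or> head G e \<in> up y" for e
  proof
    fix p assume "p \<in> open_edge G e"
    then obtain t where t: "0 < t" "t < 1" "p = theta G e t" by (auto simp: open_edge_def)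
    then show "p \<in> end_nbhd G S C" using theta_in_end_nbhd[OF e(1) _ C(1), of t] e(2) upC by auto
  qed
  show ?thesis
  proof (intro Un_least)
    show "Vertex ` up y \<subseteq> end_nbhd G S C" using upC by (auto simp: end_nbhd_def)
    show "(\<Union>e\<in>{e \<in> arcs G. tail G e \<in> up y \<or> head G e \<in> up y}. open_edge G e) \<subseteq> end_nbhd G S C"
      using edge by blast
    show "region y \<subseteq> end_nbhd G S C"
    proof
      fix p assume p: "p \<in> region y"
      show "p \<in> end_nbhd G S C"
      proof (cases p)
        case (Vertex v) then show ?thesis using p upC by (auto simp: end_nbhd_def up_def)
      next
        case (Inner e t) then show ?thesis using p edge[of e] by (auto simp: up_def)
      next
        case (End \<omega>')
        then have w: "\<omega>' \<in> ends G" "\<forall>r\<in>\<omega>'. has_tail_in r (up y)" using p by simp_all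
        then have "\<forall>r\<in>\<omega>'. has_tail_in r C" using has_tail_in_mono upC by blast
        then show ?thesis using w(1) End by (simp add: end_nbhd_def)
      qed
    qed
  qed
qed

text \<open>The loop is compared with one continuous approximation, chosen according to the point.
  At a point of the graph its level is so high that the two agree nearby; at an end it exceeds the
  heights in \<open>S\<close>, and then the loop stays in the neighbourhood whenever the
  approximation is close to \<open>up y\<close>.\<close>

lemma grand_loop_path:
  assumes x: "x \<in> verts G" shows "pathin (freudenthal G) (grand_loop \<psi> x)"
  unfolding pathin_def freudenthal_def
proof (rule continuous_on_generated_topo)
  let ?B = "{U. openin (graph_topology G) U} \<union>
      {end_nbhd G S C | S C \<omega>. finite S \<and> S \<subseteq> verts G \<and> \<omega> \<in> ends G \<and>
         C \<in> components_avoiding G S \<and> (\<forall>r\<in>\<omega>. has_tail_in r C)}"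
  let ?g = "grand_loop \<psi> x"
  have top: "?g t \<in> topspace (freudenthal G)" if "t \<in> {0..1}" for t
    using grand_loop_region[OF x that, of \<psi>] below_verts unfolding topspace_freudenthal by (cases "?g t") auto
  have tb: "topspace (freudenthal G) = \<Union> ?B" by (simp only: freudenthal_def topology_generated_by_topspace)
  show "?g ` topspace (top_of_set {0..1}) \<subseteq> \<Union> ?B"
    unfolding tb[symmetric] using top by auto
  fix U assume U: "U \<in> ?B"
  have Uo: "openin (freudenthal G) U"
    unfolding freudenthal_def using U by (rule topology_generated_by_Basis)
  have pre: "openin (top_of_set {0..1}) {t \<in> {0..1}. approx \<psi> n x t \<in> W}" if "openin (graph_topology G) W" for n W
    using openin_continuous_map_preimage[OF conjunct1[OF approx_path[OF x, of \<psi> n], unfolded pathin_def] openin_freudenthal_graph[OF that]]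
    by simp
  show "openin (top_of_set {0..1}) (?g -` U \<inter> topspace (top_of_set {0..1}))"
  proof (subst openin_subopen, intro ballI)
    fix t0 assume "t0 \<in> ?g -` U \<inter> topspace (top_of_set {0..1})"
    then have t0: "t0 \<in> {0..1}" "?g t0 \<in> U" by auto
    show "\<exists>T. openin (top_of_set {0..1}) T \<and> t0 \<in> T \<and> T \<subseteq> ?g -` U \<inter> topspace (top_of_set {0..1})"
    proof (cases "?g t0 \<in> graph_points G")
      case True
      \<comment> \<open>No region of a vertex higher than \<open>h\<close> contains the point: an
        inner point of an edge lies in a region only together with both ends of the edge, so the
        height of the tail is a bound.\<close>
      define h where "h = (case ?g t0 of Vertex v \<Rightarrow> height v | Inner e _ \<Rightarrow> height (tail G e) | End _ \<Rightarrow> 0)"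
      have small: "?g t0 \<notin> region y" if "height y = height x + Suc h" for y
      proof
        assume "?g t0 \<in> region y"
        then have "height y \<le> h" using True below_height unfolding h_def by (cases "?g t0") auto
        then show False using that by simp
      qed
      let ?A = "{v. height v = height x + Suc h}"
      \<comment> \<open>While the approximation is inside \<open>?W\<close> it is not waiting at a
        vertex of this height, so there it agrees with the loop.\<close>
      let ?W = "U \<inter> graph_points G - Vertex ` ?A"
      have W: "openin (graph_topology G) ?W" by (rule openin_minus_vertices[OF openin_graph_part[OF Uo]])
      have eq0: "?g t0 = approx \<psi> (Suc h) x t0"
        using grand_loop_approx[OF x t0(1), of \<psi> "Suc h"] small by blast
      have "?g t0 \<notin> Vertex ` ?A" by (auto simp: h_def)
      then have "t0 \<in> {t \<in> {0..1}. approx \<psi> (Suc h) x t \<in> ?W}" using t0 True eq0 by simp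
      moreover have "{t \<in> {0..1}. approx \<psi> (Suc h) x t \<in> ?W} \<subseteq> ?g -` U \<inter> topspace (top_of_set {0..1})"
      proof
        fix t assume t: "t \<in> {t \<in> {0..1}. approx \<psi> (Suc h) x t \<in> ?W}"
        then have t': "t \<in> {0..1}" "approx \<psi> (Suc h) x t \<in> U" "approx \<psi> (Suc h) x t \<notin> Vertex ` ?A" by auto
        have "?g t = approx \<psi> (Suc h) x t"
          using grand_loop_approx[OF x t'(1), of \<psi> "Suc h"] t'(3) by auto
        then show "t \<in> ?g -` U \<inter> topspace (top_of_set {0..1})" using t' by simp
      qed
      ultimately show ?thesis using pre[OF W, of "Suc h"] by blast
    next
      case False
      then obtain \<omega> where \<omega>: "?g t0 = End \<omega>" "\<omega> \<in> ends G" using top[OF t0(1)] by (auto simp: topspace_freudenthal)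
      have "\<not> openin (graph_topology G) U" using t0(2) False by (auto simp: openin_graph_topology)
      then obtain S C where SC: "U = end_nbhd G S C" "finite S" "C \<in> components_avoiding G S" using U by blast
      have tailC: "\<forall>r\<in>\<omega>. has_tail_in r C" using t0(2) \<omega>(1) SC(1) by (auto simp: end_nbhd_def)
      \<comment> \<open>The waiting vertex \<open>y\<close> found below then has greater height than
        every vertex of \<open>S\<close>, so \<open>up y\<close> avoids \<open>S\<close>.\<close>
      obtain n where n: "\<And>v. v \<in> S \<Longrightarrow> height v < n"
        using finite_nat_bounded[OF finite_imageI[OF SC(2), of height]] by auto
      have "?g t0 \<noteq> approx \<psi> n x t0" using approx_region[OF x t0(1), of \<psi> n] False by auto
      then obtain y where y: "y \<in> verts G" "height y = height x + n" "approx \<psi> n x t0 = Vertex y" "?g t0 \<in> region y"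
        using grand_loop_approx[OF x t0(1), of \<psi> n] by blast
      have tail_y: "\<forall>r\<in>\<omega>. has_tail_in r (up y)" using y(4) \<omega>(1) by simp
      have "up y \<inter> S = {}" using n y(2) below_height by (fastforce simp: up_def)
      note sub = end_nbhd_contains_up[OF SC(3) \<omega>(2) tailC tail_y this]
      let ?W = "Vertex ` up y \<union> (\<Union>e\<in>{e \<in> arcs G. tail G e \<in> up y \<or> head G e \<in> up y}. open_edge G e)"
      have W: "openin (graph_topology G) ?W" by (rule openin_edge_nbhd[OF up_verts])
      have "t0 \<in> {t \<in> {0..1}. approx \<psi> n x t \<in> ?W}" using t0(1) y(1,3) below_refl by (auto simp: up_def)
      moreover have "{t \<in> {0..1}. approx \<psi> n x t \<in> ?W} \<subseteq> ?g -` U \<inter> topspace (top_of_set {0..1})"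
      proof
        fix t assume "t \<in> {t \<in> {0..1}. approx \<psi> n x t \<in> ?W}"
        then have t: "t \<in> {0..1}" "approx \<psi> n x t \<in> ?W" by auto
        have "?g t \<in> U"
          using grand_loop_approx[OF x t(1), of \<psi> n]
        proof (elim disjE exE conjE)
          assume "?g t = approx \<psi> n x t"
          then show ?thesis using t(2) sub SC(1) by auto
        next
          fix z assume z: "approx \<psi> n x t = Vertex z" "?g t \<in> region z"
          then have "below y z" using t(2) by (auto simp: up_def)
          then show ?thesis using z(2) region_mono sub SC(1) by blast
        qed
        then show "t \<in> ?g -` U \<inter> topspace (top_of_set {0..1})" using t(1) by simp
      qed
      ultimately show ?thesis using pre[OF W, of n] by blast
    qed
  qed
qed

section \<open>Windings of the limit loop\<close>

lemma grand_loop_winding_zero: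
  assumes x: "x \<in> verts G" and e: "e \<in> arcs G" "\<not> below x (low e)"
  shows "edge_winding e (grand_loop \<psi> x) = 0"
proof (rule edge_winding_outside)
  fix t :: real assume t: "t \<in> {0..1}"
  show "grand_loop \<psi> x t \<notin> open_edge G e"
    using grand_loop_region[OF x t, of \<psi>] e by (auto simp: open_edge_eq low_def split: if_splits)
qed

text \<open>As \<open>e\<close> is a chord, the ways along tree edges to the children and back
  contribute nothing; what remains are the loops at the children and the copies of the fundamental
  cycle of \<open>e\<close>.\<close>

lemma grand_loop_winding_step:
  assumes x: "x \<in> verts G" and e: "e \<in> arcs G" "e \<notin> tree_edges"
  shows "edge_winding e (grand_loop \<psi> x) =
    (\<Sum>y\<in>children x. edge_winding e (grand_loop \<psi> y)) + (if low e = x then of_int (\<psi> e) else 0)"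
proof -
  let ?f = "grand_loop \<psi>" and ?w = "\<lambda>i. edge_winding e (item_path (grand_loop \<psi>) x i)"
  have f: "pathin (freudenthal G) (?f y) \<and> ?f y 0 = Vertex y \<and> ?f y 1 = Vertex y" if "y \<in> children x" for y
    using children_below[OF that] grand_loop_path grand_loop_ends by blast
  have child: "?w (Inr y) = edge_winding e (?f y)" if y: "y \<in> children x" for y
  proof -
    note j = children_joins[OF y]
    have te: "tree_edge y \<in> arcs G" using j by (simp add: joins_def)
    have "tree_edge y \<in> tree_edges" using y by (auto simp: children_def tree_edges_def)
    then have ne: "e \<noteq> tree_edge y" using e(2) by blast
    let ?d = "edge_path (tree_edge y) y"
    have d: "pathin (freudenthal G) ?d" "?f y 1 = ?d 0"
      using pathin_edge_path[OF te] edge_path_ends(1)[OF joins_sym[OF j]] f[OF y] by auto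
    have fd: "pathin (freudenthal G) (pjoin (?f y) ?d)" by (rule pathin_pjoin[of _ "?f y" ?d, OF _ d]) (use f[OF y] in blast)
    have "?w (Inr y) = edge_winding e (edge_path (tree_edge y) x) + (edge_winding e (?f y) + edge_winding e ?d)"
      unfolding item_path_def sum.case
      by (subst edge_winding_pjoin[OF pathin_edge_path[OF te] fd _ e(1)])
        (use edge_path_ends(2)[OF j] f[OF y] edge_winding_pjoin[of "?f y" ?d, OF _ d e(1)] in auto)
    then show ?thesis
      using edge_winding_edge_path_other[OF j ne] edge_winding_edge_path_other[OF joins_sym[OF j] ne] by simp
  qed
  have chord: "sum_list (map ?w (replicate (nat \<bar>\<psi> c\<bar>) (Inl (fund_cycle (\<psi> c > 0) c)))) = (if c = e then of_int (\<psi> e) else 0)"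
    if c: "c \<in> chords x" for c
  proof -
    have c': "c \<in> arcs G" "c \<notin> tree_edges" using c by (auto simp: chords_def)
    show ?thesis
      using fund_cycle(6)[OF c', of "\<psi> c > 0"] fund_cycle(7)[OF c' e, of "\<psi> c > 0"]
      by (auto simp: sum_list_replicate item_path_def)
  qed
  have const: "?w (Inl (\<lambda>_. Vertex x)) = 0"
    unfolding item_path_def by (simp add: edge_winding_outside)
  have conc: "sum_list (map ?w (concat (map g cs))) = (\<Sum>c\<leftarrow>cs. sum_list (map ?w (g c)))" for g and cs :: "'e list"
    by (induction cs) auto
  have "edge_winding e (?f x) = edge_winding e (assemble \<psi> ?f x)"
    by (rule edge_winding_cong) (rule grand_loop_unfold[OF x])
  also have "\<dots> = sum_list (map (edge_winding e) (map (item_path ?f x) (items \<psi> x)))"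
    unfolding assemble_def
    by (rule edge_winding_cat[where a = "Vertex x", OF _ _ e(1)])
      (use item_path_ends[of _ \<psi> x ?f] item_path_path[OF x _ f] in auto)
  also have "\<dots> = sum_list (map ?w (items \<psi> x))" by (simp add: comp_def)
  also have "\<dots> = (\<Sum>y\<leftarrow>some_list (children x). ?w (Inr y)) +
      (\<Sum>c\<leftarrow>some_list (chords x). sum_list (map ?w (replicate (nat \<bar>\<psi> c\<bar>) (Inl (fund_cycle (\<psi> c > 0) c)))))"
    unfolding items_def list.map sum_list.Cons map_append sum_list_append conc const by (simp add: comp_def)
  also have "(\<Sum>y\<leftarrow>some_list (children x). ?w (Inr y)) = (\<Sum>y\<in>children x. ?w (Inr y))"
    using some_list[OF finite_children[of x]] by (simp add: sum_list_distinct_conv_sum_set)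
  also have "\<dots> = (\<Sum>y\<in>children x. edge_winding e (?f y))" by (rule sum.cong) (use child in auto)
  also have "(\<Sum>c\<leftarrow>some_list (chords x). sum_list (map ?w (replicate (nat \<bar>\<psi> c\<bar>) (Inl (fund_cycle (\<psi> c > 0) c)))))
      = (\<Sum>c\<in>chords x. sum_list (map ?w (replicate (nat \<bar>\<psi> c\<bar>) (Inl (fund_cycle (\<psi> c > 0) c)))))"
    using some_list[OF finite_chords[of x]] by (simp add: sum_list_distinct_conv_sum_set)
  also have "\<dots> = (\<Sum>c\<in>chords x. if c = e then of_int (\<psi> e) else 0)" by (rule sum.cong) (use chord in auto)
  also have "\<dots> = (if low e = x then of_int (\<psi> e) else 0)"
    using e finite_chords[of x] by (simp add: chords_def)
  finally show ?thesis .
qed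

text \<open>The chord is paid for at its lower end only. The induction follows the branch from
  \<open>x\<close> to that vertex; the loops at all other children stay in regions that do not
  contain \<open>e\<close>.\<close>

lemma grand_loop_winding:
  assumes x: "x \<in> verts G" and e: "e \<in> arcs G" "e \<notin> tree_edges" "below x (low e)"
  shows "edge_winding e (grand_loop \<psi> x) = of_int (\<psi> e)"
  using x e(3)
proof (induction "height (low e) - height x" arbitrary: x rule: less_induct)
  case (less x)
  have zero: "edge_winding e (grand_loop \<psi> y) = 0" if "y \<in> children x" "\<not> below y (low e)" for y
    using grand_loop_winding_zero[OF _ e(1) that(2)] children_below[OF that(1)] by blast
  show ?case
  proof (cases "low e = x")
    case True
    have "\<not> below y (low e)" if "y \<in> children x" for y
      using children_below[OF that] below_height[of y x] True by auto
    then show ?thesis using grand_loop_winding_step[OF less.prems(1) e(1,2), of \<psi>] zero True by simp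
  next
    case False
    let ?z = "low e"
    have hx: "height x < height ?z" using less.prems(2) False below_same_height below_height le_neq_implies_less by blast
    have z: "?z \<in> verts G" using below_verts[OF less.prems(2)] by simp
    define y where "y = branch ?z (Suc (height x))"
    have hy: "height y = Suc (height x)" unfolding y_def by (rule height_branch[OF z]) (use hx in simp)
    have yz: "below y ?z" unfolding y_def by (rule branch_below[OF z]) (use hx in simp)
    have yv: "y \<in> verts G" using below_verts[OF yz] by simp
    have yr: "y \<noteq> root" using hy height_root by auto
    have "branch y (height x) = branch ?z (height x)"
      unfolding y_def using node_branch[OF z, of "Suc (height x)" "height x"] hx by simp
    then have "parent y = x" using less.prems(2) by (simp add: parent_def hy below_def)
    then have yc: "y \<in> children x" using yv yr by (simp add: children_def)
    have other: "edge_winding e (grand_loop \<psi> y') = 0" if y': "y' \<in> children x - {y}" for y'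
    proof (rule zero)
      show "\<not> below y' ?z"
      proof
        assume "below y' ?z"
        then have "y' = y" using children_below[of y' x] y' by (auto simp: below_def y_def)
        then show False using y' by simp
      qed
    qed (use y' in blast)
    have "(\<Sum>y'\<in>children x. edge_winding e (grand_loop \<psi> y')) = edge_winding e (grand_loop \<psi> y)"
      using sum.mono_neutral_right[OF finite_children, of "{y}" x "\<lambda>y'. edge_winding e (grand_loop \<psi> y')"] yc other by simp
    also have "\<dots> = of_int (\<psi> e)" by (rule less.hyps[OF _ yv yz]) (use hy hx in simp)
    finally show ?thesis using grand_loop_winding_step[OF less.prems(1) e(1,2), of \<psi>] False by simp
  qed
qed

text \<open>The chords are right by construction, and the tree edges follow since the windings of a
  loop are balanced, too.\<close>

lemma loop_with_windings:
  assumes \<phi>: "\<phi> \<in> balanced_functions"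
  obtains p v where "pathin (freudenthal G) p" "v \<in> verts G" "p 0 = Vertex v" "p 1 = Vertex v"
    "\<And>e. e \<in> arcs G \<Longrightarrow> edge_winding e p = of_int (\<phi> (natural_orientation G e))"
proof -
  define \<psi> where "\<psi> e = \<phi> (natural_orientation G e)" for e
  let ?p = "grand_loop \<psi> root"
  have p: "pathin (freudenthal G) ?p" "?p 0 = Vertex root" "?p 1 = Vertex root"
    using grand_loop_path[OF root_in] grand_loop_ends[OF root_in] by auto
  have "edge_winding e ?p = of_int (\<phi> (natural_orientation G e))" if e: "e \<in> arcs G" for e
  proof (rule balanced_eqI[where \<psi> = "\<lambda>e. edge_winding e ?p" and \<phi> = "\<lambda>e. of_int (\<phi> (natural_orientation G e))", OF _ _ _ e])
    show "balanced (\<lambda>e. edge_winding e ?p)" by (rule balanced_loop) (simp_all add: p)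
    show "balanced (\<lambda>e. real_of_int (\<phi> (natural_orientation G e)))" using \<phi> by (simp add: balanced_functions_def)
    fix e assume e: "e \<in> arcs G" "e \<notin> tree_edges"
    have "low e \<in> verts G" using low_high(2)[OF e(1)] below_verts by blast
    then show "edge_winding e ?p = of_int (\<phi> (natural_orientation G e))"
      using grand_loop_winding[OF root_in e root_below, of \<psi>] by (simp add: \<psi>_def)
  qed
  with p root_in show thesis by (intro that[of ?p root])
qed

end

section \<open>Chopping chains at a star\<close>

lemma homology_contractible:
  assumes "contractible_space Y" "singular_relcycle 1 Y {} z"
  shows "singular_relboundary 1 Y {} z"
proof -
  have "trivial_group (homology_group 1 Y)"
    using trivial_reduced_homology_group_contractible_space[OF assms(1), of 1] by (simp add: un_reduced_homology_group)
  then have "carrier (homology_group 1 Y) = {\<one>\<^bsub>homology_group 1 Y\<^esub>}" by (simp add: trivial_group_def)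
  moreover have "homologous_rel_set 1 Y {} z \<in> carrier (homology_group 1 Y)"
    using carrier_relative_homology_group[of 1 Y "{}"] assms(2) by auto
  ultimately have "homologous_rel_set 1 Y {} z = singular_relboundary_set 1 Y {}"
    using one_relative_homology_group[of 1 Y "{}"] by simp
  moreover have "z \<in> homologous_rel_set 1 Y {} z" by simp
  ultimately show ?thesis by blast
qed

lemma boundary_extend: "chain_boundary (Suc n) c = frag_extend (\<lambda>\<tau>. chain_boundary (Suc n) (frag_of \<tau>)) c"
  by (simp add: chain_boundary_def)

context lf_graph
begin

text \<open>Finite chains inside \<open>Y\<close> that may occur as part of a good family. The
  condition on vertices is a real restriction, as a path in \<open>Y\<close> may start at or run
  through an end.\<close>

definition gchain :: "nat \<Rightarrow> ('v,'e) point set \<Rightarrow> ('v,'e) point chain \<Rightarrow> bool" where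
  "gchain n Y c \<longleftrightarrow> (\<forall>\<tau>\<in>Poly_Mapping.keys c. singular_simplex n (freudenthal G) \<tau> \<and>
     \<tau> ` standard_simplex n \<subseteq> Y \<and> (\<forall>k\<le>n. simplicial_vertex k \<tau> \<in> graph_points G))"

lemma gchain_0 [simp]: "gchain n Y 0"
  by (simp add: gchain_def)

lemma gchain_of: "gchain n Y (frag_of \<tau>) \<longleftrightarrow> singular_simplex n (freudenthal G) \<tau> \<and>
     \<tau> ` standard_simplex n \<subseteq> Y \<and> (\<forall>k\<le>n. simplicial_vertex k \<tau> \<in> graph_points G)"
  by (simp add: gchain_def)

lemma gchain_add: "gchain n Y a \<Longrightarrow> gchain n Y b \<Longrightarrow> gchain n Y (a + b)"
  using Poly_Mapping.keys_add[of a b] unfolding gchain_def by blast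

lemma gchain_minus: "gchain n Y a \<Longrightarrow> gchain n Y (- a)"
  by (simp add: gchain_def)

lemma gchain_cmul: "gchain n Y a \<Longrightarrow> gchain n Y (frag_cmul k a)"
  using keys_cmul[of k a] unfolding gchain_def by blast

lemma gchain_sum: "(\<And>i. i \<in> I \<Longrightarrow> gchain n Y (f i)) \<Longrightarrow> gchain n Y (sum f I)"
  by (induction I rule: infinite_finite_induct) (auto intro: gchain_add)

lemma gchain_extend: "(\<And>x. x \<in> Poly_Mapping.keys c \<Longrightarrow> gchain n Y (f x)) \<Longrightarrow> gchain n Y (frag_extend f c)"
  unfolding frag_extend_def by (intro gchain_sum gchain_cmul)

lemma gchain_mono: "gchain n Y c \<Longrightarrow> Y \<subseteq> Y' \<Longrightarrow> gchain n Y' c"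
  unfolding gchain_def by blast

lemma gchain_singular: "gchain n Y c \<Longrightarrow> singular_chain n (freudenthal G) c"
  by (auto simp: gchain_def singular_chain_def)

lemma gchain_subtopology: "gchain n Y c \<Longrightarrow> singular_chain n (subtopology (freudenthal G) Y) c"
  by (auto simp: gchain_def singular_chain_def singular_simplex_subtopology)

lemma gchain_of_subtopology:
  assumes "singular_chain n (subtopology (freudenthal G) Y) c" "Y \<subseteq> graph_points G"
  shows "gchain n Y c"
  unfolding gchain_def
proof
  fix \<tau> assume "\<tau> \<in> Poly_Mapping.keys c"
  then have "singular_simplex n (subtopology (freudenthal G) Y) \<tau>"
    using assms(1) unfolding singular_chain_def by blast
  then have \<tau>: "singular_simplex n (freudenthal G) \<tau>" "\<tau> ` standard_simplex n \<subseteq> Y"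
    unfolding singular_simplex_subtopology by blast+
  then show "singular_simplex n (freudenthal G) \<tau> \<and> \<tau> ` standard_simplex n \<subseteq> Y \<and>
      (\<forall>k\<le>n. simplicial_vertex k \<tau> \<in> graph_points G)"
    using simplicial_vertex_in_image[of _ n \<tau>] assms(2) by blast
qed

lemma gchain_boundary_1:
  assumes "gchain 1 Y c" "\<rho> \<in> Poly_Mapping.keys (chain_boundary 1 c)"
  obtains q where "\<rho> = point_simplex q" "q \<in> Y" "q \<in> graph_points G"
proof -
  have "Poly_Mapping.keys (chain_boundary 1 c) \<subseteq> (\<Union>\<tau>\<in>Poly_Mapping.keys c. Poly_Mapping.keys (chain_boundary 1 (frag_of \<tau>)))"
    unfolding boundary_extend[of 0 c, folded One_nat_def] by (rule keys_frag_extend)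
  then obtain \<tau> where \<tau>: "\<tau> \<in> Poly_Mapping.keys c" "\<rho> \<in> Poly_Mapping.keys (chain_boundary 1 (frag_of \<tau>))"
    using assms(2) by blast
  have "\<rho> = point_simplex (simplex_path \<tau> 0) \<or> \<rho> = point_simplex (simplex_path \<tau> 1)"
    using \<tau>(2) keys_diff[of "frag_of (point_simplex (simplex_path \<tau> 1))" "frag_of (point_simplex (simplex_path \<tau> 0))"]
    unfolding boundary_1 by auto
  moreover have "simplex_path \<tau> t \<in> Y" if "t \<in> {0..1}" for t
    using assms(1) \<tau>(1) that unfolding gchain_def simplex_image by blast
  moreover have "simplex_path \<tau> 0 \<in> graph_points G" "simplex_path \<tau> 1 \<in> graph_points G"
    using assms(1) \<tau>(1) unfolding gchain_def simplicial_vertex_path[symmetric] by auto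
  ultimately show thesis using that by force
qed

lemma point_simplex_bary [simp]: "point_simplex a (bary 0) = a"
  unfolding point_simplex_def standard_simplex_0 by (auto simp: bary_def)

lemma gchain_path_segment:
  assumes p: "pathin (freudenthal G) p" and ab: "0 \<le> a" "a \<le> b" "b \<le> 1"
    and "p a \<in> graph_points G" "p b \<in> graph_points G" and Y: "p ` {a..b} \<subseteq> Y"
  shows "gchain 1 Y (frag_of (path_segment p a b))"
proof -
  have "singular_simplex 1 (freudenthal G) (path_segment p a b)"
    by (rule singular_simplex_path_segment[of "{0..1}"]) (use p ab in \<open>auto simp: pathin_def\<close>)
  moreover have "simplicial_vertex k (path_segment p a b) \<in> graph_points G" if "k \<le> 1" for k
    using that assms(5,6) simplicial_vertex_path[of "path_segment p a b"] by (cases "k = 0") (auto simp: le_Suc_eq)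
  ultimately show ?thesis unfolding gchain_of using path_segment_image[OF ab(2), of p] Y by auto
qed

lemma gchain_triangle:
  assumes p: "pathin (freudenthal G) p" and abc: "0 \<le> a" "a \<le> b" "b \<le> c" "c \<le> 1"
    and g: "p a \<in> graph_points G" "p b \<in> graph_points G" "p c \<in> graph_points G" and Y: "p ` {a..c} \<subseteq> Y"
  shows "gchain 2 Y (frag_of (triangle p a b c))"
proof -
  have "singular_simplex 2 (freudenthal G) (triangle p a b c)"
    by (rule singular_simplex_triangle[of "{0..1}"]) (use p abc in \<open>auto simp: pathin_def\<close>)
  moreover have "triangle p a b c ` standard_simplex 2 \<subseteq> Y"
    using triangle_image[of "{a..c}" a b c p] abc Y by auto
  moreover have "simplicial_vertex k (triangle p a b c) \<in> graph_points G" if k: "k \<le> 2" for k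
  proof -
    have "(\<lambda>j. if j = k then 1 else 0 :: real) \<in> standard_simplex 2" using k by simp
    then have "simplicial_vertex k (triangle p a b c) = p (if k = 0 then a else if k = 1 then b else c)"
      using k by (auto simp: simplicial_vertex_def triangle_def intro!: arg_cong[of _ _ p])
    then show ?thesis using g by auto
  qed
  ultimately show ?thesis unfolding gchain_of by blast
qed

text \<open>The two ranges of distances overlap between 2/3 and 3/4, so any sufficiently short piece
  of a path falls into one of them, and the boundary between near and far pieces lies in the
  overlap.\<close>

definition choppable :: "'v \<Rightarrow> ('v,'e) point set \<Rightarrow> ('v,'e) point chain \<Rightarrow> bool" where
  "choppable v Y c \<longleftrightarrow> (\<exists>A B d. gchain 1 {q \<in> Y. star_dist v q < 3/4} A \<and> gchain 1 {q \<in> Y. star_dist v q > 2/3} B \<and>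
     gchain 2 Y d \<and> c = A + B + chain_boundary 2 d)"

lemma choppable_0: "choppable v Y 0"
  unfolding choppable_def by (intro exI[of _ 0]) simp

lemma choppable_add: "choppable v Y a \<Longrightarrow> choppable v Y b \<Longrightarrow> choppable v Y (a + b)"
proof -
  assume "choppable v Y a" "choppable v Y b"
  then obtain A B d A' B' d' where *: "gchain 1 {q \<in> Y. star_dist v q < 3/4} A" "gchain 1 {q \<in> Y. star_dist v q > 2/3} B"
     "gchain 2 Y d" "a = A + B + chain_boundary 2 d" "gchain 1 {q \<in> Y. star_dist v q < 3/4} A'"
     "gchain 1 {q \<in> Y. star_dist v q > 2/3} B'" "gchain 2 Y d'" "b = A' + B' + chain_boundary 2 d'"
    unfolding choppable_def by blast
  then show ?thesis
    unfolding choppable_def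
    by (intro exI[of _ "A + A'"] exI[of _ "B + B'"] exI[of _ "d + d'"]) (auto intro: gchain_add simp: chain_boundary_add)
qed

lemma choppable_minus: "choppable v Y a \<Longrightarrow> choppable v Y (- a)"
proof -
  assume "choppable v Y a"
  then obtain A B d where *: "gchain 1 {q \<in> Y. star_dist v q < 3/4} A" "gchain 1 {q \<in> Y. star_dist v q > 2/3} B"
     "gchain 2 Y d" "a = A + B + chain_boundary 2 d"
    unfolding choppable_def by blast
  then show ?thesis
    unfolding choppable_def
    by (intro exI[of _ "- A"] exI[of _ "- B"] exI[of _ "- d"]) (auto intro: gchain_minus simp: chain_boundary_minus)
qed

lemma choppable_mono: "choppable v Y a \<Longrightarrow> Y \<subseteq> Y' \<Longrightarrow> choppable v Y' a"
  unfolding choppable_def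
  using gchain_mono[of 1 "{q \<in> Y. star_dist v q < 3/4}" _ "{q \<in> Y'. star_dist v q < 3/4}"]
    gchain_mono[of 1 "{q \<in> Y. star_dist v q > 2/3}" _ "{q \<in> Y'. star_dist v q > 2/3}"] gchain_mono[of 2 Y _ Y'] by blast

lemma star_dist_less_1: "q \<in> topspace (freudenthal G) \<Longrightarrow> star_dist v q < 1 \<Longrightarrow> q \<in> graph_points G"
  by (cases q) (auto simp: star_dist_def topspace_freudenthal)

text \<open>A plain subdivision fails, because cut points must lie in the graph while the far pieces
  may pass through ends. So an interval is classified as entirely far, or as having a chopped middle
  part that begins and ends in the graph, with far remainders on both sides that are left uncut.
  This alternative is stable under joining intervals, and Bolzano's bisection principle takes it
  from short intervals to \<open>{0..1}\<close>.\<close>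

lemma path_choppable:
  assumes p: "pathin (freudenthal G) p" and v: "v \<in> verts G"
    and g: "p 0 \<in> graph_points G" "p 1 \<in> graph_points G"
  shows "choppable v (p ` {0..1}) (frag_of (path_simplex p))"
proof -
  let ?Y = "p ` {0..1}" and ?f = "\<lambda>t. star_dist v (p t)"
  have cont: "continuous_on {0..1} ?f"
    using continuous_map_compose[OF p[unfolded pathin_def] continuous_star_dist[OF v]] by (simp add: comp_def)
  have top: "p t \<in> topspace (freudenthal G)" if "t \<in> {0..1}" for t
    using continuous_map_image_subset_topspace[OF p[unfolded pathin_def]] that by auto
  define far where "far s t \<longleftrightarrow> (\<forall>r. s \<le> r \<and> r \<le> t \<longrightarrow> ?f r > 2/3)" for s t
  define chop where "chop s t \<longleftrightarrow> p s \<in> graph_points G \<and> p t \<in> graph_points G \<and> choppable v ?Y (frag_of (path_segment p s t))" for s t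
  have chop_trans: "chop a c" if "chop a b" "chop b c" "0 \<le> a" "a \<le> b" "b \<le> c" "c \<le> 1" for a b c
  proof -
    have tri: "gchain 2 ?Y (frag_of (triangle p a b c))"
      by (rule gchain_triangle[OF p that(3-6)]) (use that in \<open>auto simp: chop_def\<close>)
    have "choppable v ?Y (- chain_boundary 2 (frag_of (triangle p a b c)))"
      unfolding choppable_def
      by (intro exI[of _ 0] exI[of _ "- frag_of (triangle p a b c)"]) (use tri in \<open>auto simp: chain_boundary_minus intro: gchain_minus\<close>)
    moreover have eq: "frag_of (path_segment p a c) =
       (frag_of (path_segment p a b) + frag_of (path_segment p b c)) + - chain_boundary 2 (frag_of (triangle p a b c))"
      unfolding boundary_triangle by simp
    ultimately have "choppable v ?Y (frag_of (path_segment p a c))"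
      using that(1,2) unfolding eq chop_def by (intro choppable_add) blast+
    then show ?thesis using that(1,2) unfolding chop_def by blast
  qed
  have chop_far: "chop s t" if "far s t" "0 \<le> s" "s \<le> t" "t \<le> 1" "p s \<in> graph_points G" "p t \<in> graph_points G" for s t
  proof -
    have "gchain 1 {q \<in> ?Y. star_dist v q > 2/3} (frag_of (path_segment p s t))"
      by (rule gchain_path_segment[OF p that(2-6)]) (use that in \<open>auto simp: far_def\<close>)
    then show ?thesis using that(5,6) unfolding chop_def choppable_def by (intro conjI exI[of _ 0] exI[of _ "frag_of (path_segment p s t)"]) auto
  qed
  have chop_near: "chop s t" if "\<And>r. s \<le> r \<Longrightarrow> r \<le> t \<Longrightarrow> ?f r < 3/4" "0 \<le> s" "s \<le> t" "t \<le> 1" for s t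
  proof -
    have pg: "p s \<in> graph_points G" "p t \<in> graph_points G"
      using star_dist_less_1[OF top, of s v] star_dist_less_1[OF top, of t v] that(1)[of s] that(1)[of t] that(2-4) by auto
    have "gchain 1 {q \<in> ?Y. star_dist v q < 3/4} (frag_of (path_segment p s t))"
      by (rule gchain_path_segment[OF p that(2-4) pg]) (use that in auto)
    then show ?thesis using pg unfolding chop_def choppable_def by (intro conjI exI[of _ "frag_of (path_segment p s t)"] exI[of _ 0]) auto
  qed
  \<comment> \<open>The guards \<open>s < s'\<close> and \<open>t' < t\<close> are there because an
    empty remainder is a single point, which need not be far.\<close>
  define mid where "mid s t \<longleftrightarrow> (\<exists>s' t'. s \<le> s' \<and> s' \<le> t' \<and> t' \<le> t \<and> (s < s' \<longrightarrow> far s s') \<and> (t' < t \<longrightarrow> far t' t) \<and> chop s' t')" for s t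
  define P where "P s t \<longleftrightarrow> (0 \<le> s \<longrightarrow> t \<le> 1 \<longrightarrow> far s t \<or> mid s t)" for s t
  have far_join: "far a c" if "far a b" "far b c" for a b c
    using that unfolding far_def by (meson linear)
  have "P 0 1"
  proof (rule Bolzano[of 0 1 P])
    fix a b c assume trans: "P a b" "P b c" "a \<le> b" "b \<le> c"
    show "P a c"
      unfolding P_def
    proof (intro impI)
      assume ac: "0 \<le> a" "c \<le> 1"
      have ab: "far a b \<or> mid a b" and bc: "far b c \<or> mid b c" using trans ac unfolding P_def by auto
      consider "far a b" "far b c" | "far a b" "mid b c" | "mid a b" "far b c" | "mid a b" "mid b c" using ab bc by blast
      then show "far a c \<or> mid a c"
      proof cases
        case 1 then show ?thesis using far_join by blast
      next
        case 2
        then obtain s t where st: "b \<le> s" "s \<le> t" "t \<le> c" "b < s \<longrightarrow> far b s" "t < c \<longrightarrow> far t c" "chop s t"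
          unfolding mid_def by blast
        have "far a s" using 2(1) st(1,4) far_join by (cases "b = s") auto
        then show ?thesis using st trans(3) unfolding mid_def by (intro disjI2 exI[of _ s] exI[of _ t]) auto
      next
        case 3
        then obtain s t where st: "a \<le> s" "s \<le> t" "t \<le> b" "a < s \<longrightarrow> far a s" "t < b \<longrightarrow> far t b" "chop s t"
          unfolding mid_def by blast
        have "far t c" using 3(2) st(3,5) far_join by (cases "t = b") auto
        then show ?thesis using st trans(4) unfolding mid_def by (intro disjI2 exI[of _ s] exI[of _ t]) auto
      next
        case 4
        then obtain s t where st: "a \<le> s" "s \<le> t" "t \<le> b" "a < s \<longrightarrow> far a s" "t < b \<longrightarrow> far t b" "chop s t"
          unfolding mid_def by blast
        obtain s' t' where st': "b \<le> s'" "s' \<le> t'" "t' \<le> c" "b < s' \<longrightarrow> far b s'" "t' < c \<longrightarrow> far t' c" "chop s' t'"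
          using 4 unfolding mid_def by blast
        \<comment> \<open>The remainders on both sides of \<open>b\<close> merge into one far piece
          between the graph points at \<open>t\<close> and \<open>s'\<close>, so the path is not cut
          at \<open>b\<close>, which might be sent to an end.\<close>
        have "chop s s'"
        proof (cases "t = s'")
          case False
          have "far t s'"
          proof (cases "t < b")
            case True
            then have tb: "far t b" using st(5) by blast
            show ?thesis
            proof (cases "b < s'")
              case True
              then show ?thesis using far_join[OF tb] st'(4) by blast
            next
              case False
              then have "s' = b" using st'(1) by simp
              then show ?thesis using tb by simp
            qed
          next
            case False2: False
            then have "t = b" using st(3) by simp
            then show ?thesis using st'(1,4) False by simp
          qed
          then have "chop t s'" by (rule chop_far) (use st st' ac in \<open>auto simp: chop_def\<close>)
          then show ?thesis by (rule chop_trans[OF st(6)]) (use st st' ac in auto)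
        qed (use st in simp)
        then have "chop s t'" by (rule chop_trans[OF _ st'(6)]) (use st st' ac in auto)
        then show ?thesis using st st' unfolding mid_def by (intro disjI2 exI[of _ s] exI[of _ t']) auto
      qed
    qed
  next
    fix x :: real assume "0 \<le> x" "x \<le> 1"
    then have x: "x \<in> {0..1}" by simp
    show "\<exists>d>0. \<forall>a b. a \<le> x \<and> x \<le> b \<and> b - a < d \<longrightarrow> P a b"
    proof (cases "?f x > 2/3")
      case True
      obtain d where d: "d > 0" "\<And>y. y \<in> {0..1} \<Longrightarrow> dist y x < d \<Longrightarrow> dist (?f y) (?f x) < ?f x - 2/3"
        using cont[unfolded continuous_on_iff, rule_format, OF x, of "?f x - 2/3"] True by auto
      have "P a b" if "a \<le> x \<and> x \<le> b \<and> b - a < d" for a b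
        unfolding P_def far_def
      proof (intro impI disjI1 allI)
        fix r assume r: "0 \<le> a" "b \<le> 1" "a \<le> r \<and> r \<le> b"
        have "dist r x < d" using r that by (auto simp: dist_real_def)
        then have "dist (?f r) (?f x) < ?f x - 2/3" using d(2)[of r] r by simp
        then show "?f r > 2/3" by (simp add: dist_real_def abs_if split: if_splits)
      qed
      then show ?thesis using d(1) by blast
    next
      case False
      then have lt: "3/4 - ?f x > 0" by simp
      obtain d where d: "d > 0" "\<And>y. y \<in> {0..1} \<Longrightarrow> dist y x < d \<Longrightarrow> dist (?f y) (?f x) < 3/4 - ?f x"
        using cont[unfolded continuous_on_iff, rule_format, OF x lt] by auto
      have "P a b" if ab: "a \<le> x \<and> x \<le> b \<and> b - a < d" for a b
        unfolding P_def
      proof (intro impI disjI2)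
        assume ab1: "0 \<le> a" "b \<le> 1"
        have "chop a b"
        proof (rule chop_near)
          fix r assume r: "a \<le> r" "r \<le> b"
          have "dist r x < d" using r ab by (auto simp: dist_real_def)
          then have "dist (?f r) (?f x) < 3/4 - ?f x" using d(2)[of r] r ab1 by simp
          then show "?f r < 3/4" by (simp add: dist_real_def abs_if split: if_splits)
        qed (use ab ab1 in auto)
        then show "mid a b" unfolding mid_def using ab by (intro exI[of _ a] exI[of _ b]) auto
      qed
      then show ?thesis using d(1) by blast
    qed
  qed simp
  then have "far 0 1 \<or> mid 0 1" by (simp add: P_def)
  then have "chop 0 1"
  proof
    assume "far 0 1" then show ?thesis using chop_far g by simp
  next
    assume "mid 0 1"
    then obtain s t where st: "0 \<le> s" "s \<le> t" "t \<le> 1" "0 < s \<longrightarrow> far 0 s" "t < 1 \<longrightarrow> far t 1" "chop s t"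
      unfolding mid_def by blast
    have sg: "p s \<in> graph_points G" "p t \<in> graph_points G" using st(6) by (auto simp: chop_def)
    have "chop 0 t"
    proof (cases "s = 0")
      case False
      then have "chop 0 s" using chop_far[of 0 s] st g sg by simp
      then show ?thesis by (rule chop_trans[OF _ st(6)]) (use st in auto)
    qed (use st in simp)
    then show ?thesis
    proof (cases "t = 1")
      case False
      then have "chop t 1" using chop_far[of t 1] st g sg by simp
      then show ?thesis by (rule chop_trans[OF \<open>chop 0 t\<close>]) (use st in auto)
    qed simp
  qed
  then show ?thesis by (simp add: chop_def path_segment_0_1)
qed

lemma gchain_choppable:
  assumes v: "v \<in> verts G" and c: "gchain 1 Y c" shows "choppable v Y c"
proof (rule frag_induction[of c "Poly_Mapping.keys c"])
  fix \<tau> assume "\<tau> \<in> Poly_Mapping.keys c"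
  then have \<tau>: "singular_simplex 1 (freudenthal G) \<tau>" "\<tau> ` standard_simplex 1 \<subseteq> Y"
    "\<forall>k\<le>1. simplicial_vertex k \<tau> \<in> graph_points G" using c unfolding gchain_def by auto
  have "simplicial_vertex 0 \<tau> \<in> graph_points G" "simplicial_vertex (Suc 0) \<tau> \<in> graph_points G" using \<tau>(3) by auto
  then have "choppable v (simplex_path \<tau> ` {0..1}) (frag_of (path_simplex (simplex_path \<tau>)))"
    unfolding simplicial_vertex_path by (intro path_choppable pathin_simplex_path \<tau>(1) v)
  then show "choppable v Y (frag_of \<tau>)"
    using choppable_mono \<tau>(2) unfolding path_simplex_simplex_path[OF \<tau>(1)] simplex_image by blast
next
  fix a b assume "choppable v Y a" "choppable v Y b"
  then show "choppable v Y (a - b)" using choppable_add[OF _ choppable_minus] by (metis diff_conv_add_uminus)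
qed (auto simp: choppable_0)

section \<open>Stars are contractible\<close>

lemma incident_joins: "e \<in> incident v \<Longrightarrow> \<exists>w. joins e v w"
  by (auto simp: incident_def joins_def)

lemma star_dist_edge_path:
  assumes "joins e v w" "u \<in> {0..1}" shows "star_dist v (edge_path e v u) = u"
proof -
  have e: "e \<in> arcs G" using assms(1) by (simp add: joins_def)
  show ?thesis
    using star_dist_theta[OF e, of u v] star_dist_theta[OF e, of "1 - u" v] assms no_loops[OF e]
    by (auto simp: edge_path_def joins_def)
qed

lemma star_cases:
  assumes "q \<in> topspace (freudenthal G)" "star_dist v q < 1"
  obtains "q = Vertex v" | e where "e \<in> incident v" "q \<in> open_edge G e" "q = edge_path e v (star_dist v q)" "0 < star_dist v q"
proof (cases q)
  case (Inner e t)
  then have e: "e \<in> arcs G" "0 < t" "t < 1" using assms(1) by (auto simp: topspace_freudenthal)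
  have "e \<in> incident v" using assms(2) Inner e by (auto simp: star_dist_def incident_def split: if_splits)
  moreover have "q \<in> open_edge G e" using Inner e by simp
  moreover have "q = edge_path e v (star_dist v q)" "0 < star_dist v q"
    using assms(2) Inner e no_loops[OF e(1)] by (auto simp: star_dist_def edge_path_def split: if_splits)
  ultimately show thesis by (rule that(2))
qed (use that(1) assms in \<open>auto simp: star_dist_def split: if_splits\<close>)

lemma openin_open_edge: "e \<in> arcs G \<Longrightarrow> openin (freudenthal G) (open_edge G e)"
proof -
  assume e: "e \<in> arcs G"
  have "openin (graph_topology G) (open_edge G e)"
    unfolding openin_graph_topology
  proof (intro conjI ballI)
    show "open_edge G e \<subseteq> graph_points G" using e by (auto simp: graph_points_def)
    fix e' assume "e' \<in> arcs G"
    have "theta G e' t \<in> open_edge G e \<longleftrightarrow> e' = e \<and> t \<in> {0<..<1}" if "t \<in> {0..1}" for t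
      using that by (rule theta_cases) auto
    then have "{t \<in> {0..1}. theta G e' t \<in> open_edge G e} = {0..1} \<inter> (if e' = e then {0<..<1} else {})" by auto
    then show "openin (top_of_set {0..1}) {t \<in> {0..1}. theta G e' t \<in> open_edge G e}"
      by (simp add: openin_open_Int)
  qed
  then show ?thesis by (rule openin_freudenthal_graph)
qed

text \<open>The homotopy shrinks the distance from \<open>v\<close> along each edge. With radius
  below 1 the arms meet only in \<open>v\<close>, so it is pasted together from the finitely many
  arms.\<close>

lemma contractible_star:
  assumes v: "v \<in> verts G"
  shows "contractible_space (subtopology (freudenthal G) {q. star_dist v q \<le> 3/4})" (is "contractible_space ?N")
proof -
  have topN: "topspace ?N = {q \<in> topspace (freudenthal G). star_dist v q \<le> 3/4}" by auto
  have vN: "Vertex v \<in> topspace ?N" using v by (simp add: topspace_freudenthal star_dist_def)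
  \<comment> \<open>Described as the complement of the other open edges, an arm is visibly closed.
    \<open>T None\<close> is the centre alone; it keeps the cover complete if \<open>v\<close> has
    no edge.\<close>
  define T where "T i = {q \<in> topspace ?N. \<forall>e\<in>incident v. i \<noteq> Some e \<longrightarrow> q \<notin> open_edge G e}" for i
  define I where "I = insert None (Some ` incident v)"
  have Tclosed: "closedin ?N (T i)" for i
  proof -
    have "openin (freudenthal G) (\<Union>e\<in>{e \<in> incident v. i \<noteq> Some e}. open_edge G e)"
      using openin_open_edge by (intro openin_Union) (auto simp: incident_def)
    then have "openin ?N ({q. star_dist v q \<le> 3/4} \<inter> (\<Union>e\<in>{e \<in> incident v. i \<noteq> Some e}. open_edge G e))"
      by (rule openin_subtopology_Int2)
    note closedin_diff[OF closedin_topspace this]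
    moreover have "T i = topspace ?N - ({q. star_dist v q \<le> 3/4} \<inter> (\<Union>e\<in>{e \<in> incident v. i \<noteq> Some e}. open_edge G e))"
      unfolding T_def by auto
    ultimately show ?thesis by (simp only:)
  qed
  have T_None: "q = Vertex v" if q: "q \<in> T None" for q
  proof -
    have q': "q \<in> topspace (freudenthal G)" "star_dist v q < 1" using q unfolding T_def topN by auto
    show ?thesis
    proof (rule star_cases[OF q'])
      fix e assume "e \<in> incident v" "q \<in> open_edge G e"
      then show ?thesis using q unfolding T_def by blast
    qed simp
  qed
  have T_Some: "q = Vertex v \<or> q \<in> open_edge G e \<and> q = edge_path e v (star_dist v q)" if q: "q \<in> T (Some e)" for q e
  proof -
    have q': "q \<in> topspace (freudenthal G)" "star_dist v q < 1" using q unfolding T_def topN by auto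
    show ?thesis
    proof (rule star_cases[OF q'])
      fix e' assume e': "e' \<in> incident v" "q \<in> open_edge G e'" "q = edge_path e' v (star_dist v q)"
      then have "e' = e" using q unfolding T_def by auto
      then show ?thesis using e' by blast
    qed simp
  qed
  define f where "f i = (\<lambda>(r, q). case i of None \<Rightarrow> Vertex v | Some e \<Rightarrow> edge_path e v ((1 - r) * star_dist v q))" for i :: "'e option"
  define g where "g = (\<lambda>(r, q). if q = Vertex v then Vertex v else f (Some (SOME e. e \<in> incident v \<and> q \<in> open_edge G e)) (r, q))"
  let ?I = "top_of_set {0..1::real}"
  let ?P = "prod_topology ?I ?N"
  have mult01: "(1 - r) * star_dist v q \<in> {0..1} \<and> (1 - r) * star_dist v q \<le> star_dist v q"
    if "r \<in> {0..1}" "q \<in> topspace ?N" for r q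
  proof -
    have s: "0 \<le> star_dist v q" "star_dist v q \<le> 3/4" using that(2) unfolding topN
      by (auto simp: star_dist_def topspace_freudenthal split: point.splits)
    have "(1 - r) * star_dist v q \<le> star_dist v q" using that(1) s by (simp add: mult_left_le_one_le)
    moreover have "0 \<le> (1 - r) * star_dist v q" using that(1) s by simp
    ultimately show ?thesis using s by simp
  qed
  have cont_g: "continuous_map ?P ?N g"
  proof (rule pasting_lemma_closed[of I ?P "\<lambda>i. {0..1} \<times> T i" ?N f])
    show "finite I" using finite_incident by (simp add: I_def)
    show "closedin ?P ({0..1} \<times> T i)" for i
      using Tclosed[of i] closedin_topspace[of ?I] by (simp add: closedin_prod_Times_iff)
  next
    fix i assume "i \<in> I"
    then consider "i = None" | e where "i = Some e" "e \<in> incident v" by (auto simp: I_def)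
    then show "continuous_map (subtopology ?P ({0..1} \<times> T i)) ?N (f i)"
    proof cases
      case 1
      then show ?thesis using vN by (simp add: f_def case_prod_unfold)
    next
      case 2
      obtain w where j: "joins e v w" using incident_joins[OF 2(2)] by blast
      have e: "e \<in> arcs G" using j by (simp add: joins_def)
      have s: "continuous_map ?N euclideanreal (star_dist v)"
        by (rule continuous_map_from_subtopology[OF continuous_star_dist[OF v]])
      have sn: "continuous_map ?P euclideanreal (\<lambda>x. star_dist v (snd x))"
        using continuous_map_compose[OF continuous_map_snd s] by (simp add: comp_def)
      have fs: "continuous_map ?P euclideanreal (\<lambda>x. fst x)"
        using continuous_map_fst[of ?I ?N] continuous_map_in_subtopology by blast
      have "continuous_map ?P euclideanreal (\<lambda>x. (1 - fst x) * star_dist v (snd x))"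
        by (intro continuous_map_real_mult continuous_map_diff sn fs) simp
      then have "continuous_map ?P (top_of_set {0..1}) (\<lambda>x. (1 - fst x) * star_dist v (snd x))"
        unfolding continuous_map_in_subtopology using mult01 by auto
      from continuous_map_compose[OF this pathin_edge_path[OF e, unfolded pathin_def]]
      have "continuous_map ?P (freudenthal G) (f i)"
        using 2 by (simp add: f_def comp_def case_prod_unfold)
      moreover have "star_dist v (f i x) \<le> 3/4" if "x \<in> topspace ?P" for x
      proof -
        obtain r q where x: "x = (r, q)" by (cases x)
        then have rq: "r \<in> {0..1}" "q \<in> topspace ?N" using that by auto
        then show ?thesis
          using mult01[OF rq] star_dist_edge_path[OF j, of "(1 - r) * star_dist v q"] rq(2) x 2(1) by (auto simp: f_def)
      qed
      ultimately have "continuous_map ?P ?N (f i)" unfolding continuous_map_in_subtopology by auto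
      then show ?thesis by (rule continuous_map_from_subtopology)
    qed
  next
    have f_vertex: "f i (r, Vertex v) = Vertex v" if i: "i \<in> I" for i r
    proof (cases i)
      case (Some e)
      then obtain w where "joins e v w" using incident_joins[of e v] i by (auto simp: I_def)
      then show ?thesis using Some edge_path_ends(1) by (simp add: f_def star_dist_def)
    qed (simp add: f_def)
    show "f i x = f j x" if ij: "i \<in> I" "j \<in> I" and x: "x \<in> topspace ?P \<inter> {0..1} \<times> T i \<inter> {0..1} \<times> T j" for i j x
    proof (cases "i = j")
      case False
      obtain r q where rq: "x = (r, q)" "q \<in> T i" "q \<in> T j" using x by auto
      have "q = Vertex v"
      proof (cases i)
        case None then show ?thesis using T_None rq(2) by simp
      next
        case (Some e)
        then have "e \<in> incident v" using ij(1) by (auto simp: I_def)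
        then have "q \<notin> open_edge G e" using rq(3) False Some unfolding T_def by auto
        then show ?thesis using T_Some rq(2) Some by blast
      qed
      then show ?thesis using f_vertex ij rq(1) by simp
    qed simp
    show "\<exists>j. j \<in> I \<and> x \<in> {0..1} \<times> T j \<and> g x = f j x" if "x \<in> topspace ?P" for x
    proof -
      obtain r q where x: "x = (r, q)" "r \<in> {0..1}" "q \<in> topspace ?N" using \<open>x \<in> topspace ?P\<close> by auto
      have q: "q \<in> topspace (freudenthal G)" "star_dist v q < 1" using x(3) by auto
      show ?thesis
      proof (rule star_cases[OF q])
        assume "q = Vertex v"
        then show ?thesis using x by (intro exI[of _ None]) (auto simp: I_def T_def g_def f_def)
      next
        fix e assume e: "e \<in> incident v" "q \<in> open_edge G e"
        have "(SOME e. e \<in> incident v \<and> q \<in> open_edge G e) = e"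
          using e by (intro some_equality) (auto simp: open_edge_eq)
        moreover have "q \<noteq> Vertex v" using e by auto
        ultimately show ?thesis using x e by (intro exI[of _ "Some e"]) (auto simp: I_def T_def g_def open_edge_eq)
      qed
    qed
  qed
  have "homotopic_with (\<lambda>_. True) ?N ?N id (\<lambda>_. Vertex v)"
  proof (subst homotopic_with, simp, intro exI[of _ g] conjI ballI TrueI)
    show "continuous_map ?P ?N g" by (rule cont_g)
    fix q assume "q \<in> topspace ?N"
    then have q: "q \<in> topspace (freudenthal G)" "star_dist v q < 1" by auto
    show "g (0, q) = id q"
    proof (rule star_cases[OF q])
      fix e assume e: "e \<in> incident v" "q \<in> open_edge G e" "q = edge_path e v (star_dist v q)"
      have "(SOME e. e \<in> incident v \<and> q \<in> open_edge G e) = e"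
        using e by (intro some_equality) (auto simp: open_edge_eq)
      moreover have "q \<noteq> Vertex v" using e by auto
      ultimately show ?thesis using e(3) by (simp add: g_def f_def)
    qed (simp add: g_def)
    show "g (1, q) = Vertex v"
    proof (rule star_cases[OF q])
      fix e assume e: "e \<in> incident v" "q \<in> open_edge G e"
      have "(SOME e. e \<in> incident v \<and> q \<in> open_edge G e) = e"
        using e by (intro some_equality) (auto simp: open_edge_eq)
      moreover obtain w where "joins e v w" using incident_joins[OF e(1)] by blast
      ultimately show ?thesis using edge_path_ends(1) by (simp add: g_def f_def)
    qed (simp add: g_def)
  qed
  then show ?thesis unfolding contractible_space_def by blast
qed

end

section \<open>Infinite chains\<close>

abbreviation bd :: "nat \<Rightarrow> ((nat \<Rightarrow> real) \<Rightarrow> 'a) \<Rightarrow> ((nat \<Rightarrow> real) \<Rightarrow> 'a) \<Rightarrow> int" where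
  "bd n \<tau> \<rho> \<equiv> Poly_Mapping.lookup (chain_boundary n (frag_of \<tau>)) \<rho>"

lemma lookup_frag_extend:
  "Poly_Mapping.lookup (frag_extend f c) x =
    (\<Sum>y\<in>Poly_Mapping.keys c. Poly_Mapping.lookup c y * Poly_Mapping.lookup (f y) x)"
  unfolding frag_extend_def by (simp add: lookup_sum)

text \<open>Sums over infinite sets are 0 by convention, so every computation with
  \<open>inf_boundary\<close> first needs a finite set containing the relevant simplices.\<close>

lemma inf_boundary_superset:
  assumes "finite A" "\<And>\<tau>. c \<tau> \<noteq> 0 \<Longrightarrow> bd n \<tau> \<rho> \<noteq> 0 \<Longrightarrow> \<tau> \<in> A"
  shows "inf_boundary n c \<rho> = (\<Sum>\<tau>\<in>A. c \<tau> * bd n \<tau> \<rho>)"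
  unfolding inf_boundary_def by (rule sum.mono_neutral_left) (use assms in auto)

lemma inf_boundary_cong:
  assumes "\<And>\<tau>. bd n \<tau> \<rho> \<noteq> 0 \<Longrightarrow> c \<tau> = d \<tau>"
  shows "inf_boundary n c \<rho> = inf_boundary n d \<rho>"
  unfolding inf_boundary_def by (rule sum.cong) (use assms in auto)

lemma inf_boundary_frag:
  "inf_boundary (Suc n) (Poly_Mapping.lookup c) \<rho> = Poly_Mapping.lookup (chain_boundary (Suc n) c) \<rho>"
  unfolding boundary_extend[of n c] lookup_frag_extend
  by (rule inf_boundary_superset) (auto simp: in_keys_iff)

definition restrict_chain :: "('a \<Rightarrow> int) \<Rightarrow> 'a set \<Rightarrow> 'a \<Rightarrow>\<^sub>0 int" where
  "restrict_chain c A = (\<Sum>\<tau>\<in>A. frag_cmul (c \<tau>) (frag_of \<tau>))"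

lemma lookup_restrict_chain:
  "finite A \<Longrightarrow> Poly_Mapping.lookup (restrict_chain c A) \<tau> = (if \<tau> \<in> A then c \<tau> else 0)"
  unfolding restrict_chain_def lookup_sum
  by (simp add: if_distrib[of "\<lambda>x. _ * x"] sum.delta cong: if_cong)

lemma lookup_cmul_frag_of: "Poly_Mapping.lookup (frag_cmul k (frag_of x)) y = k * (if y = x then 1 else 0)"
  by (simp add: eq_commute)

lemma bd_face:
  assumes "bd (Suc n) \<tau> \<rho> \<noteq> 0" obtains k where "k \<le> Suc n" "\<rho> = singular_face (Suc n) k \<tau>"
proof -
  have "bd (Suc n) \<tau> \<rho> = (\<Sum>k\<le>Suc n. (-1) ^ k * (if \<rho> = singular_face (Suc n) k \<tau> then 1 else 0))"
    by (simp only: chain_boundary_of nat.distinct if_False lookup_sum lookup_cmul_frag_of)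
  then have "\<exists>k\<in>{..Suc n}. (-1) ^ k * (if \<rho> = singular_face (Suc n) k \<tau> then 1 else (0::int)) \<noteq> 0"
    using assms by (metis (no_types, lifting) sum.neutral)
  then show thesis using that by (auto split: if_splits)
qed

lemma singular_face_vertex:
  "simplicial_vertex 0 (singular_face (Suc n) k \<tau>) = simplicial_vertex (if k = 0 then 1 else 0) \<tau>"
proof -
  have "simplical_face k (\<lambda>j. if j = 0 then 1 else 0 :: real) = (\<lambda>j. if j = (if k = 0 then 1 else 0) then 1 else 0)"
    by (auto simp: simplical_face_def fun_eq_iff)
  then show ?thesis by (simp add: simplicial_vertex_def singular_face_def)
qed

text \<open>Vertex 0 of a face is a vertex of each simplex having this face. For chains it is a
  graph point, and goodness at this point bounds the number of these simplices.\<close>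

lemma bd_vertex:
  assumes "bd (Suc n) \<tau> \<rho> \<noteq> 0"
  obtains k where "k \<le> Suc n" "simplicial_vertex 0 \<rho> = simplicial_vertex k \<tau>" "simplicial_vertex 0 \<rho> \<in> \<tau> ` standard_simplex (Suc n)"
proof -
  obtain k where "\<rho> = singular_face (Suc n) k \<tau>" using bd_face[OF assms] by blast
  then have "simplicial_vertex 0 \<rho> = simplicial_vertex (if k = 0 then 1 else 0) \<tau>" by (simp only: singular_face_vertex)
  then show thesis
    using that[of "if k = 0 then 1 else 0"] simplicial_vertex_in_image[of "if k = 0 then 1 else 0" "Suc n" \<tau>] by auto
qed

context lf_graph
begin

text \<open>As the radius exceeds 1/2, the open stars cover the graph. They can therefore replace
  arbitrary neighbourhoods in tests for goodness.\<close>

definition ostar :: "'v \<Rightarrow> ('v,'e) point set" where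
  "ostar v = {q \<in> topspace (freudenthal G). star_dist v q < 2/3}"

text \<open>Contains all open edges at \<open>v\<close> completely, so it catches every simplex with
  a winding along them; compactness of the edges still allows only finitely many members of a good
  family to meet it.\<close>

definition cstar :: "'v \<Rightarrow> ('v,'e) point set" where
  "cstar v = insert (Vertex v) (\<Union>e\<in>incident v. closed_edge G e)"

lemma open_closed_edge: "open_edge G e \<subseteq> closed_edge G e"
  unfolding open_edge_def closed_edge_def by (rule image_mono) auto

lemma star_subset_cstar: "q \<in> topspace (freudenthal G) \<Longrightarrow> star_dist v q < 1 \<Longrightarrow> q \<in> cstar v"
  by (rule star_cases[of q v]) (use open_closed_edge in \<open>auto simp: cstar_def\<close>)

lemma ostar_cstar: "ostar v \<subseteq> cstar v"
  using star_subset_cstar by (auto simp: ostar_def)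

lemma open_edge_cstar: "e \<in> incident v \<Longrightarrow> open_edge G e \<subseteq> cstar v"
  using open_closed_edge[of e] by (auto simp: cstar_def)

lemma ostar_graph: "ostar v \<subseteq> graph_points G"
  using star_dist_less_1[of _ v] by (auto simp: ostar_def)

lemma graph_point_ostar:
  assumes "q \<in> graph_points G" obtains v where "v \<in> verts G" "q \<in> ostar v"
  using assms
proof (rule graph_points_cases)
  fix v assume "v \<in> verts G" "q = Vertex v"
  then show thesis using that[of v] by (simp add: ostar_def topspace_freudenthal star_dist_def)
next
  fix e t assume e: "e \<in> arcs G" "0 < t" "t < 1" "q = Inner e t"
  then show thesis
    using that[of "tail G e"] that[of "head G e"] no_loops[OF e(1)]
    by (cases "t < 2/3") (auto simp: ostar_def topspace_freudenthal star_dist_def)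
qed

lemma openin_ostar:
  assumes v: "v \<in> verts G" shows "openin (graph_topology G) (ostar v)"
proof -
  have "openin (freudenthal G) {q \<in> topspace (freudenthal G). star_dist v q \<in> {..<2/3}}"
    by (rule openin_continuous_map_preimage[OF continuous_star_dist[OF v]]) auto
  from openin_graph_part[OF this] show ?thesis
    using ostar_graph[of v] by (simp add: ostar_def Int_absorb2)
qed

lemma finite_cstar:
  assumes good: "good_family G n I \<sigma>" and v: "v \<in> verts G"
  shows "finite {i \<in> I. \<sigma> i ` standard_simplex n \<inter> cstar v \<noteq> {}}"
proof -
  have "Vertex v \<in> graph_points G" using v by simp
  from good_familyE[OF good this] obtain U where U: "Vertex v \<in> U" "finite {i \<in> I. \<sigma> i ` standard_simplex n \<inter> U \<noteq> {}}" by blast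
  have "finite (\<Union>e\<in>incident v. {i \<in> I. \<sigma> i ` standard_simplex n \<inter> closed_edge G e \<noteq> {}})"
    using finite_incident good_family_closed_edge[OF good _ wf_digraph] by (intro finite_UN_I) (auto simp: incident_def)
  with U(2) have "finite ({i \<in> I. \<sigma> i ` standard_simplex n \<inter> U \<noteq> {}} \<union>
      (\<Union>e\<in>incident v. {i \<in> I. \<sigma> i ` standard_simplex n \<inter> closed_edge G e \<noteq> {}}))" by simp
  moreover have "{i \<in> I. \<sigma> i ` standard_simplex n \<inter> cstar v \<noteq> {}} \<subseteq> {i \<in> I. \<sigma> i ` standard_simplex n \<inter> U \<noteq> {}} \<union>
      (\<Union>e\<in>incident v. {i \<in> I. \<sigma> i ` standard_simplex n \<inter> closed_edge G e \<noteq> {}})"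
  proof
    fix i assume "i \<in> {i \<in> I. \<sigma> i ` standard_simplex n \<inter> cstar v \<noteq> {}}"
    then obtain q where q: "i \<in> I" "q \<in> \<sigma> i ` standard_simplex n" "q \<in> cstar v" by blast
    then consider "q = Vertex v" | e where "e \<in> incident v" "q \<in> closed_edge G e" by (auto simp: cstar_def)
    then show "i \<in> {i \<in> I. \<sigma> i ` standard_simplex n \<inter> U \<noteq> {}} \<union>
        (\<Union>e\<in>incident v. {i \<in> I. \<sigma> i ` standard_simplex n \<inter> closed_edge G e \<noteq> {}})"
      by cases (use q U(1) in blast)+
  qed
  ultimately show ?thesis by (rule finite_subset[rotated])
qed

lemma good_familyI:
  assumes "\<And>i. i \<in> I \<Longrightarrow> singular_simplex n (freudenthal G) (\<sigma> i) \<and> (\<forall>k\<le>n. simplicial_vertex k (\<sigma> i) \<in> graph_points G)"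
    and "\<And>v. v \<in> verts G \<Longrightarrow> finite {i \<in> I. \<sigma> i ` standard_simplex n \<inter> ostar v \<noteq> {}}"
  shows "good_family G n I \<sigma>"
  unfolding good_family_def
proof (intro conjI ballI)
  fix x assume "x \<in> graph_points G"
  then obtain v where "v \<in> verts G" "x \<in> ostar v" using graph_point_ostar by blast
  then show "\<exists>U. openin (graph_topology G) U \<and> x \<in> U \<and> finite {i \<in> I. \<sigma> i ` standard_simplex n \<inter> U \<noteq> {}}"
    using openin_ostar assms(2) by blast
qed (use assms(1) in auto)

definition gsimplex :: "nat \<Rightarrow> ((nat \<Rightarrow> real) \<Rightarrow> ('v,'e) point) \<Rightarrow> bool" where
  "gsimplex n \<tau> \<longleftrightarrow> singular_simplex n (freudenthal G) \<tau> \<and> (\<forall>k\<le>n. simplicial_vertex k \<tau> \<in> graph_points G)"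

lemma inf_chainsI:
  assumes "\<And>\<tau>. c \<tau> \<noteq> 0 \<Longrightarrow> gsimplex n \<tau>"
    and "\<And>v. v \<in> verts G \<Longrightarrow> finite {\<tau>. c \<tau> \<noteq> 0 \<and> \<tau> ` standard_simplex n \<inter> ostar v \<noteq> {}}"
  shows "c \<in> inf_chains G n"
  unfolding inf_chains_def mem_Collect_eq by (rule good_familyI) (use assms in \<open>auto simp: gsimplex_def\<close>)

lemma inf_chainsD:
  assumes "c \<in> inf_chains G n"
  shows "c \<tau> \<noteq> 0 \<Longrightarrow> gsimplex n \<tau>"
    and "v \<in> verts G \<Longrightarrow> finite {\<tau>. c \<tau> \<noteq> 0 \<and> \<tau> ` standard_simplex n \<inter> cstar v \<noteq> {}}"
  using assms finite_cstar[of n "{\<tau>. c \<tau> \<noteq> 0}" "\<lambda>\<tau>. \<tau>" v]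
  unfolding inf_chains_def good_family_def gsimplex_def by auto

lemma inf_chainsD_ostar:
  assumes "c \<in> inf_chains G n" "v \<in> verts G"
  shows "finite {\<tau>. c \<tau> \<noteq> 0 \<and> \<tau> ` standard_simplex n \<inter> ostar v \<noteq> {}}"
  by (rule finite_subset[OF _ inf_chainsD(2)[OF assms]]) (use ostar_cstar[of v] in blast)

lemma inf_chains_combine:
  assumes "c \<in> inf_chains G n" "d \<in> inf_chains G n"
    and f: "\<And>\<tau>. f \<tau> \<noteq> 0 \<Longrightarrow> c \<tau> \<noteq> 0 \<or> d \<tau> \<noteq> 0"
  shows "f \<in> inf_chains G n"
proof (rule inf_chainsI)
  fix v assume v: "v \<in> verts G"
  have "{\<tau>. f \<tau> \<noteq> 0 \<and> \<tau> ` standard_simplex n \<inter> ostar v \<noteq> {}} \<subseteq>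
      {\<tau>. c \<tau> \<noteq> 0 \<and> \<tau> ` standard_simplex n \<inter> ostar v \<noteq> {}} \<union> {\<tau>. d \<tau> \<noteq> 0 \<and> \<tau> ` standard_simplex n \<inter> ostar v \<noteq> {}}"
    using f by blast
  then show "finite {\<tau>. f \<tau> \<noteq> 0 \<and> \<tau> ` standard_simplex n \<inter> ostar v \<noteq> {}}"
    by (rule finite_subset) (intro finite_UnI inf_chainsD_ostar assms v)
qed (use f inf_chainsD(1)[OF assms(1)] inf_chainsD(1)[OF assms(2)] in blast)

lemma inf_chains_add: "c \<in> inf_chains G n \<Longrightarrow> d \<in> inf_chains G n \<Longrightarrow> (\<lambda>\<tau>. c \<tau> + d \<tau>) \<in> inf_chains G n"
  by (rule inf_chains_combine[of c n d]) auto

lemma inf_chains_diff: "c \<in> inf_chains G n \<Longrightarrow> d \<in> inf_chains G n \<Longrightarrow> (\<lambda>\<tau>. c \<tau> - d \<tau>) \<in> inf_chains G n"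
  by (rule inf_chains_combine[of c n d]) auto

lemma inf_chains_uminus: "c \<in> inf_chains G n \<Longrightarrow> (\<lambda>\<tau>. - c \<tau>) \<in> inf_chains G n"
  by (rule inf_chains_combine[of c n c]) auto

lemma gchain_gsimplex: "gchain n Y c \<Longrightarrow> Poly_Mapping.lookup c \<tau> \<noteq> 0 \<Longrightarrow> gsimplex n \<tau>"
  by (auto simp: gchain_def gsimplex_def in_keys_iff)

lemma gchain_inf_chains: "gchain n Y c \<Longrightarrow> Poly_Mapping.lookup c \<in> inf_chains G n"
proof (rule inf_chainsI)
  fix v show "finite {\<tau>. Poly_Mapping.lookup c \<tau> \<noteq> 0 \<and> \<tau> ` standard_simplex n \<inter> ostar v \<noteq> {}}"
    by (rule finite_subset[OF _ finite_keys[of c]]) (auto simp: in_keys_iff)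
qed (rule gchain_gsimplex)

lemma gchainI:
  assumes "\<And>\<tau>. \<tau> \<in> Poly_Mapping.keys c \<Longrightarrow> gsimplex n \<tau> \<and> \<tau> ` standard_simplex n \<subseteq> Y"
  shows "gchain n Y c"
  using assms by (auto simp: gchain_def gsimplex_def)

lemma finite_cofaces:
  assumes "c \<in> inf_chains G (Suc n)" shows "finite {\<tau>. c \<tau> \<noteq> 0 \<and> bd (Suc n) \<tau> \<rho> \<noteq> 0}"
proof (cases "\<exists>\<tau>. c \<tau> \<noteq> 0 \<and> bd (Suc n) \<tau> \<rho> \<noteq> 0")
  case True
  then obtain \<tau> where \<tau>: "c \<tau> \<noteq> 0" "bd (Suc n) \<tau> \<rho> \<noteq> 0" by blast
  from bd_vertex[OF \<tau>(2)] obtain k where "k \<le> Suc n" "simplicial_vertex 0 \<rho> = simplicial_vertex k \<tau>" by metis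
  then have "simplicial_vertex 0 \<rho> \<in> graph_points G" using inf_chainsD(1)[OF assms \<tau>(1)] by (simp add: gsimplex_def)
  then obtain v where v: "v \<in> verts G" "simplicial_vertex 0 \<rho> \<in> ostar v" using graph_point_ostar by blast
  have "\<tau>' ` standard_simplex (Suc n) \<inter> ostar v \<noteq> {}" if "bd (Suc n) \<tau>' \<rho> \<noteq> 0" for \<tau>'
    using bd_vertex[OF that] v(2) by (metis IntI empty_iff)
  then show ?thesis by (intro finite_subset[OF _ inf_chainsD_ostar[OF assms v(1)]]) blast
next
  case False
  then have "{\<tau>. c \<tau> \<noteq> 0 \<and> bd (Suc n) \<tau> \<rho> \<noteq> 0} = {}" by blast
  then show ?thesis by (simp only: finite.emptyI)
qed

lemma inf_boundary_add:
  assumes "c \<in> inf_chains G (Suc n)" "d \<in> inf_chains G (Suc n)"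
  shows "inf_boundary (Suc n) (\<lambda>\<tau>. c \<tau> + d \<tau>) \<rho> = inf_boundary (Suc n) c \<rho> + inf_boundary (Suc n) d \<rho>"
proof -
  let ?A = "{\<tau>. c \<tau> \<noteq> 0 \<and> bd (Suc n) \<tau> \<rho> \<noteq> 0} \<union> {\<tau>. d \<tau> \<noteq> 0 \<and> bd (Suc n) \<tau> \<rho> \<noteq> 0}"
  have A: "finite ?A" using finite_cofaces assms by blast
  have eq: "inf_boundary (Suc n) f \<rho> = (\<Sum>\<tau>\<in>?A. f \<tau> * bd (Suc n) \<tau> \<rho>)" if "\<And>\<tau>. f \<tau> \<noteq> 0 \<Longrightarrow> c \<tau> \<noteq> 0 \<or> d \<tau> \<noteq> 0" for f
    by (rule inf_boundary_superset[OF A]) (use that in blast)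
  show ?thesis
    unfolding eq[of "\<lambda>\<tau>. c \<tau> + d \<tau>", simplified] eq[of c, simplified] eq[of d, simplified]
    by (simp only: distrib_right sum.distrib)
qed

lemma inf_boundary_uminus: "inf_boundary n (\<lambda>\<tau>. - c \<tau>) \<rho> = - inf_boundary n c \<rho>"
  unfolding inf_boundary_def by (simp add: sum_negf)

lemma inf_boundary_diff:
  assumes "c \<in> inf_chains G (Suc n)" "d \<in> inf_chains G (Suc n)"
  shows "inf_boundary (Suc n) (\<lambda>\<tau>. c \<tau> - d \<tau>) \<rho> = inf_boundary (Suc n) c \<rho> - inf_boundary (Suc n) d \<rho>"
  using inf_boundary_add[OF assms(1) inf_chains_uminus[OF assms(2)], of \<rho>] by (simp add: inf_boundary_uminus)

definition inf_winding :: "'e \<Rightarrow> (((nat \<Rightarrow> real) \<Rightarrow> ('v,'e) point) \<Rightarrow> int) \<Rightarrow> real" where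
  "inf_winding e c = (\<Sum>\<tau> | c \<tau> \<noteq> 0 \<and> simplex_edge_winding e \<tau> \<noteq> 0. of_int (c \<tau>) * simplex_edge_winding e \<tau>)"

lemma inf_winding_superset:
  assumes "finite A" "\<And>\<tau>. c \<tau> \<noteq> 0 \<Longrightarrow> simplex_edge_winding e \<tau> \<noteq> 0 \<Longrightarrow> \<tau> \<in> A"
  shows "inf_winding e c = (\<Sum>\<tau>\<in>A. of_int (c \<tau>) * simplex_edge_winding e \<tau>)"
  unfolding inf_winding_def by (rule sum.mono_neutral_left) (use assms in auto)

lemma inf_winding_cong:
  assumes "\<And>\<tau>. simplex_edge_winding e \<tau> \<noteq> 0 \<Longrightarrow> c \<tau> = d \<tau>"
  shows "inf_winding e c = inf_winding e d"
  unfolding inf_winding_def by (rule sum.cong) (use assms in auto)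

lemma inf_winding_frag: "inf_winding e (Poly_Mapping.lookup c) = frag_eval (simplex_edge_winding e) c"
  unfolding frag_eval_def by (rule inf_winding_superset) (auto simp: in_keys_iff)

lemma winding_meets: "simplex_edge_winding e \<tau> \<noteq> 0 \<Longrightarrow> \<tau> ` standard_simplex 1 \<inter> open_edge G e \<noteq> {}"
  using simplex_edge_winding_outside by blast

lemma finite_winding:
  assumes "c \<in> inf_chains G 1" "e \<in> arcs G" shows "finite {\<tau>. c \<tau> \<noteq> 0 \<and> simplex_edge_winding e \<tau> \<noteq> 0}"
proof -
  have e: "e \<in> incident (tail G e)" "tail G e \<in> verts G" using assms(2) by (auto simp: incident_def)
  show ?thesis
    by (rule finite_subset[OF _ inf_chainsD(2)[OF assms(1) e(2)]]) (use winding_meets[of e] open_edge_cstar[OF e(1)] in blast)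
qed

lemma inf_winding_add:
  assumes "c \<in> inf_chains G 1" "d \<in> inf_chains G 1" "e \<in> arcs G"
  shows "inf_winding e (\<lambda>\<tau>. c \<tau> + d \<tau>) = inf_winding e c + inf_winding e d"
proof -
  let ?A = "{\<tau>. c \<tau> \<noteq> 0 \<and> simplex_edge_winding e \<tau> \<noteq> 0} \<union> {\<tau>. d \<tau> \<noteq> 0 \<and> simplex_edge_winding e \<tau> \<noteq> 0}"
  have A: "finite ?A" using finite_winding assms by blast
  have eq: "inf_winding e f = (\<Sum>\<tau>\<in>?A. of_int (f \<tau>) * simplex_edge_winding e \<tau>)" if "\<And>\<tau>. f \<tau> \<noteq> 0 \<Longrightarrow> c \<tau> \<noteq> 0 \<or> d \<tau> \<noteq> 0" for f
    by (rule inf_winding_superset[OF A]) (use that in blast)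
  show ?thesis
    unfolding eq[of "\<lambda>\<tau>. c \<tau> + d \<tau>", simplified] eq[of c, simplified] eq[of d, simplified]
    by (simp only: of_int_add distrib_right sum.distrib)
qed

lemma inf_winding_uminus: "inf_winding e (\<lambda>\<tau>. - c \<tau>) = - inf_winding e c"
  unfolding inf_winding_def by (simp add: sum_negf)

lemma inf_winding_diff:
  assumes "c \<in> inf_chains G 1" "d \<in> inf_chains G 1" "e \<in> arcs G"
  shows "inf_winding e (\<lambda>\<tau>. c \<tau> - d \<tau>) = inf_winding e c - inf_winding e d"
  using inf_winding_add[OF assms(1) inf_chains_uminus[OF assms(2)] assms(3)] by (simp add: inf_winding_uminus)

lemma face_image:
  assumes "k \<le> Suc n" shows "singular_face (Suc n) k \<tau> ` standard_simplex n \<subseteq> \<tau> ` standard_simplex (Suc n)"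
  using simplical_face_in_standard_simplex[of "Suc n" k] assms by (auto simp: singular_face_def)

lemma gsimplex_face:
  assumes g: "gsimplex (Suc n) \<tau>" and k: "k \<le> Suc n" shows "gsimplex n (singular_face (Suc n) k \<tau>)"
proof -
  have "singular_simplex n (freudenthal G) (singular_face (Suc n) k \<tau>)"
    using singular_simplex_singular_face[of "Suc n" "freudenthal G" \<tau> k] g k by (simp add: gsimplex_def)
  moreover have "simplicial_vertex j (singular_face (Suc n) k \<tau>) \<in> graph_points G" if j: "j \<le> n" for j
  proof -
    have "simplical_face k (\<lambda>i. if i = j then 1 else 0 :: real) = (\<lambda>i. if i = (if j < k then j else Suc j) then 1 else 0)"
      by (auto simp: simplical_face_def fun_eq_iff)
    then have "simplicial_vertex j (singular_face (Suc n) k \<tau>) = simplicial_vertex (if j < k then j else Suc j) \<tau>"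
      using j by (simp add: simplicial_vertex_def singular_face_def)
    then show ?thesis using g j by (auto simp: gsimplex_def)
  qed
  ultimately show ?thesis by (simp add: gsimplex_def)
qed

lemma inf_boundary_inf_chains:
  assumes c: "c \<in> inf_chains G (Suc n)" shows "inf_boundary (Suc n) c \<in> inf_chains G n"
proof (rule inf_chainsI)
  have nz: "\<exists>\<tau> k. c \<tau> \<noteq> 0 \<and> k \<le> Suc n \<and> \<rho> = singular_face (Suc n) k \<tau>" if "inf_boundary (Suc n) c \<rho> \<noteq> 0" for \<rho>
  proof -
    have "\<exists>\<tau>. c \<tau> \<noteq> 0 \<and> bd (Suc n) \<tau> \<rho> \<noteq> 0"
    proof (rule ccontr)
      assume "\<not> ?thesis"
      then have "{\<tau>. c \<tau> \<noteq> 0 \<and> bd (Suc n) \<tau> \<rho> \<noteq> 0} = {}" by blast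
      then show False using that unfolding inf_boundary_def by (simp only: sum.empty)
    qed
    then show ?thesis using bd_face by metis
  qed
  fix \<rho> assume "inf_boundary (Suc n) c \<rho> \<noteq> 0"
  then obtain \<tau> k where \<tau>: "c \<tau> \<noteq> 0" "k \<le> Suc n" "\<rho> = singular_face (Suc n) k \<tau>" using nz by blast
  then show "gsimplex n \<rho>" using gsimplex_face inf_chainsD(1)[OF c \<tau>(1)] by simp
next
  fix v assume v: "v \<in> verts G"
  have "{\<rho>. inf_boundary (Suc n) c \<rho> \<noteq> 0 \<and> \<rho> ` standard_simplex n \<inter> ostar v \<noteq> {}} \<subseteq>
      (\<lambda>(\<tau>, k). singular_face (Suc n) k \<tau>) ` ({\<tau>. c \<tau> \<noteq> 0 \<and> \<tau> ` standard_simplex (Suc n) \<inter> ostar v \<noteq> {}} \<times> {..Suc n})"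
  proof
    fix \<rho> assume \<rho>: "\<rho> \<in> {\<rho>. inf_boundary (Suc n) c \<rho> \<noteq> 0 \<and> \<rho> ` standard_simplex n \<inter> ostar v \<noteq> {}}"
    have "\<exists>\<tau>. c \<tau> \<noteq> 0 \<and> bd (Suc n) \<tau> \<rho> \<noteq> 0"
    proof (rule ccontr)
      assume "\<not> ?thesis"
      then have "{\<tau>. c \<tau> \<noteq> 0 \<and> bd (Suc n) \<tau> \<rho> \<noteq> 0} = {}" by blast
      then show False using \<rho> unfolding inf_boundary_def by (simp only: sum.empty mem_Collect_eq) simp
    qed
    then obtain \<tau> k where \<tau>: "c \<tau> \<noteq> 0" "k \<le> Suc n" "\<rho> = singular_face (Suc n) k \<tau>" using bd_face by metis
    moreover have "\<tau> ` standard_simplex (Suc n) \<inter> ostar v \<noteq> {}" using \<rho> face_image[OF \<tau>(2), of \<tau>] \<tau>(3) by blast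
    ultimately show "\<rho> \<in> (\<lambda>(\<tau>, k). singular_face (Suc n) k \<tau>) ` ({\<tau>. c \<tau> \<noteq> 0 \<and> \<tau> ` standard_simplex (Suc n) \<inter> ostar v \<noteq> {}} \<times> {..Suc n})"
      by (intro image_eqI[of _ _ "(\<tau>, k)"]) auto
  qed
  then show "finite {\<rho>. inf_boundary (Suc n) c \<rho> \<noteq> 0 \<and> \<rho> ` standard_simplex n \<inter> ostar v \<noteq> {}}"
    by (rule finite_subset) (use inf_chainsD_ostar[OF c v] in simp)
qed

section \<open>Pushing a chain off a star\<close>

lemma lift_winding:
  assumes p: "pathin (freudenthal G) p" and K: "continuous_map (freudenthal G) euclideanreal K"
    and eq: "\<And>t. t \<in> {0..1} \<Longrightarrow> edge_map G e (p t) = cis (2 * pi * K (p t))"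
  shows "edge_winding e p = K (p 1) - K (p 0)"
proof -
  have "continuous_on {0..1} (\<lambda>t. K (p t))"
    using continuous_map_compose[OF p[unfolded pathin_def] K] by (simp add: comp_def)
  then show ?thesis unfolding edge_winding_def by (rule windingI) (rule eq)
qed

definition star_sign :: "'v \<Rightarrow> 'e \<Rightarrow> real" where
  "star_sign v e = (if tail G e = v then 1 else - 1)"

text \<open>Up to sign, the angle on an edge at \<open>v\<close> is the distance from
  \<open>v\<close>, or this distance minus 1 when measured from the far end. The first lift is used
  near \<open>v\<close>, the second one away from it.\<close>

lemma edge_map_star:
  assumes e: "e \<in> incident v" and q: "q \<in> open_edge G e"
  shows "edge_map G e q = cis (2 * pi * (star_sign v e * star_dist v q))"
    "edge_map G e q = cis (2 * pi * (star_sign v e * (star_dist v q - 1)))"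
    "0 < star_dist v q" "star_dist v q < 1"
proof -
  have ea: "e \<in> arcs G" using e by (simp add: incident_def)
  note o = open_edge_star_dist[OF q ea]
  have 1: "star_sign v e * star_dist v q - star_dist (tail G e) q \<in> \<int>"
    using e o(4) by (auto simp: star_sign_def incident_def)
  have "star_sign v e * (star_dist v q - 1) - star_dist (tail G e) q =
      (star_sign v e * star_dist v q - star_dist (tail G e) q) - star_sign v e" by (simp add: algebra_simps)
  also have "\<dots> \<in> \<int>" by (rule Ints_diff[OF 1]) (simp add: star_sign_def)
  finally have 2: "star_sign v e * (star_dist v q - 1) - star_dist (tail G e) q \<in> \<int>" .
  show "edge_map G e q = cis (2 * pi * (star_sign v e * star_dist v q))" "edge_map G e q = cis (2 * pi * (star_sign v e * (star_dist v q - 1)))"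
    unfolding o(5) using 1 2 unfolding cis_eq_iff_Ints[symmetric] by simp_all
  show "0 < star_dist v q" "star_dist v q < 1" using e o(2-4) by (auto simp: incident_def)
qed

text \<open>
  These functions lift the map of \<open>e\<close> where the distance from \<open>v\<close> is at most \<open>3/4\<close> and at least \<open>2/3\<close>,
  respectively. Beyond these bounds they are bent back to \<open>0\<close>, which makes them continuous on the
  whole compactification.
\<close>

definition near_lift :: "'v \<Rightarrow> 'e \<Rightarrow> ('v,'e) point \<Rightarrow> real" where
  "near_lift v e = edge_fun e (\<lambda>t. let s = (if tail G e = v then t else 1 - t) in star_sign v e * min s (3 * (1 - s))) 0"

definition far_lift :: "'v \<Rightarrow> 'e \<Rightarrow> ('v,'e) point \<Rightarrow> real" where
  "far_lift v e = edge_fun e (\<lambda>t. let s = (if tail G e = v then t else 1 - t) in star_sign v e * max (s - 1) (- s / 2)) 0"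

lemma continuous_lifts:
  assumes e: "e \<in> arcs G"
  shows "continuous_map (freudenthal G) euclideanreal (near_lift v e)" "continuous_map (freudenthal G) euclideanreal (far_lift v e)"
proof -
  have "continuous_on {0..1} (\<lambda>t. star_sign v e * min t (3 * (1 - t)))"
    "continuous_on {0..1} (\<lambda>t. star_sign v e * min (1 - t) (3 * (1 - (1 - t))))"
    "continuous_on {0..1} (\<lambda>t. star_sign v e * max (t - 1) (- t / 2))"
    "continuous_on {0..1} (\<lambda>t. star_sign v e * max (1 - t - 1) (- (1 - t) / 2))"
    by (intro continuous_intros; simp)+
  then show "continuous_map (freudenthal G) euclideanreal (near_lift v e)" "continuous_map (freudenthal G) euclideanreal (far_lift v e)"
    unfolding near_lift_def far_lift_def
    by (cases "tail G e = v"; intro continuous_edge_fun e; simp only: Let_def if_True if_False; simp)+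
qed

text \<open>Origin of the formulas: \<open>s\<close> and \<open>3 * (1 - s)\<close> cross at
  \<open>s = 3/4\<close>, while \<open>s - 1\<close> and \<open>- s / 2\<close> cross at
  \<open>s = 2/3\<close>; all values are 0 at the ends of the edge where continuity demands
  it.\<close>

lemma lifts_open_edge:
  assumes e: "e \<in> incident v" and q: "q \<in> open_edge G e"
  shows "near_lift v e q = star_sign v e * min (star_dist v q) (3 * (1 - star_dist v q))"
    "far_lift v e q = star_sign v e * max (star_dist v q - 1) (- star_dist v q / 2)"
proof -
  have ea: "e \<in> arcs G" using e by (simp add: incident_def)
  obtain t where t: "q = Inner e t" "0 < t" "t < 1" using q by (auto simp: open_edge_eq)
  then have "star_dist v q = (if tail G e = v then t else 1 - t)"
    using e ea by (auto simp: star_dist_def incident_def)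
  then show "near_lift v e q = star_sign v e * min (star_dist v q) (3 * (1 - star_dist v q))"
    "far_lift v e q = star_sign v e * max (star_dist v q - 1) (- star_dist v q / 2)"
    using t by (simp_all add: near_lift_def far_lift_def edge_fun_def Let_def)
qed

lemma lifts_outside:
  assumes "q \<notin> open_edge G e" shows "near_lift v e q = 0" "far_lift v e q = 0"
  unfolding near_lift_def far_lift_def by (rule edge_fun_outside[OF assms])+

text \<open>On paths within distance 3/4 the function \<open>near_lift\<close> is a true lift, so
  the winding is its coboundary and depends only on the boundary of \<open>A\<close>.\<close>

lemma near_winding:
  assumes A: "gchain 1 {q \<in> Y. star_dist v q < 3/4} A" and e: "e \<in> incident v"
  shows "frag_eval (simplex_edge_winding e) A = frag_eval (\<lambda>\<rho>. near_lift v e (\<rho> (bary 0))) (chain_boundary 1 A)"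
  unfolding frag_eval_coboundary[of "near_lift v e", symmetric]
proof (rule frag_eval_cong)
  fix \<tau> assume "\<tau> \<in> Poly_Mapping.keys A"
  then have \<tau>: "singular_simplex 1 (freudenthal G) \<tau>" "\<tau> ` standard_simplex 1 \<subseteq> {q \<in> Y. star_dist v q < 3/4}"
    using A by (auto simp: gchain_def)
  have ea: "e \<in> arcs G" using e by (simp add: incident_def)
  show "simplex_edge_winding e \<tau> = near_lift v e (simplex_path \<tau> 1) - near_lift v e (simplex_path \<tau> 0)"
    unfolding simplex_edge_winding_def
  proof (rule lift_winding[OF pathin_simplex_path[OF \<tau>(1)] continuous_lifts(1)[OF ea]])
    fix t :: real assume "t \<in> {0..1}"
    then have "star_dist v (simplex_path \<tau> t) < 3/4" using \<tau>(2) unfolding simplex_image by blast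
    then show "edge_map G e (simplex_path \<tau> t) = cis (2 * pi * near_lift v e (simplex_path \<tau> t))"
      using edge_map_star(1)[OF e, of "simplex_path \<tau> t"] lifts_open_edge(1)[OF e, of "simplex_path \<tau> t"]
        lifts_outside(1)[of "simplex_path \<tau> t" e v] edge_map_outside[of "simplex_path \<tau> t" e]
      by (cases "simplex_path \<tau> t \<in> open_edge G e") (simp_all add: min_def)
  qed
qed

lemma far_winding:
  assumes B: "gchain 1 {q \<in> Y. star_dist v q > 2/3} B" and e: "e \<in> incident v"
  shows "frag_eval (simplex_edge_winding e) B = frag_eval (\<lambda>\<rho>. far_lift v e (\<rho> (bary 0))) (chain_boundary 1 B)"
  unfolding frag_eval_coboundary[of "far_lift v e", symmetric]
proof (rule frag_eval_cong)
  fix \<tau> assume "\<tau> \<in> Poly_Mapping.keys B"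
  then have \<tau>: "singular_simplex 1 (freudenthal G) \<tau>" "\<tau> ` standard_simplex 1 \<subseteq> {q \<in> Y. star_dist v q > 2/3}"
    using B by (auto simp: gchain_def)
  have ea: "e \<in> arcs G" using e by (simp add: incident_def)
  show "simplex_edge_winding e \<tau> = far_lift v e (simplex_path \<tau> 1) - far_lift v e (simplex_path \<tau> 0)"
    unfolding simplex_edge_winding_def
  proof (rule lift_winding[OF pathin_simplex_path[OF \<tau>(1)] continuous_lifts(2)[OF ea]])
    fix t :: real assume "t \<in> {0..1}"
    then have "star_dist v (simplex_path \<tau> t) > 2/3" using \<tau>(2) unfolding simplex_image by blast
    then show "edge_map G e (simplex_path \<tau> t) = cis (2 * pi * far_lift v e (simplex_path \<tau> t))"
      using edge_map_star(2)[OF e, of "simplex_path \<tau> t"] lifts_open_edge(2)[OF e, of "simplex_path \<tau> t"]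
        lifts_outside(2)[of "simplex_path \<tau> t" e v] edge_map_outside[of "simplex_path \<tau> t" e]
      by (cases "simplex_path \<tau> t \<in> open_edge G e") (simp_all add: max_def)
  qed
qed

text \<open>The invariant of the clearing process, where \<open>D\<close> consists of the vertices
  whose stars are already avoided.\<close>

definition cycle_conditions :: "'v set \<Rightarrow> (((nat \<Rightarrow> real) \<Rightarrow> ('v,'e) point) \<Rightarrow> int) \<Rightarrow> bool" where
  "cycle_conditions D \<phi> \<longleftrightarrow> \<phi> \<in> inf_chains G 1 \<and> (\<forall>\<rho>. inf_boundary 1 \<phi> \<rho> = 0) \<and> (\<forall>e\<in>arcs G. inf_winding e \<phi> = 0) \<and>
     (\<forall>u\<in>D. \<forall>\<tau>. \<phi> \<tau> \<noteq> 0 \<longrightarrow> \<tau> ` standard_simplex 1 \<inter> ostar u = {})"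

lemma chain_boundary_frag_extend: "chain_boundary n (frag_extend f c) = frag_extend (\<lambda>x. chain_boundary n (f x)) c"
  by (simp add: frag_extend_def chain_boundary_sum chain_boundary_cmul comp_def)

lemma frag_cmul_diff: "frag_cmul k (a - b) = frag_cmul k a - frag_cmul k b"
  by (rule poly_mapping_eqI) (simp add: lookup_minus right_diff_distrib)

lemma frag_extend_diff_fun: "frag_extend (\<lambda>x. f x - g x) c = frag_extend f c - frag_extend g c"
  unfolding frag_extend_def comp_def by (simp only: frag_cmul_diff sum_subtractf)

text \<open>
  Chop the part of \<open>\<phi>\<close> near \<open>v\<close> into a piece \<open>A\<close> in the closed star and a piece away from \<open>v\<close>. The boundary of
  \<open>A\<close> consists of points on the incident edges at distance between \<open>2/3\<close> and \<open>3/4\<close> from \<open>v\<close>, and since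
  the winding numbers of \<open>\<phi>\<close> vanish, it has total coefficient \<open>0\<close> on every edge. So short segments on the
  edges complete \<open>A\<close> to a cycle, which bounds in the contractible star.
\<close>

lemma push_off_star:
  assumes v: "v \<in> verts G" and \<phi>: "cycle_conditions D \<phi>"
  obtains d where "gchain 2 UNIV d"
    "\<And>\<kappa>. \<kappa> \<in> Poly_Mapping.keys d \<Longrightarrow> \<kappa> ` standard_simplex 2 \<subseteq> {q. star_dist v q \<le> 3/4} \<or> (\<forall>u\<in>D. \<kappa> ` standard_simplex 2 \<inter> ostar u = {})"
    "\<And>u \<tau>. u \<in> insert v D \<Longrightarrow> \<phi> \<tau> - Poly_Mapping.lookup (chain_boundary 2 d) \<tau> \<noteq> 0 \<Longrightarrow> \<tau> ` standard_simplex 1 \<inter> ostar u = {}"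
proof -
  have \<phi>c: "\<phi> \<in> inf_chains G 1" and \<phi>b: "\<And>\<rho>. inf_boundary 1 \<phi> \<rho> = 0" and \<phi>w: "\<And>e. e \<in> arcs G \<Longrightarrow> inf_winding e \<phi> = 0"
    and \<phi>a: "\<And>u \<tau>. u \<in> D \<Longrightarrow> \<phi> \<tau> \<noteq> 0 \<Longrightarrow> \<tau> ` standard_simplex 1 \<inter> ostar u = {}"
    using \<phi> by (auto simp: cycle_conditions_def)
  define Y where "Y = {q \<in> topspace (freudenthal G). \<forall>u\<in>D. q \<notin> ostar u}"
  \<comment> \<open>The radius is 1 rather than 3/4: \<open>P\<close> has to agree with \<phi> on
    all simplices that meet an open edge at \<open>v\<close>, to inherit the windings along these
    edges.\<close>
  define N where "N = {\<tau>. \<phi> \<tau> \<noteq> 0 \<and> \<tau> ` standard_simplex 1 \<inter> {q \<in> topspace (freudenthal G). star_dist v q < 1} \<noteq> {}}"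
  have finN: "finite N"
    by (rule finite_subset[OF _ inf_chainsD(2)[OF \<phi>c v]]) (use star_subset_cstar[of _ v] in \<open>auto simp: N_def\<close>)
  define P where "P = restrict_chain \<phi> N"
  have P: "Poly_Mapping.lookup P \<tau> = (if \<tau> \<in> N then \<phi> \<tau> else 0)" for \<tau>
    unfolding P_def by (rule lookup_restrict_chain[OF finN])
  have simplexY: "\<tau> ` standard_simplex 1 \<subseteq> Y" if "\<phi> \<tau> \<noteq> 0" for \<tau>
  proof -
    have "singular_simplex 1 (freudenthal G) \<tau>" using inf_chainsD(1)[OF \<phi>c that] by (simp add: gsimplex_def)
    then have "\<tau> ` standard_simplex 1 \<subseteq> topspace (freudenthal G)"
      unfolding singular_simplex_def using continuous_map_image_subset_topspace by fastforce
    then show ?thesis using \<phi>a[OF _ that] by (auto simp: Y_def)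
  qed
  have gP: "gchain 1 Y P"
  proof (rule gchainI)
    fix \<tau> assume "\<tau> \<in> Poly_Mapping.keys P"
    then have "\<phi> \<tau> \<noteq> 0" by (simp add: in_keys_iff P split: if_splits)
    then show "gsimplex 1 \<tau> \<and> \<tau> ` standard_simplex 1 \<subseteq> Y" using inf_chainsD(1)[OF \<phi>c] simplexY by blast
  qed
  have P_eq: "Poly_Mapping.lookup P \<tau> = \<phi> \<tau>"
    if "\<tau> ` standard_simplex 1 \<inter> {q \<in> topspace (freudenthal G). star_dist v q < 1} \<noteq> {}" for \<tau>
    using that by (auto simp: P N_def)
  obtain A B d1 where A: "gchain 1 {q \<in> Y. star_dist v q < 3/4} A" and B: "gchain 1 {q \<in> Y. star_dist v q > 2/3} B"
    and d1: "gchain 2 Y d1" and PAB: "P = A + B + chain_boundary 2 d1"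
    using gchain_choppable[OF v gP] unfolding choppable_def by blast
  have bb: "chain_boundary 1 (chain_boundary 2 d1) = 0"
    using chain_boundary_boundary_alt[of 1 "freudenthal G" d1] gchain_singular[OF d1] by (simp add: numeral_2_eq_2)
  have bA: "chain_boundary 1 A = chain_boundary 1 P - chain_boundary 1 B"
    unfolding PAB chain_boundary_add bb by simp
  \<comment> \<open>\<open>P\<close> need not be a cycle, but at distance less than 1 from
    \<open>v\<close> it has all the simplices of \<phi>, whose boundaries cancel.\<close>
  have bP: "\<exists>q. \<rho> = point_simplex q \<and> star_dist v q \<ge> 1" if \<rho>: "\<rho> \<in> Poly_Mapping.keys (chain_boundary 1 P)" for \<rho>
  proof -
    obtain q where q: "\<rho> = point_simplex q" "q \<in> Y" using gchain_boundary_1[OF gP \<rho>] by blast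
    have vq: "simplicial_vertex 0 \<rho> = q"
      unfolding q(1) simplicial_vertex_def by (simp add: point_simplex_def)
    have "star_dist v q \<ge> 1"
    proof (rule ccontr)
      assume lt: "\<not> star_dist v q \<ge> 1"
      have "Poly_Mapping.lookup (chain_boundary 1 P) \<rho> = inf_boundary 1 (Poly_Mapping.lookup P) \<rho>"
        by (simp add: inf_boundary_frag)
      also have "\<dots> = inf_boundary 1 \<phi> \<rho>"
      proof (rule inf_boundary_cong)
        fix \<tau> assume "bd 1 \<tau> \<rho> \<noteq> 0"
        then have "q \<in> \<tau> ` standard_simplex 1" using bd_vertex[of 0 \<tau> \<rho>] vq by (metis One_nat_def)
        then show "Poly_Mapping.lookup P \<tau> = \<phi> \<tau>" using lt q(2) by (intro P_eq) (auto simp: Y_def)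
      qed
      finally show False using \<phi>b \<rho> by (simp add: in_keys_iff)
    qed
    then show ?thesis using q(1) by blast
  qed
  \<comment> \<open>Boundary points of \<open>A\<close> are too close to \<open>v\<close> to come
    from \<open>P\<close>; so they come from \<open>B\<close>, which puts them into the overlap of
    the two ranges.\<close>
  have kA: "\<exists>q. \<rho> = point_simplex q \<and> q \<in> Y \<and> 2/3 < star_dist v q \<and> star_dist v q < 3/4"
    if \<rho>: "\<rho> \<in> Poly_Mapping.keys (chain_boundary 1 A)" for \<rho>
  proof -
    obtain q where q: "\<rho> = point_simplex q" "q \<in> Y" "star_dist v q < 3/4" using gchain_boundary_1[OF A \<rho>] by auto
    have "\<rho> \<in> Poly_Mapping.keys (chain_boundary 1 P) \<union> Poly_Mapping.keys (chain_boundary 1 B)"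
      using \<rho> keys_diff[of "chain_boundary 1 P" "chain_boundary 1 B"] unfolding bA by blast
    then have "\<rho> \<in> Poly_Mapping.keys (chain_boundary 1 B)" using bP[of \<rho>] q by fastforce
    then have "star_dist v q > 2/3" using gchain_boundary_1[OF B] q(1) by (metis (mono_tags, lifting) mem_Collect_eq point_simplex_eq_iff)
    then show ?thesis using q by blast
  qed
  \<comment> \<open>In the overlap the two lifts differ by exactly one turn,
    \<open>s - (s - 1)\<close>. So the total winding along \<open>e\<close>, written through both
    coboundaries, counts the boundary points of \<open>A\<close> on \<open>e\<close> with their
    coefficients.\<close>
  have balance: "frag_eval (\<lambda>\<rho>. if \<rho> (bary 0) \<in> open_edge G e then 1 else 0) (chain_boundary 1 A) = 0" if e: "e \<in> incident v" for e
  proof -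
    have ea: "e \<in> arcs G" using e by (simp add: incident_def)
    have "frag_eval (simplex_edge_winding e) P = inf_winding e \<phi>"
      unfolding inf_winding_frag[symmetric]
    proof (rule inf_winding_cong)
      fix \<tau> assume "simplex_edge_winding e \<tau> \<noteq> 0"
      then obtain q where q: "q \<in> \<tau> ` standard_simplex 1" "q \<in> open_edge G e" using winding_meets by blast
      moreover have "q \<in> topspace (freudenthal G)" using q(2) ea by (auto simp: open_edge_eq topspace_freudenthal)
      ultimately show "Poly_Mapping.lookup P \<tau> = \<phi> \<tau>" using edge_map_star(4)[OF e q(2)] by (intro P_eq) blast
    qed
    then have "0 = frag_eval (simplex_edge_winding e) A + frag_eval (simplex_edge_winding e) B"
      using \<phi>w[OF ea] edge_winding_boundary[OF gchain_singular[OF d1] ea] by (simp add: PAB frag_eval_add)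
    also have "\<dots> = frag_eval (\<lambda>\<rho>. near_lift v e (\<rho> (bary 0))) (chain_boundary 1 A) + frag_eval (\<lambda>\<rho>. far_lift v e (\<rho> (bary 0))) (chain_boundary 1 B)"
      using near_winding[OF A e] far_winding[OF B e] by simp
    also have "chain_boundary 1 B = chain_boundary 1 P - chain_boundary 1 A" using bA by simp
    also have "frag_eval (\<lambda>\<rho>. far_lift v e (\<rho> (bary 0))) (chain_boundary 1 P - chain_boundary 1 A) =
        - frag_eval (\<lambda>\<rho>. far_lift v e (\<rho> (bary 0))) (chain_boundary 1 A)"
    proof -
      have "frag_eval (\<lambda>\<rho>. far_lift v e (\<rho> (bary 0))) (chain_boundary 1 P) = 0"
      proof (rule frag_eval_eq_0)
        fix \<rho> assume "\<rho> \<in> Poly_Mapping.keys (chain_boundary 1 P)"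
        then obtain q where q: "\<rho> = point_simplex q" "star_dist v q \<ge> 1" using bP by blast
        then have "q \<notin> open_edge G e" using edge_map_star(4)[OF e, of q] by auto
        then show "far_lift v e (\<rho> (bary 0)) = 0" using lifts_outside q(1) by simp
      qed
      then show ?thesis by (simp add: frag_eval_diff)
    qed
    finally have "frag_eval (\<lambda>\<rho>. near_lift v e (\<rho> (bary 0)) - far_lift v e (\<rho> (bary 0))) (chain_boundary 1 A) = 0"
      by (simp add: frag_eval_diff_fun)
    also have "frag_eval (\<lambda>\<rho>. near_lift v e (\<rho> (bary 0)) - far_lift v e (\<rho> (bary 0))) (chain_boundary 1 A) =
        frag_eval (\<lambda>\<rho>. star_sign v e * (if \<rho> (bary 0) \<in> open_edge G e then 1 else 0)) (chain_boundary 1 A)"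
    proof (rule frag_eval_cong)
      fix \<rho> assume "\<rho> \<in> Poly_Mapping.keys (chain_boundary 1 A)"
      then obtain q where q: "\<rho> = point_simplex q" "2/3 < star_dist v q" "star_dist v q < 3/4" using kA by blast
      show "near_lift v e (\<rho> (bary 0)) - far_lift v e (\<rho> (bary 0)) = star_sign v e * (if \<rho> (bary 0) \<in> open_edge G e then 1 else 0)"
      proof (cases "q \<in> open_edge G e")
        case True
        have "min (star_dist v q) (3 * (1 - star_dist v q)) = star_dist v q"
          "max (star_dist v q - 1) (- star_dist v q / 2) = star_dist v q - 1" using q by simp_all
        then show ?thesis using lifts_open_edge[OF e True] True q(1) by (simp add: right_diff_distrib)
      qed (use lifts_outside q(1) in simp)
    qed
    finally have "star_sign v e * frag_eval (\<lambda>\<rho>. if \<rho> (bary 0) \<in> open_edge G e then 1 else 0) (chain_boundary 1 A) = 0"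
      unfolding frag_eval_def sum_distrib_left by (simp add: mult_ac)
    then show ?thesis by (simp add: star_sign_def split: if_splits)
  qed
  define eo where "eo q = (SOME e. e \<in> incident v \<and> q \<in> open_edge G e)" for q
  have eo: "eo q = e" if "e \<in> incident v" "q \<in> open_edge G e" for e q
    unfolding eo_def using that by (intro some_equality) (auto simp: open_edge_eq)
  \<comment> \<open>The segments on one edge all begin at the same point, so that these points
    cancel by \<open>balance\<close>. Distance 2/3 is just outside \<open>ostar v\<close>.\<close>
  define \<delta> where "\<delta> q = path_segment (edge_path (eo q) v) (2/3) (star_dist v q)" for q
  define m where "m e = edge_path e v (2/3)" for e
  define W where "W = {q \<in> Y. 2/3 \<le> star_dist v q \<and> star_dist v q \<le> 3/4}"
  have q_edge: "\<exists>e. e \<in> incident v \<and> q \<in> open_edge G e \<and> q = edge_path e v (star_dist v q) \<and> eo q = e"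
    if "q \<in> Y" "2/3 < star_dist v q" "star_dist v q < 3/4" for q
  proof -
    have q: "q \<in> topspace (freudenthal G)" "star_dist v q < 1" using that by (auto simp: Y_def)
    show ?thesis
    proof (rule star_cases[OF q])
      assume "q = Vertex v" then show ?thesis using that(2) by (simp add: star_dist_def)
    qed (use eo in blast)
  qed
  have \<delta>: "gchain 1 W (frag_of (\<delta> q)) \<and> simplex_path (\<delta> q) 0 = m (eo q) \<and> simplex_path (\<delta> q) 1 = q"
    if q: "q \<in> Y" "2/3 < star_dist v q" "star_dist v q < 3/4" for q
  proof -
    obtain e where e: "e \<in> incident v" "q \<in> open_edge G e" "q = edge_path e v (star_dist v q)" "eo q = e"
      using q_edge[OF q] by blast
    obtain w where j: "joins e v w" using incident_joins[OF e(1)] by blast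
    have ea: "e \<in> arcs G" using e(1) by (simp add: incident_def)
    have inW: "edge_path e v s \<in> W" if s: "s \<in> {2/3..star_dist v q}" for s
    proof -
      have s01: "s \<in> {0..1}" "0 < s" "s < 1" using s q(3) by auto
      have sd: "star_dist v (edge_path e v s) = s" by (rule star_dist_edge_path[OF j s01(1)])
      have oe: "edge_path e v s \<in> open_edge G e" using s01 by (auto simp: edge_path_inner)
      have tp: "edge_path e v s \<in> topspace (freudenthal G)" using oe ea by (auto simp: open_edge_eq topspace_freudenthal)
      \<comment> \<open>From \<open>q\<close> the segment leads towards \<open>v\<close> and hence
        away from the other end of the edge; if it met the star of \<open>u\<close>, then so would
        \<open>q\<close>.\<close>
      have "edge_path e v s \<notin> ostar u" if u: "u \<in> D" for u
      proof
        assume "edge_path e v s \<in> ostar u"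
        then have lt: "star_dist u (edge_path e v s) < 2/3" by (simp add: ostar_def)
        have "u \<noteq> v" using lt sd s by auto
        moreover have "e \<in> incident u"
          using lt oe ea by (auto simp: star_dist_def incident_def open_edge_eq split: if_splits)
        ultimately have "joins e v u" using e(1) by (auto simp: incident_def joins_def)
        then have "star_dist u q = 1 - star_dist v q"
          using open_edge_star_dist(4)[OF e(2) ea] by (auto simp: joins_def)
        then have "q \<in> ostar u" using q by (simp add: ostar_def Y_def)
        then show False using q(1) u by (auto simp: Y_def)
      qed
      then show ?thesis using sd s q(3) tp by (auto simp: W_def Y_def)
    qed
    have "gchain 1 W (frag_of (path_segment (edge_path e v) (2/3) (star_dist v q)))"
    proof (rule gchain_path_segment[OF pathin_edge_path[OF ea]])
      show "edge_path e v (2/3) \<in> graph_points G" "edge_path e v (star_dist v q) \<in> graph_points G"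
        using q ea by (auto simp: edge_path_def intro!: theta_in_graph)
    qed (use q inW in auto)
    then show ?thesis using e(3,4) by (simp add: \<delta>_def m_def)
  qed
  let ?bA = "chain_boundary 1 A"
  define Dc where "Dc = - frag_extend (\<lambda>\<rho>. frag_of (\<delta> (\<rho> (bary 0)))) ?bA"
  have gD: "gchain 1 W Dc"
    unfolding Dc_def
  proof (intro gchain_minus gchain_extend)
    fix \<rho> assume "\<rho> \<in> Poly_Mapping.keys ?bA"
    then obtain q where "\<rho> = point_simplex q" "q \<in> Y" "2/3 < star_dist v q" "star_dist v q < 3/4" using kA by blast
    then show "gchain 1 W (frag_of (\<delta> (\<rho> (bary 0))))" using \<delta>[of q] by simp
  qed
  have zero: "frag_extend (\<lambda>\<rho>. frag_of (point_simplex (m (eo (\<rho> (bary 0)))))) ?bA = 0"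
  proof (rule poly_mapping_eqI)
    fix x
    let ?f = "\<lambda>\<rho>. if point_simplex (m (eo (\<rho> (bary 0)))) = x then 1 else (0::real)"
    have "real_of_int (Poly_Mapping.lookup (frag_extend (\<lambda>\<rho>. frag_of (point_simplex (m (eo (\<rho> (bary 0)))))) ?bA) x) = frag_eval ?f ?bA"
      unfolding lookup_frag_extend frag_eval_def by (simp add: if_distrib[of "\<lambda>x. _ * x"] if_distrib[of real_of_int] eq_commute[of x] cong: if_cong)
    also have "\<dots> = 0"
    proof (cases "\<exists>e\<in>incident v. x = point_simplex (m e)")
      case True
      then obtain e where e: "e \<in> incident v" "x = point_simplex (m e)" by blast
      have m_in: "m e' \<in> open_edge G e'" if "e' \<in> incident v" for e'
        by (auto simp: m_def edge_path_inner)
      have "frag_eval ?f ?bA = frag_eval (\<lambda>\<rho>. if \<rho> (bary 0) \<in> open_edge G e then 1 else 0) ?bA"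
      proof (rule frag_eval_cong)
        fix \<rho> assume "\<rho> \<in> Poly_Mapping.keys ?bA"
        then obtain q where q: "\<rho> = point_simplex q" "q \<in> Y" "2/3 < star_dist v q" "star_dist v q < 3/4" using kA by blast
        obtain e' where e': "e' \<in> incident v" "q \<in> open_edge G e'" "eo q = e'" using q_edge[OF q(2-4)] by blast
        have disj: "a = b" if "x \<in> open_edge G a" "x \<in> open_edge G b" for x a b
          using that by (auto simp: open_edge_eq)
        have "m e' = m e \<longleftrightarrow> e' = e" using disj[OF m_in[OF e'(1)], of e] m_in[OF e(1)] by auto
        moreover have "q \<in> open_edge G e \<longleftrightarrow> e' = e" using disj[OF e'(2), of e] e'(2) by auto
        ultimately show "?f \<rho> = (if \<rho> (bary 0) \<in> open_edge G e then 1 else 0)"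
          unfolding q(1) point_simplex_bary e'(3) e(2) point_simplex_eq_iff by simp
      qed
      then show ?thesis using balance[OF e(1)] by simp
    next
      case False
      show ?thesis
      proof (rule frag_eval_eq_0)
        fix \<rho> assume "\<rho> \<in> Poly_Mapping.keys ?bA"
        then obtain q where q: "\<rho> = point_simplex q" "q \<in> Y" "2/3 < star_dist v q" "star_dist v q < 3/4" using kA by blast
        then show "?f \<rho> = 0" using q_edge[OF q(2-4)] False by auto
      qed
    qed
    finally show "Poly_Mapping.lookup (frag_extend (\<lambda>\<rho>. frag_of (point_simplex (m (eo (\<rho> (bary 0)))))) ?bA) x = Poly_Mapping.lookup 0 x"
      by simp
  qed
  have "chain_boundary 1 (frag_extend (\<lambda>\<rho>. frag_of (\<delta> (\<rho> (bary 0)))) ?bA) =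
      frag_extend (\<lambda>\<rho>. frag_of \<rho> - frag_of (point_simplex (m (eo (\<rho> (bary 0)))))) ?bA"
    unfolding chain_boundary_frag_extend
  proof (rule frag_extend_eq)
    fix \<rho> assume "\<rho> \<in> Poly_Mapping.keys ?bA"
    then obtain q where q: "\<rho> = point_simplex q" "q \<in> Y" "2/3 < star_dist v q" "star_dist v q < 3/4" using kA by blast
    show "chain_boundary 1 (frag_of (\<delta> (\<rho> (bary 0)))) = frag_of \<rho> - frag_of (point_simplex (m (eo (\<rho> (bary 0)))))"
      unfolding boundary_1 using \<delta>[OF q(2-4)] q(1) by simp
  qed
  then have bD: "chain_boundary 1 Dc = - ?bA"
    unfolding Dc_def chain_boundary_minus frag_extend_diff_fun zero using frag_expansion[of ?bA] by simp
  let ?M = "{q \<in> topspace (freudenthal G). star_dist v q \<le> 3/4}"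
  have gAD: "gchain 1 ?M (A + Dc)"
    by (intro gchain_add gchain_mono[OF A] gchain_mono[OF gD]) (auto simp: W_def Y_def)
  have subM: "subtopology (freudenthal G) {q. star_dist v q \<le> 3/4} = subtopology (freudenthal G) ?M"
    using subtopology_restrict[of "freudenthal G" "{q. star_dist v q \<le> 3/4}"] by (simp add: Collect_conj_eq)
  have "singular_relcycle 1 (subtopology (freudenthal G) ?M) {} (A + Dc)"
    unfolding singular_cycle using gchain_subtopology[OF gAD] bD by (simp add: chain_boundary_add)
  from homology_contractible[OF contractible_star[OF v, unfolded subM] this]
  obtain d2 where d2: "singular_chain 2 (subtopology (freudenthal G) ?M) d2" "chain_boundary 2 d2 = A + Dc"
    unfolding singular_boundary by (auto simp: numeral_2_eq_2)
  have gd2: "gchain 2 ?M d2" by (rule gchain_of_subtopology[OF d2(1)]) (use star_dist_less_1[of _ v] in auto)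
  show thesis
  proof
    show "gchain 2 UNIV (d1 + d2)" by (intro gchain_add gchain_mono[OF d1] gchain_mono[OF gd2]) auto
    fix \<kappa> assume "\<kappa> \<in> Poly_Mapping.keys (d1 + d2)"
    then have "\<kappa> \<in> Poly_Mapping.keys d1 \<or> \<kappa> \<in> Poly_Mapping.keys d2" using Poly_Mapping.keys_add[of d1 d2] by blast
    then show "\<kappa> ` standard_simplex 2 \<subseteq> {q. star_dist v q \<le> 3/4} \<or> (\<forall>u\<in>D. \<kappa> ` standard_simplex 2 \<inter> ostar u = {})"
    proof
      assume "\<kappa> \<in> Poly_Mapping.keys d1"
      then have "\<kappa> ` standard_simplex 2 \<subseteq> Y" using d1 by (simp add: gchain_def)
      then show ?thesis by (auto simp: Y_def)
    next
      assume "\<kappa> \<in> Poly_Mapping.keys d2"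
      then have "\<kappa> ` standard_simplex 2 \<subseteq> ?M" using gd2 by (simp add: gchain_def)
      then show ?thesis by auto
    qed
  next
    fix u \<tau> assume u: "u \<in> insert v D" and nz: "\<phi> \<tau> - Poly_Mapping.lookup (chain_boundary 2 (d1 + d2)) \<tau> \<noteq> 0"
    \<comment> \<open>What is left of \<phi> is therefore \<open>(\<phi> - P) + B - Dc\<close>:
      simplices that stay at distance 1 from \<open>v\<close>, and pieces at distance at least
      2/3.\<close>
    have "chain_boundary 2 (d1 + d2) = P - B + Dc" unfolding chain_boundary_add d2(2) PAB by simp
    then have "Poly_Mapping.lookup P \<tau> \<noteq> \<phi> \<tau> \<or> \<tau> \<in> Poly_Mapping.keys B \<or> \<tau> \<in> Poly_Mapping.keys Dc"
      using nz by (auto simp: lookup_add lookup_minus in_keys_iff)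
    then consider "\<tau> \<notin> N" "\<phi> \<tau> \<noteq> 0" | "\<tau> \<in> Poly_Mapping.keys B" | "\<tau> \<in> Poly_Mapping.keys Dc"
      by (auto simp: P split: if_splits)
    then show "\<tau> ` standard_simplex 1 \<inter> ostar u = {}"
    proof cases
      case 1
      then have "\<tau> ` standard_simplex 1 \<inter> {q \<in> topspace (freudenthal G). star_dist v q < 1} = {}" by (simp add: N_def)
      moreover have "ostar v \<subseteq> {q \<in> topspace (freudenthal G). star_dist v q < 1}" by (auto simp: ostar_def)
      ultimately show ?thesis using \<phi>a[OF _ 1(2)] u by blast
    next
      case 2
      then have "\<tau> ` standard_simplex 1 \<subseteq> {q \<in> Y. star_dist v q > 2/3}" using B by (simp add: gchain_def)
      then show ?thesis using u by (fastforce simp: Y_def ostar_def)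
    next
      case 3
      then have "\<tau> ` standard_simplex 1 \<subseteq> W" using gD by (simp add: gchain_def)
      then show ?thesis using u by (fastforce simp: W_def Y_def ostar_def)
    qed
  qed
qed

section \<open>Cycles without windings bound\<close>

definition settled_vertices :: "nat \<Rightarrow> 'v set" where
  "settled_vertices n = {u \<in> verts G. idx u < n}"

text \<open>In a finite graph the indices run out; from then on there is no vertex to treat and
  \<open>d = 0\<close>.\<close>

lemma push_off_next:
  assumes "cycle_conditions (settled_vertices n) \<phi>"
  obtains d where "gchain 2 UNIV d" "cycle_conditions (settled_vertices (Suc n)) (\<lambda>\<tau>. \<phi> \<tau> - Poly_Mapping.lookup (chain_boundary 2 d) \<tau>)"
    "\<And>\<kappa>. \<kappa> \<in> Poly_Mapping.keys d \<Longrightarrow> (\<exists>v\<in>verts G. idx v = n \<and> \<kappa> ` standard_simplex 2 \<subseteq> {q. star_dist v q \<le> 3/4}) \<or>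
       (\<forall>u\<in>settled_vertices n. \<kappa> ` standard_simplex 2 \<inter> ostar u = {})"
proof (cases "\<exists>v\<in>verts G. idx v = n")
  case False
  then have "settled_vertices (Suc n) = settled_vertices n" by (auto simp: settled_vertices_def less_Suc_eq)
  then show thesis using assms by (intro that[of 0]) auto
next
  case True
  then obtain v where v: "v \<in> verts G" "idx v = n" by blast
  have S: "settled_vertices (Suc n) = insert v (settled_vertices n)"
    using v inj_onD[OF idx_inj] by (auto simp: settled_vertices_def less_Suc_eq)
  obtain d where d: "gchain 2 UNIV d"
    "\<And>\<kappa>. \<kappa> \<in> Poly_Mapping.keys d \<Longrightarrow> \<kappa> ` standard_simplex 2 \<subseteq> {q. star_dist v q \<le> 3/4} \<or> (\<forall>u\<in>settled_vertices n. \<kappa> ` standard_simplex 2 \<inter> ostar u = {})"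
    "\<And>u \<tau>. u \<in> insert v (settled_vertices n) \<Longrightarrow> \<phi> \<tau> - Poly_Mapping.lookup (chain_boundary 2 d) \<tau> \<noteq> 0 \<Longrightarrow> \<tau> ` standard_simplex 1 \<inter> ostar u = {}"
    using push_off_star[OF v(1) assms] by metis
  let ?b = "Poly_Mapping.lookup (chain_boundary 2 d)"
  have "inf_boundary (Suc 1) (Poly_Mapping.lookup d) = ?b"
    by (rule ext) (simp add: inf_boundary_frag numeral_2_eq_2)
  then have bc: "?b \<in> inf_chains G 1"
    using inf_boundary_inf_chains[of "Poly_Mapping.lookup d" 1] gchain_inf_chains[OF d(1)] by (simp add: numeral_2_eq_2)
  have bb: "inf_boundary 1 ?b \<rho> = 0" for \<rho>
    using inf_boundary_frag[of 0 "chain_boundary 2 d" \<rho>] chain_boundary_boundary_alt[of 1 "freudenthal G" d] gchain_singular[OF d(1)]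
    by (simp add: numeral_2_eq_2)
  have bw: "inf_winding e ?b = 0" if "e \<in> arcs G" for e
    unfolding inf_winding_frag by (rule edge_winding_boundary[OF gchain_singular[OF d(1)] that])
  have \<phi>: "\<phi> \<in> inf_chains G 1" "\<And>\<rho>. inf_boundary 1 \<phi> \<rho> = 0" "\<And>e. e \<in> arcs G \<Longrightarrow> inf_winding e \<phi> = 0"
    using assms by (auto simp: cycle_conditions_def)
  have "cycle_conditions (settled_vertices (Suc n)) (\<lambda>\<tau>. \<phi> \<tau> - ?b \<tau>)"
    unfolding cycle_conditions_def S
    using inf_chains_diff[OF \<phi>(1) bc] inf_boundary_diff[of \<phi> 0 ?b] \<phi> bc bb bw inf_winding_diff[OF \<phi>(1) bc] d(3) by auto
  then show thesis using d(1,2) v by (intro that[of d]) blast+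
qed

lemma overlapping_stars:
  assumes "q \<in> topspace (freudenthal G)" "star_dist v q < 1" "star_dist u q < 1"
  shows "v = u \<or> (\<exists>e. joins e u v)"
proof (cases "u = v")
  case False
  show ?thesis
  proof (rule star_cases[OF assms(1,2)])
    assume "q = Vertex v" then show ?thesis using assms(3) False by (simp add: star_dist_def)
  next
    fix e assume e: "e \<in> incident v" "q \<in> open_edge G e"
    then have "e \<in> incident u" using assms(3) by (auto simp: open_edge_eq star_dist_def incident_def split: if_splits)
    then show ?thesis using e(1) False by (auto simp: incident_def joins_def)
  qed
qed simp

text \<open>Fix a face with vertex 0 in the star of \<open>u\<close>. Only the steps in the finite
  set \<open>K u\<close> affect it, so the boundary of the infinite sum is a telescoping sum there,
  equal to \<phi> minus a later remainder \<open>f M\<close>; and this remainder avoids the star of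
  \<open>u\<close>.\<close>

theorem cycle_bounds:
  assumes \<phi>: "\<phi> \<in> inf_chains G 1" "\<And>\<rho>. inf_boundary 1 \<phi> \<rho> = 0" "\<And>e. e \<in> arcs G \<Longrightarrow> inf_winding e \<phi> = 0"
  shows "\<exists>c\<in>inf_chains G 2. inf_boundary 2 c = \<phi>"
proof -
  define Q where "Q n a b \<longleftrightarrow> gchain 2 UNIV (snd b) \<and> fst b = (\<lambda>\<tau>. fst a \<tau> - Poly_Mapping.lookup (chain_boundary 2 (snd b)) \<tau>) \<and>
      (\<forall>\<kappa>\<in>Poly_Mapping.keys (snd b). (\<exists>v\<in>verts G. idx v = n \<and> \<kappa> ` standard_simplex 2 \<subseteq> {q. star_dist v q \<le> 3/4}) \<or>
       (\<forall>u\<in>settled_vertices n. \<kappa> ` standard_simplex 2 \<inter> ostar u = {}))"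
    for n and a b :: "(((nat \<Rightarrow> real) \<Rightarrow> ('v,'e) point) \<Rightarrow> int) \<times> ('v,'e) point chain"
  define P where "P n a \<longleftrightarrow> cycle_conditions (settled_vertices n) (fst a) \<and> (n = 0 \<longrightarrow> fst a = \<phi>)"
    for n and a :: "(((nat \<Rightarrow> real) \<Rightarrow> ('v,'e) point) \<Rightarrow> int) \<times> ('v,'e) point chain"
  have "\<exists>F. \<forall>n. P n (F n) \<and> Q n (F n) (F (Suc n))"
  proof (rule dependent_nat_choice)
    have "P 0 (\<phi>, 0)" using \<phi> by (simp add: P_def cycle_conditions_def settled_vertices_def)
    then show "\<exists>a. P 0 a" by blast
    fix a n assume "P n a"
    then have "cycle_conditions (settled_vertices n) (fst a)" by (simp add: P_def)
    then obtain d where d: "gchain 2 UNIV d" "cycle_conditions (settled_vertices (Suc n)) (\<lambda>\<tau>. fst a \<tau> - Poly_Mapping.lookup (chain_boundary 2 d) \<tau>)"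
      "\<And>\<kappa>. \<kappa> \<in> Poly_Mapping.keys d \<Longrightarrow> (\<exists>v\<in>verts G. idx v = n \<and> \<kappa> ` standard_simplex 2 \<subseteq> {q. star_dist v q \<le> 3/4}) \<or>
       (\<forall>u\<in>settled_vertices n. \<kappa> ` standard_simplex 2 \<inter> ostar u = {})" by (rule push_off_next) (rule that)
    then show "\<exists>b. P (Suc n) b \<and> Q n a b"
      by (intro exI[of _ "(\<lambda>\<tau>. fst a \<tau> - Poly_Mapping.lookup (chain_boundary 2 d) \<tau>, d)"]) (simp add: P_def Q_def)
  qed
  then obtain F where FP: "\<And>n. P n (F n)" and FQ: "\<And>n. Q n (F n) (F (Suc n))" by blast
  define f where "f n = fst (F n)" for n
  define d where "d n = snd (F (Suc n))" for n
  have f0: "f 0 = \<phi>" using FP[of 0] by (simp add: P_def f_def)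
  have fc: "cycle_conditions (settled_vertices n) (f n)" for n using FP[of n] by (simp add: P_def f_def)
  have gd: "gchain 2 UNIV (d n)" and fS: "f (Suc n) \<tau> = f n \<tau> - Poly_Mapping.lookup (chain_boundary 2 (d n)) \<tau>"
    and dk: "\<kappa> \<in> Poly_Mapping.keys (d n) \<Longrightarrow> (\<exists>v\<in>verts G. idx v = n \<and> \<kappa> ` standard_simplex 2 \<subseteq> {q. star_dist v q \<le> 3/4}) \<or>
       (\<forall>u\<in>settled_vertices n. \<kappa> ` standard_simplex 2 \<inter> ostar u = {})" for n \<tau> \<kappa>
    using FQ[of n] by (auto simp: Q_def f_def d_def)
  define K where "K u = {n. \<exists>\<kappa>\<in>Poly_Mapping.keys (d n). \<kappa> ` standard_simplex 2 \<inter> ostar u \<noteq> {}}" for u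
  have finK: "finite (K u)" if u: "u \<in> verts G" for u
  proof -
    \<comment> \<open>After step \<open>idx u\<close> the star of \<open>u\<close> is settled; a
      simplex that still meets it must lie near the vertex treated at that moment, which is then
      \<open>u\<close> or adjacent to \<open>u\<close>.\<close>
    have "K u \<subseteq> {..idx u} \<union> idx ` insert u {v. \<exists>e. joins e u v}"
    proof
      fix n assume "n \<in> K u"
      then obtain \<kappa> q where \<kappa>: "\<kappa> \<in> Poly_Mapping.keys (d n)" "q \<in> \<kappa> ` standard_simplex 2" "q \<in> ostar u" by (auto simp: K_def)
      show "n \<in> {..idx u} \<union> idx ` insert u {v. \<exists>e. joins e u v}"
      proof (cases "n \<le> idx u")
        case False
        then have "u \<in> settled_vertices n" using u by (simp add: settled_vertices_def)
        then obtain v where v: "idx v = n" "\<kappa> ` standard_simplex 2 \<subseteq> {q. star_dist v q \<le> 3/4}" using dk[OF \<kappa>(1)] \<kappa>(2,3) by blast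
        then have "star_dist v q < 1" "star_dist u q < 1" "q \<in> topspace (freudenthal G)" using \<kappa>(2,3) by (auto simp: ostar_def)
        then have "v = u \<or> (\<exists>e. joins e u v)" using overlapping_stars by blast
        then show ?thesis using v(1) by blast
      qed simp
    qed
    then show ?thesis by (rule finite_subset) (use finite_joined in simp)
  qed
  \<comment> \<open>Each simplex of some \<open>d n\<close> has a vertex in the graph and thus meets
    a star; by \<open>finK\<close> it occurs in finitely many steps only.\<close>
  define c where "c \<kappa> = (\<Sum>n | Poly_Mapping.lookup (d n) \<kappa> \<noteq> 0. Poly_Mapping.lookup (d n) \<kappa>)" for \<kappa>
  have c_eq: "c \<kappa> = (\<Sum>n<M. Poly_Mapping.lookup (d n) \<kappa>)"
    if "\<kappa> ` standard_simplex 2 \<inter> ostar u \<noteq> {}" "K u \<subseteq> {..<M}" for \<kappa> u M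
  proof -
    have "{n. Poly_Mapping.lookup (d n) \<kappa> \<noteq> 0} \<subseteq> K u"
    proof
      fix n assume "n \<in> {n. Poly_Mapping.lookup (d n) \<kappa> \<noteq> 0}"
      then have "\<kappa> \<in> Poly_Mapping.keys (d n)" by (simp add: in_keys_iff)
      then show "n \<in> K u" using that(1) unfolding K_def by blast
    qed
    then show ?thesis unfolding c_def using that(2) by (intro sum.mono_neutral_left) auto
  qed
  have c_nz: "\<exists>n. \<kappa> \<in> Poly_Mapping.keys (d n)" if "c \<kappa> \<noteq> 0" for \<kappa>
  proof (rule ccontr)
    assume "\<not> ?thesis"
    then have "{n. Poly_Mapping.lookup (d n) \<kappa> \<noteq> 0} = {}" by (auto simp: in_keys_iff)
    then show False using that unfolding c_def by (simp only: sum.empty)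
  qed
  have cc: "c \<in> inf_chains G 2"
  proof (rule inf_chainsI)
    fix \<kappa> assume "c \<kappa> \<noteq> 0"
    then show "gsimplex 2 \<kappa>" using c_nz gd by (fastforce simp: gchain_def gsimplex_def)
  next
    fix u assume u: "u \<in> verts G"
    have "{\<kappa>. c \<kappa> \<noteq> 0 \<and> \<kappa> ` standard_simplex 2 \<inter> ostar u \<noteq> {}} \<subseteq> (\<Union>n\<in>K u. Poly_Mapping.keys (d n))"
      using c_nz by (fastforce simp: K_def)
    then show "finite {\<kappa>. c \<kappa> \<noteq> 0 \<and> \<kappa> ` standard_simplex 2 \<inter> ostar u \<noteq> {}}"
      by (rule finite_subset) (use finK[OF u] in simp)
  qed
  have "inf_boundary 2 c \<rho> = \<phi> \<rho>" for \<rho>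
  proof (cases "simplicial_vertex 0 \<rho> \<in> graph_points G")
    case True
    then obtain u where u: "u \<in> verts G" "simplicial_vertex 0 \<rho> \<in> ostar u" using graph_point_ostar by blast
    obtain M0 where M0: "K u \<subseteq> {..<M0}" using finite_nat_bounded[OF finK[OF u(1)]] by blast
    \<comment> \<open>Two demands on \<open>M\<close>: the steps in \<open>K u\<close> are over, and
      \<open>u\<close> is settled, so that \<open>f M\<close> vanishes at \<rho>.\<close>
    define M where "M = max M0 (Suc (idx u))"
    have M: "K u \<subseteq> {..<M}" "u \<in> settled_vertices M" using M0 u(1) by (auto simp: M_def settled_vertices_def)
    have meets: "\<kappa> ` standard_simplex 2 \<inter> ostar u \<noteq> {}" if "bd 2 \<kappa> \<rho> \<noteq> 0" for \<kappa>
    proof -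
      have "bd (Suc 1) \<kappa> \<rho> \<noteq> 0" using that by (simp only: Suc_1 not_False_eq_True)
      then have "simplicial_vertex 0 \<rho> \<in> \<kappa> ` standard_simplex (Suc 1)" using bd_vertex by blast
      then have "simplicial_vertex 0 \<rho> \<in> \<kappa> ` standard_simplex 2" by (simp only: Suc_1)
      then show ?thesis using u(2) by blast
    qed
    have "inf_boundary 2 c \<rho> = inf_boundary 2 (Poly_Mapping.lookup (\<Sum>n<M. d n)) \<rho>"
      by (rule inf_boundary_cong) (simp add: c_eq[OF meets M(1)] lookup_sum)
    also have "\<dots> = Poly_Mapping.lookup (chain_boundary 2 (\<Sum>n<M. d n)) \<rho>"
      using inf_boundary_frag[of 1] by (simp add: numeral_2_eq_2)
    also have "\<dots> = (\<Sum>n<M. Poly_Mapping.lookup (chain_boundary 2 (d n)) \<rho>)"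
      by (simp add: chain_boundary_sum lookup_sum)
    also have "\<dots> = (\<Sum>n<M. f n \<rho> - f (Suc n) \<rho>)" by (simp add: fS)
    also have "\<dots> = f 0 \<rho> - f M \<rho>" by (rule sum_lessThan_telescope')
    also have "f M \<rho> = 0"
    proof (rule ccontr)
      assume "f M \<rho> \<noteq> 0"
      then have "\<rho> ` standard_simplex 1 \<inter> ostar u = {}" using fc[of M] M(2) by (simp add: cycle_conditions_def)
      then show False using simplicial_vertex_in_image[of 0 1 \<rho>] u(2) by auto
    qed
    finally show ?thesis by (simp add: f0)
  next
    case False
    have "\<phi> \<rho> = 0" using inf_chainsD(1)[OF \<phi>(1), of \<rho>] False by (auto simp: gsimplex_def)
    moreover have none: "\<not> (c \<kappa> \<noteq> 0 \<and> bd 2 \<kappa> \<rho> \<noteq> 0)" for \<kappa>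
    proof
      assume a: "c \<kappa> \<noteq> 0 \<and> bd 2 \<kappa> \<rho> \<noteq> 0"
      then have "bd (Suc 1) \<kappa> \<rho> \<noteq> 0" by (simp only: Suc_1 not_False_eq_True)
      then have "\<exists>k\<le>Suc 1. simplicial_vertex 0 \<rho> = simplicial_vertex k \<kappa>" using bd_vertex by blast
      then have "\<exists>k\<le>2. simplicial_vertex 0 \<rho> = simplicial_vertex k \<kappa>" by (simp only: Suc_1)
      then show False using inf_chainsD(1)[OF cc conjunct1[OF a]] False by (auto simp: gsimplex_def)
    qed
    then have "{\<kappa>. c \<kappa> \<noteq> 0 \<and> bd 2 \<kappa> \<rho> \<noteq> 0} = {}" by blast
    then have "inf_boundary 2 c \<rho> = 0" unfolding inf_boundary_def by (simp only: sum.empty)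
    ultimately show ?thesis by simp
  qed
  with cc show ?thesis by blast
qed

end

section \<open>Infinite cycles\<close>

lemma lookup_fin_part: "finite J \<Longrightarrow> Poly_Mapping.lookup (fin_part J l \<sigma>) = formal_sum J l \<sigma>"
proof
  fix \<tau> assume J: "finite J"
  have "Poly_Mapping.lookup (fin_part J l \<sigma>) \<tau> = (\<Sum>i\<in>J. if \<sigma> i = \<tau> then l i else 0)"
    unfolding fin_part_def lookup_sum lookup_cmul_frag_of by (intro sum.cong) auto
  also have "\<dots> = formal_sum J l \<sigma> \<tau>" unfolding formal_sum_def using J by (simp add: sum.inter_filter)
  finally show "Poly_Mapping.lookup (fin_part J l \<sigma>) \<tau> = formal_sum J l \<sigma> \<tau>" .
qed

lemma formal_sum_superset:
  assumes "finite A" "A \<subseteq> I" "\<And>i. i \<in> I \<Longrightarrow> \<sigma> i = \<tau> \<Longrightarrow> i \<in> A"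
  shows "formal_sum I l \<sigma> \<tau> = (\<Sum>i\<in>A. if \<sigma> i = \<tau> then l i else 0)"
proof -
  have "{i. i \<in> I \<and> \<sigma> i = \<tau>} = {i \<in> A. \<sigma> i = \<tau>}" using assms by blast
  then show ?thesis unfolding formal_sum_def by (simp add: sum.inter_filter[OF assms(1)])
qed

context lf_graph
begin

lemma fin_part_cycle:
  assumes good: "good_family G 1 I \<sigma>" and J: "J \<subseteq> I" "finite J" "formal_sum J l \<sigma> \<in> fin_cycles G 1"
  shows "singular_relcycle 1 (freudenthal G) {} (fin_part J l \<sigma>)"
  unfolding singular_cycle
proof
  show "singular_chain 1 (freudenthal G) (fin_part J l \<sigma>)"
    unfolding fin_part_def using good_familyD(1)[OF good] J(1)
    by (intro singular_chain_sum singular_chain_cmul) (auto simp: singular_chain_of)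
  show "chain_boundary 1 (fin_part J l \<sigma>) = 0"
  proof (rule poly_mapping_eqI)
    fix \<rho>
    have "Poly_Mapping.lookup (chain_boundary 1 (fin_part J l \<sigma>)) \<rho> = inf_boundary 1 (formal_sum J l \<sigma>) \<rho>"
      by (simp add: inf_boundary_frag lookup_fin_part[OF J(2), symmetric])
    then show "Poly_Mapping.lookup (chain_boundary 1 (fin_part J l \<sigma>)) \<rho> = Poly_Mapping.lookup 0 \<rho>"
      using J(3) by (simp add: fin_cycles_def)
  qed
qed

text \<open>The union of the blocks of the partition that meet \<open>T\<close>: finitely many
  finite sets, and the sum over it is a sum of cycles.\<close>

lemma finite_cycle_part:
  assumes rep: "standard_rep G 1 I l \<sigma> \<phi>" and T: "finite T" "T \<subseteq> I"
  obtains I' where "finite I'" "T \<subseteq> I'" "I' \<subseteq> I" "singular_relcycle 1 (freudenthal G) {} (fin_part I' l \<sigma>)"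
proof -
  have good: "good_family G 1 I \<sigma>" using rep by (simp add: standard_rep_def)
  obtain P where P: "partition_on I P" "\<forall>J\<in>P. finite J \<and> formal_sum J l \<sigma> \<in> fin_cycles G 1"
    using rep unfolding standard_rep_def by (elim conjE exE) blast
  have "\<forall>t\<in>T. \<exists>J\<in>P. t \<in> J" using T(2) partition_onD1[OF P(1)] by blast
  then obtain B where B: "\<And>t. t \<in> T \<Longrightarrow> B t \<in> P \<and> t \<in> B t" by metis
  have BP: "B ` T \<subseteq> P" using B by blast
  show thesis
  proof
    show "finite (\<Union>(B ` T))" using T(1) BP P(2) by blast
    show "T \<subseteq> \<Union>(B ` T)" using B by blast
    show "\<Union>(B ` T) \<subseteq> I" using BP partition_onD1[OF P(1)] by blast
    have "fin_part (\<Union>(B ` T)) l \<sigma> = (\<Sum>J\<in>B ` T. fin_part J l \<sigma>)"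
      unfolding fin_part_def
    proof (subst sum.Union_disjoint)
      show "\<forall>A\<in>B ` T. finite A" using BP P(2) by blast
      show "\<forall>A\<in>B ` T. \<forall>C\<in>B ` T. A \<noteq> C \<longrightarrow> A \<inter> C = {}"
        using BP partition_onD2[OF P(1)] unfolding disjoint_def by blast
    qed (simp add: comp_def)
    moreover have "singular_relcycle 1 (freudenthal G) {} (fin_part J l \<sigma>)" if "J \<in> B ` T" for J
    proof (rule fin_part_cycle[OF good])
      show "J \<subseteq> I" using that BP partition_onD1[OF P(1)] by blast
    qed (use that BP P(2) in blast)+
    ultimately show "singular_relcycle 1 (freudenthal G) {} (fin_part (\<Union>(B ` T)) l \<sigma>)"
      using singular_relcycle_sum[of "B ` T" 1 "freudenthal G" "{}" "\<lambda>J. fin_part J l \<sigma>"] by (simp only:)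
  qed
qed

lemma formal_sum_part:
  assumes "I' \<subseteq> I" "\<And>i. i \<in> I \<Longrightarrow> \<sigma> i = \<tau> \<Longrightarrow> i \<in> I'"
  shows "formal_sum I' l \<sigma> \<tau> = formal_sum I l \<sigma> \<tau>"
proof -
  have "{i. i \<in> I' \<and> \<sigma> i = \<tau>} = {i. i \<in> I \<and> \<sigma> i = \<tau>}" using assms by blast
  then show ?thesis unfolding formal_sum_def by simp
qed

lemma winding_fin_part:
  assumes rep: "standard_rep G 1 I l \<sigma> \<phi>" and I': "finite I'" "I' \<subseteq> I"
    and meets: "{i \<in> I. \<sigma> i ` standard_simplex 1 \<inter> closed_edge G e \<noteq> {}} \<subseteq> I'"
  shows "frag_eval (simplex_edge_winding e) (fin_part I' l \<sigma>) = inf_winding e \<phi>"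
  unfolding inf_winding_frag[symmetric] lookup_fin_part[OF I'(1)]
proof (rule inf_winding_cong)
  fix \<tau> assume "simplex_edge_winding e \<tau> \<noteq> 0"
  then have "\<tau> ` standard_simplex 1 \<inter> closed_edge G e \<noteq> {}" using winding_meets open_closed_edge by blast
  then have "formal_sum I' l \<sigma> \<tau> = formal_sum I l \<sigma> \<tau>" using meets by (intro formal_sum_part[OF I'(2)]) blast
  then show "formal_sum I' l \<sigma> \<tau> = \<phi> \<tau>" using rep by (simp add: standard_rep_def)
qed

lemma admissible_part_exists:
  assumes rep: "standard_rep G 1 I l \<sigma> \<phi>" and e: "e \<in> arcs G"
  shows "\<exists>I'. admissible_part G I l \<sigma> e I'"
proof -
  have good: "good_family G 1 I \<sigma>" using rep by (simp add: standard_rep_def)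
  obtain I' where "finite I'" "{i \<in> I. \<sigma> i ` standard_simplex 1 \<inter> closed_edge G e \<noteq> {}} \<subseteq> I'" "I' \<subseteq> I"
    "singular_relcycle 1 (freudenthal G) {} (fin_part I' l \<sigma>)"
    by (rule finite_cycle_part[OF rep good_family_closed_edge[OF good e wf_digraph]]) auto
  then show ?thesis by (auto simp: admissible_part_def)
qed

text \<open>The right-hand side involves neither the representation nor the finite part, which is
  the independence of choices that \<open>f_map\<close> relies on.\<close>

lemma f_prime_admissible:
  assumes rep: "standard_rep G 1 I l \<sigma> \<phi>" and e: "e \<in> arcs G" and I': "admissible_part G I l \<sigma> e I'"
  shows "of_int (f_prime G (homologous_rel_set 1 (freudenthal G) {} (fin_part I' l \<sigma>)) (natural_orientation G e)) = inf_winding e \<phi>"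
proof -
  have I'': "finite I'" "I' \<subseteq> I" "{i \<in> I. \<sigma> i ` standard_simplex 1 \<inter> closed_edge G e \<noteq> {}} \<subseteq> I'"
    "singular_relcycle 1 (freudenthal G) {} (fin_part I' l \<sigma>)" using I' unfolding admissible_part_def by blast+
  show ?thesis unfolding f_prime_eq(1)[OF I''(4) e] by (rule winding_fin_part[OF rep I''(1-3)])
qed

text \<open>Speaks of coefficients only. Balance is the part that boundary 0 does not provide: along
  a double ray between two different ends it fails for the finite cuts separating them. The values
  of \<open>f\<close> in the integers record integrality of the windings.\<close>

definition has_flow :: "(((nat \<Rightarrow> real) \<Rightarrow> ('v,'e) point) \<Rightarrow> int) \<Rightarrow> (('v,'e) oriented_edge \<Rightarrow> int) \<Rightarrow> bool" where
  "has_flow \<phi> f \<longleftrightarrow> \<phi> \<in> inf_chains G 1 \<and> (\<forall>\<rho>. inf_boundary 1 \<phi> \<rho> = 0) \<and> f \<in> balanced_functions \<and>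
     (\<forall>e\<in>arcs G. inf_winding e \<phi> = of_int (f (natural_orientation G e)))"

lemma has_flow_unique: "has_flow \<phi> f \<Longrightarrow> has_flow \<phi> g \<Longrightarrow> f = g"
  by (rule edge_functions_eqI) (auto simp: has_flow_def balanced_functions_def)

text \<open>Near vertex 0 of \<rho> the chain coincides with a finite part that is a cycle.\<close>

lemma standard_rep_boundary:
  assumes rep: "standard_rep G 1 I l \<sigma> \<phi>" shows "inf_boundary 1 \<phi> \<rho> = 0"
proof -
  have good: "good_family G 1 I \<sigma>" and \<phi>: "\<phi> = formal_sum I l \<sigma>" using rep by (auto simp: standard_rep_def)
  have \<phi>c: "\<phi> \<in> inf_chains G 1" unfolding \<phi> by (rule formal_sum_in_inf_chains[OF good])
  show ?thesis
  proof (cases "simplicial_vertex 0 \<rho> \<in> graph_points G")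
    case True
    obtain U where U: "simplicial_vertex 0 \<rho> \<in> U" "finite {i \<in> I. \<sigma> i ` standard_simplex 1 \<inter> U \<noteq> {}}"
      by (rule good_familyE[OF good True])
    obtain I' where I': "finite I'" "{i \<in> I. \<sigma> i ` standard_simplex 1 \<inter> U \<noteq> {}} \<subseteq> I'" "I' \<subseteq> I"
      "singular_relcycle 1 (freudenthal G) {} (fin_part I' l \<sigma>)"
      by (rule finite_cycle_part[OF rep U(2)]) auto
    have "inf_boundary 1 \<phi> \<rho> = inf_boundary 1 (Poly_Mapping.lookup (fin_part I' l \<sigma>)) \<rho>"
    proof (rule inf_boundary_cong)
      fix \<tau> assume "bd 1 \<tau> \<rho> \<noteq> 0"
      then have "bd (Suc 0) \<tau> \<rho> \<noteq> 0" by (simp only: One_nat_def not_False_eq_True)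
      then have "simplicial_vertex 0 \<rho> \<in> \<tau> ` standard_simplex (Suc 0)" using bd_vertex by blast
      then have "\<tau> ` standard_simplex 1 \<inter> U \<noteq> {}" using U(1) by auto
      then show "\<phi> \<tau> = Poly_Mapping.lookup (fin_part I' l \<sigma>) \<tau>"
        unfolding \<phi> lookup_fin_part[OF I'(1)] using I'(2) by (intro formal_sum_part[OF I'(3), symmetric]) blast
    qed
    also have "\<dots> = 0" using I'(4) inf_boundary_frag[of 0 "fin_part I' l \<sigma>" \<rho>] by (simp add: singular_cycle)
    finally show ?thesis .
  next
    case False
    have "inf_boundary 1 \<phi> \<rho> = inf_boundary 1 (\<lambda>_. 0) \<rho>"
    proof (rule inf_boundary_cong, rule ccontr)
      fix \<tau> assume a: "bd 1 \<tau> \<rho> \<noteq> 0" "\<phi> \<tau> \<noteq> 0"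
      then have "bd (Suc 0) \<tau> \<rho> \<noteq> 0" by (simp only: One_nat_def not_False_eq_True)
      then have "\<exists>k\<le>Suc 0. simplicial_vertex 0 \<rho> = simplicial_vertex k \<tau>" using bd_vertex by blast
      then show "False" using False inf_chainsD(1)[OF \<phi>c a(2)] by (auto simp: gsimplex_def)
    qed
    also have "\<dots> = 0" by (simp add: inf_boundary_def)
    finally show ?thesis .
  qed
qed

text \<open>For each finite cut, one finite part that is a cycle contains all simplices meeting
  edges of the cut; so integrality and balance are inherited from finite cycles.\<close>

lemma standard_rep_has_flow:
  assumes rep: "standard_rep G 1 I l \<sigma> \<phi>" shows "\<exists>f. has_flow \<phi> f"
proof -
  have good: "good_family G 1 I \<sigma>" and \<phi>: "\<phi> = formal_sum I l \<sigma>" using rep by (auto simp: standard_rep_def)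
  have \<phi>c: "\<phi> \<in> inf_chains G 1" unfolding \<phi> by (rule formal_sum_in_inf_chains[OF good])
  \<comment> \<open>The floor merely converts reals to integers: the windings are integral by
    \<open>f_prime_admissible\<close>.\<close>
  define f where "f x = (if x \<notin> oriented_edges G then 0 else if x = natural_orientation G (fst x) then \<lfloor>inf_winding (fst x) \<phi>\<rfloor>
      else - \<lfloor>inf_winding (fst x) \<phi>\<rfloor>)" for x
  have f: "of_int (f (natural_orientation G e)) = inf_winding e \<phi>" if e: "e \<in> arcs G" for e
  proof -
    obtain I' where "admissible_part G I l \<sigma> e I'" using admissible_part_exists[OF rep e] by blast
    from f_prime_admissible[OF rep e this, symmetric] have "of_int \<lfloor>inf_winding e \<phi>\<rfloor> = inf_winding e \<phi>" by simp
    then show ?thesis using e natural_in_oriented[OF e] by (simp add: f_def natural_orientation_def)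
  qed
  have "f \<in> edge_functions G"
  proof (rule edge_functionsI)
    fix e assume e: "e \<in> arcs G"
    then show "f (reverse (natural_orientation G e)) = - f (natural_orientation G e)"
      using natural_in_oriented[OF e] reverse_oriented[OF natural_in_oriented[OF e]] no_loops[OF e]
      by (simp add: f_def natural_orientation_def reverse_def)
  qed (simp add: f_def)
  moreover have "balanced (\<lambda>e. real_of_int (f (natural_orientation G e)))"
    unfolding balanced_def
  proof (intro allI impI)
    fix A assume A: "A \<subseteq> verts G" "finite (cut A)"
    have cA: "cut A \<subseteq> arcs G" by (auto simp: cut_def)
    have "finite (\<Union>e\<in>cut A. {i \<in> I. \<sigma> i ` standard_simplex 1 \<inter> closed_edge G e \<noteq> {}})"
      using A(2) cA good_family_closed_edge[OF good _ wf_digraph] by blast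
    then obtain I' where I': "finite I'" "(\<Union>e\<in>cut A. {i \<in> I. \<sigma> i ` standard_simplex 1 \<inter> closed_edge G e \<noteq> {}}) \<subseteq> I'"
      "I' \<subseteq> I" "singular_relcycle 1 (freudenthal G) {} (fin_part I' l \<sigma>)"
      by (rule finite_cycle_part[OF rep]) auto
    have "of_int (f (natural_orientation G e)) = frag_eval (simplex_edge_winding e) (fin_part I' l \<sigma>)" if e: "e \<in> cut A" for e
    proof -
      have "{i \<in> I. \<sigma> i ` standard_simplex 1 \<inter> closed_edge G e \<noteq> {}} \<subseteq> I'" using I'(2) e by blast
      from winding_fin_part[OF rep I'(1,3) this] show ?thesis using f[of e] e cA by (simp add: subset_iff)
    qed
    then have "cut_sum (\<lambda>e. real_of_int (f (natural_orientation G e))) A =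
        cut_sum (\<lambda>e. frag_eval (simplex_edge_winding e) (fin_part I' l \<sigma>)) A"
      unfolding cut_sum_def by (intro sum.cong) auto
    also have "\<dots> = 0" using balanced_cycle[OF I'(4)] A unfolding balanced_def by blast
    finally show "cut_sum (\<lambda>e. real_of_int (f (natural_orientation G e))) A = 0" .
  qed
  ultimately have "f \<in> balanced_functions" by (simp add: balanced_functions_def)
  then show ?thesis using \<phi>c standard_rep_boundary[OF rep] f by (auto simp: has_flow_def)
qed

lemma fin_cyclesI:
  assumes "gchain 1 UNIV z" "chain_boundary 1 z = 0" shows "Poly_Mapping.lookup z \<in> fin_cycles G 1"
proof -
  have "inf_boundary 1 (Poly_Mapping.lookup z) = (\<lambda>_. 0)"
    using inf_boundary_frag[of 0 z] assms(2) by (intro ext) simp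
  then show ?thesis using gchain_inf_chains[OF assms(1)] by (simp add: fin_cycles_def fin_chains_def)
qed

lemma fin_cycles_subset: "fin_cycles G 1 \<subseteq> inf_cycles G 1"
proof
  fix \<phi> assume \<phi>: "\<phi> \<in> fin_cycles G 1"
  let ?I = "{\<tau>. \<phi> \<tau> \<noteq> 0}"
  have fin: "finite ?I" and \<phi>c: "\<phi> \<in> inf_chains G 1" using \<phi> by (auto simp: fin_cycles_def fin_chains_def)
  have fs: "formal_sum ?I \<phi> (\<lambda>\<tau>. \<tau>) = \<phi>"
  proof
    fix \<tau> show "formal_sum ?I \<phi> (\<lambda>\<tau>. \<tau>) \<tau> = \<phi> \<tau>"
      using formal_sum_superset[OF fin order_refl, of "\<lambda>\<tau>. \<tau>" \<tau> \<phi>] fin by (simp add: sum.delta)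
  qed
  have "standard_rep G 1 ?I \<phi> (\<lambda>\<tau>. \<tau>) \<phi>"
    unfolding standard_rep_def
  proof (intro conjI exI[of _ "if ?I = {} then {} else {?I}"])
    show "partition_on ?I (if ?I = {} then {} else {?I})" by (auto simp: partition_on_def)
    show "good_family G 1 ?I (\<lambda>\<tau>. \<tau>)" using \<phi>c by (simp add: inf_chains_def)
  qed (use fs fin \<phi> in auto)
  then show "\<phi> \<in> inf_cycles G 1" by (rule standard_rep_imp_inf_cycles[OF loopfree_digraph_axioms conn lf])
qed

lemma inf_cycles_has_flow: "\<phi> \<in> inf_cycles G 1 \<Longrightarrow> \<exists>f. has_flow \<phi> f"
  using standard_rep_has_flow by (auto simp: inf_cycles_def)

text \<open>Only finitely many 2-simplices meet the closed star of an end of \<open>e\<close>, and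
  their faces account for all windings along \<open>e\<close>; so the statement for finite
  boundaries applies.\<close>

lemma winding_inf_boundary:
  assumes c: "c \<in> inf_chains G 2" and e: "e \<in> arcs G"
  shows "inf_winding e (inf_boundary 2 c) = 0"
proof -
  have v: "tail G e \<in> verts G" "e \<in> incident (tail G e)" using e by (auto simp: incident_def)
  define K where "K = {\<kappa>. c \<kappa> \<noteq> 0 \<and> \<kappa> ` standard_simplex 2 \<inter> cstar (tail G e) \<noteq> {}}"
  have K: "finite K" unfolding K_def by (rule inf_chainsD(2)[OF c v(1)])
  let ?d = "restrict_chain c K"
  have "inf_winding e (inf_boundary 2 c) = inf_winding e (Poly_Mapping.lookup (chain_boundary 2 ?d))"
  proof (rule inf_winding_cong)
    fix \<tau> assume "simplex_edge_winding e \<tau> \<noteq> 0"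
    then have \<tau>: "\<tau> ` standard_simplex 1 \<inter> cstar (tail G e) \<noteq> {}" using winding_meets open_edge_cstar[OF v(2)] by blast
    have "inf_boundary (Suc 1) c \<tau> = inf_boundary (Suc 1) (Poly_Mapping.lookup ?d) \<tau>"
    proof (rule inf_boundary_cong)
      fix \<kappa> assume "bd (Suc 1) \<kappa> \<tau> \<noteq> 0"
      then obtain k where k: "k \<le> Suc 1" "\<tau> = singular_face (Suc 1) k \<kappa>" by (rule bd_face)
      then have "\<kappa> ` standard_simplex (Suc 1) \<inter> cstar (tail G e) \<noteq> {}" using face_image[OF k(1), of \<kappa>] \<tau> by blast
      then have "\<kappa> ` standard_simplex 2 \<inter> cstar (tail G e) \<noteq> {}" by (simp only: Suc_1 not_False_eq_True)
      then show "c \<kappa> = Poly_Mapping.lookup ?d \<kappa>" unfolding lookup_restrict_chain[OF K] by (cases "c \<kappa> = 0") (simp_all add: K_def)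
    qed
    also have "\<dots> = Poly_Mapping.lookup (chain_boundary (Suc 1) ?d) \<tau>" by (rule inf_boundary_frag)
    finally show "inf_boundary 2 c \<tau> = Poly_Mapping.lookup (chain_boundary 2 ?d) \<tau>" by (simp only: Suc_1)
  qed
  also have "\<dots> = 0"
    unfolding inf_winding_frag
  proof (rule edge_winding_boundary[OF gchain_singular e])
    show "gchain 2 UNIV ?d"
      by (rule gchainI) (use inf_chainsD(1)[OF c] in \<open>simp add: in_keys_iff lookup_restrict_chain[OF K] split: if_splits\<close>)
  qed
  finally show ?thesis .
qed

lemma finite_fibre:
  assumes "good_family G n I \<sigma>" shows "finite {i \<in> I. \<sigma> i = \<tau>}"
proof (cases "\<exists>i\<in>I. \<sigma> i = \<tau>")
  case True
  then have "simplicial_vertex 0 \<tau> \<in> graph_points G" using good_familyD(2)[OF assms] by blast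
  then obtain U where U: "simplicial_vertex 0 \<tau> \<in> U" "finite {i \<in> I. \<sigma> i ` standard_simplex n \<inter> U \<noteq> {}}"
    by (rule good_familyE[OF assms])
  have "{i \<in> I. \<sigma> i = \<tau>} \<subseteq> {i \<in> I. \<sigma> i ` standard_simplex n \<inter> U \<noteq> {}}"
    using U(1) simplicial_vertex_in_image[of 0 n \<tau>] by blast
  then show ?thesis using U(2) by (rule finite_subset)
next
  case False
  then have "{i \<in> I. \<sigma> i = \<tau>} = {}" by blast
  then show ?thesis by (simp only: finite.emptyI)
qed

lemma cycle_plus_boundary:
  assumes z: "gsimplex 1 \<tau>\<^sub>0" "chain_boundary 1 (frag_of \<tau>\<^sub>0) = 0" and c: "c \<in> inf_chains G 2"
  shows "(\<lambda>\<tau>. Poly_Mapping.lookup (frag_of \<tau>\<^sub>0) \<tau> + inf_boundary 2 c \<tau>) \<in> inf_cycles G 1"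
proof -
  let ?K = "{\<kappa>. c \<kappa> \<noteq> 0}"
  define I where "I = insert None (Some ` (?K \<times> {..2::nat}))"
  define \<sigma> where "\<sigma> i = (case i of None \<Rightarrow> \<tau>\<^sub>0 | Some (\<kappa>, k) \<Rightarrow> singular_face (Suc 1) k \<kappa>)" for i
  define l where "l i = (case i of None \<Rightarrow> 1 | Some (\<kappa>, k) \<Rightarrow> (-1) ^ k * c \<kappa>)" for i
  have two: "{..Suc 1} = {..2::nat}" by (simp only: Suc_1)
  have c': "c \<in> inf_chains G (Suc 1)" using c by (simp only: Suc_1)
  have face: "gsimplex 1 (singular_face (Suc 1) k \<kappa>)" if "c \<kappa> \<noteq> 0" "k \<le> 2" for \<kappa> k
    by (rule gsimplex_face[OF inf_chainsD(1)[OF c' that(1)]]) (use that(2) in simp)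
  have g: "gsimplex 1 (\<sigma> i)" if "i \<in> I" for i
    using that z(1) face by (auto simp: I_def \<sigma>_def)
  have good: "good_family G 1 I \<sigma>"
  proof (rule good_familyI)
    fix v assume v: "v \<in> verts G"
    have "{i \<in> I. \<sigma> i ` standard_simplex 1 \<inter> ostar v \<noteq> {}} \<subseteq>
        insert None (Some ` ({\<kappa>. c \<kappa> \<noteq> 0 \<and> \<kappa> ` standard_simplex (Suc 1) \<inter> ostar v \<noteq> {}} \<times> {..2::nat}))"
    proof
      fix i assume i: "i \<in> {i \<in> I. \<sigma> i ` standard_simplex 1 \<inter> ostar v \<noteq> {}}"
      show "i \<in> insert None (Some ` ({\<kappa>. c \<kappa> \<noteq> 0 \<and> \<kappa> ` standard_simplex (Suc 1) \<inter> ostar v \<noteq> {}} \<times> {..2::nat}))"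
      proof (cases i)
        case (Some p)
        then obtain \<kappa> k where \<kappa>: "i = Some (\<kappa>, k)" "c \<kappa> \<noteq> 0" "k \<le> 2" using i by (auto simp: I_def)
        have "singular_face (Suc 1) k \<kappa> ` standard_simplex 1 \<inter> ostar v \<noteq> {}" using i \<kappa>(1) by (simp add: \<sigma>_def)
        then have "\<kappa> ` standard_simplex (Suc 1) \<inter> ostar v \<noteq> {}" using face_image[of k 1 \<kappa>] \<kappa>(3) by fastforce
        then show ?thesis using \<kappa> by blast
      qed simp
    qed
    then show "finite {i \<in> I. \<sigma> i ` standard_simplex 1 \<inter> ostar v \<noteq> {}}"
      by (rule finite_subset) (use inf_chainsD_ostar[OF c' v] in simp)
  qed (use g in \<open>simp add: gsimplex_def\<close>)
  have bd_sum: "bd (Suc 1) \<kappa> \<tau> = (\<Sum>k\<le>2. if singular_face (Suc 1) k \<kappa> = \<tau> then (-1) ^ k else 0)" for \<kappa> \<tau>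
    unfolding two[symmetric] chain_boundary_of by (simp only: nat.distinct if_False lookup_sum lookup_cmul_frag_of) (intro sum.cong; simp)
  have sum_eq: "formal_sum I l \<sigma> \<tau> = Poly_Mapping.lookup (frag_of \<tau>\<^sub>0) \<tau> + inf_boundary 2 c \<tau>" for \<tau>
  proof -
    define F where "F = {i \<in> I. \<sigma> i = \<tau>}"
    have F: "finite F" unfolding F_def by (rule finite_fibre[OF good])
    define K where "K = {\<kappa>. \<exists>k. Some (\<kappa>, k) \<in> F}"
    have "K \<subseteq> (\<lambda>i. fst (the i)) ` F" unfolding K_def by force
    then have K: "finite K" using F by (meson finite_imageI finite_subset)
    have Kc: "c \<kappa> \<noteq> 0" if "\<kappa> \<in> K" for \<kappa> using that by (auto simp: K_def F_def I_def)
    have "formal_sum I l \<sigma> \<tau> = (\<Sum>i\<in>insert None (Some ` (K \<times> {..2::nat})). if \<sigma> i = \<tau> then l i else 0)"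
    proof (rule formal_sum_superset)
      show "finite (insert None (Some ` (K \<times> {..2::nat})))" using K by simp
      show "insert None (Some ` (K \<times> {..2::nat})) \<subseteq> I" using Kc by (auto simp: I_def)
      fix i assume "i \<in> I" "\<sigma> i = \<tau>"
      then show "i \<in> insert None (Some ` (K \<times> {..2::nat}))" by (auto simp: K_def F_def I_def)
    qed
    also have "\<dots> = (if \<tau>\<^sub>0 = \<tau> then 1 else 0) + (\<Sum>p\<in>K \<times> {..2::nat}. if \<sigma> (Some p) = \<tau> then l (Some p) else 0)"
      using K by (subst sum.insert) (auto simp: sum.reindex \<sigma>_def l_def)
    also have "(\<Sum>p\<in>K \<times> {..2::nat}. if \<sigma> (Some p) = \<tau> then l (Some p) else 0) =
        (\<Sum>\<kappa>\<in>K. \<Sum>k\<le>2. if singular_face (Suc 1) k \<kappa> = \<tau> then (-1) ^ k * c \<kappa> else 0)"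
      unfolding sum.cartesian_product by (intro sum.cong) (auto simp: \<sigma>_def l_def)
    also have "\<dots> = (\<Sum>\<kappa>\<in>K. c \<kappa> * bd (Suc 1) \<kappa> \<tau>)"
      unfolding bd_sum sum_distrib_left by (intro sum.cong) auto
    also have "\<dots> = inf_boundary (Suc 1) c \<tau>"
    proof (rule inf_boundary_superset[symmetric, OF K])
      fix \<kappa> assume \<kappa>: "c \<kappa> \<noteq> 0" "bd (Suc 1) \<kappa> \<tau> \<noteq> 0"
      from \<kappa>(2) obtain k where "k \<le> Suc 1" "\<tau> = singular_face (Suc 1) k \<kappa>" by (rule bd_face)
      then have "Some (\<kappa>, k) \<in> F" using \<kappa>(1) by (auto simp: F_def I_def \<sigma>_def)
      then show "\<kappa> \<in> K" by (auto simp: K_def)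
    qed
    finally show ?thesis by (simp add: Suc_1[symmetric] del: Suc_1)
  qed
  define block where "block \<kappa> = Some ` ({\<kappa>} \<times> {..2::nat})" for \<kappa> :: "(nat \<Rightarrow> real) \<Rightarrow> ('v,'e) point"
  have "standard_rep G 1 I l \<sigma> (\<lambda>\<tau>. Poly_Mapping.lookup (frag_of \<tau>\<^sub>0) \<tau> + inf_boundary 2 c \<tau>)"
    unfolding standard_rep_def
  proof (intro conjI exI[of _ "insert {None} (block ` ?K)"] ballI)
    show "(\<lambda>\<tau>. Poly_Mapping.lookup (frag_of \<tau>\<^sub>0) \<tau> + inf_boundary 2 c \<tau>) = formal_sum I l \<sigma>"
      by (rule ext) (simp only: sum_eq)
    show "partition_on I (insert {None} (block ` ?K))"
      by (rule partition_onI) (auto simp: I_def block_def disjnt_iff)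
    fix J assume J: "J \<in> insert {None} (block ` ?K)"
    then show fin: "finite J" by (auto simp: block_def)
    have "fin_part {None} l \<sigma> = frag_of \<tau>\<^sub>0" by (simp add: fin_part_def l_def \<sigma>_def)
    moreover have "fin_part (block \<kappa>) l \<sigma> = frag_cmul (c \<kappa>) (chain_boundary (Suc 1) (frag_of \<kappa>))" for \<kappa>
    proof -
      have "inj_on Some ({\<kappa>} \<times> {..2::nat})" "inj_on (Pair \<kappa>) {..2::nat}" by (auto intro: inj_onI)
      moreover have "{\<kappa>} \<times> {..2} = Pair \<kappa> ` {..2::nat}" by auto
      ultimately have "fin_part (block \<kappa>) l \<sigma> = (\<Sum>k\<le>2. frag_cmul ((-1) ^ k * c \<kappa>) (frag_of (singular_face (Suc 1) k \<kappa>)))"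
        unfolding fin_part_def block_def by (simp add: sum.reindex \<sigma>_def l_def comp_def)
      also have "\<dots> = frag_cmul (c \<kappa>) (chain_boundary (Suc 1) (frag_of \<kappa>))"
        unfolding two[symmetric] chain_boundary_of by (simp only: nat.distinct if_False frag_cmul_sum) (simp add: mult.commute comp_def)
      finally show ?thesis .
    qed
    moreover have "chain_boundary 1 (chain_boundary (Suc 1) (frag_of \<kappa>)) = 0" if "c \<kappa> \<noteq> 0" for \<kappa>
      using chain_boundary_boundary_alt[of 1 "freudenthal G" "frag_of \<kappa>"] inf_chainsD(1)[OF c' that]
      by (simp add: gsimplex_def singular_chain_of)
    ultimately have "chain_boundary 1 (fin_part J l \<sigma>) = 0" using J z(2) by (auto simp: chain_boundary_cmul)
    moreover have "gchain 1 UNIV (fin_part J l \<sigma>)"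
      unfolding fin_part_def
    proof (intro gchain_sum gchain_cmul)
      fix i assume "i \<in> J"
      then have "i \<in> I" using J by (auto simp: I_def block_def)
      then show "gchain 1 UNIV (frag_of (\<sigma> i))" using g[of i] by (simp add: gchain_of gsimplex_def)
    qed
    ultimately show "formal_sum J l \<sigma> \<in> fin_cycles G 1"
      using fin_cyclesI[of "fin_part J l \<sigma>"] by (simp add: lookup_fin_part[OF fin])
  qed (rule good)
  then show ?thesis by (rule standard_rep_imp_inf_cycles[OF loopfree_digraph_axioms conn lf])
qed

lemma balanced_add:
  assumes "balanced \<psi>" "balanced \<psi>'" shows "balanced (\<lambda>e. \<psi> e + \<psi>' e)"
proof -
  have "cut_sum (\<lambda>e. \<psi> e + \<psi>' e) A = cut_sum \<psi> A + cut_sum \<psi>' A" for A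
    unfolding cut_sum_def sum.distrib[symmetric] by (intro sum.cong) auto
  then show ?thesis using assms by (simp add: balanced_def)
qed

lemma balanced_uminus:
  assumes "balanced \<psi>" shows "balanced (\<lambda>e. - \<psi> e)"
proof -
  have "cut_sum (\<lambda>e. - \<psi> e) A = - cut_sum \<psi> A" for A
    unfolding cut_sum_def sum_negf[symmetric] by (intro sum.cong) auto
  then show ?thesis using assms by (simp add: balanced_def)
qed

lemma balanced_functions_add: "f \<in> balanced_functions \<Longrightarrow> g \<in> balanced_functions \<Longrightarrow> (\<lambda>x. f x + g x) \<in> balanced_functions"
  using balanced_add by (auto simp: balanced_functions_def edge_functions_def)

lemma balanced_functions_uminus: "f \<in> balanced_functions \<Longrightarrow> (\<lambda>x. - f x) \<in> balanced_functions"
  using balanced_uminus by (auto simp: balanced_functions_def edge_functions_def)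

lemma balanced_functions_zero: "(\<lambda>_. 0) \<in> balanced_functions"
  by (auto simp: balanced_functions_def edge_functions_def balanced_def cut_sum_def intro!: sum.neutral)

lemma has_flow_add: "has_flow \<phi> f \<Longrightarrow> has_flow \<psi> g \<Longrightarrow> has_flow (\<lambda>\<tau>. \<phi> \<tau> + \<psi> \<tau>) (\<lambda>x. f x + g x)"
  unfolding has_flow_def
  using inf_boundary_add[of \<phi> 0 \<psi>] by (simp add: inf_chains_add inf_winding_add balanced_functions_add)

lemma has_flow_zero: "has_flow (\<lambda>_. 0) (\<lambda>_. 0)"
proof -
  have "(\<lambda>_. 0) \<in> inf_chains G 1" by (rule inf_chainsI) auto
  then show ?thesis using balanced_functions_zero by (simp add: has_flow_def inf_boundary_def inf_winding_def)
qed

lemma has_flow_uminus: "has_flow \<phi> f \<Longrightarrow> has_flow (\<lambda>\<tau>. - \<phi> \<tau>) (\<lambda>x. - f x)"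
  unfolding has_flow_def
  by (simp add: inf_chains_uminus inf_winding_uminus balanced_functions_uminus inf_boundary_uminus)

lemma has_flow_diff: "has_flow \<phi> f \<Longrightarrow> has_flow \<psi> g \<Longrightarrow> has_flow (\<lambda>\<tau>. \<phi> \<tau> - \<psi> \<tau>) (\<lambda>x. f x - g x)"
  using has_flow_add[OF _ has_flow_uminus] by fastforce

lemma has_flow_zero_bounds:
  assumes "has_flow \<phi> (\<lambda>_. 0)" shows "\<phi> \<in> inf_boundaries G 1"
  using cycle_bounds[of \<phi>] assms by (auto simp: has_flow_def inf_boundaries_def numeral_2_eq_2)

text \<open>One simplex suffices for any flow; hence every flow is already attained by finite
  cycles, which is why both homology groups coincide.\<close>

lemma realizing_loop:
  assumes f: "f \<in> balanced_functions"
  obtains \<tau> where "gsimplex 1 \<tau>" "chain_boundary 1 (frag_of \<tau>) = 0" "has_flow (Poly_Mapping.lookup (frag_of \<tau>)) f"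
proof -
  obtain p v where p: "pathin (freudenthal G) p" "v \<in> verts G" "p 0 = Vertex v" "p 1 = Vertex v"
    "\<And>e. e \<in> arcs G \<Longrightarrow> edge_winding e p = of_int (f (natural_orientation G e))"
    by (rule loop_with_windings[OF f]) blast
  let ?\<tau> = "path_simplex p"
  have ends: "simplex_path ?\<tau> 0 = Vertex v" "simplex_path ?\<tau> 1 = Vertex v"
    using p(3,4) simplex_path_path_simplex[of 0 p] simplex_path_path_simplex[of 1 p] by auto
  have "simplicial_vertex k ?\<tau> \<in> graph_points G" if "k \<le> 1" for k
    using that ends p(2) simplicial_vertex_path[of ?\<tau>] by (cases k) (auto simp: graph_points_def)
  then have g: "gsimplex 1 ?\<tau>" using singular_simplex_path_simplex[OF p(1)] by (simp add: gsimplex_def)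
  have b: "chain_boundary 1 (frag_of ?\<tau>) = 0" unfolding boundary_1 ends by simp
  have gc: "gchain 1 UNIV (frag_of ?\<tau>)" using g by (simp add: gchain_of gsimplex_def)
  have "inf_boundary 1 (Poly_Mapping.lookup (frag_of ?\<tau>)) \<rho> = 0" for \<rho>
    using inf_boundary_frag[of 0 "frag_of ?\<tau>"] b by simp
  then have "has_flow (Poly_Mapping.lookup (frag_of ?\<tau>)) f"
    unfolding has_flow_def inf_winding_frag frag_eval_of simplex_edge_winding_path using gchain_inf_chains[OF gc] f p(5) by simp
  with g b show thesis by (rule that)
qed

text \<open>Subtract a loop with the same flow: the rest has no windings and bounds, and
  \<open>cycle_plus_boundary\<close> turns loop plus boundary into a standard representation.
  Closure under sums and inverses then follows from linearity of the conditions.\<close>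

lemma inf_cycles_iff: "\<phi> \<in> inf_cycles G 1 \<longleftrightarrow> (\<exists>f. has_flow \<phi> f)"
proof
  assume "\<exists>f. has_flow \<phi> f"
  then obtain f where f: "has_flow \<phi> f" by blast
  then have "f \<in> balanced_functions" by (simp add: has_flow_def)
  then obtain \<tau> where \<tau>: "gsimplex 1 \<tau>" "chain_boundary 1 (frag_of \<tau>) = 0" "has_flow (Poly_Mapping.lookup (frag_of \<tau>)) f"
    by (rule realizing_loop)
  have "has_flow (\<lambda>\<rho>. \<phi> \<rho> - Poly_Mapping.lookup (frag_of \<tau>) \<rho>) (\<lambda>_. 0)" using has_flow_diff[OF f \<tau>(3)] by simp
  from has_flow_zero_bounds[OF this] obtain c where c: "c \<in> inf_chains G 2"
    "(\<lambda>\<rho>. \<phi> \<rho> - Poly_Mapping.lookup (frag_of \<tau>) \<rho>) = inf_boundary 2 c"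
    unfolding inf_boundaries_def Suc_1 by (rule imageE)
  have "\<phi> = (\<lambda>\<rho>. Poly_Mapping.lookup (frag_of \<tau>) \<rho> + inf_boundary 2 c \<rho>)"
    unfolding c(2)[symmetric] by (rule ext) (simp only: add_diff_eq add_diff_cancel_left')
  then show "\<phi> \<in> inf_cycles G 1" using cycle_plus_boundary[OF \<tau>(1,2) c(1)] by simp
qed (rule inf_cycles_has_flow)

lemma inf_boundaries_iff: "\<phi> \<in> inf_boundaries G 1 \<longleftrightarrow> has_flow \<phi> (\<lambda>_. 0)"
proof
  assume "\<phi> \<in> inf_boundaries G 1"
  then obtain c where c: "c \<in> inf_chains G 2" "\<phi> = inf_boundary 2 c" by (auto simp: inf_boundaries_def numeral_2_eq_2)
  \<comment> \<open>Boundaries are recognised as cycles through \<open>cycle_plus_boundary\<close>,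
    which asks for a loop; so a loop without windings is added and subtracted again.\<close>
  obtain \<tau> where \<tau>: "gsimplex 1 \<tau>" "chain_boundary 1 (frag_of \<tau>) = 0" "has_flow (Poly_Mapping.lookup (frag_of \<tau>)) (\<lambda>_. 0)"
    using realizing_loop[OF balanced_functions_zero] by blast
  obtain f where "has_flow (\<lambda>\<rho>. Poly_Mapping.lookup (frag_of \<tau>) \<rho> + inf_boundary 2 c \<rho>) f"
    using cycle_plus_boundary[OF \<tau>(1,2) c(1)] inf_cycles_has_flow by blast
  from has_flow_diff[OF this \<tau>(3)] have "has_flow \<phi> f" by (simp add: c(2))
  then show "has_flow \<phi> (\<lambda>_. 0)"
    using winding_inf_boundary[OF c(1)] balanced_functions_zero by (simp add: has_flow_def c(2))
qed (rule has_flow_zero_bounds)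

section \<open>The isomorphism\<close>

definition flow :: "(((nat \<Rightarrow> real) \<Rightarrow> ('v,'e) point) \<Rightarrow> int) \<Rightarrow> ('v,'e) oriented_edge \<Rightarrow> int" where
  "flow \<phi> = (THE f. has_flow \<phi> f)"

lemma flow_eqI: "has_flow \<phi> f \<Longrightarrow> flow \<phi> = f"
  unfolding flow_def using has_flow_unique by blast

lemma has_flow_flow: "\<phi> \<in> inf_cycles G 1 \<Longrightarrow> has_flow \<phi> (flow \<phi>)"
  using inf_cycles_has_flow flow_eqI by metis

lemma flow_edge_function: "\<phi> \<in> inf_cycles G 1 \<Longrightarrow> flow \<phi> \<in> edge_functions G"
  using has_flow_flow by (auto simp: has_flow_def balanced_functions_def)

lemma f_prime_flow:
  assumes rep: "standard_rep G 1 I l \<sigma> \<phi>" and x: "x \<in> oriented_edges G" and I': "admissible_part G I l \<sigma> (fst x) I'"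
  shows "f_prime G (homologous_rel_set 1 (freudenthal G) {} (fin_part I' l \<sigma>)) x = flow \<phi> x"
proof -
  obtain e where e: "e \<in> arcs G" "x = natural_orientation G e \<or> x = reverse (natural_orientation G e)"
    using x by (auto elim: oriented_edges_cases)
  then have "fst x = e" by (auto simp: reverse_natural) (simp_all add: natural_orientation_def)
  then have adm: "admissible_part G I l \<sigma> e I'" using I' by simp
  have \<phi>: "\<phi> \<in> inf_cycles G 1" by (rule standard_rep_imp_inf_cycles[OF loopfree_digraph_axioms conn lf rep])
  have "real_of_int (f_prime G (homologous_rel_set 1 (freudenthal G) {} (fin_part I' l \<sigma>)) (natural_orientation G e)) =
      of_int (flow \<phi> (natural_orientation G e))"
    unfolding f_prime_admissible[OF rep e(1) adm] using has_flow_flow[OF \<phi>] e(1) by (simp add: has_flow_def)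
  then have nat: "f_prime G (homologous_rel_set 1 (freudenthal G) {} (fin_part I' l \<sigma>)) (natural_orientation G e) =
      flow \<phi> (natural_orientation G e)" by simp
  have "singular_relcycle 1 (freudenthal G) {} (fin_part I' l \<sigma>)" using adm by (simp add: admissible_part_def)
  from f_prime_eq(2)[OF this e(1)]
  show ?thesis using e(2) nat flow_edge_function[OF \<phi>] natural_in_oriented[OF e(1)] by (auto simp: edge_functions_def)
qed

lemma inf_cycle_group_simps:
  "carrier (inf_cycle_group G 1) = inf_cycles G 1" "monoid.mult (inf_cycle_group G 1) c d = (\<lambda>\<tau>. c \<tau> + d \<tau>)"
  "one (inf_cycle_group G 1) = (\<lambda>_. 0)"
  by (simp_all add: inf_cycle_group_def)

lemma oriented_cycle_group_simps:
  "carrier (oriented_cycle_group G) = balanced_functions" "monoid.mult (oriented_cycle_group G) f g = (\<lambda>x. f x + g x)"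
  "one (oriented_cycle_group G) = (\<lambda>_. 0)"
  by (simp_all add: oriented_cycle_group_def edge_function_group_def oriented_cycle_space_eq)

lemma group_inf_cycles: "group (inf_cycle_group G 1)"
proof (rule groupI; simp only: inf_cycle_group_def partial_object.simps monoid.simps)
  show "(\<lambda>_. 0) \<in> inf_cycles G 1"
    unfolding inf_cycles_iff using has_flow_zero by blast
  fix a b c :: "((nat \<Rightarrow> real) \<Rightarrow> ('v,'e) point) \<Rightarrow> int"
  assume a: "a \<in> inf_cycles G 1"
  show "b \<in> inf_cycles G 1 \<Longrightarrow> (\<lambda>\<tau>. a \<tau> + b \<tau>) \<in> inf_cycles G 1"
    using a has_flow_add unfolding inf_cycles_iff by blast
  show "\<exists>y\<in>inf_cycles G 1. (\<lambda>\<tau>. y \<tau> + a \<tau>) = (\<lambda>_. 0)"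
  proof
    show "(\<lambda>\<tau>. - a \<tau>) \<in> inf_cycles G 1" using a has_flow_uminus unfolding inf_cycles_iff by blast
  qed simp
qed (simp_all add: add.assoc)

lemma group_balanced_functions: "group (oriented_cycle_group G)"
proof (rule groupI; simp only: oriented_cycle_group_simps)
  show "(\<lambda>_. 0) \<in> balanced_functions" by (rule balanced_functions_zero)
  fix a b c :: "('v,'e) oriented_edge \<Rightarrow> int"
  assume a: "a \<in> balanced_functions"
  show "b \<in> balanced_functions \<Longrightarrow> (\<lambda>x. a x + b x) \<in> balanced_functions" using a balanced_functions_add by blast
  show "\<exists>y\<in>balanced_functions. (\<lambda>x. y x + a x) = (\<lambda>_. 0)"
  proof
    show "(\<lambda>x. - a x) \<in> balanced_functions" by (rule balanced_functions_uminus[OF a])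
  qed simp
qed (simp_all add: add.assoc)

lemma flow_add: "\<phi> \<in> inf_cycles G 1 \<Longrightarrow> \<psi> \<in> inf_cycles G 1 \<Longrightarrow> flow (\<lambda>\<tau>. \<phi> \<tau> + \<psi> \<tau>) = (\<lambda>x. flow \<phi> x + flow \<psi> x)"
  by (intro flow_eqI has_flow_add has_flow_flow)

lemma fin_cycle_with_flow:
  assumes "f \<in> balanced_functions" obtains z where "z \<in> fin_cycles G 1" "flow z = f"
proof -
  obtain \<tau> where \<tau>: "gsimplex 1 \<tau>" "chain_boundary 1 (frag_of \<tau>) = 0" "has_flow (Poly_Mapping.lookup (frag_of \<tau>)) f"
    by (rule realizing_loop[OF assms])
  have "gchain 1 UNIV (frag_of \<tau>)" using \<tau>(1) by (simp add: gchain_of gsimplex_def)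
  from fin_cyclesI[OF this \<tau>(2)] flow_eqI[OF \<tau>(3)] show thesis by (rule that)
qed

lemma flow_hom: "group_hom (inf_cycle_group G 1) (oriented_cycle_group G) flow"
proof (intro group_hom.intro group_hom_axioms.intro group_inf_cycles group_balanced_functions homI; simp only: inf_cycle_group_simps oriented_cycle_group_simps)
  fix \<phi> \<psi> assume \<phi>: "\<phi> \<in> inf_cycles G 1"
  show "flow \<phi> \<in> balanced_functions" using has_flow_flow[OF \<phi>] by (simp add: has_flow_def)
  show "\<psi> \<in> inf_cycles G 1 \<Longrightarrow> flow (\<lambda>\<tau>. \<phi> \<tau> + \<psi> \<tau>) = (\<lambda>x. flow \<phi> x + flow \<psi> x)" using flow_add[OF \<phi>] .
qed

lemma flow_image: "flow ` inf_cycles G 1 = balanced_functions" "flow ` fin_cycles G 1 = balanced_functions"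
proof -
  have "flow ` inf_cycles G 1 \<subseteq> balanced_functions" using has_flow_flow by (auto simp: has_flow_def)
  moreover have "balanced_functions \<subseteq> flow ` fin_cycles G 1" using fin_cycle_with_flow by blast
  ultimately show "flow ` inf_cycles G 1 = balanced_functions" "flow ` fin_cycles G 1 = balanced_functions"
    using image_mono[OF fin_cycles_subset, of flow] by blast+
qed

lemma flow_kernel: "kernel (inf_cycle_group G 1) (oriented_cycle_group G) flow = inf_boundaries G 1"
proof -
  have "\<phi> \<in> inf_cycles G 1 \<and> flow \<phi> = (\<lambda>_. 0) \<longleftrightarrow> has_flow \<phi> (\<lambda>_. 0)" for \<phi>
    using has_flow_flow[of \<phi>] flow_eqI[of \<phi>] inf_cycles_iff[of \<phi>] by auto
  then show ?thesis
    unfolding kernel_def inf_cycle_group_simps oriented_cycle_group_simps inf_boundaries_iff[symmetric] by blast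
qed

lemma flow_class:
  assumes \<phi>: "\<phi> \<in> inf_cycles G 1" shows "flow ` inf_homology_class G 1 \<phi> = {flow \<phi>}" "\<phi> \<in> inf_homology_class G 1 \<phi>"
proof -
  have cls: "inf_homology_class G 1 \<phi> = (\<lambda>\<beta> \<tau>. \<beta> \<tau> + \<phi> \<tau>) ` inf_boundaries G 1"
    by (auto simp: inf_homology_class_def r_coset_def inf_cycle_group_simps[unfolded One_nat_def])
  have "flow (\<lambda>\<tau>. \<beta> \<tau> + \<phi> \<tau>) = flow \<phi>" if "\<beta> \<in> inf_boundaries G 1" for \<beta>
    using has_flow_add[OF that[unfolded inf_boundaries_iff] has_flow_flow[OF \<phi>]] by (intro flow_eqI) simp
  moreover have z: "(\<lambda>_. 0) \<in> inf_boundaries G 1" using has_flow_zero by (simp only: inf_boundaries_iff)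
  ultimately show "flow ` inf_homology_class G 1 \<phi> = {flow \<phi>}" unfolding cls image_image by (auto intro!: image_eqI)
  show "\<phi> \<in> inf_homology_class G 1 \<phi>" unfolding cls by (rule image_eqI[OF _ z]) simp
qed

lemma f_map_class:
  assumes \<phi>: "\<phi> \<in> inf_cycles G 1" shows "f_map G (inf_homology_class G 1 \<phi>) = flow \<phi>"
proof
  fix x show "f_map G (inf_homology_class G 1 \<phi>) x = flow \<phi> x"
  proof (cases "x \<in> oriented_edges G")
    case True
    then have e: "fst x \<in> arcs G" by (auto elim!: oriented_edges_cases simp: reverse_natural) (simp_all add: natural_orientation_def)
    obtain I :: "nat set" and l \<sigma> where rep: "standard_rep G 1 I l \<sigma> \<phi>" using \<phi> by (auto simp: inf_cycles_def)
    obtain I' where I': "admissible_part G I l \<sigma> (fst x) I'" using admissible_part_exists[OF rep e] by blast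
    have "(THE z. \<exists>\<phi>' \<in> inf_cycles G 1. \<exists>(I :: nat set) l \<sigma> I'.
             inf_homology_class G 1 \<phi> = inf_homology_class G 1 \<phi>' \<and> standard_rep G 1 I l \<sigma> \<phi>' \<and>
             admissible_part G I l \<sigma> (fst x) I' \<and>
             z = f_prime G (homologous_rel_set 1 (freudenthal G) {} (fin_part I' l \<sigma>)) x) = flow \<phi> x"
    proof (rule the_equality)
      show "\<exists>\<phi>' \<in> inf_cycles G 1. \<exists>(I :: nat set) l \<sigma> I'.
             inf_homology_class G 1 \<phi> = inf_homology_class G 1 \<phi>' \<and> standard_rep G 1 I l \<sigma> \<phi>' \<and>
             admissible_part G I l \<sigma> (fst x) I' \<and>
             flow \<phi> x = f_prime G (homologous_rel_set 1 (freudenthal G) {} (fin_part I' l \<sigma>)) x"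
        by (intro bexI[OF _ \<phi>] exI[of _ I] exI[of _ l] exI[of _ \<sigma>] exI[of _ I'] conjI refl rep I' f_prime_flow[OF rep True I', symmetric])
    next
      fix z assume "\<exists>\<phi>' \<in> inf_cycles G 1. \<exists>(I :: nat set) l \<sigma> I'.
             inf_homology_class G 1 \<phi> = inf_homology_class G 1 \<phi>' \<and> standard_rep G 1 I l \<sigma> \<phi>' \<and>
             admissible_part G I l \<sigma> (fst x) I' \<and>
             z = f_prime G (homologous_rel_set 1 (freudenthal G) {} (fin_part I' l \<sigma>)) x"
      then obtain \<phi>' and J :: "nat set" and l' \<sigma>' J' where \<phi>': "\<phi>' \<in> inf_cycles G 1"
        "inf_homology_class G 1 \<phi> = inf_homology_class G 1 \<phi>'" and rep': "standard_rep G 1 J l' \<sigma>' \<phi>'"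
        and J': "admissible_part G J l' \<sigma>' (fst x) J'"
        and z: "z = f_prime G (homologous_rel_set 1 (freudenthal G) {} (fin_part J' l' \<sigma>')) x" by blast
      have "flow \<phi>' = flow \<phi>" using flow_class(1)[OF \<phi>] flow_class(1)[OF \<phi>'(1)] \<phi>'(2) by simp
      then show "z = flow \<phi> x" using z f_prime_flow[OF rep' True J'] by simp
    qed
    then show ?thesis using True by (simp only: f_map_def if_True)
  next
    case False
    then have "flow \<phi> x = 0" using flow_edge_function[OF \<phi>] unfolding edge_functions_def by blast
    then show ?thesis using False by (simp add: f_map_def)
  qed
qed

lemma carrier_inf_homology: "carrier (inf_homology_group G 1) = inf_homology_class G 1 ` inf_cycles G 1"
  unfolding inf_homology_group_def FactGroup_def RCOSETS_def inf_homology_class_def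
  by (auto simp: inf_cycle_group_simps[unfolded One_nat_def])

text \<open>First isomorphism theorem for \<open>flow\<close>, whose kernel consists of the
  boundaries; \<open>f_map\<close> is the induced map on the quotient.\<close>

lemma f_map_iso: "f_map G \<in> iso (inf_homology_group G 1) (oriented_cycle_group G)"
proof -
  interpret group_hom "inf_cycle_group G 1" "oriented_cycle_group G" flow by (rule flow_hom)
  have "(\<lambda>X. the_elem (flow ` X)) \<in> iso (inf_homology_group G 1) (oriented_cycle_group G)"
    unfolding inf_homology_group_def flow_kernel[symmetric]
    by (rule FactGroup_iso_set) (simp only: inf_cycle_group_simps oriented_cycle_group_simps flow_image)
  moreover have "group (inf_homology_group G 1)"
    unfolding inf_homology_group_def flow_kernel[symmetric] by (rule normal.factorgroup_is_group[OF normal_kernel])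
  moreover have "f_map G X = the_elem (flow ` X)" if "X \<in> carrier (inf_homology_group G 1)" for X
    using that unfolding carrier_inf_homology by (auto simp: f_map_class[unfolded One_nat_def] flow_class[unfolded One_nat_def])
  ultimately show ?thesis using group.iso_eq by blast
qed

lemma fin_homology_eq: "fin_homology_group G 1 = inf_homology_group G 1"
proof -
  have inj: "inj_on (f_map G) (carrier (inf_homology_group G 1))"
    using f_map_iso by (simp add: iso_def bij_betw_def)
  have "inf_homology_class G 1 ` inf_cycles G 1 \<subseteq> inf_homology_class G 1 ` fin_cycles G 1"
  proof
    fix X assume "X \<in> inf_homology_class G 1 ` inf_cycles G 1"
    then obtain \<phi> where \<phi>: "\<phi> \<in> inf_cycles G 1" "X = inf_homology_class G 1 \<phi>" by blast
    have "flow \<phi> \<in> flow ` fin_cycles G 1" unfolding flow_image(2) using \<phi>(1) flow_image(1) by blast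
    then obtain z where z: "z \<in> fin_cycles G 1" "flow \<phi> = flow z" by (rule imageE)
    then have z': "z \<in> inf_cycles G 1" using fin_cycles_subset by blast
    \<comment> \<open>Equal flow means equal image under \<open>f_map\<close>, which is injective on
      classes.\<close>
    have "X = inf_homology_class G 1 z"
      by (rule inj_onD[OF inj]) (use \<phi> z(2) z' in \<open>simp_all only: f_map_class carrier_inf_homology imageI\<close>)
    then show "X \<in> inf_homology_class G 1 ` fin_cycles G 1" using z(1) by blast
  qed
  then have "inf_homology_class G 1 ` fin_cycles G 1 = carrier (inf_homology_group G 1)"
    unfolding carrier_inf_homology using fin_cycles_subset by blast
  then show ?thesis unfolding fin_homology_group_def by simp
qed

end

theorem theorem21:
  fixes G :: "('v,'e) pre_digraph"
  assumes "loopfree_digraph G"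
    and "Digraph_Component.connected G"
    and "locally_finite G"
  shows "(\<forall>\<phi> \<in> inf_cycles G 1. \<forall>(I :: 'i set) l \<sigma>. standard_rep G 1 I l \<sigma> \<phi> \<longrightarrow>
            (\<forall>x \<in> oriented_edges G. \<forall>I'. admissible_part G I l \<sigma> (fst x) I' \<longrightarrow>
               f_map G (inf_homology_class G 1 \<phi>) x =
               f_prime G (homologous_rel_set 1 (freudenthal G) {} (fin_part I' l \<sigma>)) x))
       \<and> f_map G \<in> iso (inf_homology_group G 1) (oriented_cycle_group G)
       \<and> f_map G \<in> iso (fin_homology_group G 1) (oriented_cycle_group G)
       \<and> fin_homology_group G 1 = inf_homology_group G 1"
proof -
  interpret loopfree_digraph G by (rule assms(1))
  interpret lf_graph G by unfold_locales (rule assms)+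
  show ?thesis
    unfolding fin_homology_eq using f_map_iso by (intro conjI ballI allI impI refl) (simp_all only: f_map_class f_prime_flow)
qed

end
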